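(* Let $d\ge1$, $\alpha\in\mathbb{R}$, $\tau(d)=\frac{\pi^{d/2}}{\Gamma(d/2)}$, and let $Q_\alpha$ be the trigonometric multiplicative chaotic operator on $\mathbb{T}^d$ defined in the context, with the associated projection $\mathbb{E}Q_\alpha$. Then $$\mathcal{S}_{\frac{\tau(d)\alpha^2}{4}-}\subset\operatorname{Ker}\mathbb{E}Q_\alpha\subset\mathcal{S}_{\frac{\tau(d)\alpha^2}{4}+},\qquad \mathcal{R}_{\frac{\tau(d)\alpha^2}{4}+}\subset\operatorname{Im}\mathbb{E}Q_\alpha\subset\mathcal{R}_{\frac{\tau(d)\alpha^2}{4}-}.$$
   Context: $\mathbb{T}^d=\mathbb{R}^d/2\pi\mathbb{Z}^d$; $\mathcal{M}^+(\mathbb{T}^d)$ is the set of finite positive Borel measures on $\mathbb{T}^d$. $\mathbb{Z}^d_+$ is a subset of $\mathbb{Z}^d\setminus\{0\}$ containing exactly one of $n,-n$ for each $n\ne0$ (for $d=1$, the positive integers). $\{\omega_n\}_{n\in\mathbb{Z}^d_+}$ are i.i.d. uniformly distributed on $\mathbb{T}=\mathbb{R}/2\pi\mathbb{Z}$. $I_0(x)=\int_0^{2\pi}e^{x\cos u}\frac{du}{2\pi}$, and $|\cdot|$ is the Euclidean norm. $A_N\uparrow\mathbb{Z}^d_+$ denotes either $A_N=\{n\in\mathbb{Z}^d_+:\max_j|n_j|\le N\}$ or $A_N=\{n\in\mathbb{Z}^d_+:|n|\le N\}$. Put $$Q_{\alpha,N}(x)=\prod_{n\in A_N}\frac{\exp\left(\frac{\alpha}{|n|^{d/2}}\cos(n\cdot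 x+\omega_n)\right)}{I_0(\alpha|n|^{-d/2})}.$$ For every $\sigma\in\mathcal{M}^+(\mathbb{T}^d)$, almost surely $Q_{\alpha,N}\,d\sigma$ converges weakly to a random measure $Q_\alpha\sigma$. The map $\mathbb{E}Q_\alpha:\mathcal{M}^+(\mathbb{T}^d)\to\mathcal{M}^+(\mathbb{T}^d)$ is $(\mathbb{E}Q_\alpha\sigma)(A)=\mathbb{E}(Q_\alpha\sigma(A))$. It is a projection; $\operatorname{Ker}\mathbb{E}Q_\alpha$ is the set of $\sigma\in\mathcal{M}^+(\mathbb{T}^d)$ with $\mathbb{E}Q_\alpha\sigma=0$ (equivalently $Q_\alpha\sigma=0$ a.s.), and its image $\operatorname{Im}\mathbb{E}Q_\alpha$ is the set of $\sigma\in\mathcal{M}^+(\mathbb{T}^d)$ with $\mathbb{E}Q_\alpha\sigma=\sigma$. For $\beta\ge0$, the $\beta$-energy of $\sigma$ is $I^\sigma_\beta=\iint\frac{d\sigma(t)\,d\sigma(s)}{|t-s|^\beta}$, where $|t-s|$ is the distance on $\mathbb{T}^d$. The $\beta$-capacity of a Borel set $E$ is $1/\inf I^\nu_\beta$, the infimum over probability measures $\nu$ concentrated on $E$ (so the capacity is zero iff all these energies are infinite). $\mathcal{S}_\beta$ ($\beta$-singular measures) is the set of $\sigma\in\mathcal{M}^+(\mathbb{T}^d)$ supported by (i.e. with complement null for $\sigma$) a Borel set of zero $\beta$-capacity. $\mathcal{R}_\beta$ ($\beta$-regular measures) is the set of $\sigma\in\mathcal{M}^+(\mathbb{T}^d)$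 that are countable sums $\sum_i\sigma_i$, convergent in total variation, of measures $\sigma_i$ with disjoint Borel supports and $I^{\sigma_i}_\beta<\infty$ for all $i$. With indices ranging over nonnegative reals (and an empty intersection meaning all of $\mathcal{M}^+(\mathbb{T}^d)$): $$\mathcal{S}_{a+}=\bigcap_{\beta>a}\mathcal{S}_\beta,\quad \mathcal{S}_{a-}=\bigcup_{\beta<a}\mathcal{S}_\beta,\quad \mathcal{R}_{a-}=\bigcap_{\beta<a}\mathcal{R}_\beta,\quad \mathcal{R}_{a+}=\bigcup_{\beta>a}\mathcal{R}_\beta.$$ *)

theory Defs
  imports "HOL-Probability.Probability"
begin

section \<open>The torus\<close>

definition ivec :: "int ^ 'n \<Rightarrow> real ^ 'n" where
  "ivec k = (\<chi> i. real_of_int (k $ i))"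

definition torus_rel :: "real ^ 'n \<Rightarrow> real ^ 'n \<Rightarrow> bool" where
  "torus_rel x y \<longleftrightarrow> (\<exists>k. x - y = (2 * pi) *\<^sub>R ivec k)"

lemma ivec_nth: "ivec k $ i = real_of_int (k $ i)"
  by (simp add: ivec_def)

lemma ivec_0: "ivec 0 = 0"
  by (simp add: ivec_def vec_eq_iff)

lemma ivec_add: "ivec (k + l) = ivec k + ivec l"
  by (simp add: ivec_def vec_eq_iff)

lemma ivec_minus: "ivec (- k) = - ivec k"
  by (simp add: ivec_def vec_eq_iff)

lemma ivec_diff: "ivec (k - l) = ivec k - ivec l"
  by (simp add: ivec_def vec_eq_iff)

lemma equivp_torus_rel: "equivp torus_rel"
proof (rule equivpI)
  show "reflp torus_rel"
    by (rule reflpI) (auto simp: torus_rel_def ivec_0 intro!: exI[of _ 0])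
  show "symp torus_rel"
  proof (rule sympI)
    fix x y :: "real ^ 'n" assume "torus_rel x y"
    then obtain k where "x - y = (2 * pi) *\<^sub>R ivec k" by (auto simp: torus_rel_def)
    then have "y - x = (2 * pi) *\<^sub>R ivec (- k)"
      by (metis ivec_minus minus_diff_eq scaleR_minus_right)
    then show "torus_rel y x" by (auto simp: torus_rel_def)
  qed
  show "transp torus_rel"
  proof (rule transpI)
    fix x y z :: "real ^ 'n" assume "torus_rel x y" "torus_rel y z"
    then obtain k l where "x - y = (2 * pi) *\<^sub>R ivec k" "y - z = (2 * pi) *\<^sub>R ivec l"
      by (auto simp: torus_rel_def)
    moreover have "x - z = (x - y) + (y - z)" by simp
    ultimately have "x - z = (2 * pi) *\<^sub>R ivec (k + l)"
      by (simp only: ivec_add scaleR_add_right)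
    then show "torus_rel x z" by (auto simp: torus_rel_def)
  qed
qed

quotient_type 'n torus = "real ^ 'n :: finite" / torus_rel
  morphisms rep_torus torus_of
  by (rule equivp_torus_rel)

definition pdist :: "real ^ 'n \<Rightarrow> real ^ 'n \<Rightarrow> real" where
  "pdist x y = (INF k. norm (x - y + (2 * pi) *\<^sub>R ivec k))"

lemma pdist_bdd: "bdd_below (range (\<lambda>k. norm (x - y + (2 * pi) *\<^sub>R ivec k)))"
  by (rule bdd_belowI[of _ 0]) auto

lemma pdist_le: "pdist x y \<le> norm (x - y + (2 * pi) *\<^sub>R ivec k)"
  unfolding pdist_def by (rule cINF_lower[OF pdist_bdd]) simp

lemma pdist_nonneg: "0 \<le> pdist x y"
  unfolding pdist_def by (rule cINF_greatest) auto

lemma pdist_less_iff: "pdist x y < e \<longleftrightarrow> (\<exists>k. norm (x - y + (2 * pi) *\<^sub>R ivec k) < e)"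
  unfolding pdist_def by (subst cINF_less_iff[OF _ pdist_bdd]) auto

lemma pdist_shift:
  assumes "torus_rel x x'" "torus_rel y y'"
  shows "pdist x' y' \<le> pdist x y"
proof (rule field_le_epsilon)
  fix e :: real assume "0 < e"
  then obtain k where k: "norm (x - y + (2 * pi) *\<^sub>R ivec k) < pdist x y + e"
    using pdist_less_iff[of x y "pdist x y + e"] by auto
  obtain a b where ab: "x - x' = (2 * pi) *\<^sub>R ivec a" "y - y' = (2 * pi) *\<^sub>R ivec b"
    using assms by (auto simp: torus_rel_def)
  have "x - y + (2 * pi) *\<^sub>R ivec k = x' - y' + ((x - x') - (y - y') + (2 * pi) *\<^sub>R ivec k)"
    by (simp add: algebra_simps)
  also have "\<dots> = x' - y' + (2 * pi) *\<^sub>R ivec (a - b + k)"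
    unfolding ab by (simp add: ivec_add ivec_diff scaleR_add_right scaleR_diff_right)
  finally show "pdist x' y' \<le> pdist x y + e"
    using pdist_le[of x' y' "a - b + k"] k by simp
qed

lemma pdist_self: "pdist x x = 0"
  using pdist_le[of x x 0] pdist_nonneg[of x x] by (simp add: ivec_0)

lemma pdist_sym_le: "pdist y x \<le> pdist x y"
proof (rule field_le_epsilon)
  fix e :: real assume "0 < e"
  then obtain k where k: "norm (x - y + (2 * pi) *\<^sub>R ivec k) < pdist x y + e"
    using pdist_less_iff[of x y "pdist x y + e"] by auto
  have "y - x + (2 * pi) *\<^sub>R ivec (- k) = - (x - y + (2 * pi) *\<^sub>R ivec k)"
    by (simp add: ivec_minus)
  then have "norm (y - x + (2 * pi) *\<^sub>R ivec (- k)) = norm (x - y + (2 * pi) *\<^sub>R ivec k)"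
    by (metis norm_minus_cancel)
  then show "pdist y x \<le> pdist x y + e"
    using pdist_le[of y x "- k"] k by linarith
qed

lemma pdist_sym: "pdist x y = pdist y x"
  by (intro antisym pdist_sym_le)

lemma pdist_triangle: "pdist x z \<le> pdist x y + pdist y z"
proof (rule field_le_epsilon)
  fix e :: real assume "0 < e"
  then obtain k l where k: "norm (x - y + (2 * pi) *\<^sub>R ivec k) < pdist x y + e / 2"
    and l: "norm (y - z + (2 * pi) *\<^sub>R ivec l) < pdist y z + e / 2"
    using pdist_less_iff[of x y "pdist x y + e / 2"] pdist_less_iff[of y z "pdist y z + e / 2"] by auto
  have "x - z + (2 * pi) *\<^sub>R ivec (k + l)
      = (x - y + (2 * pi) *\<^sub>R ivec k) + (y - z + (2 * pi) *\<^sub>R ivec l)"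
    by (simp add: ivec_add scaleR_add_right)
  then have "norm (x - z + (2 * pi) *\<^sub>R ivec (k + l))
      \<le> norm (x - y + (2 * pi) *\<^sub>R ivec k) + norm (y - z + (2 * pi) *\<^sub>R ivec l)"
    by (metis norm_triangle_ineq)
  then show "pdist x z \<le> pdist x y + pdist y z + e"
    using pdist_le[of x z "k + l"] k l by linarith
qed

lemma norm_ivec_ge_1:
  assumes "k \<noteq> 0" shows "1 \<le> norm (ivec k)"
proof -
  obtain i where "k $ i \<noteq> 0" using assms by (auto simp: vec_eq_iff)
  then have "1 \<le> \<bar>k $ i\<bar>" by arith
  then have "1 \<le> \<bar>ivec k $ i\<bar>" by (simp add: ivec_def)
  also have "\<dots> \<le> norm (ivec k)" by (rule component_le_norm_cart)
  finally show ?thesis .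
qed

lemma pdist_eq_0_iff: "pdist x y = 0 \<longleftrightarrow> torus_rel x y"
proof
  assume "torus_rel x y"
  then show "pdist x y = 0"
    using pdist_shift[of x x x y] pdist_shift[of x y y y]
    by (metis antisym pdist_nonneg pdist_self equivp_reflp equivp_torus_rel)
next
  assume z: "pdist x y = 0"
  let ?v = "\<lambda>k. x - y + (2 * pi) *\<^sub>R ivec k"
  obtain k where k: "norm (?v k) < 1" using pdist_less_iff[of x y 1] z by auto
  have "norm (?v k) = 0"
  proof (rule ccontr)
    assume nz: "norm (?v k) \<noteq> 0"
    then obtain l where l: "norm (?v l) < norm (?v k)"
      using pdist_less_iff[of x y "norm (?v k)"] z by auto
    then have "k - l \<noteq> 0" by auto
    then have "2 * pi \<le> norm ((2 * pi) *\<^sub>R ivec (k - l))"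
      using norm_ivec_ge_1[of "k - l"] by simp
    also have "(2 * pi) *\<^sub>R ivec (k - l) = ?v k - ?v l"
      by (simp add: ivec_diff scaleR_diff_right)
    also have "norm \<dots> \<le> norm (?v k) + norm (?v l)" by (rule norm_triangle_ineq4)
    finally show False using k l pi_ge_two by linarith
  qed
  then have "x - y = (2 * pi) *\<^sub>R ivec (- k)"
    by (simp add: ivec_minus eq_neg_iff_add_eq_0)
  then show "torus_rel x y" by (auto simp: torus_rel_def)
qed

instantiation torus :: (finite) metric_space
begin

lift_definition dist_torus :: "'a torus \<Rightarrow> 'a torus \<Rightarrow> real" is pdist
  by (meson antisym pdist_shift equivp_symp equivp_torus_rel)

definition uniformity_torus :: "('a torus \<times> 'a torus) filter" where
  "uniformity_torus = (INF e\<in>{0<..}. principal {(x, y). dist x y < e})"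

definition open_torus :: "'a torus set \<Rightarrow> bool" where
  "open_torus U \<longleftrightarrow> (\<forall>x\<in>U. eventually (\<lambda>(x', y). x' = x \<longrightarrow> y \<in> U) uniformity)"

instance
proof
  fix x y z :: "'a torus"
  show "dist x y = 0 \<longleftrightarrow> x = y" by transfer (rule pdist_eq_0_iff)
  show "dist x y \<le> dist x z + dist y z"
    by transfer (metis pdist_sym pdist_triangle)
qed (auto simp: uniformity_torus_def open_torus_def)

end

lemma dist_torus_of: "dist (torus_of x) (torus_of y) = pdist x y"
  by transfer simp

lemma torus_of_cases: obtains x where "t = torus_of x"
  by (metis Quotient3_torus Quotient3_abs_rep)

lemma continuous_on_torus_of: "continuous_on S torus_of"
proof -
  have "dist (torus_of x) (torus_of y) \<le> dist x y" for x y :: "real ^ 'n"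
    unfolding dist_torus_of dist_norm using pdist_le[of x y 0] by (simp add: ivec_0)
  then show ?thesis
    unfolding continuous_on_iff by (meson le_less_trans)
qed

text \<open>The metric topology is the quotient topology.\<close>

lemma open_torus_iff: "open U \<longleftrightarrow> open (torus_of -` U)"
proof
  assume "open U"
  then show "open (torus_of -` U)"
    by (rule open_vimage[OF _ continuous_on_torus_of])
next
  assume o: "open (torus_of -` U)"
  show "open U" unfolding open_dist
  proof
    fix t assume "t \<in> U"
    obtain x where t: "t = torus_of x" by (rule torus_of_cases)
    then obtain e where e: "e > 0" "\<And>y. dist y x < e \<Longrightarrow> torus_of y \<in> U"
      using o \<open>t \<in> U\<close> unfolding open_dist by auto
    have "s \<in> U" if d: "dist s t < e" for s
    proof -
      obtain y where s: "s = torus_of y" by (rule torus_of_cases)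
      obtain k where k: "norm (y - x + (2 * pi) *\<^sub>R ivec k) < e"
        using d unfolding s t dist_torus_of pdist_less_iff by auto
      have "torus_rel (y + (2 * pi) *\<^sub>R ivec k) y" by (auto simp: torus_rel_def)
      then have "torus_of (y + (2 * pi) *\<^sub>R ivec k) = s"
        unfolding s by (metis torus.abs_eq_iff)
      moreover have "dist (y + (2 * pi) *\<^sub>R ivec k) x < e"
        using k by (simp add: dist_norm algebra_simps)
      ultimately show ?thesis using e(2) by metis
    qed
    then show "\<exists>e>0. \<forall>y. dist y t < e \<longrightarrow> y \<in> U" using e(1) by auto
  qed
qed

lemma measurable_torus_of [measurable]: "torus_of \<in> borel_measurable borel"
  by (rule borel_measurable_continuous_onI[OF continuous_on_torus_of])

definition torus_measures :: "('n :: finite) torus measure set" where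
  "torus_measures = {\<sigma>. sets \<sigma> = sets borel \<and> finite_measure \<sigma>}"


section \<open>The random phases and the truncations\<close>

text \<open>The circle is \<^typ>\<open>1 torus\<close>, the torus of dimension \<open>CARD(1) = 1\<close>.\<close>

definition circle_uniform :: "1 torus measure" where
  "circle_uniform = distr (uniform_measure lborel {0..<2 * pi}) borel (\<lambda>u. torus_of (vec u))"

lemma cos_torus_rel:
  fixes n :: "int ^ 'n"
  assumes "torus_rel x x'" "torus_rel (w :: real ^ 1) w'"
  shows "cos (ivec n \<bullet> x + w $ 1) = cos (ivec n \<bullet> x' + w' $ 1)"
proof -
  obtain k l where k: "x - x' = (2 * pi) *\<^sub>R ivec k" and l: "w - w' = (2 * pi) *\<^sub>R ivec l"
    using assms by (auto simp: torus_rel_def)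
  have x: "x = x' + (2 * pi) *\<^sub>R ivec k" using k by (simp add: algebra_simps)
  have w: "w = w' + (2 * pi) *\<^sub>R ivec l" using l by (simp add: algebra_simps)
  have i: "ivec n \<bullet> ivec k = of_int (\<Sum>i\<in>UNIV. n $ i * k $ i)"
    unfolding inner_vec_def by (simp add: ivec_def)
  define m where "m = (\<Sum>i\<in>UNIV. n $ i * k $ i) + l $ 1"
  have "ivec n \<bullet> x + w $ 1 = (ivec n \<bullet> x' + w' $ 1) + 2 * pi * of_int m"
    unfolding x w m_def by (simp add: inner_add_right i ivec_nth distrib_left)
  moreover have "cos (2 * pi * of_int m) = 1" "sin (2 * pi * of_int m) = 0"
    by (rule cos_int_2pin sin_int_2pin)+
  ultimately show ?thesis by (simp only: cos_add) simp
qed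

lift_definition cos_wave :: "int ^ ('n :: finite) \<Rightarrow> 'n torus \<Rightarrow> 1 torus \<Rightarrow> real"
  is "\<lambda>n x w. cos (ivec n \<bullet> x + w $ 1)"
  by (rule cos_torus_rel)

definition half_lattice :: "(int ^ 'n) set \<Rightarrow> bool" where
  "half_lattice H \<longleftrightarrow> 0 \<notin> H \<and> (\<forall>n. n \<noteq> 0 \<longrightarrow> (n \<in> H \<longleftrightarrow> - n \<notin> H)) \<and>
     (CARD('n) = 1 \<longrightarrow> H = {n. \<forall>i. 0 < n $ i})"

definition cube_trunc :: "(int ^ 'n) set \<Rightarrow> nat \<Rightarrow> (int ^ 'n) set" where
  "cube_trunc H N = {n \<in> H. (MAX j. \<bar>n $ j\<bar>) \<le> int N}"

definition ball_trunc :: "(int ^ 'n) set \<Rightarrow> nat \<Rightarrow> (int ^ 'n) set" where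
  "ball_trunc H N = {n \<in> H. norm (ivec n) \<le> real N}"


section \<open>The chaotic operator\<close>

definition bessel_I0 :: "real \<Rightarrow> real" where
  "bessel_I0 x = integral {0..2 * pi} (\<lambda>u. exp (x * cos u) / (2 * pi))"

definition chaos_partial ::
  "real \<Rightarrow> (nat \<Rightarrow> (int ^ 'n) set) \<Rightarrow> (int ^ 'n \<Rightarrow> 1 torus) \<Rightarrow> nat \<Rightarrow> ('n :: finite) torus \<Rightarrow> real"
  where "chaos_partial \<alpha> A w N x =
    (\<Prod>n\<in>A N. exp (\<alpha> / norm (ivec n) powr (real CARD('n) / 2) * cos_wave n x (w n))
      / bessel_I0 (\<alpha> * norm (ivec n) powr - (real CARD('n) / 2)))"

definition weakly_converges :: "(nat \<Rightarrow> ('n :: finite) torus measure) \<Rightarrow> 'n torus measure \<Rightarrow> bool" where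
  "weakly_converges \<mu> \<nu> \<longleftrightarrow> \<nu> \<in> torus_measures \<and>
     (\<forall>f :: 'n torus \<Rightarrow> real. continuous_on UNIV f \<longrightarrow>
        (\<lambda>N. \<integral>x. f x \<partial>\<mu> N) \<longlonglongrightarrow> (\<integral>x. f x \<partial>\<nu>))"

text \<open>
  \<open>chaos \<alpha> A w \<sigma>\<close> is the random measure at the realisation \<open>w\<close> of the phases. The weak limit
  exists for almost every \<open>w\<close>; on the exceptional null set the value is the zero measure.
\<close>

definition chaos ::
  "real \<Rightarrow> (nat \<Rightarrow> (int ^ 'n) set) \<Rightarrow> (int ^ 'n \<Rightarrow> 1 torus) \<Rightarrow> ('n :: finite) torus measure \<Rightarrow> 'n torus measure"
  where "chaos \<alpha> A w \<sigma> =
    (let \<mu> = (\<lambda>N. density \<sigma> (\<lambda>x. ennreal (chaos_partial \<alpha> A w N x)))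
     in if \<exists>\<nu>. weakly_converges \<mu> \<nu> then (THE \<nu>. weakly_converges \<mu> \<nu>) else null_measure borel)"

definition expected_chaos ::
  "'w measure \<Rightarrow> (int ^ 'n \<Rightarrow> 'w \<Rightarrow> 1 torus) \<Rightarrow> real \<Rightarrow> (nat \<Rightarrow> (int ^ 'n) set) \<Rightarrow>
    ('n :: finite) torus measure \<Rightarrow> 'n torus measure"
  where "expected_chaos M \<omega> \<alpha> A \<sigma> =
    measure_of (space borel) (sets borel) (\<lambda>B. \<integral>\<^sup>+p. emeasure (chaos \<alpha> A (\<lambda>n. \<omega> n p) \<sigma>) B \<partial>M)"

definition Ker_expected_chaos ::
  "'w measure \<Rightarrow> (int ^ 'n \<Rightarrow> 'w \<Rightarrow> 1 torus) \<Rightarrow> real \<Rightarrow> (nat \<Rightarrow> (int ^ 'n) set) \<Rightarrow>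
    ('n :: finite) torus measure set"
  where "Ker_expected_chaos M \<omega> \<alpha> A =
    {\<sigma> \<in> torus_measures. expected_chaos M \<omega> \<alpha> A \<sigma> = null_measure borel}"

text \<open>The expected operator is a projection, so its image is its set of fixed points.\<close>

definition Im_expected_chaos ::
  "'w measure \<Rightarrow> (int ^ 'n \<Rightarrow> 'w \<Rightarrow> 1 torus) \<Rightarrow> real \<Rightarrow> (nat \<Rightarrow> (int ^ 'n) set) \<Rightarrow>
    ('n :: finite) torus measure set"
  where "Im_expected_chaos M \<omega> \<alpha> A =
    {\<sigma> \<in> torus_measures. expected_chaos M \<omega> \<alpha> A \<sigma> = \<sigma>}"


section \<open>Energy, capacity, singular and regular measures\<close>

text \<open>
  On the diagonal the kernel \<open>1 / |t - s|\<^sup>\<beta>\<close> is infinite for \<open>\<beta> > 0\<close>; for \<open>\<beta> = 0\<close> it is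
  constantly 1, which has to be said separately because \<open>0 powr 0 = 0\<close>.
\<close>

definition riesz_kernel :: "real \<Rightarrow> ('n :: finite) torus \<Rightarrow> 'n torus \<Rightarrow> ennreal" where
  "riesz_kernel \<beta> t s = (if \<beta> = 0 then 1 else inverse (ennreal (dist t s powr \<beta>)))"

definition energy :: "real \<Rightarrow> ('n :: finite) torus measure \<Rightarrow> ennreal" where
  "energy \<beta> \<sigma> = (\<integral>\<^sup>+t. \<integral>\<^sup>+s. riesz_kernel \<beta> t s \<partial>\<sigma> \<partial>\<sigma>)"

definition capacity :: "real \<Rightarrow> ('n :: finite) torus set \<Rightarrow> ennreal" where
  "capacity \<beta> E =
    inverse (INF \<nu>\<in>{\<nu>. sets \<nu> = sets borel \<and> prob_space \<nu> \<and> emeasure \<nu> (- E) = 0}. energy \<beta> \<nu>)"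

definition sing :: "real \<Rightarrow> ('n :: finite) torus measure set" where
  "sing \<beta> = {\<sigma> \<in> torus_measures.
     \<exists>E\<in>sets borel. capacity \<beta> E = 0 \<and> emeasure \<sigma> (- E) = 0}"

text \<open>
  Total variation convergence of the partial sums is expressed by the uniform distance over Borel
  sets, which is equivalent to the total variation norm. A finite sum is padded with zero measures
  carried by the empty set.
\<close>

definition reg :: "real \<Rightarrow> ('n :: finite) torus measure set" where
  "reg \<beta> = {\<sigma> \<in> torus_measures.
     \<exists>(\<sigma>s :: nat \<Rightarrow> 'n torus measure) E.
       (\<forall>i. \<sigma>s i \<in> torus_measures \<and> E i \<in> sets borel \<and> emeasure (\<sigma>s i) (- E i) = 0 \<and>
            energy \<beta> (\<sigma>s i) < \<infinity>) \<and>
       disjoint_family E \<and>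
       (\<lambda>m. SUP B\<in>sets borel. \<bar>measure \<sigma> B - (\<Sum>i<m. measure (\<sigma>s i) B)\<bar>) \<longlonglongrightarrow> 0}"

definition sing_plus :: "real \<Rightarrow> ('n :: finite) torus measure set" where
  "sing_plus a = torus_measures \<inter> (\<Inter>\<beta>\<in>{\<beta>. 0 \<le> \<beta> \<and> a < \<beta>}. sing \<beta>)"

definition sing_minus :: "real \<Rightarrow> ('n :: finite) torus measure set" where
  "sing_minus a = (\<Union>\<beta>\<in>{\<beta>. 0 \<le> \<beta> \<and> \<beta> < a}. sing \<beta>)"

definition reg_minus :: "real \<Rightarrow> ('n :: finite) torus measure set" where
  "reg_minus a = torus_measures \<inter> (\<Inter>\<beta>\<in>{\<beta>. 0 \<le> \<beta> \<and> \<beta> < a}. reg \<beta>)"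

definition reg_plus :: "real \<Rightarrow> ('n :: finite) torus measure set" where
  "reg_plus a = (\<Union>\<beta>\<in>{\<beta>. 0 \<le> \<beta> \<and> a < \<beta>}. reg \<beta>)"

definition tau :: "nat \<Rightarrow> real" where
  "tau d = pi powr (real d / 2) / Gamma (real d / 2)"

end

(* Everything is read off from the potential U_b(x) = \<integral> |x - y|^-b d\<sigma>(y): a measure \<sigma> is b-singular iff
   U_b = \<infinity> holds \<sigma>-almost everywhere, and b-regular iff U_b < \<infinity> holds \<sigma>-almost everywhere. Let
   a = \<tau>(d) \<alpha>^2 / 4. The expected total mass of the limit measure is at most \<sigma>{U_b < \<infinity>} for b < a and
   at least \<sigma>{U_b < \<infinity>} for b > a, which gives the four inclusions.

   Upper bound: tilt the phases by the N-th product Q_N(x). Then Q_N near x is about N^a, because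
   \<Sum> |n|^-d over the half lattice grows like \<tau>(d) log N. If U_b(x) = \<infinity> and b < a, infinitely many
   balls B(x, r) have mass at least r^c for some c < a, so the total mass is unbounded under the tilted
   law; since it is almost surely bounded under the original law, the mass carried by {U_b = \<infinity>} is lost.

   Lower bound: restrict to points x with Q_N(x) <= \<Lambda> N^b at all dyadic scales N. This discards little
   mass, uniformly in N, and the remaining second moment is bounded by the b-energy, because the sums
   \<Sum> |n|^-d cos(n t) over |n| > 1/|t| are bounded (Abel summation along a coordinate in which t is
   large). Hence the total masses are uniformly integrable. *)

theory Submission
  imports Defs
begin

section \<open>The torus as a metric space\<close>

text \<open>The constant: the logarithm of \<open>bessel_I0 x\<close> is x^2 / 4 up to cubic terms,
  whose sum over the lattice converges, and \<tau>(d) is half the area of the unit sphere because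
  only one of n, -n occurs. So the moment of order 1 + s of Q_N(x) is about N^(a s (1 + s)); the
  derivative in s at 0 is the exponent a seen under the tilted law. The obstacle for regular
  measures: the plain second moment is about |x - y|^(-2a) and would require finite 2a-energy.
  Capping the weight at x along the scales lowers the exponent to any b > a. For singular measures
  no pathwise lower bound on the weights is used. A bounded total mass forces, by convexity, a large
  mean of Q_N^-s on a ball of large mass, while the mixed moment of Q_N(x) Q_N(y)^-s is small for y
  near x; one good scale suffices for each x and each error. Total masses decide everything because
  the expected measure never exceeds \<sigma> on a Borel set, so equal total mass forces
  equality.\<close>

lemma torus_of_eq_iff: "torus_of x = torus_of y \<longleftrightarrow> torus_rel x y"
  by (rule torus.abs_eq_iff)

lemma torus_of_shift: "torus_of (x + (2 * pi) *\<^sub>R ivec k) = torus_of x"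
  unfolding torus_of_eq_iff torus_rel_def by (rule exI[of _ k]) simp

text \<open>Subtracting the nearest multiple of 2 pi in each coordinate. The bound pi later keeps
  half of each coordinate inside the range where |sin u| is comparable to |u|.\<close>

lemma torus_centered_rep:
  fixes x :: "real ^ 'n"
  obtains k where "\<And>i. \<bar>(x + (2 * pi) *\<^sub>R ivec k) $ i\<bar> \<le> pi"
proof -
  define k where "k = (\<chi> i. - round (x $ i / (2 * pi)))"
  have "\<bar>(x + (2 * pi) *\<^sub>R ivec k) $ i\<bar> \<le> pi" for i
  proof -
    have "\<bar>of_int (round (x $ i / (2 * pi))) - x $ i / (2 * pi)\<bar> \<le> 1 / 2"
      by (rule of_int_round_abs_le)
    then have "\<bar>x $ i / (2 * pi) - of_int (round (x $ i / (2 * pi)))\<bar> * (2 * pi) \<le> 1 / 2 * (2 * pi)"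
      by (intro mult_right_mono) (auto simp: abs_minus_commute)
    also have "\<bar>x $ i / (2 * pi) - of_int (round (x $ i / (2 * pi)))\<bar> * (2 * pi)
        = \<bar>(x $ i / (2 * pi) - of_int (round (x $ i / (2 * pi)))) * (2 * pi)\<bar>"
      by (simp add: abs_mult)
    also have "(x $ i / (2 * pi) - of_int (round (x $ i / (2 * pi)))) * (2 * pi)
        = (x + (2 * pi) *\<^sub>R ivec k) $ i"
      by (simp add: k_def ivec_nth field_simps)
    finally show ?thesis by simp
  qed
  then show ?thesis by (rule that)
qed

lemma compact_UNIV_torus: "compact (UNIV :: 'n::finite torus set)"
proof -
  have "(UNIV :: 'n torus set) = torus_of ` cbox (- (\<chi> i. pi)) (\<chi> i. pi)"
  proof safe
    fix t :: "'n torus"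
    obtain x where t: "t = torus_of x" by (rule torus_of_cases)
    obtain k where "\<And>i. \<bar>(x + (2 * pi) *\<^sub>R ivec k) $ i\<bar> \<le> pi"
      using torus_centered_rep by blast
    then have "- pi \<le> (x + (2 * pi) *\<^sub>R ivec k) $ i \<and> (x + (2 * pi) *\<^sub>R ivec k) $ i \<le> pi" for i
      by (metis abs_le_iff minus_le_iff)
    then have "x + (2 * pi) *\<^sub>R ivec k \<in> cbox (- (\<chi> i. pi)) (\<chi> i. pi)"
      by (simp add: mem_box_cart)
    moreover have "t = torus_of (x + (2 * pi) *\<^sub>R ivec k)" by (simp add: t torus_of_shift)
    ultimately show "t \<in> torus_of ` cbox (- (\<chi> i. pi)) (\<chi> i. pi)" by blast
  qed auto
  then show ?thesis
    by (metis compact_cbox compact_continuous_image continuous_on_torus_of)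
qed

text \<open>The preimage of the image is the union of all lattice translates of \<open>U\<close>.
  Hence the images of a countable base of Euclidean space form a countable base of the
  torus.\<close>

lemma open_torus_of_image:
  assumes "open U" shows "open (torus_of ` U)"
proof -
  have "torus_of -` torus_of ` U = (\<Union>k. (\<lambda>x. (2 * pi) *\<^sub>R ivec k + x) ` U)"
  proof safe
    fix x y assume "torus_of x = torus_of y" "y \<in> U"
    then obtain k where "x - y = (2 * pi) *\<^sub>R ivec k"
      by (auto simp: torus_of_eq_iff torus_rel_def)
    then have "x = (2 * pi) *\<^sub>R ivec k + y" by (simp add: algebra_simps)
    then show "x \<in> (\<Union>k. (\<lambda>x. (2 * pi) *\<^sub>R ivec k + x) ` U)" using \<open>y \<in> U\<close> by blast
  next
    fix x k assume "x \<in> U"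
    then show "(2 * pi) *\<^sub>R ivec k + x \<in> torus_of -` torus_of ` U"
      by (metis add.commute imageI torus_of_shift vimageI)
  qed
  then show ?thesis
    unfolding open_torus_iff using assms by (auto intro!: open_translation)
qed

text \<open>Makes the distance measurable for the product sigma-algebra and, together with
  completeness, gives inner regularity of finite Borel measures.\<close>

instance torus :: (finite) second_countable_topology
proof
  obtain B :: "(real ^ 'a) set set" where B: "countable B" "topological_basis B"
    using ex_countable_basis by blast
  have "topological_basis (image torus_of ` B)"
  proof (rule topological_basisI)
    fix U' :: "'a torus set" assume "U' \<in> image torus_of ` B"
    then show "open U'" using B(2) by (auto intro!: open_torus_of_image topological_basis_open)
  next
    fix U' :: "'a torus set" and t assume o: "open U'" and t: "t \<in> U'"
    obtain x where x: "t = torus_of x" by (rule torus_of_cases)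
    obtain V where V: "V \<in> B" "x \<in> V" "V \<subseteq> torus_of -` U'"
      using B(2) o t x by (metis open_torus_iff topological_basisE vimageI)
    then show "\<exists>B'\<in>image torus_of ` B. t \<in> B' \<and> B' \<subseteq> U'"
      using x by (intro bexI[of _ "torus_of ` V"]) auto
  qed
  then show "\<exists>B::'a torus set set. countable B \<and> open = generate_topology B"
    using B(1) by (intro exI[of _ "image torus_of ` B"])
      (auto intro!: ext simp: topological_basis_imp_subbasis)
qed

lemma continuous_on_torus:
  fixes f :: "'n::finite torus \<Rightarrow> 'b::topological_space"
  assumes "continuous_on UNIV (\<lambda>x. f (torus_of x))"
  shows "continuous_on UNIV f"
proof (rule continuous_on_open_vimage[THEN iffD2, OF open_UNIV, rule_format])
  fix B :: "'b set" assume "open B"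
  then have "open ((\<lambda>x. f (torus_of x)) -` B \<inter> UNIV)"
    using assms by (simp add: continuous_on_open_vimage)
  then have "open (torus_of -` (f -` B))" by (simp add: vimage_def)
  then show "open (f -` B \<inter> UNIV)" by (simp add: open_torus_iff)
qed

lemma cos_sin_shift_lattice:
  fixes n :: "int ^ 'n"
  shows "cos (ivec n \<bullet> (x + (2 * pi) *\<^sub>R ivec k)) = cos (ivec n \<bullet> x)"
    and "sin (ivec n \<bullet> (x + (2 * pi) *\<^sub>R ivec k)) = sin (ivec n \<bullet> x)"
proof -
  define m where "m = (\<Sum>i\<in>UNIV. n $ i * k $ i)"
  have i: "ivec n \<bullet> ivec k = of_int m"
    unfolding inner_vec_def m_def by (simp add: ivec_def)
  have *: "ivec n \<bullet> (x + (2 * pi) *\<^sub>R ivec k) = ivec n \<bullet> x + 2 * pi * of_int m"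
    by (simp add: inner_add_right i)
  have "cos (2 * pi * of_int m) = 1" "sin (2 * pi * of_int m) = 0"
    by (rule cos_int_2pin sin_int_2pin)+
  then show "cos (ivec n \<bullet> (x + (2 * pi) *\<^sub>R ivec k)) = cos (ivec n \<bullet> x)"
    "sin (ivec n \<bullet> (x + (2 * pi) *\<^sub>R ivec k)) = sin (ivec n \<bullet> x)"
    unfolding * cos_add sin_add by simp_all
qed

section \<open>Cosines and sines of lattice frequencies on the torus\<close>

lift_definition tcos :: "int ^ ('n :: finite) \<Rightarrow> 'n torus \<Rightarrow> real" is "\<lambda>n x. cos (ivec n \<bullet> x)"
  by (metis add.commute cos_sin_shift_lattice(1) diff_add_cancel torus_rel_def)

lift_definition tsin :: "int ^ ('n :: finite) \<Rightarrow> 'n torus \<Rightarrow> real" is "\<lambda>n x. sin (ivec n \<bullet> x)"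
  by (metis add.commute cos_sin_shift_lattice(2) diff_add_cancel torus_rel_def)

lemma tcos_of: "tcos n (torus_of x) = cos (ivec n \<bullet> x)"
  by (rule tcos.abs_eq)

lemma tsin_of: "tsin n (torus_of x) = sin (ivec n \<bullet> x)"
  by (rule tsin.abs_eq)

lemma continuous_on_tcos: "continuous_on UNIV (tcos n)"
  by (rule continuous_on_torus) (auto simp: tcos_of intro!: continuous_intros)

lemma continuous_on_tsin: "continuous_on UNIV (tsin n)"
  by (rule continuous_on_torus) (auto simp: tsin_of intro!: continuous_intros)

lemma measurable_tcos [measurable]: "tcos n \<in> borel_measurable borel"
  by (rule borel_measurable_continuous_onI[OF continuous_on_tcos])

lemma measurable_tsin [measurable]: "tsin n \<in> borel_measurable borel"
  by (rule borel_measurable_continuous_onI[OF continuous_on_tsin])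

lemma tcos_tsin_squares: "(tcos n x)\<^sup>2 + (tsin n x)\<^sup>2 = 1"
  by transfer simp

text \<open>The addition formula separates the point from the phase, so joint measurability reduces
  to products of measurable factors. On the circle, \<open>tcos 1\<close> and \<open>tsin 1\<close>
  are the cosine and sine of the phase.\<close>

lemma cos_wave_eq: "cos_wave n x w = tcos n x * tcos 1 w - tsin n x * tsin 1 w"
proof -
  have "ivec 1 \<bullet> w = w $ 1" for w :: "real ^ 1"
    by (simp add: inner_vec_def ivec_nth)
  then show ?thesis by transfer (simp add: cos_add)
qed

lemma measurable_cos_wave [measurable]:
  assumes [measurable]: "f \<in> borel_measurable N" "g \<in> borel_measurable N"
  shows "(\<lambda>p. cos_wave n (f p) (g p)) \<in> borel_measurable N"
  unfolding cos_wave_eq by measurable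

text \<open>The cosine of n . (x - y), written without a difference of torus points. It measures how
  strongly the waves of frequency n at x and at y are correlated.\<close>

definition tcosd :: "int ^ 'n \<Rightarrow> ('n::finite) torus \<Rightarrow> 'n torus \<Rightarrow> real" where
  "tcosd n x y = tcos n x * tcos n y + tsin n x * tsin n y"

lemma tcosd_of: "tcosd n (torus_of x) (torus_of y) = cos (ivec n \<bullet> (x - y))"
  by (simp add: tcosd_def tcos_of tsin_of inner_diff_right cos_diff)

lemma tcosd_minus: "tcosd (- n) x y = tcosd n x y"
  unfolding tcosd_def by transfer (simp add: ivec_minus)

lemma abs_tcosd_le_1: "\<bar>tcosd n x y\<bar> \<le> 1"
proof -
  obtain x' y' where "x = torus_of x'" "y = torus_of y'" by (meson torus_of_cases)
  then show ?thesis by (simp add: tcosd_of)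
qed

text \<open>1 - cos u = 2 sin^2 (u / 2) \<le> u^2 / 2, applied to a representative of the difference
  that is shorter than r. Frequencies far below 1 / r hardly distinguish x from y.\<close>

lemma tcosd_ge:
  assumes "dist x y < r"
  shows "1 - (norm (ivec n))\<^sup>2 * r\<^sup>2 / 2 \<le> tcosd n x y"
proof -
  obtain x' y' where xy: "x = torus_of x'" "y = torus_of y'" by (meson torus_of_cases)
  obtain k where k: "norm (x' - y' + (2 * pi) *\<^sub>R ivec k) < r"
    using assms unfolding xy dist_torus_of pdist_less_iff by auto
  let ?v = "x' - y' + (2 * pi) *\<^sub>R ivec k"
  have "tcosd n x y = cos (ivec n \<bullet> ?v)"
    unfolding xy tcosd_of cos_sin_shift_lattice(1) ..
  moreover have "1 - (ivec n \<bullet> ?v)\<^sup>2 / 2 \<le> cos (ivec n \<bullet> ?v)"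
  proof -
    have "cos (ivec n \<bullet> ?v) = 1 - 2 * (sin (ivec n \<bullet> ?v / 2))\<^sup>2"
      using cos_double_sin[of "ivec n \<bullet> ?v / 2"] by simp
    moreover have "(sin (ivec n \<bullet> ?v / 2))\<^sup>2 \<le> (ivec n \<bullet> ?v / 2)\<^sup>2"
      by (rule abs_le_square_iff[THEN iffD1]) (rule abs_sin_x_le_abs_x)
    ultimately show ?thesis by (simp add: power_divide)
  qed
  moreover have "(ivec n \<bullet> ?v)\<^sup>2 \<le> (norm (ivec n))\<^sup>2 * r\<^sup>2"
  proof -
    have "\<bar>ivec n \<bullet> ?v\<bar> \<le> norm (ivec n) * norm ?v" by (rule Cauchy_Schwarz_ineq2)
    also have "\<dots> \<le> norm (ivec n) * r" using k by (intro mult_left_mono) auto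
    finally show ?thesis
      by (metis abs_ge_zero power2_abs power_mono power_mult_distrib)
  qed
  ultimately show ?thesis by linarith
qed

text \<open>\<open>j\<close> is the coordinate of largest modulus, so the l1 bound on the norm gives
  the distance estimate. Abel summation will run along this coordinate.\<close>

lemma tcosd_rep:
  fixes x y :: "'n::finite torus"
  obtains t :: "real ^ 'n" and j where "\<And>n. tcosd n x y = cos (ivec n \<bullet> t)"
    "\<And>i. \<bar>t $ i\<bar> \<le> pi" "dist x y \<le> real CARD('n) * \<bar>t $ j\<bar>"
proof -
  obtain x' y' where xy: "x = torus_of x'" "y = torus_of y'" by (meson torus_of_cases)
  obtain k where k: "\<And>i. \<bar>(x' - y' + (2 * pi) *\<^sub>R ivec k) $ i\<bar> \<le> pi"
    using torus_centered_rep by blast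
  define t where "t = x' - y' + (2 * pi) *\<^sub>R ivec k"
  have "Max (range (\<lambda>i. \<bar>t $ i\<bar>)) \<in> range (\<lambda>i. \<bar>t $ i\<bar>)" by (intro Max_in) auto
  then obtain j where "Max (range (\<lambda>i. \<bar>t $ i\<bar>)) = \<bar>t $ j\<bar>" by blast
  then have j: "\<bar>t $ i\<bar> \<le> \<bar>t $ j\<bar>" for i
    by (metis Max_ge finite finite_imageI rangeI)
  have "dist x y \<le> norm t" unfolding xy dist_torus_of t_def by (rule pdist_le)
  also have "\<dots> \<le> (\<Sum>i\<in>UNIV. \<bar>t $ i\<bar>)" by (rule norm_le_l1_cart)
  also have "\<dots> \<le> (\<Sum>i\<in>(UNIV::'n set). \<bar>t $ j\<bar>)" by (intro sum_mono j)
  finally have "dist x y \<le> real CARD('n) * \<bar>t $ j\<bar>" by simp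
  moreover have "tcosd n x y = cos (ivec n \<bullet> t)" for n
    unfolding xy tcosd_of t_def cos_sin_shift_lattice(1) ..
  ultimately show ?thesis using k t_def by (metis that)
qed

section \<open>Lattice sums\<close>

lemma bij_betw_vec_nth_PiE: "bij_betw vec_nth {n :: int ^ 'n. \<forall>i. n $ i \<in> S i} (\<Pi>\<^sub>E i\<in>UNIV. S i)"
  by (rule bij_betw_byWitness[where f' = vec_lambda]) (auto simp: PiE_def vec_eq_iff)

lemma finite_lattice_box:
  "(\<And>i. finite (S i)) \<Longrightarrow> finite {n :: int ^ 'n. \<forall>i. n $ i \<in> S i}"
  using bij_betw_finite[OF bij_betw_vec_nth_PiE[of S]] by (simp add: finite_PiE)

lemma card_lattice_box: "card {n :: int ^ 'n. \<forall>i. n $ i \<in> S i} = (\<Prod>i\<in>UNIV. card (S i))"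
  using bij_betw_same_card[OF bij_betw_vec_nth_PiE[of S]] by (simp add: card_PiE)

text \<open>The common features of the cube and the ball truncation: the gauge lies between the
  maximum norm and the Euclidean norm and is monotone in the moduli of the coordinates. Monotonicity
  makes the part of a shell on a coordinate half-line an interval.\<close>

definition lattice_norm :: "(int ^ 'n \<Rightarrow> real) \<Rightarrow> bool" where
  "lattice_norm \<nu> \<longleftrightarrow> (\<forall>n i. real_of_int \<bar>n $ i\<bar> \<le> \<nu> n) \<and> (\<forall>n. \<nu> n \<le> norm (ivec n)) \<and>
    (\<forall>n m. (\<forall>i. \<bar>n $ i\<bar> \<le> \<bar>m $ i\<bar>) \<longrightarrow> \<nu> n \<le> \<nu> m)"

lemma abs_component_le_norm_ivec: "real_of_int \<bar>n $ i\<bar> \<le> norm (ivec n)"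
  using component_le_norm_cart[of "ivec n" i] by (simp add: ivec_nth)

lemma norm_ivec_mono:
  assumes "\<And>i. \<bar>n $ i\<bar> \<le> \<bar>m $ i\<bar>" shows "norm (ivec n) \<le> norm (ivec m)"
proof -
  have "(\<Sum>i\<in>UNIV. (real_of_int (n $ i))\<^sup>2) \<le> (\<Sum>i\<in>UNIV. (real_of_int (m $ i))\<^sup>2)"
    using assms by (intro sum_mono) (metis abs_le_square_iff of_int_abs of_int_le_iff)
  then show ?thesis by (simp add: norm_vec_def L2_set_def ivec_nth)
qed

lemma lattice_norm_euclidean: "lattice_norm (\<lambda>n. norm (ivec n))"
  unfolding lattice_norm_def by (auto intro: norm_ivec_mono simp: abs_component_le_norm_ivec[simplified])

lemma lattice_norm_max: "lattice_norm (\<lambda>n :: int ^ 'n. real_of_int (MAX j. \<bar>n $ j\<bar>))"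
  unfolding lattice_norm_def
proof (intro conjI allI impI)
  fix n m :: "int ^ 'n" and i
  show "real_of_int \<bar>n $ i\<bar> \<le> real_of_int (MAX j. \<bar>n $ j\<bar>)"
    unfolding of_int_le_iff by (rule Max_ge) auto
  have "(MAX j. \<bar>n $ j\<bar>) \<in> range (\<lambda>j. \<bar>n $ j\<bar>)" by (rule Max_in) auto
  then obtain k where k: "(MAX j. \<bar>n $ j\<bar>) = \<bar>n $ k\<bar>" by blast
  show "real_of_int (MAX j. \<bar>n $ j\<bar>) \<le> norm (ivec n)"
    unfolding k by (rule abs_component_le_norm_ivec)
  assume "\<forall>i. \<bar>n $ i\<bar> \<le> \<bar>m $ i\<bar>"
  then have "(MAX j. \<bar>n $ j\<bar>) \<le> (MAX j. \<bar>m $ j\<bar>)"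
    unfolding k by (intro order_trans[OF _ Max_ge[of _ "\<bar>m $ k\<bar>"]]) auto
  then show "real_of_int (MAX j. \<bar>n $ j\<bar>) \<le> real_of_int (MAX j. \<bar>m $ j\<bar>)" by simp
qed

lemma norm_ivec_le_lattice_norm:
  fixes n :: "int ^ 'n"
  assumes "lattice_norm \<nu>" shows "norm (ivec n) \<le> real CARD('n) * \<nu> n"
proof -
  have "norm (ivec n) \<le> (\<Sum>i\<in>UNIV. \<bar>ivec n $ i\<bar>)" by (rule norm_le_l1_cart)
  also have "\<dots> \<le> (\<Sum>i\<in>(UNIV :: 'n set). \<nu> n)"
    using assms by (intro sum_mono) (auto simp: ivec_nth lattice_norm_def)
  finally show ?thesis by simp
qed

lemma lattice_norm_ball_subset:
  assumes "lattice_norm \<nu>"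
  shows "{n. \<nu> n \<le> real N} \<subseteq> {n :: int ^ 'n. \<forall>i. n $ i \<in> {- int N..int N}}"
proof safe
  fix n :: "int ^ 'n" and i assume "\<nu> n \<le> real N"
  then have "real_of_int \<bar>n $ i\<bar> \<le> real N" using assms unfolding lattice_norm_def by (meson order_trans)
  then have "\<bar>n $ i\<bar> \<le> int N" by linarith
  then show "n $ i \<in> {- int N..int N}" by (simp add: abs_le_iff)
qed

lemma finite_lattice_norm_ball: "lattice_norm \<nu> \<Longrightarrow> finite {n. \<nu> n \<le> real N}"
  by (erule finite_subset[OF lattice_norm_ball_subset]) (rule finite_lattice_box, simp)

lemma card_lattice_norm_ball:
  fixes \<nu> :: "int ^ 'n \<Rightarrow> real"
  assumes "lattice_norm \<nu>" shows "card {n. \<nu> n \<le> real N} \<le> (2 * N + 1) ^ CARD('n)"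
proof -
  have "card {n. \<nu> n \<le> real N} \<le> card {n :: int ^ 'n. \<forall>i. n $ i \<in> {- int N..int N}}"
    by (rule card_mono[OF _ lattice_norm_ball_subset[OF assms]]) (rule finite_lattice_box, simp)
  also have "\<dots> = (\<Prod>i\<in>(UNIV :: 'n set). nat (2 * int N + 1))" unfolding card_lattice_box by simp
  also have "\<dots> = (2 * N + 1) ^ CARD('n)" by (simp add: nat_add_distrib nat_mult_distrib)
  finally show ?thesis .
qed

text \<open>The dyadic shell number i has at most (5 * 2^i)^d points, each contributing at most
  2^(-i p), which leaves a geometric series of ratio 2^(d - p). The bound is uniform over finite
  sets, the form in which all later sums appear.\<close>

lemma lattice_powr_summable:
  assumes p: "real CARD('n) < p"
  obtains C where "\<And>F :: (int ^ 'n) set. finite F \<Longrightarrow> (\<Sum>n\<in>F. norm (ivec n) powr - p) \<le> C"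
proof -
  define d where "d = CARD('n)"
  define r where "r = 2 powr (real d - p)"
  have r: "0 \<le> r" "r < 1"
    using powr_less_cancel_iff[of 2 "real d - p" 0] p by (auto simp: r_def d_def)
  define C where "C = 5 ^ d * (1 / (1 - r))"
  have shell: "(\<Sum>n\<in>F \<inter> {n. 2 ^ i \<le> norm (ivec n) \<and> norm (ivec n) < 2 ^ Suc i}. norm (ivec n) powr - p) \<le> 5 ^ d * r ^ i"
    if F: "finite F" for F :: "(int ^ 'n) set" and i
  proof -
    let ?S = "F \<inter> {n. 2 ^ i \<le> norm (ivec n) \<and> norm (ivec n) < 2 ^ Suc i}"
    have "card ?S \<le> card {n :: int ^ 'n. norm (ivec n) \<le> real (2 ^ Suc i)}"
      by (rule card_mono[OF finite_lattice_norm_ball[OF lattice_norm_euclidean]]) auto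
    also have "\<dots> \<le> (2 * 2 ^ Suc i + 1) ^ d" unfolding d_def by (rule card_lattice_norm_ball[OF lattice_norm_euclidean])
    also have "\<dots> \<le> (5 * 2 ^ i) ^ d" by (intro power_mono) auto
    finally have "real (card ?S) \<le> real ((5 * 2 ^ i) ^ d)" by (simp only: of_nat_le_iff)
    then have card: "real (card ?S) \<le> (5 * 2 ^ i) ^ d" by simp
    have "(\<Sum>n\<in>?S. norm (ivec n) powr - p) \<le> (\<Sum>n\<in>?S. (2 ^ i) powr - p)"
      using p by (intro sum_mono powr_mono2') auto
    also have "\<dots> = real (card ?S) * (2 ^ i) powr - p" by simp
    also have "\<dots> \<le> (5 * 2 ^ i) ^ d * (2 ^ i) powr - p" using card by (intro mult_right_mono) auto
    also have "\<dots> = 5 ^ d * r ^ i"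
    proof -
      have "(2 ^ i) ^ d * (2 ^ i) powr - p = ((2 ^ i) powr real d) * (2 ^ i) powr - p"
        by (simp add: powr_realpow)
      also have "\<dots> = (2 ^ i) powr (real d - p)" by (simp add: powr_add[symmetric])
      also have "\<dots> = r ^ i" unfolding r_def by (simp add: powr_realpow[symmetric] powr_powr mult.commute)
      finally show ?thesis by (simp add: power_mult_distrib)
    qed
    finally show ?thesis .
  qed
  have "(\<Sum>n\<in>F. norm (ivec n) powr - p) \<le> C" if F: "finite F" for F :: "(int ^ 'n) set"
  proof -
    have "\<exists>I. \<forall>n\<in>F. norm (ivec n) < 2 ^ I"
      using F
    proof (induction F rule: finite_induct)
      case (insert n F)
      then obtain I where I: "\<forall>n\<in>F. norm (ivec n) < 2 ^ I" by blast
      obtain J where J: "norm (ivec n) < 2 ^ J" using real_arch_pow[of 2 "norm (ivec n)"] by auto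
      have "(2::real) ^ I \<le> 2 ^ (max I J)" "(2::real) ^ J \<le> 2 ^ (max I J)" by (auto intro: power_increasing)
      then have "\<forall>m\<in>insert n F. norm (ivec m) < 2 ^ (max I J)" using I J by (auto intro: less_le_trans)
      then show ?case by blast
    qed auto
    then obtain I where I: "\<forall>n\<in>F. norm (ivec n) < 2 ^ I" by blast
    let ?G = "\<lambda>i. F \<inter> {n. 2 ^ i \<le> norm (ivec n) \<and> norm (ivec n) < 2 ^ Suc i}"
    have main: "(\<Sum>n\<in>F. if norm (ivec n) < 2 ^ I then norm (ivec n) powr - p else 0) \<le> (\<Sum>i<I. \<Sum>n\<in>?G i. norm (ivec n) powr - p)" for I
    proof (induction I)
      case 0
      \<comment> \<open>Only the zero vector has norm below 1, and \<open>0 powr - p\<close> is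
        0.\<close>
      have "(if norm (ivec n) < 1 then norm (ivec n) powr - p else 0) \<le> 0" for n :: "int ^ 'n"
        using norm_ivec_ge_1[of n] by (cases "n = 0") (auto simp: ivec_0)
      then show ?case by (auto intro!: sum_nonpos)
    next
      case (Suc I)
      have "(\<Sum>n\<in>F. if norm (ivec n) < 2 ^ Suc I then norm (ivec n) powr - p else 0)
          = (\<Sum>n\<in>F. (if norm (ivec n) < 2 ^ I then norm (ivec n) powr - p else 0)
            + (if n \<in> {n. 2 ^ I \<le> norm (ivec n) \<and> norm (ivec n) < 2 ^ Suc I} then norm (ivec n) powr - p else 0))"
        by (rule sum.cong) (auto intro: less_le_trans)
      also have "\<dots> = (\<Sum>n\<in>F. if norm (ivec n) < 2 ^ I then norm (ivec n) powr - p else 0) + (\<Sum>n\<in>?G I. norm (ivec n) powr - p)"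
        using F by (simp only: sum.distrib sum.inter_restrict)
      finally show ?case using Suc by simp
    qed
    have "(\<Sum>n\<in>F. norm (ivec n) powr - p) = (\<Sum>n\<in>F. if norm (ivec n) < 2 ^ I then norm (ivec n) powr - p else 0)"
      using I by (intro sum.cong) auto
    also have "\<dots> \<le> (\<Sum>i<I. \<Sum>n\<in>?G i. norm (ivec n) powr - p)" by (rule main)
    also have "\<dots> \<le> (\<Sum>i<I. 5 ^ d * r ^ i)" by (intro sum_mono shell F)
    also have "\<dots> = 5 ^ d * (\<Sum>i<I. r ^ i)" by (simp add: sum_distrib_left)
    also have "\<dots> \<le> C" unfolding C_def
    proof (intro mult_left_mono)
      have "(\<Sum>i<I. r ^ i) = (1 - r ^ I) / (1 - r)" using r by (simp add: sum_gp_strict)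
      also have "\<dots> \<le> 1 / (1 - r)" using r by (intro divide_right_mono) auto
      finally show "(\<Sum>i<I. r ^ i) \<le> 1 / (1 - r)" .
    qed simp
    finally show ?thesis .
  qed
  then show ?thesis by (rule that)
qed

section \<open>Cancellation in lattice cosine sums\<close>

text \<open>Abel summation: 2 sin(\<theta> / 2) cos(m \<theta> + \<phi>) is a difference of
  consecutive shifted sines, and the weights decrease. The factor \<open>sin (\<theta> / 2)\<close>
  stays on the left because it may vanish.\<close>

lemma abel_cos_sum_bound:
  fixes w :: "nat \<Rightarrow> real"
  assumes anti: "\<And>m n. a \<le> m \<Longrightarrow> m \<le> n \<Longrightarrow> n < b \<Longrightarrow> w n \<le> w m"
    and w0: "\<And>m. a \<le> m \<Longrightarrow> m < b \<Longrightarrow> 0 \<le> w m" and W: "\<And>m. a \<le> m \<Longrightarrow> m < b \<Longrightarrow> w m \<le> W" and "0 \<le> W"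
  shows "\<bar>\<Sum>m=a..<b. w m * cos (real m * \<theta> + \<phi>)\<bar> * \<bar>sin (\<theta> / 2)\<bar> \<le> W"
proof (cases "a < b")
  case True
  define s where "s m = sin (real m * \<theta> + \<phi> - \<theta> / 2)" for m :: nat
  have s: "\<bar>s m\<bar> \<le> 1" for m by (simp add: s_def)
  have step: "2 * sin (\<theta> / 2) * cos (real m * \<theta> + \<phi>) = s (Suc m) - s m" for m
  proof -
    have "s (Suc m) = sin ((real m * \<theta> + \<phi>) + \<theta> / 2)" by (simp add: s_def algebra_simps)
    then show ?thesis unfolding s_def by (simp add: sin_add sin_diff)
  qed
  \<comment> \<open>Each step adds the decrease \<open>w (c - 1) - w c\<close> to the bound, and
    these decreases telescope.\<close>
  have main: "\<bar>(\<Sum>m=a..<c. w m * (s (Suc m) - s m)) - w (c - 1) * s c\<bar> \<le> 2 * w a - w (c - 1)"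
    if "Suc a \<le> c" "c \<le> b" for c
    using that
  proof (induction c rule: dec_induct)
    case base
    have "\<bar>w a * s a\<bar> \<le> w a * 1"
      unfolding abs_mult using w0[of a] True s[of a] by (intro mult_mono) auto
    then show ?case by (simp add: algebra_simps)
  next
    case (step c)
    let ?v = "w (c - 1) - w c"
    have v: "0 \<le> ?v" using anti[of "c - 1" c] step by auto
    have eq: "(\<Sum>m=a..<Suc c. w m * (s (Suc m) - s m)) - w c * s (Suc c)
        = ((\<Sum>m=a..<c. w m * (s (Suc m) - s m)) - w (c - 1) * s c) + ?v * s c"
      using step by (simp add: algebra_simps)
    have B: "\<bar>?v * s c\<bar> \<le> ?v * 1"
      unfolding abs_mult using v s[of c] by (intro mult_mono) auto
    have A: "\<bar>(\<Sum>m=a..<c. w m * (s (Suc m) - s m)) - w (c - 1) * s c\<bar> \<le> 2 * w a - w (c - 1)"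
      using step by simp
    show ?case unfolding diff_Suc_1 eq
      by (rule order_trans[OF abs_triangle_ineq]) (use add_mono[OF A B] in simp)
  qed
  let ?S = "\<Sum>m=a..<b. w m * cos (real m * \<theta> + \<phi>)"
  have "(2 * sin (\<theta> / 2)) * ?S = (\<Sum>m=a..<b. w m * (s (Suc m) - s m))"
    unfolding sum_distrib_left by (rule sum.cong) (simp_all add: step[symmetric])
  moreover have "\<bar>w (b - 1) * s b\<bar> \<le> w (b - 1) * 1"
    unfolding abs_mult using w0[of "b - 1"] True s[of b] by (intro mult_mono) auto
  ultimately have "\<bar>(2 * sin (\<theta> / 2)) * ?S\<bar> \<le> 2 * w a"
    using main[of b] True by auto
  then have "2 * (\<bar>?S\<bar> * \<bar>sin (\<theta> / 2)\<bar>) \<le> 2 * w a" by (simp add: abs_mult mult_ac)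
  then show ?thesis using W[of a] True by simp
qed (use assms in auto)

text \<open>A finite order-convex set of naturals is an interval; convexity is the form in which the
  slices of a shell are known.\<close>

lemma abel_cos_sum_bound_convex:
  fixes w :: "nat \<Rightarrow> real"
  assumes S: "finite S" "\<And>k m n. k \<in> S \<Longrightarrow> n \<in> S \<Longrightarrow> k \<le> m \<Longrightarrow> m \<le> n \<Longrightarrow> m \<in> S"
    and anti: "\<And>m n. m \<in> S \<Longrightarrow> n \<in> S \<Longrightarrow> m \<le> n \<Longrightarrow> w n \<le> w m"
    and w0: "\<And>m. m \<in> S \<Longrightarrow> 0 \<le> w m" and W: "\<And>m. m \<in> S \<Longrightarrow> w m \<le> W" and "0 \<le> W"
  shows "\<bar>\<Sum>m\<in>S. w m * cos (real m * \<theta> + \<phi>)\<bar> * \<bar>sin (\<theta> / 2)\<bar> \<le> W"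
proof (cases "S = {}")
  case False
  have eq: "S = {Min S..<Suc (Max S)}"
  proof safe
    fix m assume "m \<in> S"
    then show "m \<in> {Min S..<Suc (Max S)}" using S(1) by (simp add: less_Suc_eq_le)
  next
    fix m assume "m \<in> {Min S..<Suc (Max S)}"
    then show "m \<in> S" using S(2)[of "Min S" "Max S" m] S(1) False by (simp add: less_Suc_eq_le)
  qed
  define a b where "a = Min S" and "b = Suc (Max S)"
  have eq': "S = {a..<b}" using eq by (simp add: a_def b_def)
  show ?thesis unfolding eq' using anti w0 W \<open>0 \<le> W\<close> by (intro abel_cos_sum_bound) (auto simp: eq')
qed (use \<open>0 \<le> W\<close> in auto)

text \<open>|sin x| \<ge> |x| - |x|^3 / 6, and x^2 \<le> 4 leaves one third of |x|. The range 2
  contains pi / 2, the largest half coordinate of a centred representative.\<close>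

lemma abs_sin_ge_third:
  assumes "\<bar>x\<bar> \<le> 2" shows "\<bar>x\<bar> / 3 \<le> \<bar>sin (x :: real)\<bar>"
proof -
  have "\<bar>sin x - (\<Sum>m<3. sin_coeff m * x ^ m)\<bar> \<le> inverse (fact 3) * \<bar>x\<bar> ^ 3"
    by (rule Maclaurin_sin_bound)
  moreover have "(\<Sum>m<3. sin_coeff m * x ^ m) = x" by (simp add: eval_nat_numeral sin_coeff_def)
  moreover have "inverse (fact 3) * \<bar>x\<bar> ^ 3 \<le> 2 / 3 * \<bar>x\<bar>"
  proof -
    have "\<bar>x\<bar> * \<bar>x\<bar> \<le> 2 * 2" using assms by (intro mult_mono) auto
    then have "(\<bar>x\<bar> * \<bar>x\<bar>) * \<bar>x\<bar> \<le> 4 * \<bar>x\<bar>" by (intro mult_right_mono) auto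
    then show ?thesis by (simp add: eval_nat_numeral field_simps)
  qed
  ultimately show ?thesis by linarith
qed

text \<open>The variance weight |n|^-d: the squared amplitude of the wave of frequency n is
  \<alpha>^2 times this.\<close>

definition inv_norm_pow :: "int ^ 'n \<Rightarrow> real" where
  "inv_norm_pow n = 1 / norm (ivec n) ^ CARD('n)"

definition replace_coord :: "'n \<Rightarrow> int ^ 'n \<Rightarrow> int \<Rightarrow> int ^ 'n" where
  "replace_coord j y k = (\<chi> i. if i = j then k else y $ i)"

lemma replace_coord_nth: "replace_coord j y k $ i = (if i = j then k else y $ i)"
  by (simp add: replace_coord_def)

lemma sum_int_symmetric:
  fixes h :: "int \<Rightarrow> real"
  assumes "finite S"
  shows "(\<Sum>k | nat \<bar>k\<bar> \<in> S. h k) = (\<Sum>m\<in>S. h (int m)) + (\<Sum>m\<in>S - {0}. h (- int m))"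
proof -
  have "{k. nat \<bar>k\<bar> \<in> S} = int ` S \<union> (\<lambda>m. - int m) ` (S - {0})"
  proof safe
    fix k :: int assume k: "nat \<bar>k\<bar> \<in> S" "k \<notin> (\<lambda>m. - int m) ` (S - {0})"
    have "0 \<le> k"
    proof (rule ccontr)
      assume "\<not> 0 \<le> k"
      then have "k = - int (nat \<bar>k\<bar>)" "nat \<bar>k\<bar> \<noteq> 0" by simp_all
      then have "k \<in> (\<lambda>m. - int m) ` (S - {0})" using k(1) by (intro image_eqI[of _ _ "nat \<bar>k\<bar>"]) auto
      then show False using k(2) by contradiction
    qed
    then have "k = int (nat \<bar>k\<bar>)" by simp
    then show "k \<in> int ` S" using k(1) by blast
  qed auto
  moreover have "int ` S \<inter> (\<lambda>m. - int m) ` (S - {0}) = {}"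
  proof -
    have False if "k \<in> int ` S" "k \<in> (\<lambda>m. - int m) ` (S - {0})" for k
    proof -
      from that(1) obtain m where "k = int m" by blast
      moreover from that(2) obtain m' where "k = - int m'" "m' \<in> S - {0}" by blast
      ultimately show False by auto
    qed
    then show ?thesis by blast
  qed
  ultimately have "(\<Sum>k | nat \<bar>k\<bar> \<in> S. h k) = (\<Sum>k\<in>int ` S. h k) + (\<Sum>k\<in>(\<lambda>m. - int m) ` (S - {0}). h k)"
    using assms by (simp add: sum.union_disjoint)
  then show ?thesis by (simp add: sum.reindex inj_on_def)
qed

text \<open>On a line parallel to axis j the terms decrease in modulus away from 0, so Abel
  summation bounds the line by a constant times 2^(-i d) / |t_j|. The shell meets at most 5^d * 2^(i
  (d - 1)) such lines, which leaves 2^-i / |t_j|.\<close>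

lemma lattice_shell_cos_sum:
  fixes t :: "real ^ 'n"
  assumes \<nu>: "lattice_norm \<nu>" and tj: "\<bar>t $ j\<bar> \<le> pi"
  shows "\<bar>\<Sum>n | 2 ^ i < \<nu> n \<and> \<nu> n \<le> 2 ^ Suc i. inv_norm_pow n * cos (ivec n \<bullet> t)\<bar> * \<bar>t $ j\<bar>
    \<le> 12 * 5 ^ CARD('n) / 2 ^ i"
proof -
  define d where "d = CARD('n)"
  have d: "0 < d" by (simp add: d_def)
  define E where "E = {n. 2 ^ i < \<nu> n \<and> \<nu> n \<le> 2 ^ Suc i}"
  define h where "h n = inv_norm_pow n * cos (ivec n \<bullet> t)" for n
  have mono: "\<nu> n \<le> \<nu> m" if "\<And>i. \<bar>n $ i\<bar> \<le> \<bar>m $ i\<bar>" for n m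
    using \<nu> that by (auto simp: lattice_norm_def)
  have le_norm: "\<nu> n \<le> norm (ivec n)" for n using \<nu> by (auto simp: lattice_norm_def)
  have Efin: "finite E"
    using finite_lattice_norm_ball[OF \<nu>, of "2 ^ Suc i"] by (rule finite_subset[rotated]) (auto simp: E_def)
  \<comment> \<open>Base points of the lines parallel to axis j that meet the shell.\<close>
  define P where "P = (\<lambda>n. replace_coord j n 0) ` E"
  define W where "W = (1 :: real) / (2 ^ i) ^ d"
  \<comment> \<open>Each of the two half-lines contributes W, and |sin (t_j / 2)| \<ge> |t_j| / 6;
    hence 12 = 2 * 6.\<close>
  have slice: "\<bar>\<Sum>n\<in>{n\<in>E. replace_coord j n 0 = y}. h n\<bar> * \<bar>t $ j\<bar> \<le> 12 * W" if "y \<in> P" for y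
  proof -
    have yj: "y $ j = 0" using that by (auto simp: P_def replace_coord_nth)
    define S where "S = {m :: nat. replace_coord j y (int m) \<in> E}"
    \<comment> \<open>The gauge depends only on the moduli of the coordinates, so the slice is
      symmetric and described by a set of naturals.\<close>
    have absE: "replace_coord j y k \<in> E \<longleftrightarrow> nat \<bar>k\<bar> \<in> S" for k
    proof -
      have "\<nu> (replace_coord j y k) = \<nu> (replace_coord j y (int (nat \<bar>k\<bar>)))"
        by (intro antisym mono) (auto simp: replace_coord_nth)
      then show ?thesis by (simp add: S_def E_def)
    qed
    have inj: "inj (replace_coord j y)"
      by (rule injI) (metis replace_coord_nth)
    have Sfin: "finite S"
    proof (rule finite_imageD)
      show "finite ((\<lambda>m. replace_coord j y (int m)) ` S)"
        by (rule finite_subset[OF _ Efin]) (auto simp: S_def)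
      show "inj_on (\<lambda>m. replace_coord j y (int m)) S"
      proof (rule inj_onI)
        fix a b assume "replace_coord j y (int a) = replace_coord j y (int b)"
        then have "int a = int b" by (rule injD[OF inj])
        then show "a = b" by simp
      qed
    qed
    have conv: "m \<in> S" if "k \<in> S" "n \<in> S" "k \<le> m" "m \<le> n" for k m n
    proof -
      have "\<nu> (replace_coord j y (int k)) \<le> \<nu> (replace_coord j y (int m))"
        "\<nu> (replace_coord j y (int m)) \<le> \<nu> (replace_coord j y (int n))"
        using that by (auto intro!: mono simp: replace_coord_nth)
      then show ?thesis using that by (auto simp: S_def E_def)
    qed
    define w where "w m = inv_norm_pow (replace_coord j y (int m))" for m
    have normgt: "2 ^ i < norm (ivec n)" if "n \<in> E" for n using that le_norm[of n] by (auto simp: E_def)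
    have anti: "w n \<le> w m" if "m \<in> S" "n \<in> S" "m \<le> n" for m n
    proof -
      have "norm (ivec (replace_coord j y (int m))) \<le> norm (ivec (replace_coord j y (int n)))"
        using that by (intro norm_ivec_mono) (auto simp: replace_coord_nth)
      moreover have "0 < norm (ivec (replace_coord j y (int m)))"
        using normgt[of "replace_coord j y (int m)"] that zero_less_power[of "2::real" i] by (auto simp: S_def intro: less_trans)
      ultimately show ?thesis unfolding w_def inv_norm_pow_def
        by (intro divide_left_mono power_mono mult_pos_pos zero_less_power) auto
    qed
    have w0: "0 \<le> w m" for m by (simp add: w_def inv_norm_pow_def)
    have wW: "w m \<le> W" if "m \<in> S" for m
    proof -
      have g: "2 ^ i < norm (ivec (replace_coord j y (int m)))" using normgt that by (simp add: S_def)
      then have "0 < norm (ivec (replace_coord j y (int m)))" by (rule less_trans[rotated]) simp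
      then show ?thesis unfolding w_def inv_norm_pow_def W_def d_def
        using g by (intro divide_left_mono power_mono mult_pos_pos zero_less_power) auto
    qed
    have W0: "0 \<le> W" by (simp add: W_def)
    have hk: "h (replace_coord j y k) = w (nat \<bar>k\<bar>) * cos (of_int k * t $ j + ivec y \<bullet> t)" for k
    proof -
      have "norm (ivec (replace_coord j y k)) = norm (ivec (replace_coord j y (int (nat \<bar>k\<bar>))))"
        by (intro antisym norm_ivec_mono) (auto simp: replace_coord_nth)
      moreover have "ivec (replace_coord j y k) \<bullet> t = of_int k * t $ j + ivec y \<bullet> t"
      proof -
        have "ivec (replace_coord j y k) \<bullet> t = (\<Sum>i\<in>UNIV. (if i = j then of_int k * t $ j else 0) + ivec y $ i * t $ i)"
          unfolding inner_vec_def by (rule sum.cong) (auto simp: ivec_nth replace_coord_nth yj)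
        then show ?thesis by (simp add: sum.distrib inner_vec_def)
      qed
      ultimately show ?thesis by (simp add: h_def w_def inv_norm_pow_def)
    qed
    have "{n\<in>E. replace_coord j n 0 = y} = replace_coord j y ` {k. nat \<bar>k\<bar> \<in> S}"
    proof safe
      fix n assume n: "n \<in> E" "y = replace_coord j n 0"
      have "n = replace_coord j (replace_coord j n 0) (n $ j)" by (simp add: vec_eq_iff replace_coord_nth)
      then show "n \<in> replace_coord j (replace_coord j n 0) ` {k. nat \<bar>k\<bar> \<in> S}"
        using n absE[of "n $ j"] by (metis (mono_tags, lifting) imageI mem_Collect_eq)
    next
      fix k assume k: "nat \<bar>k\<bar> \<in> S"
      then show "replace_coord j y k \<in> E" by (simp add: absE)
      show "replace_coord j (replace_coord j y k) 0 = y" using yj by (simp add: vec_eq_iff replace_coord_nth)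
    qed
    then have "(\<Sum>n\<in>{n\<in>E. replace_coord j n 0 = y}. h n) = (\<Sum>k | nat \<bar>k\<bar> \<in> S. h (replace_coord j y k))"
      using inj by (simp add: sum.reindex inj_on_def)
    also have "\<dots> = (\<Sum>m\<in>S. w m * cos (real m * t $ j + ivec y \<bullet> t))
        + (\<Sum>m\<in>S - {0}. w m * cos (real m * t $ j + - (ivec y \<bullet> t)))"
      unfolding sum_int_symmetric[OF Sfin] hk
    proof -
      \<comment> \<open>Cosine is even, so the negative half-line becomes a forward sum with the
        opposite phase.\<close>
      have "cos (- (real m * t $ j) + ivec y \<bullet> t) = cos (real m * t $ j + - (ivec y \<bullet> t))" for m
        using cos_minus[of "real m * t $ j + - (ivec y \<bullet> t)"] by simp
      then show "(\<Sum>m\<in>S. w (nat \<bar>int m\<bar>) * cos (real_of_int (int m) * t $ j + ivec y \<bullet> t)) +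
        (\<Sum>m\<in>S - {0}. w (nat \<bar>- int m\<bar>) * cos (real_of_int (- int m) * t $ j + ivec y \<bullet> t)) =
        (\<Sum>m\<in>S. w m * cos (real m * t $ j + ivec y \<bullet> t)) +
        (\<Sum>m\<in>S - {0}. w m * cos (real m * t $ j + - (ivec y \<bullet> t)))" by simp
    qed
    finally have split: "(\<Sum>n\<in>{n\<in>E. replace_coord j n 0 = y}. h n) = (\<Sum>m\<in>S. w m * cos (real m * t $ j + ivec y \<bullet> t))
        + (\<Sum>m\<in>S - {0}. w m * cos (real m * t $ j + - (ivec y \<bullet> t)))" (is "?T = ?T1 + ?T2") .
    have T1: "\<bar>?T1\<bar> * \<bar>sin (t $ j / 2)\<bar> \<le> W"
    proof (rule abel_cos_sum_bound_convex)
      show "finite S" by (rule Sfin)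
      show "m \<in> S" if "k \<in> S" "n \<in> S" "k \<le> m" "m \<le> n" for k m n
        using conv that .
    qed (use anti w0 wW W0 in auto)
    have conv': "m \<in> S - {0}" if "k \<in> S - {0}" "n \<in> S - {0}" "k \<le> m" "m \<le> n" for k m n
      using conv[of k n m] that by auto
    have T2: "\<bar>?T2\<bar> * \<bar>sin (t $ j / 2)\<bar> \<le> W"
    proof (rule abel_cos_sum_bound_convex)
      show "finite (S - {0})" using Sfin by simp
      show "m \<in> S - {0}" if "k \<in> S - {0}" "n \<in> S - {0}" "k \<le> m" "m \<le> n" for k m n
        using conv' that .
    qed (use anti w0 wW W0 in auto)
    have "\<bar>?T\<bar> * \<bar>sin (t $ j / 2)\<bar> \<le> (\<bar>?T1\<bar> + \<bar>?T2\<bar>) * \<bar>sin (t $ j / 2)\<bar>"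
      unfolding split by (intro mult_right_mono abs_triangle_ineq) auto
    also have "\<dots> \<le> 2 * W" using T1 T2 by (simp add: distrib_right)
    finally have T: "\<bar>?T\<bar> * \<bar>sin (t $ j / 2)\<bar> \<le> 2 * W" .
    have "\<bar>t $ j / 2\<bar> / 3 \<le> \<bar>sin (t $ j / 2)\<bar>"
      using tj pi_less_4 by (intro abs_sin_ge_third) auto
    then have "\<bar>?T\<bar> * (\<bar>t $ j / 2\<bar> / 3) \<le> \<bar>?T\<bar> * \<bar>sin (t $ j / 2)\<bar>" by (intro mult_left_mono) auto
    then have "\<bar>?T\<bar> * (\<bar>t $ j / 2\<bar> / 3) \<le> 2 * W" using T by linarith
    then show ?thesis by simp
  qed
  \<comment> \<open>Pinning coordinate j to 0 leaves d - 1 free coordinates, which is the gain of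
    one power of 2^i over the number of points.\<close>
  have cardP: "real (card P) \<le> 5 ^ d * (2 ^ i) ^ (d - 1)"
  proof -
    let ?N = "2 ^ Suc i :: nat"
    let ?B = "\<lambda>i'. if i' = j then {0} else {- int ?N..int ?N}"
    have "P \<subseteq> {n. \<forall>i. n $ i \<in> ?B i}"
    proof safe
      fix y i' assume "y \<in> P"
      then obtain n where n: "n \<in> E" "y = replace_coord j n 0" by (auto simp: P_def)
      have "n \<in> {n. \<nu> n \<le> real ?N}" using n by (simp add: E_def)
      then have "n \<in> {n. \<forall>i. n $ i \<in> {- int ?N..int ?N}}" using lattice_norm_ball_subset[OF \<nu>, of ?N] by blast
      then show "y $ i' \<in> ?B i'" using n by (simp add: replace_coord_nth)
    qed
    then have "card P \<le> card {n. \<forall>i. n $ i \<in> ?B i}"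
      by (rule card_mono[rotated]) (rule finite_lattice_box, simp)
    also have "\<dots> = (\<Prod>i'\<in>UNIV. if i' = j then 1 else 2 * ?N + 1)"
      unfolding card_lattice_box by (rule prod.cong) (auto simp: nat_add_distrib nat_mult_distrib)
    also have "\<dots> = (\<Prod>i'\<in>UNIV - {j}. 2 * ?N + 1)"
      by (subst prod.remove[of _ j]) (auto intro!: prod.cong)
    also have "\<dots> = (2 * ?N + 1) ^ (d - 1)" by (simp add: d_def card_Diff_singleton)
    also have "\<dots> \<le> (5 * 2 ^ i) ^ (d - 1)" by (intro power_mono) auto
    also have "\<dots> = 5 ^ (d - 1) * (2 ^ i) ^ (d - 1)" by (simp add: power_mult_distrib)
    also have "\<dots> \<le> 5 ^ d * (2 ^ i) ^ (d - 1)" by (intro mult_right_mono power_increasing) auto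
    finally have "real (card P) \<le> real (5 ^ d * (2 ^ i) ^ (d - 1))" by (simp only: of_nat_le_iff)
    then show ?thesis by simp
  qed
  have "(\<Sum>n\<in>E. h n) = (\<Sum>y\<in>P. \<Sum>n\<in>{n\<in>E. replace_coord j n 0 = y}. h n)"
    unfolding P_def by (rule sum.image_gen[OF Efin])
  then have "\<bar>\<Sum>n\<in>E. h n\<bar> * \<bar>t $ j\<bar> \<le> (\<Sum>y\<in>P. \<bar>\<Sum>n\<in>{n\<in>E. replace_coord j n 0 = y}. h n\<bar>) * \<bar>t $ j\<bar>"
    by (intro mult_right_mono) (auto simp: sum_abs)
  also have "\<dots> \<le> (\<Sum>y\<in>P. 12 * W)"
    unfolding sum_distrib_right by (rule sum_mono) (rule slice)
  also have "\<dots> = real (card P) * (12 * W)" by simp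
  also have "\<dots> \<le> (5 ^ d * (2 ^ i) ^ (d - 1)) * (12 * W)"
    using cardP by (intro mult_right_mono) (auto simp: W_def)
  also have "\<dots> = 12 * 5 ^ d / 2 ^ i"
  proof -
    have "((2::real) ^ i) ^ d = 2 ^ i * (2 ^ i) ^ (d - 1)" using d by (metis power_eq_if nat_neq_iff)
    then show ?thesis by (simp add: W_def)
  qed
  finally show ?thesis by (simp add: E_def h_def d_def)
qed

lemma lattice_norm_uminus: "lattice_norm \<nu> \<Longrightarrow> \<nu> (- n) = \<nu> n"
  unfolding lattice_norm_def by (intro antisym) auto

text \<open>A symmetric set without 0 is the disjoint union of its part in \<open>H\<close> and the
  mirror image of that part.\<close>

lemma half_lattice_sum:
  fixes f :: "int ^ 'n \<Rightarrow> real"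
  assumes H: "half_lattice H" and E: "finite E" "0 \<notin> E" "\<And>n. n \<in> E \<Longrightarrow> - n \<in> E"
    and even: "\<And>n. f (- n) = f n"
  shows "(\<Sum>n\<in>E. f n) = 2 * (\<Sum>n\<in>E \<inter> H. f n)"
proof -
  have H': "n \<in> H \<longleftrightarrow> - n \<notin> H" if "n \<noteq> 0" for n
    using H that unfolding half_lattice_def by blast
  have "E = (E \<inter> H) \<union> uminus ` (E \<inter> H)"
  proof safe
    fix n assume n: "n \<in> E" "n \<notin> uminus ` (E \<inter> H)"
    then have "- n \<notin> E \<inter> H" by (metis imageI minus_minus)
    then have "- n \<notin> H" using E(3) n by blast
    then show "n \<in> H" using H'[of n] E(2) n by metis
  qed (use E(3) in auto)
  moreover have "(E \<inter> H) \<inter> uminus ` (E \<inter> H) = {}"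
  proof -
    have False if "n \<in> H" "n = - m" "m \<in> E" "m \<in> H" for n m
      using that H'[of m] E(2) by metis
    then show ?thesis by blast
  qed
  moreover have "finite (E \<inter> H)" using E(1) by simp
  ultimately have "(\<Sum>n\<in>E. f n) = (\<Sum>n\<in>E \<inter> H. f n) + (\<Sum>n\<in>uminus ` (E \<inter> H). f n)"
    by (metis finite_imageI sum.union_disjoint)
  also have "(\<Sum>n\<in>uminus ` (E \<inter> H). f n) = (\<Sum>n\<in>E \<inter> H. f n)"
    by (subst sum.reindex) (auto simp: even)
  finally show ?thesis by simp
qed

lemma inv_norm_pow_uminus: "inv_norm_pow (- n) = inv_norm_pow n"
  by (simp add: inv_norm_pow_def ivec_minus)

lemma inv_norm_pow_nonneg: "0 \<le> inv_norm_pow n"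
  by (simp add: inv_norm_pow_def)

text \<open>The shell bounds form a geometric series of the size of its first term 2^-k \<le> |x -
  y| \<le> d |t_j|, so the factor |t_j| cancels and no dependence on K remains. Frequencies beyond 1
  / |x - y| thus contribute a bounded amount to the correlation.\<close>

lemma lattice_tail_cos_sum:
  fixes \<nu> :: "int ^ 'n \<Rightarrow> real"
  assumes \<nu>: "lattice_norm \<nu>" and H: "half_lattice H"
    and xy: "(1/2) ^ k \<le> dist x y" and kK: "k \<le> K"
  shows "\<bar>\<Sum>n | n \<in> H \<and> 2 ^ k < \<nu> n \<and> \<nu> n \<le> 2 ^ K. inv_norm_pow n * tcosd n x y\<bar>
    \<le> 12 * 5 ^ CARD('n) * CARD('n)"
proof -
  define d where "d = real CARD('n)"
  obtain t :: "real ^ 'n" and j where t: "\<And>n. tcosd n x y = cos (ivec n \<bullet> t)"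
    "\<And>i. \<bar>t $ i\<bar> \<le> pi" "dist x y \<le> d * \<bar>t $ j\<bar>"
    unfolding d_def using tcosd_rep by blast
  have d0: "0 < d" by (simp add: d_def)
  let ?g = "\<lambda>n. inv_norm_pow n * tcosd n x y"
  let ?E = "\<lambda>a b. {n. 2 ^ a < \<nu> n \<and> \<nu> n \<le> 2 ^ b}"
  have fin: "finite (?E a b)" for a b
    using finite_lattice_norm_ball[OF \<nu>, of "2 ^ b"] by (rule finite_subset[rotated]) auto
  have shell: "\<bar>\<Sum>n\<in>?E i (Suc i). ?g n\<bar> * \<bar>t $ j\<bar> \<le> 12 * 5 ^ CARD('n) / 2 ^ i" for i
    using lattice_shell_cos_sum[OF \<nu> t(2)[of j], of i] by (simp only: t(1))
  \<comment> \<open>The geometric sum in telescoping form; passing to the half lattice later halves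
    24 to 12.\<close>
  have full: "\<bar>\<Sum>n\<in>?E k K. ?g n\<bar> * \<bar>t $ j\<bar> \<le> 24 * 5 ^ CARD('n) * (1 / 2 ^ k - 1 / 2 ^ K)"
    using kK
  proof (induction K rule: dec_induct)
    case (step K)
    have "(2::real) ^ k \<le> 2 ^ K" using step by (intro power_increasing) auto
    moreover have "(2::real) ^ K \<le> 2 ^ Suc K" by simp
    moreover have "{n. a < \<nu> n \<and> \<nu> n \<le> c} = {n. a < \<nu> n \<and> \<nu> n \<le> b} \<union> {n. b < \<nu> n \<and> \<nu> n \<le> c}"
      if "a \<le> b" "b \<le> c" for a b c using that by auto
    ultimately have "?E k (Suc K) = ?E k K \<union> ?E K (Suc K)" by blast
    moreover have "?E k K \<inter> ?E K (Suc K) = {}" by auto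
    ultimately have "(\<Sum>n\<in>?E k (Suc K). ?g n) = (\<Sum>n\<in>?E k K. ?g n) + (\<Sum>n\<in>?E K (Suc K). ?g n)"
      using fin by (simp only: sum.union_disjoint)
    then have "\<bar>\<Sum>n\<in>?E k (Suc K). ?g n\<bar> * \<bar>t $ j\<bar>
        \<le> (\<bar>\<Sum>n\<in>?E k K. ?g n\<bar> + \<bar>\<Sum>n\<in>?E K (Suc K). ?g n\<bar>) * \<bar>t $ j\<bar>"
      by (simp only:) (intro mult_right_mono abs_triangle_ineq abs_ge_zero)
    also have "\<dots> \<le> 24 * 5 ^ CARD('n) * (1 / 2 ^ k - 1 / 2 ^ K) + 12 * 5 ^ CARD('n) / 2 ^ K"
      unfolding distrib_right by (intro add_mono step.IH shell)
    also have "\<dots> = 24 * 5 ^ CARD('n) * (1 / 2 ^ k - 1 / 2 ^ Suc K)" by (simp add: field_simps)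
    finally show ?case .
  next
    case base
    have "?E k k = {}" by auto
    then show ?case by (simp only: sum.empty) simp
  qed
  have nu0: "\<nu> 0 = 0"
  proof -
    have "\<nu> 0 \<le> 0" "0 \<le> \<nu> 0" using \<nu> unfolding lattice_norm_def
      by (metis ivec_0 norm_zero) (metis \<nu> lattice_norm_def abs_zero of_int_0 zero_index)
    then show ?thesis by simp
  qed
  have "(\<Sum>n\<in>?E k K. ?g n) = 2 * (\<Sum>n\<in>?E k K \<inter> H. ?g n)"
    by (rule half_lattice_sum[OF H fin]) (auto simp: lattice_norm_uminus[OF \<nu>] nu0 inv_norm_pow_uminus tcosd_minus)
  moreover have "?E k K \<inter> H = {n. n \<in> H \<and> 2 ^ k < \<nu> n \<and> \<nu> n \<le> 2 ^ K}" by auto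
  ultimately have eq: "\<bar>\<Sum>n\<in>?E k K. ?g n\<bar> = 2 * \<bar>\<Sum>n | n \<in> H \<and> 2 ^ k < \<nu> n \<and> \<nu> n \<le> 2 ^ K. ?g n\<bar>"
    by (simp add: abs_mult)
  let ?S = "\<bar>\<Sum>n | n \<in> H \<and> 2 ^ k < \<nu> n \<and> \<nu> n \<le> 2 ^ K. ?g n\<bar>"
  have "2 * ?S * \<bar>t $ j\<bar> \<le> 24 * 5 ^ CARD('n) * (1 / 2 ^ k - 1 / 2 ^ K)" using full unfolding eq .
  also have "\<dots> \<le> 24 * 5 ^ CARD('n) * (1/2) ^ k"
    by (intro mult_left_mono) (auto simp: power_one_over)
  also have "\<dots> \<le> 24 * 5 ^ CARD('n) * (d * \<bar>t $ j\<bar>)"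
    using xy t(3) by (intro mult_left_mono) auto
  finally have "(2 * ?S) * \<bar>t $ j\<bar> \<le> (24 * 5 ^ CARD('n) * d) * \<bar>t $ j\<bar>" by (simp add: mult_ac)
  moreover have "0 < \<bar>t $ j\<bar>"
  proof -
    have "0 < dist x y" using xy zero_less_power[of "1/2::real" k] by linarith
    then have "0 < d * \<bar>t $ j\<bar>" using t(3) by linarith
    then show ?thesis using d0 by (simp add: zero_less_mult_iff)
  qed
  ultimately have "2 * ?S \<le> 24 * 5 ^ CARD('n) * d" by (simp only: mult_le_cancel_right_pos)
  then show ?thesis by (simp add: d_def mult_ac)
qed

section \<open>Lattice point counting and logarithmic growth of the variance\<close>

lemma norm_vec_le_card:
  fixes x :: "real ^ 'n"
  assumes "\<And>i. \<bar>x $ i\<bar> \<le> 1" shows "norm x \<le> real CARD('n)"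
proof -
  have "norm x \<le> (\<Sum>i\<in>UNIV. \<bar>x $ i\<bar>)" by (rule norm_le_l1_cart)
  also have "\<dots> \<le> (\<Sum>i\<in>(UNIV :: 'n set). 1)" by (intro sum_mono assms)
  finally show ?thesis by simp
qed

text \<open>Gauss's argument with unit cubes at the lattice points: the closed cubes cover a
  slightly smaller ball, the open ones are disjoint inside a slightly larger ball. A cube reaches at
  most d from its corner, which is the change of radius.\<close>

lemma lattice_point_count_bounds:
  fixes N :: nat
  assumes N: "CARD('n) \<le> N"
  defines "V \<equiv> unit_ball_vol (real CARD('n))"
  shows "V * (real N - real CARD('n)) ^ CARD('n) \<le> real (card {n :: int ^ 'n. norm (ivec n) \<le> real N})"
    and "real (card {n :: int ^ 'n. norm (ivec n) \<le> real N}) \<le> V * (real N + real CARD('n)) ^ CARD('n)"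
proof -
  define d where "d = real CARD('n)"
  define S where "S = {n :: int ^ 'n. norm (ivec n) \<le> real N}"
  have fin: "finite S" unfolding S_def by (rule finite_lattice_norm_ball[OF lattice_norm_euclidean])
  let ?o = "(\<chi> i. 1) :: real ^ 'n"
  have o: "?o \<bullet> b = 1" if "b \<in> Basis" for b
    using that by (auto simp: Basis_vec_def inner_axis)
  define C where "C n = cbox (ivec n) (ivec n + ?o)" for n :: "int ^ 'n"
  define B where "B n = box (ivec n) (ivec n + ?o)" for n :: "int ^ 'n"
  have mC: "emeasure lborel (C n) = 1" for n
    unfolding C_def emeasure_lborel_cbox_eq by (simp add: inner_add_left o)
  have mB: "emeasure lborel (B n) = 1" for n
    unfolding B_def emeasure_lborel_box_eq by (simp add: inner_add_left o)
  have ball: "emeasure lborel (cball (0 :: real ^ 'n) r) = ennreal (V * r ^ CARD('n))" if "0 \<le> r" for r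
    using emeasure_cball[OF that, of "0 :: real ^ 'n"] by (simp add: V_def)
  have "cball (0 :: real ^ 'n) (real N - d) \<subseteq> (\<Union>n\<in>S. C n)"
  proof
    fix x :: "real ^ 'n" assume x: "x \<in> cball 0 (real N - d)"
    define n where "n = (\<chi> i. \<lfloor>x $ i\<rfloor>)"
    have xn: "x \<in> C n" by (auto simp: C_def mem_box_cart n_def ivec_nth)
    have "norm (ivec n) \<le> norm x + norm (ivec n - x)" by (metis add.commute diff_add_cancel norm_triangle_ineq)
    moreover have "norm (ivec n - x) \<le> d" unfolding d_def
      by (rule norm_vec_le_card) (simp add: n_def ivec_nth, linarith)
    ultimately have "n \<in> S" using x by (simp add: S_def)
    then show "x \<in> (\<Union>n\<in>S. C n)" using xn by blast
  qed
  then have "emeasure lborel (cball (0 :: real ^ 'n) (real N - d)) \<le> emeasure lborel (\<Union>n\<in>S. C n)"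
    by (intro emeasure_mono) (auto intro!: sets.finite_UN fin simp: C_def)
  also have "\<dots> \<le> (\<Sum>n\<in>S. emeasure lborel (C n))"
    by (intro emeasure_subadditive_finite fin) (auto simp: C_def)
  also have "\<dots> = ennreal (real (card S))" by (simp add: mC ennreal_of_nat_eq_real_of_nat)
  finally have "ennreal (V * (real N - d) ^ CARD('n)) \<le> ennreal (real (card S))"
    using N by (subst (asm) ball) (auto simp: d_def)
  then show "V * (real N - real CARD('n)) ^ CARD('n) \<le> real (card {n :: int ^ 'n. norm (ivec n) \<le> real N})"
    by (simp add: S_def d_def)
  have disj: "disjoint_family_on B S"
    unfolding disjoint_family_on_def
  proof (intro ballI impI)
    fix m n :: "int ^ 'n" assume "m \<noteq> n"
    then obtain i where i: "m $ i \<noteq> n $ i" by (auto simp: vec_eq_iff)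
    have False if "x \<in> B m" "x \<in> B n" for x
    proof -
      have "real_of_int (m $ i) < x $ i" "x $ i < real_of_int (m $ i) + 1"
        "real_of_int (n $ i) < x $ i" "x $ i < real_of_int (n $ i) + 1"
        using that by (auto simp: B_def mem_box_cart ivec_nth)
      then show False using i by linarith
    qed
    then show "B m \<inter> B n = {}" by blast
  qed
  have "ennreal (real (card S)) = (\<Sum>n\<in>S. emeasure lborel (B n))" by (simp add: mB ennreal_of_nat_eq_real_of_nat)
  also have "\<dots> = emeasure lborel (\<Union>n\<in>S. B n)"
    by (rule sum_emeasure[OF _ disj fin]) (auto simp: B_def)
  also have "\<dots> \<le> emeasure lborel (cball (0 :: real ^ 'n) (real N + d))"
  proof (rule emeasure_mono)
    show "(\<Union>n\<in>S. B n) \<subseteq> cball 0 (real N + d)"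
    proof
      fix x assume "x \<in> (\<Union>n\<in>S. B n)"
      then obtain n where n: "n \<in> S" "x \<in> B n" by blast
      have "norm x \<le> norm (ivec n) + norm (x - ivec n)" by (metis add.commute diff_add_cancel norm_triangle_ineq)
      moreover have "norm (x - ivec n) \<le> d" unfolding d_def
      proof (rule norm_vec_le_card)
        fix i
        have "real_of_int (n $ i) < x $ i" "x $ i < real_of_int (n $ i) + 1"
          using n(2) by (auto simp: B_def mem_box_cart ivec_nth)
        then show "\<bar>(x - ivec n) $ i\<bar> \<le> 1" by (simp add: ivec_nth)
      qed
      ultimately show "x \<in> cball 0 (real N + d)" using n(1) by (simp add: S_def)
    qed
  qed simp
  also have "\<dots> = ennreal (V * (real N + d) ^ CARD('n))" by (rule ball) (simp add: d_def)
  finally have "ennreal (real (card S)) \<le> ennreal (V * (real N + d) ^ CARD('n))" .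
  moreover have "0 \<le> V * (real N + d) ^ CARD('n)" by (simp add: V_def d_def)
  ultimately show "real (card {n :: int ^ 'n. norm (ivec n) \<le> real N}) \<le> V * (real N + real CARD('n)) ^ CARD('n)"
    by (simp add: S_def d_def)
qed

lemma lattice_count_asymp:
  "(\<lambda>N. real (card {n :: int ^ 'n. n \<noteq> 0 \<and> norm (ivec n) \<le> real N}) / real N ^ CARD('n))
    \<longlonglongrightarrow> unit_ball_vol (real CARD('n))"
proof -
  define d V where "d = real CARD('n)" and "V = unit_ball_vol (real CARD('n))"
  define c where "c N = real (card {n :: int ^ 'n. norm (ivec n) \<le> real N})" for N
  have d0: "0 < CARD('n)" by simp
  have c': "real (card {n :: int ^ 'n. n \<noteq> 0 \<and> norm (ivec n) \<le> real N}) = c N - 1" for N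
  proof -
    have "{n :: int ^ 'n. n \<noteq> 0 \<and> norm (ivec n) \<le> real N} = {n. norm (ivec n) \<le> real N} - {0}" by auto
    moreover have "finite {n :: int ^ 'n. norm (ivec n) \<le> real N}"
      by (rule finite_lattice_norm_ball[OF lattice_norm_euclidean])
    moreover have "(0 :: int ^ 'n) \<in> {n. norm (ivec n) \<le> real N}" by (simp add: ivec_0)
    ultimately have "card {n :: int ^ 'n. n \<noteq> 0 \<and> norm (ivec n) \<le> real N} = card {n :: int ^ 'n. norm (ivec n) \<le> real N} - 1"
      "0 < card {n :: int ^ 'n. norm (ivec n) \<le> real N}"
      by (simp_all only: card_Diff_singleton card_gt_0_iff) auto
    then show ?thesis by (simp add: c_def)
  qed
  have inv: "(\<lambda>N. d / real N) \<longlonglongrightarrow> 0" by (rule lim_const_over_n)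
  have low: "(\<lambda>N. V * (1 - d / real N) ^ CARD('n)) \<longlonglongrightarrow> V"
    using tendsto_mult[OF tendsto_const[of V] tendsto_power[OF tendsto_diff[OF tendsto_const[of 1] inv], of "CARD('n)"]] by simp
  have up: "(\<lambda>N. V * (1 + d / real N) ^ CARD('n)) \<longlonglongrightarrow> V"
    using tendsto_mult[OF tendsto_const[of V] tendsto_power[OF tendsto_add[OF tendsto_const[of 1] inv], of "CARD('n)"]] by simp
  have scale: "V * (real N + s) ^ CARD('n) / real N ^ CARD('n) = V * (1 + s / real N) ^ CARD('n)" if "0 < N" for N s
  proof -
    have "1 + s / real N = (real N + s) / real N" using that by (simp add: field_simps)
    then show ?thesis by (simp add: power_divide)
  qed
  have "(\<lambda>N. c N / real N ^ CARD('n)) \<longlonglongrightarrow> V"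
  proof (rule tendsto_sandwich[OF _ _ low up])
    show "\<forall>\<^sub>F N in sequentially. V * (1 - d / real N) ^ CARD('n) \<le> c N / real N ^ CARD('n)"
      using eventually_ge_at_top[of "CARD('n)"]
    proof eventually_elim
      case (elim N)
      have "V * (real N + - d) ^ CARD('n) \<le> c N"
        using lattice_point_count_bounds(1)[OF elim] by (simp add: V_def d_def c_def)
      then have "V * (real N + - d) ^ CARD('n) / real N ^ CARD('n) \<le> c N / real N ^ CARD('n)"
        by (intro divide_right_mono) auto
      moreover have "0 < N" using elim d0 by linarith
      ultimately show ?case using scale[of N "- d"] by simp
    qed
    show "\<forall>\<^sub>F N in sequentially. c N / real N ^ CARD('n) \<le> V * (1 + d / real N) ^ CARD('n)"
      using eventually_ge_at_top[of "CARD('n)"]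
    proof eventually_elim
      case (elim N)
      have "c N \<le> V * (real N + d) ^ CARD('n)"
        using lattice_point_count_bounds(2)[OF elim] by (simp add: V_def d_def c_def)
      then have "c N / real N ^ CARD('n) \<le> V * (real N + d) ^ CARD('n) / real N ^ CARD('n)"
        by (intro divide_right_mono) auto
      moreover have "0 < N" using elim d0 by linarith
      ultimately show ?case using scale[of N d] by simp
    qed
  qed
  moreover have "(\<lambda>N. 1 / real N ^ CARD('n)) \<longlonglongrightarrow> 0"
    using tendsto_power[OF lim_1_over_n, of "CARD('n)"] d0 by (simp add: power_one_over zero_power)
  ultimately have "(\<lambda>N. c N / real N ^ CARD('n) - 1 / real N ^ CARD('n)) \<longlonglongrightarrow> V - 0"
    by (rule tendsto_diff)
  then show ?thesis unfolding c' V_def by (simp add: diff_divide_distrib)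
qed

lemma harm_over_ln: "(\<lambda>N. harm N / ln (real N)) \<longlonglongrightarrow> 1"
proof -
  have ln: "filterlim (\<lambda>N. ln (real N)) at_top sequentially"
    by (rule filterlim_compose[OF ln_at_top filterlim_real_sequentially])
  have "(\<lambda>N. (harm N - ln (real N)) / ln (real N) + 1) \<longlonglongrightarrow> 0 + 1"
    by (intro tendsto_intros real_tendsto_divide_at_top[OF euler_mascheroni_LIMSEQ ln])
  moreover have "\<forall>\<^sub>F N in sequentially. (harm N - ln (real N)) / ln (real N) + 1 = harm N / ln (real N)"
    using eventually_ge_at_top[of 2]
  proof eventually_elim
    case (elim N)
    then have "ln (real N) \<noteq> 0" by simp
    then show ?case by (simp add: field_simps)
  qed
  ultimately show ?thesis using tendsto_cong by fastforce
qed

text \<open>A logarithmic Cesaro mean: u_k is L / k plus o(1 / k), and the harmonic numbers grow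
  like ln N.\<close>

lemma log_cesaro:
  fixes u :: "nat \<Rightarrow> real"
  assumes u: "(\<lambda>k. real k * u k) \<longlonglongrightarrow> L"
  shows "(\<lambda>N. (\<Sum>k=1..N. u k) / ln (real N)) \<longlonglongrightarrow> L"
proof -
  define v where "v k = u k - L / real k" for k
  have ln: "filterlim (\<lambda>N. ln (real N)) at_top sequentially"
    by (rule filterlim_compose[OF ln_at_top filterlim_real_sequentially])
  have "(\<lambda>N. (\<Sum>k=1..N. v k) / ln (real N)) \<longlonglongrightarrow> 0"
  proof (rule LIMSEQ_I)
    fix e :: real assume e: "0 < e"
    \<comment> \<open>The harmonic sum is eventually below 2 ln N, so a quarter of e becomes half of
      it; the other half absorbs the early terms.\<close>
    obtain K0 where K0: "\<And>k. K0 \<le> k \<Longrightarrow> norm (real k * u k - L) < e / 4"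
      using LIMSEQ_D[OF u, of "e / 4"] e by auto
    define K where "K = Suc K0"
    have vk: "\<bar>v k\<bar> \<le> e / 4 * inverse (real k)" if "K \<le> k" for k
    proof -
      have k: "0 < real k" using that by (simp add: K_def)
      have "\<bar>real k * v k\<bar> \<le> e / 4" using K0[of k] that k by (simp add: v_def K_def algebra_simps)
      then have "real k * \<bar>v k\<bar> \<le> e / 4" using k by (simp add: abs_mult)
      then show ?thesis using k by (simp add: field_simps)
    qed
    define C where "C = (\<Sum>k<K. \<bar>v k\<bar>)"
    have bound: "\<bar>\<Sum>k=1..N. v k\<bar> \<le> C + e / 4 * harm N" for N
    proof -
      have "\<bar>\<Sum>k=1..N. v k\<bar> \<le> (\<Sum>k=1..N. \<bar>v k\<bar>)" by (rule sum_abs)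
      also have "\<dots> \<le> (\<Sum>k=1..N. (if k < K then \<bar>v k\<bar> else 0) + e / 4 * inverse (real k))"
        using vk e by (intro sum_mono) (auto simp: not_less)
      also have "\<dots> = (\<Sum>k=1..N. if k < K then \<bar>v k\<bar> else 0) + e / 4 * harm N"
        by (simp add: sum.distrib harm_def sum_distrib_left)
      also have "(\<Sum>k=1..N. if k < K then \<bar>v k\<bar> else 0) = (\<Sum>k\<in>{1..N} \<inter> {..<K}. \<bar>v k\<bar>)"
        by (simp add: sum.inter_restrict lessThan_def)
      also have "\<dots> \<le> C" unfolding C_def by (rule sum_mono2) auto
      finally show ?thesis by simp
    qed
    have "(\<lambda>N. C / ln (real N)) \<longlonglongrightarrow> 0"
      by (rule real_tendsto_divide_at_top[OF tendsto_const ln])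
    then have "eventually (\<lambda>N. C / ln (real N) < e / 2) sequentially"
      by (rule order_tendstoD) (use e in simp)
    moreover have "eventually (\<lambda>N. harm N / ln (real N) < 2) sequentially"
      using harm_over_ln by (rule order_tendstoD) simp
    ultimately have "eventually (\<lambda>N. norm ((\<Sum>k=1..N. v k) / ln (real N) - 0) < e) sequentially"
      using eventually_ge_at_top[of 2]
    proof eventually_elim
      case (elim N)
      have l: "0 < ln (real N)" using elim by simp
      have "\<bar>\<Sum>k=1..N. v k\<bar> / ln (real N) \<le> (C + e / 4 * harm N) / ln (real N)"
        using l by (intro divide_right_mono bound) auto
      also have "\<dots> = C / ln (real N) + e / 4 * (harm N / ln (real N))" by (simp add: add_divide_distrib)
      also have "\<dots> < e / 2 + e / 4 * 2" using elim e by (intro add_strict_mono mult_strict_left_mono) auto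
      finally show ?case using l by (simp add: abs_div)
    qed
    then show "\<exists>no. \<forall>n\<ge>no. norm ((\<Sum>k=1..n. v k) / ln (real n) - 0) < e"
      by (simp add: eventually_sequentially)
  qed
  then have "(\<lambda>N. (\<Sum>k=1..N. v k) / ln (real N) + L * (harm N / ln (real N))) \<longlonglongrightarrow> 0 + L * 1"
    by (intro tendsto_intros harm_over_ln)
  moreover have "(\<Sum>k=1..N. v k) / ln (real N) + L * (harm N / ln (real N)) = (\<Sum>k=1..N. u k) / ln (real N)" for N
  proof -
    have "(\<Sum>k=1..N. u k) = (\<Sum>k=1..N. v k) + L * harm N"
      by (simp add: v_def harm_def sum_subtractf sum_distrib_left divide_inverse)
    then show ?thesis by (simp add: add_divide_distrib)
  qed
  ultimately show ?thesis by simp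
qed

text \<open>Rounding the norm up makes the summand constant between consecutive integer radii, so
  summation by parts expresses the sum through the counts alone.\<close>

lemma ceiling_sum_abel:
  fixes d :: nat
  defines "S \<equiv> \<lambda>N. {n :: int ^ 'n. n \<noteq> 0 \<and> norm (ivec n) \<le> real N}"
  shows "(\<Sum>n\<in>S N. 1 / real_of_int \<lceil>norm (ivec n)\<rceil> ^ d)
    = (\<Sum>k=1..N. real (card (S k)) * (1 / real k ^ d - 1 / real (Suc k) ^ d)) + real (card (S N)) / real (Suc N) ^ d"
proof (induction N)
  case 0
  have "S 0 = {}" using norm_ivec_ge_1 by (force simp: S_def)
  then show ?case by simp
next
  case (Suc N)
  have fin: "finite (S k)" for k
    using finite_lattice_norm_ball[OF lattice_norm_euclidean, of k] by (rule finite_subset[rotated]) (auto simp: S_def)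
  have sub: "S N \<subseteq> S (Suc N)" by (auto simp: S_def)
  have "(\<Sum>n\<in>S (Suc N) - S N. 1 / real_of_int \<lceil>norm (ivec n)\<rceil> ^ d) = (\<Sum>n\<in>S (Suc N) - S N. 1 / real (Suc N) ^ d)"
  proof (rule sum.cong[OF refl])
    fix n assume "n \<in> S (Suc N) - S N"
    then have "real N < norm (ivec n)" "norm (ivec n) \<le> real N + 1" by (auto simp: S_def)
    then have "\<lceil>norm (ivec n)\<rceil> = int (Suc N)" by (intro ceiling_unique) auto
    then show "1 / real_of_int \<lceil>norm (ivec n)\<rceil> ^ d = 1 / real (Suc N) ^ d" by simp
  qed
  also have "\<dots> = (real (card (S (Suc N))) - real (card (S N))) / real (Suc N) ^ d"
    using sub fin by (simp add: card_Diff_subset of_nat_diff card_mono)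
  finally have inc: "(\<Sum>n\<in>S (Suc N). 1 / real_of_int \<lceil>norm (ivec n)\<rceil> ^ d)
      = (\<Sum>n\<in>S N. 1 / real_of_int \<lceil>norm (ivec n)\<rceil> ^ d) + (real (card (S (Suc N))) - real (card (S N))) / real (Suc N) ^ d"
    using sum.subset_diff[OF sub fin, of "\<lambda>n. 1 / real_of_int \<lceil>norm (ivec n)\<rceil> ^ d"] by simp
  have "(\<Sum>k=1..Suc N. real (card (S k)) * (1 / real k ^ d - 1 / real (Suc k) ^ d))
      = (\<Sum>k=1..N. real (card (S k)) * (1 / real k ^ d - 1 / real (Suc k) ^ d))
        + real (card (S (Suc N))) * (1 / real (Suc N) ^ d - 1 / real (Suc (Suc N)) ^ d)"
    by simp
  then show ?case unfolding inc Suc.IH by (simp only:) (simp add: diff_divide_distrib right_diff_distrib)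
qed

text \<open>Bernoulli's inequality bounds the rounding error by d |n|^(-d - 1), one power better
  than the summand and therefore summable over the lattice.\<close>

lemma inv_norm_pow_ceiling:
  fixes n :: "int ^ 'n"
  assumes "n \<noteq> 0"
  shows "\<bar>inv_norm_pow n - 1 / real_of_int \<lceil>norm (ivec n)\<rceil> ^ CARD('n)\<bar>
    \<le> real CARD('n) * norm (ivec n) powr - (real CARD('n) + 1)"
proof -
  define m where "m = norm (ivec n)"
  define k where "k = real_of_int \<lceil>m\<rceil>"
  define d where "d = CARD('n)"
  have m1: "1 \<le> m" using norm_ivec_ge_1[OF assms] by (simp add: m_def)
  have k: "m \<le> k" "k \<le> m + 1" unfolding k_def by linarith+
  have k0: "0 < k" using m1 k by linarith
  have le: "1 / k ^ d \<le> 1 / m ^ d"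
    using m1 k by (intro divide_left_mono power_mono mult_pos_pos zero_less_power) auto
  have "1 + real d * (m / k - 1) \<le> (1 + (m / k - 1)) ^ d"
    using m1 k0 by (intro Bernoulli_inequality) simp
  then have "1 - (m / k) ^ d \<le> real d * (1 - m / k)" by (simp add: algebra_simps)
  also have "\<dots> \<le> real d * (1 / m)"
  proof (intro mult_left_mono)
    have "1 - m / k = (k - m) / k" using k0 by (simp add: field_simps)
    also have "\<dots> \<le> 1 / m" using k m1 by (intro frac_le) auto
    finally show "1 - m / k \<le> 1 / m" .
  qed simp
  finally have b: "1 - (m / k) ^ d \<le> real d * (1 / m)" .
  have "1 / m ^ d - 1 / k ^ d = (1 - (m / k) ^ d) * (1 / m ^ d)"
    using m1 k0 by (simp add: power_divide field_simps)
  also have "\<dots> \<le> real d * (1 / m) * (1 / m ^ d)" using b m1 by (intro mult_right_mono) auto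
  also have "\<dots> = real d * m powr - (real d + 1)"
  proof -
    have "m powr - (real d + 1) = inverse (m powr real (Suc d))"
      unfolding powr_minus by (simp add: add.commute)
    also have "\<dots> = inverse (m ^ Suc d)" using m1 by (subst powr_realpow) auto
    finally show ?thesis by (simp add: divide_inverse)
  qed
  finally have "1 / m ^ d - 1 / k ^ d \<le> real d * m powr - (real d + 1)" .
  then show ?thesis using le unfolding inv_norm_pow_def m_def[symmetric] k_def[symmetric] d_def[symmetric] by simp
qed

text \<open>d times the volume of the unit ball is the area of the unit sphere, and \<tau>(d) is
  half of that area.\<close>

lemma half_dim_unit_ball_vol:
  assumes "0 < d" shows "real d * unit_ball_vol (real d) / 2 = tau d"
proof -
  have "Gamma (real d / 2 + 1) = real d / 2 * Gamma (real d / 2)"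
    using assms by (intro Gamma_plus1) (auto simp: nonpos_Ints_def)
  moreover have "0 < Gamma (real d / 2)" using assms by (intro Gamma_real_pos) simp
  ultimately show ?thesis using assms by (simp add: unit_ball_vol_def tau_def field_simps)
qed

text \<open>For Euclidean balls, the count asymptotics and summation by parts give k u_k
  \<rightarrow> d V with V the volume of the unit ball. The shape of the truncation affects only a
  bounded error, so cubes and balls share the constant; the half lattice takes half of d V.\<close>

lemma lattice_log_sum:
  fixes \<nu> :: "int ^ 'n \<Rightarrow> real"
  assumes \<nu>: "lattice_norm \<nu>" and H: "half_lattice H"
  shows "(\<lambda>N. (\<Sum>n | n \<in> H \<and> \<nu> n \<le> real N. inv_norm_pow n) / ln (real N)) \<longlonglongrightarrow> tau CARD('n)"
proof -
  define d V where "d = CARD('n)" and "V = unit_ball_vol (real CARD('n))"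
  have d0: "0 < d" by (simp add: d_def)
  define S where "S N = {n :: int ^ 'n. n \<noteq> 0 \<and> norm (ivec n) \<le> real N}" for N
  define T where "T N = (\<Sum>n\<in>S N. 1 / real_of_int \<lceil>norm (ivec n)\<rceil> ^ d)" for N
  define u where "u k = real (card (S k)) * (1 / real k ^ d - 1 / real (Suc k) ^ d)" for k
  have cnt: "(\<lambda>N. real (card (S N)) / real N ^ d) \<longlonglongrightarrow> V"
    unfolding S_def d_def V_def by (rule lattice_count_asymp)
  have r: "(\<lambda>k. real k / real (Suc k)) \<longlonglongrightarrow> 1" by (rule LIMSEQ_n_over_Suc_n)
  \<comment> \<open>With r = k / (k + 1) the difference of powers is 1 - r^d = (1 - r)(1 + ... +
    r^(d - 1)), and k (1 - r) = r tends to 1.\<close>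
  have ku: "\<forall>\<^sub>F k in sequentially. (real (card (S k)) / real k ^ d) * ((real k / real (Suc k)) * (\<Sum>i<d. (real k / real (Suc k)) ^ i)) = real k * u k"
    using eventually_gt_at_top[of 0]
  proof eventually_elim
    case (elim k)
    have "(real k / real (Suc k)) * (\<Sum>i<d. (real k / real (Suc k)) ^ i) = real k * ((1 - real k / real (Suc k)) * (\<Sum>i<d. (real k / real (Suc k)) ^ i))"
      by (simp add: field_simps)
    also have "\<dots> = real k * (1 - (real k / real (Suc k)) ^ d)"
      by (simp only: one_diff_power_eq)
    finally show ?case using elim by (simp only: u_def) (simp add: power_divide field_simps)
  qed
  have "(\<lambda>k. (real (card (S k)) / real k ^ d) * ((real k / real (Suc k)) * (\<Sum>i<d. (real k / real (Suc k)) ^ i))) \<longlonglongrightarrow> V * (1 * (\<Sum>i<d. 1 ^ i))"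
    by (intro tendsto_mult cnt r tendsto_sum tendsto_power)
  then have "(\<lambda>k. real k * u k) \<longlonglongrightarrow> V * real d"
    using tendsto_cong[OF ku] by simp
  then have U: "(\<lambda>N. (\<Sum>k=1..N. u k) / ln (real N)) \<longlonglongrightarrow> V * real d" by (rule log_cesaro)
  have ln: "filterlim (\<lambda>N. ln (real N)) at_top sequentially"
    by (rule filterlim_compose[OF ln_at_top filterlim_real_sequentially])
  obtain C where C: "\<And>F :: (int ^ 'n) set. finite F \<Longrightarrow> (\<Sum>n\<in>F. norm (ivec n) powr - (real CARD('n) + 1)) \<le> C"
    using lattice_powr_summable[of "real CARD('n) + 1", where 'n = 'n] by auto
  define D where "D N = {n. n \<noteq> 0 \<and> \<nu> n \<le> real N}" for N
  have finD: "finite (D N)" for N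
    using finite_lattice_norm_ball[OF \<nu>, of N] by (rule finite_subset[rotated]) (auto simp: D_def)
  have SD: "S N \<subseteq> D N" for N using \<nu> by (auto simp: S_def D_def lattice_norm_def intro: order_trans)
  have finS: "finite (S N)" for N using SD finD by (rule finite_subset)
  define err where "err N = (\<Sum>n\<in>D N. inv_norm_pow n) - (\<Sum>k=1..N. u k)" for N
  have "\<forall>\<^sub>F N in sequentially. norm (err N) \<le> V + 1 + d * C + 3 ^ d"
  proof -
    have "\<forall>\<^sub>F N in sequentially. real (card (S N)) / real N ^ d < V + 1"
      using cnt by (rule order_tendstoD) simp
    then show ?thesis using eventually_gt_at_top[of 0]
    proof eventually_elim
      case (elim N)
      have "(\<Sum>n\<in>D N. inv_norm_pow n) = (\<Sum>n\<in>D N - S N. inv_norm_pow n) + (\<Sum>n\<in>S N. inv_norm_pow n)"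
        by (rule sum.subset_diff[OF SD finD])
      \<comment> \<open>The extra points have Euclidean norm at least N and number at most (3 N)^d,
        so together they contribute at most 3^d.\<close>
      moreover have "\<bar>\<Sum>n\<in>D N - S N. inv_norm_pow n\<bar> \<le> 3 ^ d"
      proof -
        have "(\<Sum>n\<in>D N - S N. inv_norm_pow n) \<le> (\<Sum>n\<in>D N - S N. 1 / real N ^ d)"
        proof (rule sum_mono)
          fix n assume "n \<in> D N - S N"
          then have "real N \<le> norm (ivec n)" by (auto simp: D_def S_def)
          then show "inv_norm_pow n \<le> 1 / real N ^ d"
            unfolding inv_norm_pow_def d_def[symmetric] using elim
            by (intro divide_left_mono power_mono mult_pos_pos zero_less_power) auto
        qed
        also have "\<dots> = real (card (D N - S N)) * (1 / real N ^ d)" by simp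
        also have "\<dots> \<le> (3 * real N) ^ d * (1 / real N ^ d)"
        proof (rule mult_right_mono)
          have "card (D N - S N) \<le> card {n. \<nu> n \<le> real N}"
            by (rule card_mono[OF finite_lattice_norm_ball[OF \<nu>]]) (auto simp: D_def)
          also have "\<dots> \<le> (2 * N + 1) ^ d" unfolding d_def by (rule card_lattice_norm_ball[OF \<nu>])
          also have "\<dots> \<le> (3 * N) ^ d" using elim by (intro power_mono) auto
          finally have "real (card (D N - S N)) \<le> real ((3 * N) ^ d)" by (simp only: of_nat_le_iff)
          then show "real (card (D N - S N)) \<le> (3 * real N) ^ d" by simp
        qed simp
        also have "\<dots> = 3 ^ d" using elim by (simp add: power_mult_distrib)
        finally show ?thesis by (simp add: sum_nonneg inv_norm_pow_nonneg)
      qed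
      moreover have "\<bar>(\<Sum>n\<in>S N. inv_norm_pow n) - T N\<bar> \<le> d * C"
      proof -
        have "\<bar>(\<Sum>n\<in>S N. inv_norm_pow n) - T N\<bar> \<le> (\<Sum>n\<in>S N. \<bar>inv_norm_pow n - 1 / real_of_int \<lceil>norm (ivec n)\<rceil> ^ d\<bar>)"
          unfolding T_def sum_subtractf[symmetric] by (rule sum_abs)
        also have "\<dots> \<le> (\<Sum>n\<in>S N. d * norm (ivec n) powr - (real CARD('n) + 1))"
          unfolding d_def by (intro sum_mono inv_norm_pow_ceiling) (auto simp: S_def)
        also have "\<dots> \<le> d * C"
          unfolding sum_distrib_left[symmetric] by (intro mult_left_mono C finS) simp
        finally show ?thesis .
      qed
      moreover have "T N = (\<Sum>k=1..N. u k) + real (card (S N)) / real (Suc N) ^ d"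
        unfolding T_def S_def u_def by (rule ceiling_sum_abel)
      moreover have "0 \<le> real (card (S N)) / real (Suc N) ^ d" by simp
      moreover have "real (card (S N)) / real (Suc N) ^ d \<le> V + 1"
      proof -
        have "real (card (S N)) / real (Suc N) ^ d \<le> real (card (S N)) / real N ^ d"
          using elim by (intro divide_left_mono power_mono mult_pos_pos zero_less_power) auto
        then show ?thesis using elim by linarith
      qed
      ultimately show ?case unfolding err_def real_norm_def by linarith
    qed
  qed
  note err_bound = this
  have "(\<lambda>N. err N / ln (real N)) \<longlonglongrightarrow> 0"
  proof (rule Lim_null_comparison)
    show "(\<lambda>N. (V + 1 + d * C + 3 ^ d) / ln (real N)) \<longlonglongrightarrow> 0"
      by (rule real_tendsto_divide_at_top[OF tendsto_const ln])
    show "\<forall>\<^sub>F N in sequentially. norm (err N / ln (real N)) \<le> (V + 1 + d * C + 3 ^ d) / ln (real N)"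
      using err_bound eventually_ge_at_top[of 2]
    proof eventually_elim
      case (elim N)
      then have "0 < ln (real N)" by simp
      then show ?case using elim by (simp add: abs_div divide_right_mono)
    qed
  qed
  then have "(\<lambda>N. err N / ln (real N) + (\<Sum>k=1..N. u k) / ln (real N)) \<longlonglongrightarrow> 0 + V * real d"
    by (intro tendsto_add U)
  then have full: "(\<lambda>N. (\<Sum>n\<in>D N. inv_norm_pow n) / ln (real N)) \<longlonglongrightarrow> V * real d"
    by (simp add: err_def diff_divide_distrib)
  have half: "(\<Sum>n\<in>D N. inv_norm_pow n) = 2 * (\<Sum>n | n \<in> H \<and> \<nu> n \<le> real N. inv_norm_pow n)" for N
  proof -
    have "D N \<inter> H = {n. n \<in> H \<and> \<nu> n \<le> real N}" using H by (auto simp: D_def half_lattice_def)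
    then show ?thesis
      using half_lattice_sum[OF H finD, of N inv_norm_pow] by (auto simp: D_def lattice_norm_uminus[OF \<nu>] inv_norm_pow_uminus)
  qed
  have "(\<lambda>N. (\<Sum>n\<in>D N. inv_norm_pow n) / ln (real N) / 2) \<longlonglongrightarrow> V * real d / 2"
    by (intro tendsto_intros full) simp
  then show ?thesis unfolding half
    using half_dim_unit_ball_vol[OF d0] by (simp add: V_def d_def mult.commute)
qed

section \<open>Exponential moments on the circle\<close>

lemma integral_periodic_shift:
  fixes f :: "real \<Rightarrow> real"
  assumes cont: "continuous_on UNIV f" and per: "\<And>x. f (x + p) = f x" and c: "0 \<le> c" "c \<le> p"
  shows "integral {0..p} (\<lambda>x. f (x + c)) = integral {0..p} f"
proof -
  have co: "continuous_on S f" for S using cont continuous_on_subset by blast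
  have io: "f integrable_on {a..b}" for a b by (intro integrable_continuous_interval co)
  have "integral {0..p} (\<lambda>x. f (x + c)) = integral {c..p + c} f"
    using integral_shift[of 0 c p f] co by (simp add: o_def)
  also have "\<dots> = integral {c..p} f + integral {p..p + c} f"
    using c io by (intro Henstock_Kurzweil_Integration.integral_combine[symmetric]) auto
  also have "integral {p..p + c} f = integral {0..c} f"
    using integral_shift[of 0 p c f] co by (simp add: o_def per add.commute)
  also have "integral {c..p} f + integral {0..c} f = integral {0..p} f"
    using Henstock_Kurzweil_Integration.integral_combine[of 0 c p f] c io by simp
  finally show ?thesis .
qed

text \<open>The left side is the real part of z e^(i t) with z = u e^(i a) + v e^(i b); \<phi> is
  the argument of z and the square root is its modulus.\<close>

lemma cos_superposition:
  obtains \<phi> where "0 \<le> \<phi>" "\<phi> \<le> 2 * pi"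
    "\<And>t. u * cos (a + t) + v * cos (b + t) = sqrt (u\<^sup>2 + v\<^sup>2 + 2 * u * v * cos (a - b)) * cos (t + \<phi>)"
proof -
  define z where "z = of_real u * cis a + of_real v * cis b"
  have z: "z = of_real (norm z) * cis (Arg2pi z)"
    using Arg2pi_eq[of z] by (simp add: cis_conv_exp mult.commute)
  have n2: "(norm z)\<^sup>2 = u\<^sup>2 + v\<^sup>2 + 2 * u * v * cos (a - b)"
  proof -
    have "(norm z)\<^sup>2 = (u * cos a + v * cos b)\<^sup>2 + (u * sin a + v * sin b)\<^sup>2"
      unfolding cmod_power2 z_def by simp
    also have "\<dots> = u\<^sup>2 * ((cos a)\<^sup>2 + (sin a)\<^sup>2) + v\<^sup>2 * ((cos b)\<^sup>2 + (sin b)\<^sup>2) + 2 * u * v * cos (a - b)"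
      unfolding cos_diff by algebra
    finally show ?thesis by simp
  qed
  have "norm z = sqrt (u\<^sup>2 + v\<^sup>2 + 2 * u * v * cos (a - b))"
    using n2 by (metis norm_ge_zero real_sqrt_unique)
  moreover have "u * cos (a + t) + v * cos (b + t) = norm z * cos (t + Arg2pi z)" for t
  proof -
    have "u * cos (a + t) + v * cos (b + t) = Re (z * cis t)"
      unfolding z_def by (simp add: cos_add algebra_simps)
    also have "\<dots> = Re (of_real (norm z) * cis (Arg2pi z) * cis t)" using z by simp
    also have "\<dots> = norm z * cos (t + Arg2pi z)" by (simp add: cos_add algebra_simps)
    finally show ?thesis .
  qed
  ultimately show ?thesis
    using that[of "Arg2pi z"] Arg2pi_ge_0[of z] Arg2pi_lt_2pi[of z] by simp
qed

lemma circle_uniform_nn_integral: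
  assumes f: "f \<in> borel_measurable borel"
  shows "(\<integral>\<^sup>+w. f w \<partial>circle_uniform) = (\<integral>\<^sup>+u\<in>{0..2 * pi}. f (torus_of (vec u)) \<partial>lborel) / ennreal (2 * pi)"
proof -
  have vm: "(vec :: real \<Rightarrow> real ^ 1) \<in> borel_measurable borel"
    unfolding vec_def[abs_def]
    by (intro borel_measurable_continuous_onI continuous_on_vec_lambda continuous_on_id)
  have [measurable]: "(\<lambda>u::real. torus_of (vec u :: real ^ 1)) \<in> borel_measurable borel"
    by (rule measurable_compose[OF vm measurable_torus_of])
  note [measurable] = f
  have "(\<integral>\<^sup>+w. f w \<partial>circle_uniform) = (\<integral>\<^sup>+u. f (torus_of (vec u)) \<partial>uniform_measure lborel {0..<2 * pi})"
    unfolding circle_uniform_def by (subst nn_integral_distr) auto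
  also have "\<dots> = (\<integral>\<^sup>+u\<in>{0..<2 * pi}. f (torus_of (vec u)) \<partial>lborel) / emeasure lborel {0..<2 * pi}"
    by (subst nn_integral_uniform_measure) auto
  \<comment> \<open>The endpoint 2 pi is a null set; the closed interval matches the integrals that
    define \<open>bessel_I0\<close>.\<close>
  also have "(\<integral>\<^sup>+u\<in>{0..<2 * pi}. f (torus_of (vec u)) \<partial>lborel) = (\<integral>\<^sup>+u\<in>{0..2 * pi}. f (torus_of (vec u)) \<partial>lborel)"
    by (rule nn_integral_cong_AE) (use AE_lborel_singleton[of "2 * pi"] in \<open>eventually_elim, auto simp: indicator_def\<close>)
  finally show ?thesis by simp
qed

lemma bessel_I0_integral:
  "((\<lambda>u. exp (x * cos u)) has_integral 2 * pi * bessel_I0 x) {0..2 * pi}"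
proof -
  have "(\<lambda>u. exp (x * cos u)) integrable_on {0..2 * pi}"
    by (intro integrable_continuous_interval continuous_intros)
  then have "((\<lambda>u. exp (x * cos u)) has_integral integral {0..2 * pi} (\<lambda>u. exp (x * cos u))) {0..2 * pi}"
    by (rule integrable_integral)
  moreover have "bessel_I0 x = integral {0..2 * pi} (\<lambda>u. exp (x * cos u)) / (2 * pi)"
    unfolding bessel_I0_def by simp
  ultimately show ?thesis by simp
qed

text \<open>Integrating the cubic Taylor polynomial of exp at x cos u: the odd powers of cos u
  average to 0 and cos^2 u to 1 / 2. The quartic remainder is nonnegative and at most exp |x| *
  x^4.\<close>

lemma bessel_I0_estimates:
  shows "1 + x\<^sup>2 / 4 \<le> bessel_I0 x" and "bessel_I0 x \<le> 1 + x\<^sup>2 / 4 + exp \<bar>x\<bar> * x ^ 4"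
proof -
  let ?P = "\<lambda>u. 1 + x * cos u + (x * cos u)\<^sup>2 / 2 + (x * cos u) ^ 3 / 6"
  have "(?P has_integral
      (\<lambda>u. u + x * sin u + x\<^sup>2 / 2 * (u / 2 + sin u * cos u / 2) + x ^ 3 / 6 * (sin u - (sin u) ^ 3 / 3)) (2 * pi)
    - (\<lambda>u. u + x * sin u + x\<^sup>2 / 2 * (u / 2 + sin u * cos u / 2) + x ^ 3 / 6 * (sin u - (sin u) ^ 3 / 3)) 0) {0..2 * pi}"
  proof (rule fundamental_theorem_of_calculus)
    fix u :: real
    have s: "sin u * sin u = 1 - cos u * cos u" using sin_squared_eq[of u] by (simp add: power2_eq_square)
    have "((\<lambda>u. u + x * sin u + x\<^sup>2 / 2 * (u / 2 + sin u * cos u / 2) + x ^ 3 / 6 * (sin u - (sin u) ^ 3 / 3))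
      has_real_derivative (1 + x * cos u + x\<^sup>2 / 2 * (1 / 2 + (cos u * cos u - sin u * sin u) / 2)
        + x ^ 3 / 6 * (cos u - 3 * (sin u)\<^sup>2 * cos u / 3))) (at u within {0..2 * pi})"
      by (auto intro!: derivative_eq_intros simp: field_simps)
    also have "1 + x * cos u + x\<^sup>2 / 2 * (1 / 2 + (cos u * cos u - sin u * sin u) / 2)
        + x ^ 3 / 6 * (cos u - 3 * (sin u)\<^sup>2 * cos u / 3) = ?P u"
      unfolding power2_eq_square power3_eq_cube s by (simp add: field_simps)
    finally show "((\<lambda>u. u + x * sin u + x\<^sup>2 / 2 * (u / 2 + sin u * cos u / 2) + x ^ 3 / 6 * (sin u - (sin u) ^ 3 / 3))
      has_vector_derivative ?P u) (at u within {0..2 * pi})"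
      by (simp add: has_real_derivative_iff_has_vector_derivative)
  qed simp
  then have P: "(?P has_integral 2 * pi * (1 + x\<^sup>2 / 4)) {0..2 * pi}"
    by (simp add: algebra_simps)
  have ex: "\<exists>t. \<bar>t\<bar> \<le> \<bar>x * cos u\<bar> \<and> exp (x * cos u) = ?P u + exp t / 24 * (x * cos u) ^ 4" for u
  proof -
    obtain t where t: "\<bar>t\<bar> \<le> \<bar>x * cos u\<bar>"
      "exp (x * cos u) = (\<Sum>m<4. (x * cos u) ^ m / fact m) + exp t / fact 4 * (x * cos u) ^ 4"
      using Maclaurin_exp_le[of "x * cos u" 4] by blast
    moreover have "(\<Sum>m<4. z ^ m / fact m) = 1 + z + z\<^sup>2 / 2 + z ^ 3 / 6" for z :: real
      by (simp add: eval_nat_numeral)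
    moreover have "fact 4 = (24 :: real)" by (simp add: eval_nat_numeral)
    ultimately show ?thesis by metis
  qed
  have "2 * pi * (1 + x\<^sup>2 / 4) \<le> 2 * pi * bessel_I0 x"
  proof (rule has_integral_le[OF P bessel_I0_integral])
    fix u
    obtain t where "exp (x * cos u) = ?P u + exp t / 24 * (x * cos u) ^ 4" using ex by blast
    moreover have "0 \<le> exp t / 24 * (x * cos u) ^ 4" by simp
    ultimately show "?P u \<le> exp (x * cos u)" by linarith
  qed
  then show "1 + x\<^sup>2 / 4 \<le> bessel_I0 x" by simp
  have P': "((\<lambda>u. ?P u + exp \<bar>x\<bar> * x ^ 4) has_integral 2 * pi * (1 + x\<^sup>2 / 4) + 2 * pi * (exp \<bar>x\<bar> * x ^ 4)) {0..2 * pi}"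
    using has_integral_const_real[of "exp \<bar>x\<bar> * x ^ 4" 0 "2 * pi"] by (intro has_integral_add P) simp
  have "2 * pi * bessel_I0 x \<le> 2 * pi * (1 + x\<^sup>2 / 4) + 2 * pi * (exp \<bar>x\<bar> * x ^ 4)"
  proof (rule has_integral_le[OF bessel_I0_integral P'])
    fix u
    obtain t where t: "\<bar>t\<bar> \<le> \<bar>x * cos u\<bar>" "exp (x * cos u) = ?P u + exp t / 24 * (x * cos u) ^ 4" using ex by blast
    have xc: "\<bar>x * cos u\<bar> \<le> \<bar>x\<bar>" by (simp add: abs_mult mult_left_le)
    have "exp t / 24 * (x * cos u) ^ 4 \<le> exp \<bar>x\<bar> * x ^ 4"
    proof (rule mult_mono)
      have "exp t \<le> exp \<bar>x\<bar>" using t(1) xc by simp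
      then show "exp t / 24 \<le> exp \<bar>x\<bar>" using exp_gt_zero[of "\<bar>x\<bar>"] by linarith
      show "(x * cos u) ^ 4 \<le> x ^ 4"
        using power_mono[OF xc, of 4] by (simp add: power_even_abs)
    qed auto
    then show "exp (x * cos u) \<le> ?P u + exp \<bar>x\<bar> * x ^ 4" using t(2) by linarith
  qed
  then have "2 * pi * bessel_I0 x \<le> 2 * pi * (1 + x\<^sup>2 / 4 + exp \<bar>x\<bar> * x ^ 4)"
    by (simp add: algebra_simps)
  then show "bessel_I0 x \<le> 1 + x\<^sup>2 / 4 + exp \<bar>x\<bar> * x ^ 4" by simp
qed

lemma bessel_I0_pos: "0 < bessel_I0 x"
  using bessel_I0_estimates(1)[of x] by (smt (verit) divide_nonneg_pos zero_le_power2)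

text \<open>Two waves of the same frequency superpose to one wave, whose phase shift disappears
  under the uniform law. Only its amplitude, hence only \<open>tcosd n x y\<close>, remains.\<close>

lemma circle_exp_moment:
  "(\<integral>\<^sup>+w. ennreal (exp (c * (u * cos_wave n x w + v * cos_wave n y w))) \<partial>circle_uniform)
    = ennreal (bessel_I0 (c * sqrt (u\<^sup>2 + v\<^sup>2 + 2 * u * v * tcosd n x y)))"
proof -
  obtain x' y' where xy: "x = torus_of x'" "y = torus_of y'" by (meson torus_of_cases)
  define \<rho> where "\<rho> = sqrt (u\<^sup>2 + v\<^sup>2 + 2 * u * v * tcosd n x y)"
  obtain \<phi> where \<phi>: "0 \<le> \<phi>" "\<phi> \<le> 2 * pi"
    "\<And>t. u * cos (ivec n \<bullet> x' + t) + v * cos (ivec n \<bullet> y' + t) = \<rho> * cos (t + \<phi>)"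
    using cos_superposition[of u "ivec n \<bullet> x'" v "ivec n \<bullet> y'"]
    unfolding \<rho>_def xy tcosd_of inner_diff_right by metis
  have w: "u * cos_wave n x (torus_of (vec t)) + v * cos_wave n y (torus_of (vec t)) = \<rho> * cos (t + \<phi>)" for t
    unfolding xy cos_wave.abs_eq by (simp add: \<phi>(3))
  have "integral {0..2 * pi} (\<lambda>t. exp (c * \<rho> * cos (t + \<phi>))) = integral {0..2 * pi} (\<lambda>t. exp (c * \<rho> * cos t))"
    using \<phi>(1,2) by (intro integral_periodic_shift[where f = "\<lambda>t. exp (c * \<rho> * cos t)"]) (auto intro!: continuous_intros)
  also have "\<dots> = 2 * pi * bessel_I0 (c * \<rho>)"
    by (rule integral_unique[OF bessel_I0_integral])
  finally have I: "integral {0..2 * pi} (\<lambda>t. exp (c * (\<rho> * cos (t + \<phi>)))) = 2 * pi * bessel_I0 (c * \<rho>)"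
    by (simp add: mult.assoc)
  have "((\<lambda>t. exp (c * (\<rho> * cos (t + \<phi>)))) has_integral 2 * pi * bessel_I0 (c * \<rho>)) {0..2 * pi}"
    unfolding I[symmetric] by (intro integrable_integral integrable_continuous_interval continuous_intros)
  then have "(\<integral>\<^sup>+t\<in>{0..2 * pi}. ennreal (exp (c * (\<rho> * cos (t + \<phi>)))) \<partial>lborel) = ennreal (2 * pi * bessel_I0 (c * \<rho>))"
    by (intro nn_integral_has_integral_lebesgue') auto
  then have "(\<integral>\<^sup>+w. ennreal (exp (c * (u * cos_wave n x w + v * cos_wave n y w))) \<partial>circle_uniform)
      = ennreal (2 * pi * bessel_I0 (c * \<rho>)) / ennreal (2 * pi)"
    by (subst circle_uniform_nn_integral) (auto simp: w)
  also have "\<dots> = ennreal (bessel_I0 (c * \<rho>))"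
    using bessel_I0_pos[of "c * \<rho>"] by (subst divide_ennreal) auto
  finally show ?thesis by (simp add: \<rho>_def)
qed

text \<open>On bounded ranges the logarithm of I_0 is x^2 / 4 up to a cubic error. A cubic error is
  affordable because the cubed amplitudes decay like |n|^(-3d/2), which is summable.\<close>

lemma bessel_I0_log_expansion:
  fixes R :: real
  assumes "0 \<le> R"
  obtains K where "0 \<le> K" "\<And>x. \<bar>x\<bar> \<le> R \<Longrightarrow> bessel_I0 x \<le> exp (x\<^sup>2 / 4 + K * \<bar>x\<bar> ^ 3)"
    "\<And>x. \<bar>x\<bar> \<le> R \<Longrightarrow> exp (x\<^sup>2 / 4 - K * \<bar>x\<bar> ^ 3) \<le> bessel_I0 x"
proof -
  \<comment> \<open>x^4 \<le> R |x|^3 on the range; the part exp R serves the upper estimate, the 1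
    the lower one.\<close>
  define K where "K = (exp R + 1) * R"
  have x4: "x ^ 4 = \<bar>x\<bar> * \<bar>x\<bar> ^ 3" for x :: real
  proof -
    have "x ^ 4 = \<bar>x\<bar> ^ 4" by (simp add: power_even_abs)
    then show ?thesis by (simp add: eval_nat_numeral)
  qed
  have 1: "bessel_I0 x \<le> exp (x\<^sup>2 / 4 + K * \<bar>x\<bar> ^ 3)" if "\<bar>x\<bar> \<le> R" for x
  proof -
    have "exp \<bar>x\<bar> * x ^ 4 = (exp \<bar>x\<bar> * \<bar>x\<bar>) * \<bar>x\<bar> ^ 3" unfolding x4 by simp
    also have "\<dots> \<le> K * \<bar>x\<bar> ^ 3"
      unfolding K_def using that assms
      by (intro mult_right_mono mult_mono) (auto intro: order_trans[of _ "exp R"])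
    finally have "bessel_I0 x \<le> 1 + (x\<^sup>2 / 4 + K * \<bar>x\<bar> ^ 3)" using bessel_I0_estimates(2)[of x] by linarith
    also have "\<dots> \<le> exp (x\<^sup>2 / 4 + K * \<bar>x\<bar> ^ 3)" by (rule exp_ge_add_one_self)
    finally show ?thesis .
  qed
  have 2: "exp (x\<^sup>2 / 4 - K * \<bar>x\<bar> ^ 3) \<le> bessel_I0 x" if "\<bar>x\<bar> \<le> R" for x
  proof -
    let ?y = "x\<^sup>2 / 4"
    have y0: "0 \<le> ?y" by simp
    have "?y\<^sup>2 = x ^ 4 / 16" by (simp add: power_divide)
    also have "\<dots> \<le> x ^ 4" by simp
    also have "\<dots> \<le> R * \<bar>x\<bar> ^ 3" unfolding x4 using that by (intro mult_right_mono) auto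
    also have "\<dots> \<le> K * \<bar>x\<bar> ^ 3" unfolding K_def using assms by (intro mult_right_mono) (auto simp: algebra_simps)
    finally have K: "?y\<^sup>2 \<le> K * \<bar>x\<bar> ^ 3" .
    \<comment> \<open>For y > 1 the left side is negative, so the estimate holds on the whole
      half-line.\<close>
    have "?y - ?y\<^sup>2 \<le> ln (1 + ?y)"
    proof (cases "?y \<le> 1")
      case True
      then show ?thesis using ln_one_plus_pos_lower_bound[OF y0] by simp
    next
      case False
      then have "?y * 1 \<le> ?y * ?y" by (intro mult_left_mono) auto
      then have "?y - ?y\<^sup>2 \<le> 0" by (simp add: power2_eq_square)
      moreover have "0 \<le> ln (1 + ?y)" using y0 by (intro ln_ge_zero) linarith
      ultimately show ?thesis by linarith
    qed
    then have "?y - K * \<bar>x\<bar> ^ 3 \<le> ln (1 + ?y)" using K by linarith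
    then have "exp (?y - K * \<bar>x\<bar> ^ 3) \<le> exp (ln (1 + ?y))" by simp
    also have "\<dots> = 1 + ?y" using y0 by (intro exp_ln) linarith
    also have "\<dots> \<le> bessel_I0 x" by (rule bessel_I0_estimates(1))
    finally show ?thesis .
  qed
  have "0 \<le> K" using assms by (simp add: K_def)
  then show ?thesis using 1 2 that by blast
qed

section \<open>Weak limits on compact metric spaces\<close>

text \<open>The tent functions decrease to the indicator of \<open>C\<close>. For an empty set
  \<open>infdist\<close> is 0 by convention and the tents would be constantly 1, hence the
  assumption \<open>C \<noteq> {}\<close>.\<close>

lemma measure_closed_LIMSEQ:
  fixes M :: "'a::metric_space measure"
  assumes "finite_measure M" and sets: "sets M = sets borel" and C: "closed C" "C \<noteq> {}"
  shows "(\<lambda>k. \<integral>x. max 0 (1 - real k * infdist x C) \<partial>M) \<longlonglongrightarrow> measure M C"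
proof -
  interpret finite_measure M by fact
  have "(\<lambda>k. \<integral>x. max 0 (1 - real k * infdist x C) \<partial>M) \<longlonglongrightarrow> (\<integral>x. indicator C x \<partial>M)"
  proof (rule integral_dominated_convergence[where w = "\<lambda>_. 1"])
    show "(indicator C :: 'a \<Rightarrow> real) \<in> borel_measurable M"
      using C sets by (auto intro!: borel_measurable_indicator borel_closed)
    show "(\<lambda>x. max 0 (1 - real k * infdist x C)) \<in> borel_measurable M" for k
      unfolding measurable_cong_sets[OF sets refl]
      by (rule borel_measurable_continuous_onI) (intro continuous_intros)
    show "AE x in M. (\<lambda>k. max 0 (1 - real k * infdist x C)) \<longlonglongrightarrow> indicator C x"
    proof (rule AE_I2)
      fix x
      show "(\<lambda>k. max 0 (1 - real k * infdist x C)) \<longlonglongrightarrow> indicator C x"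
      proof (cases "x \<in> C")
        case False
        then have pos: "0 < infdist x C" using C by (metis in_closed_iff_infdist_zero infdist_nonneg order_le_less)
        obtain K where K: "1 < real K * infdist x C" using reals_Archimedean3[OF pos] by blast
        have "max 0 (1 - real k * infdist x C) = 0" if "K \<le> k" for k
        proof -
          have "real K * infdist x C \<le> real k * infdist x C"
            using that pos by (intro mult_right_mono) auto
          then show ?thesis using K by simp
        qed
        then have "eventually (\<lambda>k. max 0 (1 - real k * infdist x C) = 0) sequentially"
          by (auto simp: eventually_sequentially)
        then show ?thesis using False by (simp add: tendsto_eventually)
      qed simp
    qed
  qed (auto simp: infdist_nonneg)
  then show ?thesis using sets_eq_imp_space_eq[OF sets] by simp
qed

text \<open>Tent functions reach the closed sets, which form an intersection-stable generator of the
  Borel sets.\<close>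

lemma finite_measure_eqI_continuous:
  fixes M N :: "'a::metric_space measure"
  assumes M: "finite_measure M" "sets M = sets borel" and N: "finite_measure N" "sets N = sets borel"
    and eq: "\<And>f :: 'a \<Rightarrow> real. continuous_on UNIV f \<Longrightarrow> (\<And>x. 0 \<le> f x) \<Longrightarrow> (\<And>x. f x \<le> 1) \<Longrightarrow>
      (\<integral>x. f x \<partial>M) = (\<integral>x. f x \<partial>N)"
  shows "M = N"
proof (rule measure_eqI_generator_eq[where E = "Collect closed" and \<Omega> = UNIV and A = "\<lambda>_. UNIV"])
  interpret M: finite_measure M by fact
  interpret N: finite_measure N by fact
  show "Int_stable (Collect closed :: 'a set set)" by (auto simp: Int_stable_def)
  show "emeasure M C = emeasure N C" if C: "C \<in> Collect closed" for C
  proof (cases "C = {}")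
    case False
    have "(\<integral>x. max 0 (1 - real k * infdist x C) \<partial>M) = (\<integral>x. max 0 (1 - real k * infdist x C) \<partial>N)" for k
      by (rule eq) (auto intro!: continuous_intros simp: infdist_nonneg)
    then have "measure M C = measure N C"
      using measure_closed_LIMSEQ[OF M, of C] measure_closed_LIMSEQ[OF N, of C] C False
      by (auto intro: LIMSEQ_unique)
    then show ?thesis by (simp add: M.emeasure_eq_measure N.emeasure_eq_measure)
  qed simp
  show "sets M = sigma_sets UNIV (Collect closed)"
    unfolding M(2) by (simp add: borel_eq_closed)
  show "sets N = sigma_sets UNIV (Collect closed)"
    unfolding N(2) by (simp add: borel_eq_closed)
qed (auto simp: finite_measure.emeasure_finite[OF M(1)])

text \<open>The sets with measurable mass form a Dynkin system; it contains the closed sets as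
  limits of tent functions.\<close>

lemma measurable_measure_kernel:
  fixes \<kappa> :: "'w \<Rightarrow> 'a::metric_space measure"
  assumes \<kappa>: "\<And>p. finite_measure (\<kappa> p)" "\<And>p. sets (\<kappa> p) = sets borel"
    and meas: "\<And>f :: 'a \<Rightarrow> real. continuous_on UNIV f \<Longrightarrow> (\<And>x. 0 \<le> f x) \<Longrightarrow> (\<And>x. f x \<le> 1) \<Longrightarrow>
      (\<lambda>p. \<integral>x. f x \<partial>\<kappa> p) \<in> borel_measurable M"
    and B: "B \<in> sets borel"
  shows "(\<lambda>p. measure (\<kappa> p) B) \<in> borel_measurable M"
proof -
  have sp: "space (\<kappa> p) = UNIV" for p using sets_eq_imp_space_eq[OF \<kappa>(2)] by simp
  have B': "B \<in> sigma_sets UNIV (Collect closed)"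
    using B by (simp add: borel_eq_closed)
  show ?thesis
  proof (rule sigma_sets_induct_disjoint[OF _ _ B'])
    show "Int_stable (Collect closed :: 'a set set)" by (auto simp: Int_stable_def)
    show "(\<lambda>p. measure (\<kappa> p) C) \<in> borel_measurable M" if C: "C \<in> Collect closed" for C
    proof (cases "C = {}")
      case False
      show ?thesis
      proof (rule borel_measurable_LIMSEQ_metric)
        show "(\<lambda>p. \<integral>x. max 0 (1 - real k * infdist x C) \<partial>\<kappa> p) \<in> borel_measurable M" for k
          by (rule meas) (auto intro!: continuous_intros simp: infdist_nonneg)
        show "(\<lambda>k. \<integral>x. max 0 (1 - real k * infdist x C) \<partial>\<kappa> p) \<longlonglongrightarrow> measure (\<kappa> p) C" for p
          using measure_closed_LIMSEQ[OF \<kappa>, of C] C False by simp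
      qed
    qed simp
    have U: "(\<lambda>p. measure (\<kappa> p) UNIV) \<in> borel_measurable M"
      using meas[of "\<lambda>_. 1"] by (simp add: sp)
    show "(\<lambda>p. measure (\<kappa> p) (UNIV - A)) \<in> borel_measurable M"
      if "A \<in> sigma_sets UNIV (Collect closed)" "(\<lambda>p. measure (\<kappa> p) A) \<in> borel_measurable M" for A
    proof -
      have "A \<in> sets (\<kappa> p)" for p using that by (simp add: \<kappa>(2) borel_eq_closed)
      then have "measure (\<kappa> p) (UNIV - A) = measure (\<kappa> p) UNIV - measure (\<kappa> p) A" for p
        using finite_measure.finite_measure_compl[OF \<kappa>(1), of A p] by (simp add: sp)
      then show ?thesis using that U by simp
    qed
    show "(\<lambda>p. measure (\<kappa> p) (\<Union>i. A i)) \<in> borel_measurable M"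
      if A: "disjoint_family A" "range A \<subseteq> sigma_sets UNIV (Collect closed)"
        "\<And>i. (\<lambda>p. measure (\<kappa> p) (A i)) \<in> borel_measurable M" for A :: "nat \<Rightarrow> 'a set"
    proof -
      have "range A \<subseteq> sets (\<kappa> p)" for p using A(2) by (simp add: \<kappa>(2) borel_eq_closed)
      then have "(\<lambda>i. measure (\<kappa> p) (A i)) sums measure (\<kappa> p) (\<Union>i. A i)" for p
        by (rule finite_measure.finite_measure_UNION[OF \<kappa>(1) _ A(1)])
      then have "measure (\<kappa> p) (\<Union>i. A i) = (\<Sum>i. measure (\<kappa> p) (A i))" for p
        by (rule sums_unique)
      then show ?thesis using A(3) by simp
    qed
  qed auto
qed

lemma finite_net_index:
  assumes "compact (UNIV :: 'a::metric_space set)" "0 < e"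
  shows "\<exists>(z :: nat \<Rightarrow> 'a) (L :: nat). (\<forall>x. \<exists>i<L. dist (z i) x < e) \<and> 0 < L"
proof -
  obtain k where k: "finite k" "(UNIV :: 'a set) \<subseteq> (\<Union>x\<in>k. ball x e)"
    using seq_compact_imp_totally_bounded[OF assms(1)[unfolded compact_eq_seq_compact_metric]] assms(2)
    by blast
  obtain n and z :: "nat \<Rightarrow> 'a" where z: "k = z ` {i. i < n}" using finite_imp_nat_seg_image_inj_on[OF k(1)] by metis
  have *: "\<exists>i<n. dist (z i) x < e" for x
  proof -
    have "x \<in> (\<Union>x\<in>k. ball x e)" using k(2) by blast
    then show ?thesis unfolding z by auto
  qed
  moreover have "0 < n" using *[of undefined] by auto
  ultimately show ?thesis by blast
qed

text \<open>
  The cells \<open>{x. q k x = i}\<close> form successively finer finite partitions whose order is compatible,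
  so that the limit cumulative masses \<open>F k i\<close> cut the interval from 0 to the limit mass into
  nested subintervals. The limit measure is the law of the point located by these subintervals
  under Lebesgue measure.
\<close>

lemma compact_weak_limit:
  assumes cpt: "compact (UNIV :: 'a::metric_space set)"
  shows "\<exists>\<C> :: 'a set set. countable \<C> \<and> \<C> \<subseteq> sets borel \<and> UNIV \<in> \<C> \<and>
    (\<forall>\<mu> :: nat \<Rightarrow> 'a measure. (\<forall>N. finite_measure (\<mu> N) \<and> sets (\<mu> N) = sets borel) \<longrightarrow>
      (\<forall>C\<in>\<C>. convergent (\<lambda>N. measure (\<mu> N) C)) \<longrightarrow>
      (\<exists>\<nu>. finite_measure \<nu> \<and> sets \<nu> = sets borel \<and>
        (\<forall>f :: 'a \<Rightarrow> real. continuous_on UNIV f \<longrightarrow> (\<lambda>N. \<integral>x. f x \<partial>\<mu> N) \<longlonglongrightarrow> (\<integral>x. f x \<partial>\<nu>))))"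
proof -
  have "\<exists>(z :: nat \<Rightarrow> 'a) (L :: nat). (\<forall>x. \<exists>i<L. dist (z i) x < (1/2) ^ k) \<and> 0 < L" for k :: nat
    by (rule finite_net_index[OF cpt]) simp
  then have "\<forall>k. \<exists>(z :: nat \<Rightarrow> 'a) (L :: nat). (\<forall>x. \<exists>i<L. dist (z i) x < (1/2) ^ k) \<and> 0 < L" ..
  from choice[OF this] obtain z :: "nat \<Rightarrow> nat \<Rightarrow> 'a"
    where "\<forall>k. \<exists>L :: nat. (\<forall>x. \<exists>i<L. dist (z k i) x < (1/2) ^ k) \<and> 0 < L" ..
  from choice[OF this] obtain L :: "nat \<Rightarrow> nat"
    where zL: "\<And>k x. \<exists>i<L k. dist (z k i) x < (1/2) ^ k" and L0: "\<And>k. 0 < L k" by blast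
  \<comment> \<open>The digit of x at level k: the first net point within 2^-k of x.\<close>
  define p where "p k x = (LEAST i. dist (z k i) x < (1/2) ^ k)" for k x
  have p: "dist (z k (p k x)) x < (1/2) ^ k" "p k x < L k" for k x
  proof -
    obtain i where i: "i < L k" "dist (z k i) x < (1/2) ^ k" using zL by blast
    show "dist (z k (p k x)) x < (1/2) ^ k" unfolding p_def using i(2) by (rule LeastI)
    show "p k x < L k" unfolding p_def using Least_le[of "\<lambda>i. dist (z k i) x < (1/2) ^ k" i] i by linarith
  qed
  \<comment> \<open>A mixed-radix number with digits \<open>p 0 x\<close>, ...,
    \<open>p (k - 1) x\<close>. Division by \<open>L k\<close> drops the last digit, so refinement
    respects the order.\<close>
  define q where "q k x = rec_nat 0 (\<lambda>k q. q * L k + p k x) k" for k x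
  have q0: "q 0 x = 0" and qS: "q (Suc k) x = q k x * L k + p k x" for k x
    by (simp_all add: q_def)
  define B where "B k = (\<Prod>i<k. L i)" for k
  have BS: "B (Suc k) = B k * L k" and B0: "B 0 = 1" for k by (simp_all add: B_def)
  have Bpos: "0 < B k" for k using L0 by (auto simp: B_def prod_pos)
  have qdiv: "q (Suc k) x div L k = q k x" and qmod: "q (Suc k) x mod L k = p k x" for k x
    using p(2)[of k x] by (auto simp: qS)
  have qB: "q k x < B k" for k x
  proof (induction k)
    case (Suc k)
    have "q k x * L k + p k x < (q k x + 1) * L k" using p(2)[of k x] by simp
    also have "\<dots> \<le> B k * L k" using Suc by (intro mult_right_mono) auto
    finally show ?case by (simp add: qS BS)
  qed (simp add: q0 B0)
  \<comment> \<open>Cumulative sets instead of single cells, so that their limit masses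
    \<open>F k i\<close> are the endpoints of the subintervals.\<close>
  define cell where "cell k i = {x. q k x < i}" for k i
  have pm [measurable]: "p k \<in> measurable borel (count_space UNIV)" for k
    unfolding p_def
  proof (rule measurable_Least)
    show "Measurable.pred borel (\<lambda>x. dist (z k i) x < (1/2) ^ k)" for i
      using borel_open[OF open_ball[of "z k i" "(1/2) ^ k"]] by (simp add: pred_def ball_def)
  qed
  have qm [measurable]: "q k \<in> measurable borel (count_space UNIV)" for k
  proof (induction k)
    case (Suc k)
    then show ?case by (simp add: qS[abs_def])
  qed (simp add: q0[abs_def])
  have cellm: "cell k i \<in> sets borel" for k i
    using measurable_sets[OF qm[of k], of "{..<i}"] by (simp add: cell_def vimage_def)
  show ?thesis
  proof (intro exI[of _ "range (\<lambda>(k, i). cell k i)"] conjI allI impI)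
    show "countable (range (\<lambda>(k, i). cell k i))" by simp
    show "range (\<lambda>(k, i). cell k i) \<subseteq> sets borel" using cellm by auto
    have "UNIV = cell 0 1" by (auto simp: cell_def q0)
    then show "UNIV \<in> range (\<lambda>(k, i). cell k i)" by (metis case_prod_conv rangeI)
    fix \<mu> :: "nat \<Rightarrow> 'a measure"
    assume "\<forall>N. finite_measure (\<mu> N) \<and> sets (\<mu> N) = sets borel"
      and "\<forall>C\<in>range (\<lambda>(k, i). cell k i). convergent (\<lambda>N. measure (\<mu> N) C)"
    then have fin: "finite_measure (\<mu> N)" and sets: "sets (\<mu> N) = sets borel"
      and conv: "C \<in> range (\<lambda>(k, i). cell k i) \<Longrightarrow> convergent (\<lambda>N. measure (\<mu> N) C)" for N C
      by blast+
    have sp: "space (\<mu> N) = UNIV" for N using sets_eq_imp_space_eq[OF sets] by simp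
    define F where "F k i = lim (\<lambda>N. measure (\<mu> N) (cell k i))" for k i
    have F: "(\<lambda>N. measure (\<mu> N) (cell k i)) \<longlonglongrightarrow> F k i" for k i
    proof -
      have "cell k i \<in> range (\<lambda>(k, i). cell k i)" by (metis case_prod_conv rangeI)
      from conv[OF this] show ?thesis by (simp add: F_def convergent_LIMSEQ_iff)
    qed
    have Fmono: "F k i \<le> F k j" if "i \<le> j" for k i j
    proof (rule LIMSEQ_le[OF F F], intro exI[of _ 0] allI impI)
      fix N
      interpret finite_measure "\<mu> N" by (rule fin)
      show "measure (\<mu> N) (cell k i) \<le> measure (\<mu> N) (cell k j)"
        using that cellm by (intro finite_measure_mono) (auto simp: cell_def sets)
    qed
    have F00: "F k 0 = 0" for k
      using LIMSEQ_unique[OF F[of k 0], of 0] by (simp add: cell_def)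
    have Fr: "F (Suc k) (L k * i) = F k i" for k i
    proof -
      have "q k x < i \<longleftrightarrow> q (Suc k) x < L k * i" for x
        using div_less_iff_less_mult[OF L0[of k], of "q (Suc k) x" i] by (simp add: qdiv mult.commute)
      then have "cell (Suc k) (L k * i) = cell k i" by (simp add: cell_def)
      then show ?thesis by (simp add: F_def)
    qed
    define m where "m = F 0 1"
    have FB: "F k (B k) = m" for k
    proof (induction k)
      case (Suc k)
      then show ?case using Fr[of k "B k"] by (simp add: BS mult.commute)
    qed (simp add: B0 m_def)
    \<comment> \<open>The strict inequality makes \<open>LEAST\<close> select the subinterval that
      contains u and skip empty ones.\<close>
    define I where "I k u = (LEAST i. u < F k (i + 1))" for k u
    have Ibase: "u < F k (I k u + 1)" "F k (I k u) \<le> u" "I k u < B k" if u: "u \<in> {0..<m}" for k u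
    proof -
      have ex: "u < F k ((B k - 1) + 1)" using u FB[of k] Bpos[of k] by simp
      show 1: "u < F k (I k u + 1)" unfolding I_def using ex by (rule LeastI)
      have "I k u \<le> B k - 1" unfolding I_def using ex by (rule Least_le)
      then show "I k u < B k" using Bpos[of k] by linarith
      show "F k (I k u) \<le> u"
      proof (cases "I k u")
        case 0
        then show ?thesis using u by (simp add: F00)
      next
        case (Suc i)
        then have "\<not> u < F k (i + 1)" using not_less_Least[of i "\<lambda>i. u < F k (i + 1)"] by (simp add: I_def)
        then show ?thesis using Suc by simp
      qed
    qed
    have Iuniq: "i = I k u" if u: "u \<in> {0..<m}" and i: "F k i \<le> u" "u < F k (i + 1)" for k i u
    proof (rule ccontr)
      assume "i \<noteq> I k u"
      then consider "i + 1 \<le> I k u" | "I k u + 1 \<le> i" by linarith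
      then show False
      proof cases
        case 1
        then show ?thesis using Fmono[OF 1, of k] Ibase(2)[OF u, of k] i by linarith
      next
        case 2
        then show ?thesis using Fmono[OF 2, of k] Ibase(1)[OF u, of k] i by linarith
      qed
    qed
    have Idiv: "I (Suc k) u div L k = I k u" if u: "u \<in> {0..<m}" for k u
    proof (rule Iuniq[OF u])
      let ?i = "I (Suc k) u div L k"
      have "L k * ?i \<le> I (Suc k) u" by simp
      then show "F k ?i \<le> u" using Fmono[of "L k * ?i" "I (Suc k) u" "Suc k"] Ibase(2)[OF u, of "Suc k"]
        by (simp add: Fr)
      have "I (Suc k) u + 1 \<le> L k * (?i + 1)"
        using dividend_less_div_times[OF L0, of "I (Suc k) u" k] by (simp add: mult.commute)
      from Fmono[OF this, of "Suc k"] have "F (Suc k) (I (Suc k) u + 1) \<le> F k (?i + 1)" unfolding Fr .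
      then show "u < F k (?i + 1)" using Ibase(1)[OF u, of "Suc k"] by linarith
    qed
    \<comment> \<open>The net point of the last digit of the located cell at level k + 1.\<close>
    define X where "X k u = z k (I (Suc k) u mod L k)" for k u
    have Xd: "dist (X k u) (X (Suc k) u) < 2 * (1/2) ^ k" if u: "u \<in> {0..<m}" for k u
    proof -
      let ?i = "I (Suc (Suc k)) u"
      \<comment> \<open>The subinterval contains u, so the cell is inhabited: equal cumulative sets
        would have equal limit masses. A point of the cell lies close to both net points.\<close>
      have "cell (Suc (Suc k)) ?i \<noteq> cell (Suc (Suc k)) (?i + 1)"
      proof
        assume "cell (Suc (Suc k)) ?i = cell (Suc (Suc k)) (?i + 1)"
        then have "F (Suc (Suc k)) ?i = F (Suc (Suc k)) (?i + 1)" by (simp add: F_def)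
        then show False using Ibase(1,2)[OF u, of "Suc (Suc k)"] by simp
      qed
      then obtain x where x: "q (Suc (Suc k)) x = ?i" by (auto simp: cell_def less_Suc_eq)
      have x': "q (Suc k) x = I (Suc k) u" using Idiv[OF u, of "Suc k"] qdiv[of "Suc k" x] x by simp
      have "X k u = z k (p k x)" "X (Suc k) u = z (Suc k) (p (Suc k) x)"
        using qmod[of k x] qmod[of "Suc k" x] x x' by (simp_all add: X_def)
      then have "dist (X k u) x < (1/2) ^ k" "dist (X (Suc k) u) x < (1/2) ^ Suc k"
        using p(1)[of k x] p(1)[of "Suc k" x] by (simp_all only:)
      moreover have "(1/2::real) ^ Suc k \<le> (1/2) ^ k" by simp
      ultimately show ?thesis using dist_triangle2[of "X k u" "X (Suc k) u" x] by linarith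
    qed
    have Xlim: "\<exists>x. (\<lambda>k. X k u) \<longlonglongrightarrow> x" if u: "u \<in> {0..<m}" for u
    proof -
      have "Cauchy (\<lambda>k. X k u)"
      proof (rule metric_CauchyI)
        fix e :: real assume "0 < e"
        then obtain K where K: "(1/2::real) ^ K < e / 8" using real_arch_pow_inv[of "e/8" "1/2"] by auto
        have d: "dist (X K u) (X (K + n) u) \<le> 4 * (1/2) ^ K - 4 * (1/2) ^ (K + n)" for n
        proof (induction n)
          case (Suc n)
          have "dist (X K u) (X (K + Suc n) u) \<le> dist (X K u) (X (K + n) u) + dist (X (K + n) u) (X (Suc (K + n)) u)"
            by (simp add: dist_triangle)
          also have "\<dots> \<le> 4 * (1/2) ^ K - 4 * (1/2) ^ (K + n) + 2 * (1/2) ^ (K + n)"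
            using Suc Xd[OF u, of "K + n"] by linarith
          finally show ?case by simp
        qed simp
        have d': "dist (X K u) (X n u) < e / 2" if "n \<ge> K" for n
        proof -
          have "(0::real) < (1/2) ^ (K + (n - K))" by simp
          then have "4 * (1/2) ^ K - 4 * (1/2::real) ^ (K + (n - K)) < e / 2" using K by linarith
          then show ?thesis using d[of "n - K"] that by simp
        qed
        have "dist (X a u) (X b u) < e" if "a \<ge> K" "b \<ge> K" for a b
          using d'[OF that(1)] d'[OF that(2)] dist_triangle3[of "X a u" "X b u" "X K u"] by linarith
        then show "\<exists>M. \<forall>m\<ge>M. \<forall>n\<ge>M. dist (X m u) (X n u) < e" by blast
      qed
      then show ?thesis
        using compact_imp_complete[OF cpt] by (auto simp: complete_def)
    qed
    define R where "R = restrict_space lborel {0..<m}"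
    have spR: "space R = {0..<m}" by (simp add: R_def space_restrict_space)
    have finR: "finite_measure R"
    proof
      have "emeasure R (space R) = emeasure lborel {0..<m}"
        unfolding spR unfolding R_def by (subst emeasure_restrict_space) auto
      then show "emeasure R (space R) \<noteq> \<infinity>" by (cases "0 \<le> m") auto
    qed
    interpret R: finite_measure R by (rule finR)
    have Im: "I k \<in> measurable R (count_space UNIV)" for k
      unfolding R_def I_def
      by (rule measurable_restrict_space1) (rule measurable_Least, simp)
    have Xm: "X k \<in> borel_measurable R" for k
      unfolding X_def by (rule measurable_compose[OF Im]) simp
    define Y where "Y u = lim (\<lambda>k. X k u)" for u
    have XY: "(\<lambda>k. X k u) \<longlonglongrightarrow> Y u" if "u \<in> space R" for u
      using Xlim[of u] that unfolding spR Y_def by (metis limI)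
    have Ym: "Y \<in> borel_measurable R"
      by (rule borel_measurable_LIMSEQ_metric[OF Xm XY])
    define \<nu> where "\<nu> = distr R borel Y"
    have step: "(\<integral>u. f (X k u) \<partial>R) = (\<Sum>i<B (Suc k). f (z k (i mod L k)) * (F (Suc k) (i + 1) - F (Suc k) i))"
      for f :: "'a \<Rightarrow> real" and k
    proof -
      let ?J = "\<lambda>i. {F (Suc k) i..<F (Suc k) (i + 1)}"
      have "F (Suc k) i \<le> m" if "i \<le> B (Suc k)" for i using Fmono[OF that, of "Suc k"] FB by simp
      moreover have "0 \<le> F (Suc k) i" for i using Fmono[of 0 i "Suc k"] by (simp add: F00)
      ultimately have J: "?J i \<subseteq> {0..<m}" if "i < B (Suc k)" for i
      proof -
        have "F (Suc k) (i + 1) \<le> m" "0 \<le> F (Suc k) i"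
          using that \<open>\<And>i. i \<le> B (Suc k) \<Longrightarrow> F (Suc k) i \<le> m\<close> \<open>\<And>i. 0 \<le> F (Suc k) i\<close> by simp_all
        then show ?thesis unfolding subset_iff atLeastLessThan_iff by (meson order_trans order.strict_trans2)
      qed
      have "(\<integral>u. f (X k u) \<partial>R) = (\<integral>u. (\<Sum>i<B (Suc k). f (z k (i mod L k)) * indicator (?J i) u) \<partial>R)"
      proof (rule Bochner_Integration.integral_cong[OF refl])
        fix u assume "u \<in> space R"
        then have u: "u \<in> {0..<m}" by (simp add: spR)
        have "(\<Sum>i<B (Suc k). f (z k (i mod L k)) * indicator (?J i) u) =
            (\<Sum>i<B (Suc k). if i = I (Suc k) u then f (X k u) else 0)"
        proof (rule sum.cong[OF refl])
          fix i
          show "f (z k (i mod L k)) * indicator (?J i) u = (if i = I (Suc k) u then f (X k u) else 0)"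
          proof (cases "i = I (Suc k) u")
            case True
            then show ?thesis using Ibase(1,2)[OF u, of "Suc k"] by (simp add: X_def)
          next
            case False
            then have "u \<notin> ?J i" using Iuniq[OF u, of "Suc k" i] by auto
            then show ?thesis using False by simp
          qed
        qed
        then show "f (X k u) = (\<Sum>i<B (Suc k). f (z k (i mod L k)) * indicator (?J i) u)"
          using Ibase(3)[OF u, of "Suc k"] by simp
      qed
      also have "\<dots> = (\<Sum>i<B (Suc k). f (z k (i mod L k)) * (\<integral>u. indicator (?J i) u \<partial>R))"
      proof (subst Bochner_Integration.integral_sum)
        show "integrable R (\<lambda>u. f (z k (i mod L k)) * indicator (?J i) u)" for i
          by (intro integrable_mult_right R.integrable_const_bound[where B = 1])
            (auto simp: indicator_def R_def intro!: measurable_restrict_space1)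
      qed simp
      also have "\<dots> = (\<Sum>i<B (Suc k). f (z k (i mod L k)) * (F (Suc k) (i + 1) - F (Suc k) i))"
      proof (rule sum.cong[OF refl])
        fix i assume "i \<in> {..<B (Suc k)}"
        then have Ji: "?J i \<subseteq> {0..<m}" using J by simp
        have "(\<integral>u. indicator (?J i) u \<partial>R) = measure R (?J i)"
          unfolding Bochner_Integration.integral_indicator spR using Ji by (simp only: Int_absorb2)
        also have "\<dots> = measure lborel (?J i)"
          unfolding R_def using Ji by (subst measure_restrict_space) auto
        also have "\<dots> = F (Suc k) (i + 1) - F (Suc k) i" using Fmono[of i "i + 1" "Suc k"] by simp
        finally show "f (z k (i mod L k)) * (\<integral>u. indicator (?J i) u \<partial>R) =
          f (z k (i mod L k)) * (F (Suc k) (i + 1) - F (Suc k) i)" by simp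
      qed
      finally show ?thesis .
    qed
    show "\<exists>\<nu>. finite_measure \<nu> \<and> sets \<nu> = sets borel \<and>
        (\<forall>f :: 'a \<Rightarrow> real. continuous_on UNIV f \<longrightarrow> (\<lambda>N. \<integral>x. f x \<partial>\<mu> N) \<longlonglongrightarrow> (\<integral>x. f x \<partial>\<nu>))"
    proof (intro exI[of _ \<nu>] conjI allI impI)
      show "finite_measure \<nu>" unfolding \<nu>_def by (rule R.finite_measure_distr[OF Ym])
      show "sets \<nu> = sets borel" by (simp add: \<nu>_def)
      fix f :: "'a \<Rightarrow> real" assume f: "continuous_on UNIV f"
      have fm [measurable]: "f \<in> borel_measurable borel" by (rule borel_measurable_continuous_onI[OF f])
      have "bounded (range f)" using compact_continuous_image[OF f cpt] by (rule compact_imp_bounded)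
      then obtain K where K: "\<And>x. \<bar>f x\<bar> \<le> K" by (auto simp: bounded_iff)
      have lim1: "(\<lambda>k. \<integral>u. f (X k u) \<partial>R) \<longlonglongrightarrow> (\<integral>x. f x \<partial>\<nu>)"
        unfolding \<nu>_def integral_distr[OF Ym fm]
      proof (rule integral_dominated_convergence[where w = "\<lambda>_. K"])
        show "AE u in R. (\<lambda>k. f (X k u)) \<longlonglongrightarrow> f (Y u)"
        proof (rule AE_I2)
          fix u assume "u \<in> space R"
          from XY[OF this] show "(\<lambda>k. f (X k u)) \<longlonglongrightarrow> f (Y u)"
            using f by (auto simp: continuous_on_eq_continuous_at intro: isCont_tendsto_compose)
        qed
        show "(\<lambda>u. f (X k u)) \<in> borel_measurable R" for k using measurable_compose[OF Xm fm] .
        show "(\<lambda>u. f (Y u)) \<in> borel_measurable R" using measurable_compose[OF Ym fm] .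
      qed (use K in auto)
      have T: "(\<lambda>N. measure (\<mu> N) UNIV) \<longlonglongrightarrow> m"
        using F[of 0 1] by (simp add: m_def cell_def q0)
      have m0: "0 \<le> m" using Fmono[of 0 1 0] by (simp add: m_def F00)
      have uc: "uniformly_continuous_on UNIV f" by (rule compact_uniformly_continuous[OF f cpt])
      show "(\<lambda>N. \<integral>x. f x \<partial>\<mu> N) \<longlonglongrightarrow> (\<integral>x. f x \<partial>\<nu>)"
      proof (rule LIMSEQ_I)
        fix r :: real assume r: "0 < r"
        \<comment> \<open>The total mass is eventually below m + 1, so oscillation e costs at most e
          (m + 1) = r / 3.\<close>
        define e where "e = r / (3 * (m + 1))"
        have e: "0 < e" "e * (m + 1) = r / 3" using r m0 by (auto simp: e_def field_simps)
        obtain d where d: "0 < d" "\<And>x y. dist x y < d \<Longrightarrow> dist (f x) (f y) < e"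
          using uc e(1) unfolding uniformly_continuous_on_def by (metis UNIV_I)
        obtain k0 where k0: "(1/2::real) ^ k0 < d" using d(1) real_arch_pow_inv[of d "1/2"] by auto
        obtain k1 where k1: "\<And>k. k1 \<le> k \<Longrightarrow> \<bar>(\<integral>u. f (X k u) \<partial>R) - (\<integral>x. f x \<partial>\<nu>)\<bar> < r / 3"
          using LIMSEQ_D[OF lim1, of "r / 3"] r by (auto simp: real_norm_def)
        define k where "k = max k0 k1"
        have "(1/2::real) ^ k \<le> (1/2) ^ k0" by (intro power_decreasing) (auto simp: k_def)
        then have kd: "(1/2::real) ^ k < d" using k0 by linarith
        have k1': "\<bar>(\<integral>u. f (X k u) \<partial>R) - (\<integral>x. f x \<partial>\<nu>)\<bar> < r / 3" by (rule k1) (simp add: k_def)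
        \<comment> \<open>The integral under \<open>\<mu> N\<close> of the step function that
          replaces f(x) by its value at the net point of x. It involves finitely many cumulative
          masses, so it converges.\<close>
        let ?S = "\<lambda>N. \<Sum>i<B (Suc k). f (z k (i mod L k)) * (measure (\<mu> N) (cell (Suc k) (i + 1)) - measure (\<mu> N) (cell (Suc k) i))"
        have "?S \<longlonglongrightarrow> (\<integral>u. f (X k u) \<partial>R)"
          unfolding step by (intro tendsto_intros F)
        then obtain N1 where N1: "\<And>N. N1 \<le> N \<Longrightarrow> \<bar>?S N - (\<integral>u. f (X k u) \<partial>R)\<bar> < r / 3"
          using LIMSEQ_D[of ?S "\<integral>u. f (X k u) \<partial>R" "r / 3"] r by (auto simp: real_norm_def)
        obtain N2 where N2: "\<And>N. N2 \<le> N \<Longrightarrow> \<bar>measure (\<mu> N) UNIV - m\<bar> < 1"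
          using LIMSEQ_D[OF T, of 1] by (auto simp: real_norm_def)
        have S: "\<bar>(\<integral>x. f x \<partial>\<mu> N) - ?S N\<bar> \<le> e * measure (\<mu> N) UNIV" for N
        proof -
          interpret finite_measure "\<mu> N" by (rule fin)
          have fm' [measurable]: "f \<in> borel_measurable (\<mu> N)" using fm by (simp add: measurable_cong_sets[OF sets refl])
          have qm' [measurable]: "q j \<in> measurable (\<mu> N) (count_space UNIV)" for j using qm by (simp add: measurable_cong_sets[OF sets refl])
          let ?g = "\<lambda>x. f (z k (q (Suc k) x mod L k))"
          have fi: "integrable (\<mu> N) f" by (rule integrable_const_bound[where B = K]) (use K in auto)
          have gm: "?g \<in> borel_measurable (\<mu> N)" by measurable
          have gi: "integrable (\<mu> N) ?g" by (rule integrable_const_bound[where B = K]) (use K gm in auto)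
          have "(\<integral>x. ?g x \<partial>\<mu> N) = (\<integral>x. (\<Sum>i<B (Suc k). f (z k (i mod L k)) * (indicator (cell (Suc k) (i + 1)) x - indicator (cell (Suc k) i) x)) \<partial>\<mu> N)"
          proof (rule Bochner_Integration.integral_cong[OF refl])
            fix x
            have "(\<Sum>i<B (Suc k). f (z k (i mod L k)) * (indicator (cell (Suc k) (i + 1)) x - indicator (cell (Suc k) i) x)) =
              (\<Sum>i<B (Suc k). if i = q (Suc k) x then ?g x else 0)"
              by (rule sum.cong) (auto simp: cell_def indicator_def)
            then show "?g x = (\<Sum>i<B (Suc k). f (z k (i mod L k)) * (indicator (cell (Suc k) (i + 1)) x - indicator (cell (Suc k) i) x))"
              using qB[of "Suc k" x] by simp
          qed
          also have "\<dots> = ?S N"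
          proof -
            have i: "integrable (\<mu> N) (indicator (cell j i) :: 'a \<Rightarrow> real)" for j i
              using cellm by (intro integrable_real_indicator) (auto simp: sets less_top[symmetric])
            show ?thesis by (subst Bochner_Integration.integral_sum) (auto simp: i sp)
          qed
          finally have "(\<integral>x. f x \<partial>\<mu> N) - ?S N = (\<integral>x. f x - ?g x \<partial>\<mu> N)" using fi gi by simp
          moreover have "\<bar>\<integral>x. f x - ?g x \<partial>\<mu> N\<bar> \<le> (\<integral>x. e \<partial>\<mu> N)"
          proof (rule order_trans[OF integral_abs_bound], rule integral_mono)
            fix x
            have "dist x (z k (p k x)) < d" using p(1)[of k x] kd by (simp add: dist_commute)
            from d(2)[OF this] show "\<bar>f x - ?g x\<bar> \<le> e" by (simp add: qmod dist_real_def)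
          qed (use fi gi in auto)
          ultimately show ?thesis by (simp add: sp mult.commute)
        qed
        show "\<exists>no. \<forall>n\<ge>no. norm ((\<integral>x. f x \<partial>\<mu> n) - (\<integral>x. f x \<partial>\<nu>)) < r"
        proof (intro exI[of _ "max N1 N2"] allI impI)
          fix N assume N: "max N1 N2 \<le> N"
          have "e * measure (\<mu> N) UNIV \<le> e * (m + 1)" using N2[of N] N e(1) by (intro mult_left_mono) auto
          then have "\<bar>(\<integral>x. f x \<partial>\<mu> N) - ?S N\<bar> \<le> r / 3" using S[of N] e(2) by linarith
          moreover have "\<bar>?S N - (\<integral>u. f (X k u) \<partial>R)\<bar> < r / 3" using N1[of N] N by simp
          ultimately show "norm ((\<integral>x. f x \<partial>\<mu> N) - (\<integral>x. f x \<partial>\<nu>)) < r"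
            unfolding real_norm_def using k1' by linarith
        qed
      qed
    qed
  qed
qed

section \<open>Convergence of nonnegative martingales\<close>

text \<open>The buy-low-sell-high strategy: a position is opened below \<open>a\<close> and kept
  until the value reaches \<open>b\<close>. The decision for the step from n to n + 1 uses the
  values up to n only.\<close>

fun holding :: "real \<Rightarrow> real \<Rightarrow> (nat \<Rightarrow> real) \<Rightarrow> nat \<Rightarrow> bool" where
  "holding a b y 0 \<longleftrightarrow> y 0 < a"
| "holding a b y (Suc n) \<longleftrightarrow> (if holding a b y n then y (Suc n) < b else y (Suc n) < a)"

fun upcrossings :: "real \<Rightarrow> real \<Rightarrow> (nat \<Rightarrow> real) \<Rightarrow> nat \<Rightarrow> nat" where
  "upcrossings a b y 0 = 0"
| "upcrossings a b y (Suc n) = upcrossings a b y n + of_bool (holding a b y n \<and> b \<le> y (Suc n))"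

text \<open>Each completed upcrossing earns at least b - a. The last term makes up for a loss of the
  open position, which was entered below \<open>a\<close>.\<close>

lemma upcrossings_gain:
  assumes "a < b"
  shows "(b - a) * real (upcrossings a b y N) \<le>
    (\<Sum>n<N. of_bool (holding a b y n) * (y (Suc n) - y n)) + (if holding a b y N then a - y N else 0)"
proof (induction N)
  case (Suc N)
  then show ?case using assms
    by (cases "holding a b y N"; cases "b \<le> y (Suc N)") (auto simp: algebra_simps)
qed auto

lemma upcrossings_gain_nonneg:
  assumes "a < b" "0 \<le> a" "\<And>n. 0 \<le> y n"
  shows "(b - a) * real (upcrossings a b y N) \<le>
    a + (\<Sum>n<N. of_bool (holding a b y n) * (y (Suc n) - y n))"
  using upcrossings_gain[OF assms(1), of y N] assms(2) assms(3)[of N] by (auto split: if_splits)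

lemma upcrossings_mono: "m \<le> n \<Longrightarrow> upcrossings a b y m \<le> upcrossings a b y n"
  by (rule lift_Suc_mono_le[of "upcrossings a b y"]) auto

text \<open>Values below \<open>a\<close> recur, so a position is opened after any time; values
  above \<open>b\<close> recur, so it is sold again.\<close>

lemma upcrossings_unbounded:
  assumes ab: "a < b" and lo: "\<And>n. \<exists>m>n. y m < a" and hi: "\<And>n. \<exists>m>n. b < y m"
  shows "\<exists>N. k \<le> upcrossings a b y N"
proof (induction k)
  case (Suc k)
  then obtain N where N: "k \<le> upcrossings a b y N" by blast
  obtain n where n: "n \<ge> N" "holding a b y n"
  proof (rule ccontr)
    assume c: "\<not> thesis"
    then have no: "\<not> holding a b y n" if "n \<ge> N" for n using that \<open>\<And>n. N \<le> n \<Longrightarrow> holding a b y n \<Longrightarrow> thesis\<close> by blast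
    obtain m where m: "m > N" "y m < a" using lo by blast
    then obtain m' where m': "m = Suc m'" "m' \<ge> N" by (cases m) auto
    then have "holding a b y m" using m no[of m'] by simp
    then show False using no m by simp
  qed
  obtain m where m: "m \<ge> n" "holding a b y m" "b \<le> y (Suc m)"
  proof (rule ccontr)
    assume c: "\<not> thesis"
    then have no: "y (Suc m) < b" if "m \<ge> n" "holding a b y m" for m
      using that \<open>\<And>m. n \<le> m \<Longrightarrow> holding a b y m \<Longrightarrow> b \<le> y (Suc m) \<Longrightarrow> thesis\<close> by force
    have h: "holding a b y m" if "m \<ge> n" for m
      using that by (induction rule: dec_induct) (use n no in auto)
    obtain m where m: "m > n" "b < y m" using hi by blast
    then obtain m' where m': "m = Suc m'" "m' \<ge> n" by (cases m) auto
    then show False using no[OF m'(2) h[OF m'(2)]] m by simp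
  qed
  have "upcrossings a b y N \<le> upcrossings a b y m"
    using n m by (intro upcrossings_mono) simp
  then have "Suc k \<le> upcrossings a b y (Suc m)" using N m by simp
  then show ?case by blast
qed auto

text \<open>If lower and upper limit differed, two rationals strictly between them would be crossed
  infinitely often; \<open>fin\<close> excludes the limit infinity. Rational levels keep the number
  of exceptional events countable.\<close>

lemma convergent_if_upcrossings_bounded:
  fixes y :: "nat \<Rightarrow> real"
  assumes nn: "\<And>n. 0 \<le> y n"
    and bd: "\<And>a b :: rat. 0 \<le> a \<Longrightarrow> a < b \<Longrightarrow> \<exists>k. \<forall>N. upcrossings (of_rat a) (of_rat b) y N < k"
    and fin: "\<And>n. \<exists>m>n. y m < c"
  shows "convergent y"
proof -
  let ?y = "\<lambda>n. ereal (y n)"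
  have "liminf ?y = limsup ?y"
  proof (rule ccontr)
    assume "liminf ?y \<noteq> limsup ?y"
    then have lt: "liminf ?y < limsup ?y" using Liminf_le_Limsup[of sequentially ?y] by auto
    have l0: "0 \<le> liminf ?y" using nn by (intro Liminf_bounded) auto
    obtain a' where a': "liminf ?y < ereal a'" "ereal a' < limsup ?y" using lt ereal_dense2 by blast
    obtain b' where b': "ereal a' < ereal b'" "ereal b' < limsup ?y" using a'(2) ereal_dense2 by blast
    obtain c' where c': "liminf ?y < ereal c'" "ereal c' < ereal a'" using a'(1) ereal_dense2 by blast
    obtain a :: rat where a: "c' < of_rat a" "of_rat a < a'" using c'(2) of_rat_dense[of c' a'] by auto
    obtain b :: rat where b: "a' < of_rat b" "of_rat b < b'" using b'(1) of_rat_dense[of a' b'] by auto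
    have c0: "0 < c'" using l0 c'(1) by (metis ereal_less(2) order_le_less_trans)
    have ab: "0 \<le> a" "a < b"
    proof -
      have "(0::real) < of_rat a" by (rule less_trans[OF c0 a(1)])
      then have "0 < a" by simp
      then show "0 \<le> a" by simp
      have "(of_rat a :: real) < of_rat b" using a b by simp
      then show "a < b" by (simp add: of_rat_less)
    qed
    have lo: "\<exists>m>n. y m < of_rat a" for n
    proof (rule ccontr)
      assume "\<not> (\<exists>m>n. y m < of_rat a)"
      then have "\<forall>m\<ge>Suc n. of_rat a \<le> y m" by (meson Suc_le_eq not_less)
      then have "eventually (\<lambda>m. ereal (of_rat a) \<le> ?y m) sequentially"
        unfolding eventually_sequentially by auto
      then have "ereal (of_rat a) \<le> liminf ?y" by (rule Liminf_bounded)
      then have "ereal (of_rat a) < ereal c'" using c'(1) by (rule le_less_trans)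
      then show False using a by simp
    qed
    have hi: "\<exists>m>n. of_rat b < y m" for n
    proof (rule ccontr)
      assume "\<not> (\<exists>m>n. of_rat b < y m)"
      then have "\<forall>m\<ge>Suc n. y m \<le> of_rat b" by (meson Suc_le_eq not_less)
      then have "eventually (\<lambda>m. ?y m \<le> ereal (of_rat b)) sequentially"
        unfolding eventually_sequentially by auto
      then have "limsup ?y \<le> ereal (of_rat b)" by (rule Limsup_bounded)
      with b'(2) have "ereal b' < ereal (of_rat b)" by (rule less_le_trans)
      then show False using b by simp
    qed
    have "(of_rat a :: real) < of_rat b" using ab(2) by (simp add: of_rat_less)
    then have "\<exists>N. k \<le> upcrossings (of_rat a) (of_rat b) y N" for k
      using lo hi by (rule upcrossings_unbounded)
    then show False using bd[OF ab] by (meson not_less)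
  qed
  moreover have "0 \<le> liminf ?y" using nn by (intro Liminf_bounded) auto
  moreover have "liminf ?y < \<infinity>"
  proof (rule ccontr)
    assume "\<not> liminf ?y < \<infinity>"
    then have "ereal c < liminf ?y" by simp
    then have "eventually (\<lambda>n. ereal c < ?y n) sequentially" by (rule less_LiminfD)
    then obtain N where "\<And>n. N \<le> n \<Longrightarrow> c < y n" by (auto simp: eventually_sequentially)
    then show False using fin[of N] by (meson less_imp_le not_less)
  qed
  ultimately obtain r where r: "liminf ?y = ereal r" "limsup ?y = ereal r"
    by (cases "limsup ?y") auto
  then have "?y \<longlonglongrightarrow> ereal r" by (intro Liminf_eq_Limsup) auto
  then show ?thesis by (auto simp: convergent_def)
qed

text \<open>Doob's upcrossing argument: the strategy is predictable, so its expected gain is 0 and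
  the expected number of upcrossings is at most a / (b - a). Fatou's lemma gives a finite lower
  limit. The hypothesis \<open>mart\<close> is the conditional expectation property in integrated
  form.\<close>

lemma (in prob_space) nonneg_martingale_convergence:
  fixes Y :: "nat \<Rightarrow> 'a \<Rightarrow> real" and F :: "nat \<Rightarrow> 'a measure"
  assumes sub: "\<And>n. subalgebra M (F n)"
    and mono: "\<And>n. subalgebra (F (Suc n)) (F n)"
    and adapted: "\<And>n. Y n \<in> borel_measurable (F n)"
    and int: "\<And>n. integrable M (Y n)"
    and nn: "\<And>n w. 0 \<le> Y n w"
    and mart: "\<And>n G. G \<in> sets (F n) \<Longrightarrow>
      (\<integral>w. indicator G w * Y (Suc n) w \<partial>M) = (\<integral>w. indicator G w * Y n w \<partial>M)"
  shows "AE w in M. convergent (\<lambda>n. Y n w)"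
proof -
  have sp: "space (F n) = space M" for n using sub by (auto simp: subalgebra_def)
  have hold: "{w \<in> space M. holding a b (\<lambda>n. Y n w) n} \<in> sets (F n)" for a b n
  proof (induction n)
    case 0
    then show ?case using measurable_sets[OF adapted[of 0], of "{..<a}"]
      by (simp add: vimage_def Int_def sp conj_commute)
  next
    case (Suc n)
    let ?H = "{w \<in> space M. holding a b (\<lambda>n. Y n w) n}"
    have H: "?H \<in> sets (F (Suc n))" using Suc mono[of n] by (auto simp: subalgebra_def)
    have *: "{w \<in> space M. Y (Suc n) w < c} \<in> sets (F (Suc n))" for c
      using measurable_sets[OF adapted[of "Suc n"], of "{..<c}"]
      by (simp add: vimage_def Int_def sp conj_commute)
    have "{w \<in> space M. holding a b (\<lambda>n. Y n w) (Suc n)} =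
        (?H \<inter> {w \<in> space M. Y (Suc n) w < b}) \<union> ({w \<in> space M. Y (Suc n) w < a} - ?H)"
      by auto
    also have "\<dots> \<in> sets (F (Suc n))" using H * by auto
    finally show ?case .
  qed
  have holdM: "{w \<in> space M. holding a b (\<lambda>n. Y n w) n} \<in> sets M" for a b n
    using hold[of a b n] sub[of n] by (auto simp: subalgebra_def)
  have Ym [measurable]: "Y n \<in> borel_measurable M" for n using int by auto
  have um [measurable]: "(\<lambda>w. upcrossings a b (\<lambda>n. Y n w) N) \<in> measurable M (count_space UNIV)" for a b N
  proof (induction N)
    case (Suc N)
    note [measurable] = Suc
    have [measurable]: "Measurable.pred M (\<lambda>w. holding a b (\<lambda>n. Y n w) N)"
      using holdM[of a b N] by (simp add: pred_def)
    show ?case unfolding upcrossings.simps by measurable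
  qed simp
  have bound: "(\<integral>\<^sup>+w. ennreal (real (upcrossings a b (\<lambda>n. Y n w) N)) \<partial>M) \<le> ennreal (a / (b - a))"
    if ab: "0 \<le> a" "a < b" for a b :: real and N
  proof -
    let ?h = "\<lambda>n w. indicator {w \<in> space M. holding a b (\<lambda>n. Y n w) n} w :: real"
    let ?g = "\<lambda>w. a / (b - a) + (\<Sum>n<N. ?h n w * Y (Suc n) w - ?h n w * Y n w) / (b - a)"
    have i: "integrable M (\<lambda>w. ?h n w * Y m w)" for n m
      using integrable_mult_indicator[OF holdM int] by simp
    have gi: "integrable M ?g" using i by auto
    have le: "real (upcrossings a b (\<lambda>n. Y n w) N) \<le> ?g w" if "w \<in> space M" for w
    proof -
      have "(\<Sum>n<N. ?h n w * Y (Suc n) w - ?h n w * Y n w) =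
          (\<Sum>n<N. of_bool (holding a b (\<lambda>n. Y n w) n) * (Y (Suc n) w - Y n w))"
        using that by (intro sum.cong) (auto simp: indicator_def)
      then have "(b - a) * real (upcrossings a b (\<lambda>n. Y n w) N) \<le>
          a + (\<Sum>n<N. ?h n w * Y (Suc n) w - ?h n w * Y n w)"
        using upcrossings_gain_nonneg[of a b "\<lambda>n. Y n w" N] ab nn by simp
      then show ?thesis
        using ab by (simp add: add_divide_distrib[symmetric] pos_le_divide_eq mult.commute)
    qed
    have g0: "AE w in M. 0 \<le> ?g w"
    proof (rule AE_I2)
      fix w assume "w \<in> space M"
      from le[OF this] show "0 \<le> ?g w" by (rule order_trans[rotated]) simp
    qed
    have "(\<integral>\<^sup>+w. ennreal (real (upcrossings a b (\<lambda>n. Y n w) N)) \<partial>M) \<le> (\<integral>\<^sup>+w. ennreal (?g w) \<partial>M)"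
      by (intro nn_integral_mono ennreal_leI le)
    also have "\<dots> = ennreal (\<integral>w. ?g w \<partial>M)"
      by (rule nn_integral_eq_integral[OF gi g0])
    also have "(\<integral>w. ?g w \<partial>M) = a / (b - a)"
      using i mart[OF hold] by (simp add: prob_space)
    finally show ?thesis .
  qed
  have ub: "AE w in M. \<exists>k. \<forall>N. upcrossings a b (\<lambda>n. Y n w) N < k" if ab: "0 \<le> a" "a < b" for a b :: real
  proof -
    let ?u = "\<lambda>N w. ennreal (real (upcrossings a b (\<lambda>n. Y n w) N))"
    have "(\<integral>\<^sup>+w. (SUP N. ?u N w) \<partial>M) = (SUP N. \<integral>\<^sup>+w. ?u N w \<partial>M)"
    proof (rule nn_integral_monotone_convergence_SUP)
      show "incseq ?u" by (auto simp: incseq_def le_fun_def intro!: ennreal_leI upcrossings_mono)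
      show "?u N \<in> borel_measurable M" for N by measurable
    qed
    also have "\<dots> \<le> ennreal (a / (b - a))" by (intro SUP_least bound ab)
    also have "\<dots> < \<infinity>" by simp
    finally have "AE w in M. (SUP N. ?u N w) \<noteq> \<infinity>"
      by (intro nn_integral_PInf_AE) (auto simp: less_top)
    then show ?thesis
    proof eventually_elim
      case (elim w)
      then obtain c where c: "(SUP N. ?u N w) = ennreal c" "0 \<le> c"
        by (metis ennreal_cases infinity_ennreal_def)
      have "upcrossings a b (\<lambda>n. Y n w) N < nat \<lceil>c\<rceil> + 1" for N
      proof -
        have "?u N w \<le> ennreal c" unfolding c(1)[symmetric] by (rule SUP_upper) simp
        then have "real (upcrossings a b (\<lambda>n. Y n w) N) \<le> c" using c(2) by simp
        then show ?thesis by linarith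
      qed
      then show ?case by blast
    qed
  qed
  have ubr: "AE w in M. \<forall>a b :: rat. 0 \<le> a \<longrightarrow> a < b \<longrightarrow>
      (\<exists>k. \<forall>N. upcrossings (of_rat a) (of_rat b) (\<lambda>n. Y n w) N < k)"
    unfolding AE_all_countable
  proof (intro allI)
    fix a b :: rat
    show "AE w in M. 0 \<le> a \<longrightarrow> a < b \<longrightarrow> (\<exists>k. \<forall>N. upcrossings (of_rat a) (of_rat b) (\<lambda>n. Y n w) N < k)"
    proof (cases "0 \<le> a \<and> a < b")
      case True
      then show ?thesis using ub[of "of_rat a" "of_rat b"] by (simp add: of_rat_less)
    qed auto
  qed
  have EY: "(\<integral>w. Y n w \<partial>M) = (\<integral>w. Y 0 w \<partial>M)" for n
  proof (induction n)
    case (Suc n)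
    have "space M \<in> sets (F n)" using sp[of n] sets.top[of "F n"] by simp
    from mart[OF this] have "(\<integral>w. Y (Suc n) w \<partial>M) = (\<integral>w. Y n w \<partial>M)"
      by (simp cong: Bochner_Integration.integral_cong)
    then show ?case using Suc by simp
  qed simp
  have nnY: "(\<integral>\<^sup>+w. ennreal (Y n w) \<partial>M) = ennreal (\<integral>w. Y 0 w \<partial>M)" for n
    using nn_integral_eq_integral[OF int, of n] nn by (simp add: EY[of n])
  have "(\<integral>\<^sup>+w. liminf (\<lambda>n. ennreal (Y n w)) \<partial>M) \<le> liminf (\<lambda>n. \<integral>\<^sup>+w. ennreal (Y n w) \<partial>M)"
    by (intro nn_integral_liminf) simp
  also have "\<dots> = ennreal (\<integral>w. Y 0 w \<partial>M)"
    unfolding nnY by (simp add: Liminf_const)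
  also have "\<dots> < \<infinity>" by simp
  finally have "AE w in M. liminf (\<lambda>n. ennreal (Y n w)) \<noteq> \<infinity>"
    by (intro nn_integral_PInf_AE) (auto simp: less_top)
  with ubr show ?thesis
  proof eventually_elim
    case (elim w)
    obtain r where r: "liminf (\<lambda>n. ennreal (Y n w)) = ennreal r" "0 \<le> r"
      using elim(2) by (metis ennreal_cases infinity_ennreal_def)
    define c where "c = r + 1"
    have c: "liminf (\<lambda>n. ennreal (Y n w)) < ennreal c"
      unfolding r(1) c_def using r(2) by (subst ennreal_less_iff) auto
    have "\<exists>m>n. Y m w < c" for n
    proof (rule ccontr)
      assume "\<not> (\<exists>m>n. Y m w < c)"
      then have "\<forall>m\<ge>Suc n. c \<le> Y m w" by (meson Suc_le_eq not_less)
      then have "eventually (\<lambda>m. ennreal c \<le> ennreal (Y m w)) sequentially"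
        unfolding eventually_sequentially by (auto intro!: exI[of _ "Suc n"] ennreal_leI)
      then have "ennreal c \<le> liminf (\<lambda>n. ennreal (Y n w))" by (rule Liminf_bounded)
      then show False using c by simp
    qed
    then show ?case
      using elim(1) nn by (intro convergent_if_upcrossings_bounded[where c = c]) auto
  qed
qed

section \<open>Potentials, energy and capacity\<close>

instance torus :: (finite) complete_space
proof
  fix X :: "nat \<Rightarrow> 'a torus" assume "Cauchy X"
  then show "convergent X"
    using compact_imp_complete[OF compact_UNIV_torus] by (auto simp: complete_def convergent_def)
qed

lemma torus_measuresD:
  assumes "\<sigma> \<in> torus_measures"
  shows "finite_measure \<sigma>" "sets \<sigma> = sets borel" "space \<sigma> = UNIV"
  using assms sets_eq_imp_space_eq[of \<sigma> borel] by (auto simp: torus_measures_def)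

lemma torus_measures_density_indicator:
  assumes "\<sigma> \<in> torus_measures" "E \<in> sets borel"
  shows "density \<sigma> (indicator E) \<in> torus_measures"
proof -
  interpret finite_measure \<sigma> by (rule torus_measuresD[OF assms(1)])
  have "finite_measure (density \<sigma> (indicator E))"
    using assms(2) torus_measuresD(2)[OF assms(1)] by (intro finite_measure_restricted) simp
  then show ?thesis using torus_measuresD(2)[OF assms(1)] by (simp add: torus_measures_def)
qed

lemma riesz_kernel_pos: "t \<noteq> s \<Longrightarrow> riesz_kernel \<beta> t s = ennreal (dist t s powr - \<beta>)"
  by (simp add: riesz_kernel_def inverse_ennreal powr_minus)

lemma riesz_kernel_diag: "riesz_kernel \<beta> t t = (if \<beta> = 0 then 1 else \<infinity>)"
  by (simp add: riesz_kernel_def)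

lemma riesz_kernel_sym: "riesz_kernel \<beta> t s = riesz_kernel \<beta> s t"
  by (simp add: riesz_kernel_def dist_commute)

lemma measurable_riesz_kernel [measurable]:
  "(\<lambda>p. riesz_kernel \<beta> (fst p) (snd p)) \<in> borel_measurable (borel \<Otimes>\<^sub>M borel)"
  unfolding riesz_kernel_def by measurable

definition potential :: "real \<Rightarrow> ('n::finite) torus measure \<Rightarrow> 'n torus \<Rightarrow> ennreal" where
  "potential \<beta> \<sigma> x = (\<integral>\<^sup>+y. riesz_kernel \<beta> x y \<partial>\<sigma>)"

lemma measurable_riesz_kernel_pair:
  assumes "\<sigma> \<in> torus_measures"
  shows "(\<lambda>(x, y). riesz_kernel \<beta> x y) \<in> borel_measurable (borel \<Otimes>\<^sub>M \<sigma>)"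
  using measurable_riesz_kernel torus_measuresD(2)[OF assms]
  by (simp add: case_prod_beta measurable_cong_sets[OF sets_pair_measure_cong[OF refl torus_measuresD(2)[OF assms]] refl])

lemma measurable_riesz_kernel_snd [measurable]:
  "(\<lambda>y. riesz_kernel \<beta> x y) \<in> borel_measurable borel"
  unfolding riesz_kernel_def by measurable

lemma measurable_potential:
  assumes "\<sigma> \<in> torus_measures" shows "potential \<beta> \<sigma> \<in> borel_measurable borel"
proof -
  interpret finite_measure \<sigma> by (rule torus_measuresD[OF assms])
  show ?thesis unfolding potential_def[abs_def]
    by (rule borel_measurable_nn_integral[OF measurable_riesz_kernel_pair[OF assms]])
qed

lemma energy_potential: "energy \<beta> \<sigma> = (\<integral>\<^sup>+x. potential \<beta> \<sigma> x \<partial>\<sigma>)"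
  by (simp add: energy_def potential_def)

lemma mutual_energy_commute:
  assumes "\<sigma> \<in> torus_measures" "\<nu> \<in> torus_measures"
  shows "(\<integral>\<^sup>+x. potential \<beta> \<sigma> x \<partial>\<nu>) = (\<integral>\<^sup>+x. potential \<beta> \<nu> x \<partial>\<sigma>)"
proof -
  interpret s: finite_measure \<sigma> by (rule torus_measuresD[OF assms(1)])
  interpret n: finite_measure \<nu> by (rule torus_measuresD[OF assms(2)])
  interpret pair_sigma_finite \<nu> \<sigma> ..
  have m: "(\<lambda>(x, y). riesz_kernel \<beta> x y) \<in> borel_measurable (\<nu> \<Otimes>\<^sub>M \<sigma>)"
    using measurable_riesz_kernel torus_measuresD(2)[OF assms(1)] torus_measuresD(2)[OF assms(2)]
    by (simp add: case_prod_beta measurable_cong_sets[OF sets_pair_measure_cong[OF torus_measuresD(2)[OF assms(2)] torus_measuresD(2)[OF assms(1)]] refl])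
  have "(\<integral>\<^sup>+x. potential \<beta> \<sigma> x \<partial>\<nu>) = (\<integral>\<^sup>+y. (\<integral>\<^sup>+x. riesz_kernel \<beta> x y \<partial>\<nu>) \<partial>\<sigma>)"
    unfolding potential_def using Fubini'[OF m] by simp
  also have "\<dots> = (\<integral>\<^sup>+x. potential \<beta> \<nu> x \<partial>\<sigma>)"
    unfolding potential_def by (intro nn_integral_cong riesz_kernel_sym)
  finally show ?thesis .
qed

lemma potential_restrict:
  assumes "\<sigma> \<in> torus_measures" "E \<in> sets borel"
  shows "potential \<beta> (density \<sigma> (indicator E)) x = (\<integral>\<^sup>+y. indicator E y * riesz_kernel \<beta> x y \<partial>\<sigma>)"
  unfolding potential_def using assms torus_measuresD(2)[OF assms(1)]
  by (subst nn_integral_density) (auto simp: measurable_cong_sets[OF torus_measuresD(2)[OF assms(1)] refl])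

lemma potential_restrict_le:
  assumes "\<sigma> \<in> torus_measures" "E \<in> sets borel"
  shows "potential \<beta> (density \<sigma> (indicator E)) x \<le> potential \<beta> \<sigma> x"
  unfolding potential_restrict[OF assms] unfolding potential_def
  by (intro nn_integral_mono) (auto simp: indicator_def)

lemma energy_restrict:
  assumes "\<sigma> \<in> torus_measures" "E \<in> sets borel"
  shows "energy \<beta> (density \<sigma> (indicator E)) = (\<integral>\<^sup>+x. indicator E x * potential \<beta> (density \<sigma> (indicator E)) x \<partial>\<sigma>)"
proof -
  have "potential \<beta> (density \<sigma> (indicator E)) \<in> borel_measurable \<sigma>"
    using measurable_potential[OF torus_measures_density_indicator[OF assms]]
    by (simp add: measurable_cong_sets[OF torus_measuresD(2)[OF assms(1)] refl])
  then show ?thesis unfolding energy_potential using assms torus_measuresD(2)[OF assms(1)]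
    by (subst nn_integral_density) (auto simp: measurable_cong_sets[OF torus_measuresD(2)[OF assms(1)] refl])
qed

lemma energy_restrict_bounded_potential:
  assumes \<sigma>: "\<sigma> \<in> torus_measures" and E: "E \<in> sets borel"
    and C: "\<And>x. x \<in> E \<Longrightarrow> potential \<beta> \<sigma> x \<le> ennreal C"
  shows "energy \<beta> (density \<sigma> (indicator E)) < \<infinity>"
proof -
  interpret finite_measure \<sigma> by (rule torus_measuresD[OF \<sigma>])
  have "energy \<beta> (density \<sigma> (indicator E)) \<le> (\<integral>\<^sup>+x. ennreal C \<partial>\<sigma>)"
    unfolding energy_restrict[OF \<sigma> E]
  proof (rule nn_integral_mono)
    fix x
    show "indicator E x * potential \<beta> (density \<sigma> (indicator E)) x \<le> ennreal C"
      using C[of x] potential_restrict_le[OF \<sigma> E, of \<beta> x] by (cases "x \<in> E") (auto intro: order_trans)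
  qed
  also have "\<dots> = ennreal C * emeasure \<sigma> UNIV" using torus_measuresD(3)[OF \<sigma>] by simp
  also have "\<dots> < \<infinity>" using emeasure_finite[of UNIV] by (auto simp: ennreal_mult_eq_top_iff less_top[symmetric])
  finally show ?thesis .
qed

lemma energy_restrict_le:
  assumes "\<sigma> \<in> torus_measures" "E \<in> sets borel"
  shows "energy \<beta> (density \<sigma> (indicator E)) \<le> energy \<beta> \<sigma>"
  unfolding energy_restrict[OF assms] unfolding energy_potential
proof (rule nn_integral_mono)
  fix x
  show "indicator E x * potential \<beta> (density \<sigma> (indicator E)) x \<le> potential \<beta> \<sigma> x"
    using potential_restrict_le[OF assms, of \<beta> x] by (cases "x \<in> E") auto
qed

text \<open>Normalising a nonzero \<mu> to a probability measure multiplies the energy by a finite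
  constant, so it would witness positive capacity.\<close>

lemma capacity_zero_finite_energy:
  assumes cap: "capacity \<beta> E = 0" and \<mu>: "\<mu> \<in> torus_measures" and E: "E \<in> sets borel"
    and carr: "emeasure \<mu> (- E) = 0" and en: "energy \<beta> \<mu> < \<infinity>"
  shows "emeasure \<mu> UNIV = 0"
proof (rule ccontr)
  assume nz: "emeasure \<mu> UNIV \<noteq> 0"
  interpret finite_measure \<mu> by (rule torus_measuresD[OF \<mu>])
  have sp: "space \<mu> = UNIV" and se: "sets \<mu> = sets borel" using torus_measuresD[OF \<mu>] by auto
  define m where "m = emeasure \<mu> UNIV"
  have m: "m \<noteq> 0" "m \<noteq> \<infinity>" using nz emeasure_finite[of UNIV] by (auto simp: m_def)
  define c where "c = inverse m"
  have c: "c < \<infinity>" using m by (simp add: c_def less_top[symmetric])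
  define \<nu> where "\<nu> = scale_measure c \<mu>"
  have pot: "potential \<beta> \<nu> x = c * potential \<beta> \<mu> x" for x
    unfolding potential_def \<nu>_def
    by (rule nn_integral_scale_measure) (simp add: measurable_cong_sets[OF se refl])
  have "energy \<beta> \<nu> = c * (\<integral>\<^sup>+x. c * potential \<beta> \<mu> x \<partial>\<mu>)"
    unfolding energy_potential pot unfolding \<nu>_def
    using measurable_potential[OF \<mu>, of \<beta>]
    by (intro nn_integral_scale_measure) (simp add: measurable_cong_sets[OF se refl])
  also have "\<dots> = c * (c * energy \<beta> \<mu>)"
    unfolding energy_potential using measurable_potential[OF \<mu>, of \<beta>]
    by (subst nn_integral_cmult) (simp_all add: measurable_cong_sets[OF se refl])
  also have "\<dots> < \<infinity>" using c en by (simp add: ennreal_mult_less_top)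
  finally have en': "energy \<beta> \<nu> < \<infinity>" .
  have "prob_space \<nu>"
  proof
    show "emeasure \<nu> (space \<nu>) = 1"
      using m by (simp add: \<nu>_def space_scale_measure sp c_def m_def[symmetric] ennreal_divide_self[unfolded divide_ennreal_def] mult.commute less_top)
  qed
  then have "\<nu> \<in> {\<nu>. sets \<nu> = sets borel \<and> prob_space \<nu> \<and> emeasure \<nu> (- E) = 0}"
    using se carr by (simp add: \<nu>_def)
  then have "(INF \<nu>\<in>{\<nu>. sets \<nu> = sets borel \<and> prob_space \<nu> \<and> emeasure \<nu> (- E) = 0}. energy \<beta> \<nu>) \<le> energy \<beta> \<nu>"
    by (rule INF_lower)
  then have "(INF \<nu>\<in>{\<nu>. sets \<nu> = sets borel \<and> prob_space \<nu> \<and> emeasure \<nu> (- E) = 0}. energy \<beta> \<nu>) < \<infinity>"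
    using en' by (rule le_less_trans)
  then show False using cap by (simp add: capacity_def)
qed

lemma capacity_zeroI:
  assumes "\<And>\<nu>. sets \<nu> = sets borel \<Longrightarrow> prob_space \<nu> \<Longrightarrow> emeasure \<nu> (- E) = 0 \<Longrightarrow> energy \<beta> \<nu> = \<infinity>"
  shows "capacity \<beta> E = 0"
proof -
  have "(INF \<nu>\<in>{\<nu>. sets \<nu> = sets borel \<and> prob_space \<nu> \<and> emeasure \<nu> (- E) = 0}. energy \<beta> \<nu>) = \<infinity>"
    unfolding infinity_ennreal_def by (rule top_le, rule INF_greatest) (use assms in auto)
  then show ?thesis by (simp add: capacity_def)
qed

section \<open>Maximum principle and singularity in terms of potentials\<close>

lemma riesz_kernel_doubling:
  assumes \<beta>: "0 \<le> \<beta>" and d: "dist x' y \<le> 2 * dist x y"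
  shows "riesz_kernel \<beta> x y \<le> ennreal (2 powr \<beta>) * riesz_kernel \<beta> x' y"
proof (cases "x' = y")
  case True
  have "1 \<le> ennreal (2 powr \<beta>)" using ge_one_powr_ge_zero[of 2 \<beta>] \<beta> by simp
  then show ?thesis using True by (auto simp: riesz_kernel_def ennreal_mult_top)
next
  case False
  then have xy: "x \<noteq> y" using d by auto
  have pos: "0 < dist x' y" "0 < dist x y" using False xy by auto
  have "dist x y powr - \<beta> \<le> (dist x' y / 2) powr - \<beta>"
    using d pos \<beta> by (intro powr_mono2') auto
  also have "\<dots> = 2 powr \<beta> * dist x' y powr - \<beta>"
    using pos by (simp add: powr_divide powr_minus field_simps)
  finally show ?thesis
    unfolding riesz_kernel_pos[OF False] riesz_kernel_pos[OF xy]
    by (simp add: ennreal_mult[symmetric] ennreal_leI)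
qed

text \<open>Replace x by a nearest point x' of \<open>K\<close>: every y in \<open>K\<close>
  satisfies |x' - y| \<le> 2 |x - y|, so the kernel grows by at most 2^\<beta> on passing from x' to
  x.\<close>

lemma potential_maximum_principle:
  assumes \<nu>: "\<nu> \<in> torus_measures" and \<beta>: "0 \<le> \<beta>" and K: "compact K"
    and C: "\<And>x. x \<in> K \<Longrightarrow> potential \<beta> (density \<nu> (indicator K)) x \<le> C"
  shows "potential \<beta> (density \<nu> (indicator K)) x \<le> ennreal (2 powr \<beta>) * C"
proof (cases "K = {}")
  case True
  then show ?thesis using potential_restrict[OF \<nu>, of "{}" \<beta> x] by simp
next
  case False
  have Kb: "K \<in> sets borel" using K by (simp add: borel_compact)
  obtain x' where x': "x' \<in> K" "\<And>y. y \<in> K \<Longrightarrow> dist x x' \<le> dist x y"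
    using continuous_attains_inf[OF K False continuous_on_dist[OF continuous_on_const continuous_on_id], of x] by auto
  have "potential \<beta> (density \<nu> (indicator K)) x \<le> (\<integral>\<^sup>+y. ennreal (2 powr \<beta>) * (indicator K y * riesz_kernel \<beta> x' y) \<partial>\<nu>)"
    unfolding potential_restrict[OF \<nu> Kb]
  proof (rule nn_integral_mono)
    fix y
    show "indicator K y * riesz_kernel \<beta> x y \<le> ennreal (2 powr \<beta>) * (indicator K y * riesz_kernel \<beta> x' y)"
    proof (cases "y \<in> K")
      case True
      have "dist x' y \<le> dist x x' + dist x y" by (metis dist_commute dist_triangle)
      then have "dist x' y \<le> 2 * dist x y" using x'(2)[OF True] by linarith
      then show ?thesis using riesz_kernel_doubling[OF \<beta>] True by simp
    qed simp
  qed
  also have "\<dots> = ennreal (2 powr \<beta>) * potential \<beta> (density \<nu> (indicator K)) x'"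
    unfolding potential_restrict[OF \<nu> Kb] using Kb
    by (intro nn_integral_cmult) (auto simp: measurable_cong_sets[OF torus_measuresD(2)[OF \<nu>] refl])
  also have "\<dots> \<le> ennreal (2 powr \<beta>) * C" by (intro mult_left_mono C x') simp
  finally show ?thesis .
qed

lemma ennreal_finite_levels:
  fixes f :: "'a \<Rightarrow> ennreal"
  shows "{x. f x < \<infinity>} = (\<Union>k::nat. {x. f x \<le> of_nat k})"
proof safe
  fix x assume "f x < \<infinity>"
  then obtain r where r: "f x = ennreal r" "0 \<le> r" by (metis ennreal_cases infinity_ennreal_def less_irrefl)
  obtain k :: nat where "r \<le> real k" using real_arch_simple by blast
  then have "f x \<le> of_nat k" using r by (metis ennreal_leI ennreal_of_nat_eq_real_of_nat)
  then show "x \<in> (\<Union>k::nat. {x. f x \<le> of_nat k})" by blast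
next
  fix x k assume "f x \<le> of_nat k"
  then show "f x < \<infinity>" by (rule le_less_trans) (simp add: of_nat_less_top)
qed

text \<open>A finite-energy probability \<nu> on this set has a compact part of positive mass on
  which its own potential is bounded. By the maximum principle the potential of that part is bounded
  everywhere, so its mutual energy with \<sigma> is finite; but integrating the infinite potential
  of \<sigma> over it gives infinity.\<close>

lemma capacity_infinite_potential:
  assumes \<sigma>: "\<sigma> \<in> torus_measures" and \<beta>: "0 \<le> \<beta>"
  shows "capacity \<beta> {x. potential \<beta> \<sigma> x = \<infinity>} = 0"
proof (rule capacity_zeroI, rule ccontr)
  fix \<nu> :: "'a torus measure"
  assume se: "sets \<nu> = sets borel" and pr: "prob_space \<nu>"
    and carr: "emeasure \<nu> (- {x. potential \<beta> \<sigma> x = \<infinity>}) = 0" and en: "energy \<beta> \<nu> \<noteq> \<infinity>"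
  interpret prob_space \<nu> by (rule pr)
  have \<nu>: "\<nu> \<in> torus_measures" using se finite_measure_axioms by (simp add: torus_measures_def)
  note [measurable] = measurable_potential[OF \<sigma>, of \<beta>] measurable_potential[OF \<nu>, of \<beta>]
  let ?E = "{x. potential \<beta> \<sigma> x = \<infinity>}"
  have Eb [measurable]: "?E \<in> sets borel"
    using measurable_sets[OF measurable_potential[OF \<sigma>, of \<beta>], of "{\<infinity>}"] by (simp add: vimage_def)
  define F where "F k = {x. potential \<beta> \<nu> x \<le> of_nat k} \<inter> ?E" for k :: nat
  have Fb: "F k \<in> sets borel" for k
    using measurable_sets[OF measurable_potential[OF \<nu>, of \<beta>], of "{..of_nat k}"] Eb
    by (simp add: F_def vimage_def)
  have "AE x in \<nu>. potential \<beta> \<nu> x \<noteq> \<infinity>"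
    using en measurable_potential[OF \<nu>, of \<beta>]
    by (intro nn_integral_PInf_AE) (auto simp: energy_potential measurable_cong_sets[OF se refl])
  moreover have "AE x in \<nu>. x \<in> ?E"
    using carr Eb by (intro AE_I[of _ _ "- ?E"]) (auto simp: se)
  ultimately have "AE x in \<nu>. x \<in> (\<Union>k. F k)"
  proof eventually_elim
    case (elim x)
    then have "x \<in> {x. potential \<beta> \<nu> x < \<infinity>}" by (simp add: less_top)
    then show ?case using elim(2) unfolding ennreal_finite_levels F_def by blast
  qed
  then have "emeasure \<nu> (\<Union>k. F k) = 1"
    using Fb by (intro emeasure_eq_1_AE) (auto simp: se)
  moreover have "emeasure \<nu> (\<Union>k. F k) = 0" if "\<And>k. emeasure \<nu> (F k) = 0"
    using that Fb by (intro emeasure_UN_eq_0) (auto simp: se)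
  ultimately obtain k where k: "emeasure \<nu> (F k) \<noteq> 0" by fastforce
  \<comment> \<open>Inner regularity supplies the compact set on which a nearest point
    exists.\<close>
  have "emeasure \<nu> (F k) = (SUP K\<in>{K. K \<subseteq> F k \<and> compact K}. emeasure \<nu> K)"
    by (rule inner_regular) (auto simp: se Fb)
  then have "0 < (SUP K\<in>{K. K \<subseteq> F k \<and> compact K}. emeasure \<nu> K)"
    using k by (simp add: zero_less_iff_neq_zero)
  then obtain K where K: "K \<subseteq> F k" "compact K" "0 < emeasure \<nu> K"
    by (auto simp: less_SUP_iff)
  have Kb: "K \<in> sets borel" using K by (simp add: borel_compact)
  let ?\<nu> = "density \<nu> (indicator K)"
  have \<nu>': "?\<nu> \<in> torus_measures" by (rule torus_measures_density_indicator[OF \<nu> Kb])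
  have "potential \<beta> ?\<nu> x \<le> ennreal (2 powr \<beta>) * of_nat k" for x
  proof (rule potential_maximum_principle[OF \<nu> \<beta> K(2)])
    fix x assume "x \<in> K"
    then have "potential \<beta> \<nu> x \<le> of_nat k" using K(1) by (auto simp: F_def)
    then show "potential \<beta> ?\<nu> x \<le> of_nat k" using potential_restrict_le[OF \<nu> Kb] order_trans by blast
  qed
  then have "(\<integral>\<^sup>+x. potential \<beta> ?\<nu> x \<partial>\<sigma>) \<le> (\<integral>\<^sup>+x. ennreal (2 powr \<beta>) * of_nat k \<partial>\<sigma>)"
    by (intro nn_integral_mono)
  also have "\<dots> < \<infinity>"
  proof -
    interpret s: finite_measure \<sigma> by (rule torus_measuresD[OF \<sigma>])
    show ?thesis using s.emeasure_finite by (auto simp: ennreal_mult_eq_top_iff less_top[symmetric] ennreal_of_nat_eq_real_of_nat)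
  qed
  finally have fin: "(\<integral>\<^sup>+x. potential \<beta> \<sigma> x \<partial>?\<nu>) < \<infinity>"
    by (simp add: mutual_energy_commute[OF \<sigma> \<nu>'])
  have "(\<integral>\<^sup>+x. potential \<beta> \<sigma> x \<partial>?\<nu>) = (\<integral>\<^sup>+x. indicator K x * potential \<beta> \<sigma> x \<partial>\<nu>)"
    using Kb measurable_potential[OF \<sigma>, of \<beta>]
    by (subst nn_integral_density) (auto simp: measurable_cong_sets[OF se refl] se)
  also have "\<dots> = (\<integral>\<^sup>+x. \<infinity> * indicator K x \<partial>\<nu>)"
    using K(1) by (intro nn_integral_cong) (auto simp: F_def indicator_def)
  also have "\<dots> = \<infinity> * emeasure \<nu> K" using Kb by (subst nn_integral_cmult_indicator) (auto simp: se)
  also have "\<dots> = \<infinity>" using K(3) by (simp add: ennreal_top_mult)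
  finally show False using fin by simp
qed

text \<open>Forward: \<sigma> restricted to a level set of its potential has finite energy, so it
  cannot live on a set of capacity 0, and the levels exhaust the finite part. Backward: the set of
  infinite potential itself has capacity 0 and carries \<sigma>.\<close>

lemma sing_iff:
  assumes \<sigma>: "\<sigma> \<in> torus_measures" and \<beta>: "0 \<le> \<beta>"
  shows "\<sigma> \<in> sing \<beta> \<longleftrightarrow> emeasure \<sigma> {x. potential \<beta> \<sigma> x < \<infinity>} = 0"
proof
  have se: "sets \<sigma> = sets borel" using torus_measuresD[OF \<sigma>] by simp
  have lev: "{x. potential \<beta> \<sigma> x \<le> c} \<in> sets borel" for c
    using measurable_sets[OF measurable_potential[OF \<sigma>, of \<beta>], of "{..c}"] by (simp add: vimage_def)
  {
    assume "\<sigma> \<in> sing \<beta>"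
    then obtain E where E: "E \<in> sets borel" "capacity \<beta> E = 0" "emeasure \<sigma> (- E) = 0"
      by (auto simp: sing_def)
    have null: "emeasure \<sigma> ({x. potential \<beta> \<sigma> x \<le> of_nat k} \<inter> E) = 0" for k :: nat
    proof -
      let ?F = "{x. potential \<beta> \<sigma> x \<le> of_nat k} \<inter> E"
      have Fb: "?F \<in> sets borel" using lev E by auto
      have "emeasure (density \<sigma> (indicator ?F)) UNIV = 0"
      proof (rule capacity_zero_finite_energy[OF E(2) torus_measures_density_indicator[OF \<sigma> Fb] E(1)])
        have "?F \<inter> - E = {}" by blast
        then show "emeasure (density \<sigma> (indicator ?F)) (- E) = 0"
          using emeasure_restricted[of ?F \<sigma> "- E"] Fb E(1) by (simp add: se)
        show "energy \<beta> (density \<sigma> (indicator ?F)) < \<infinity>"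
          by (rule energy_restrict_bounded_potential[OF \<sigma> Fb, of _ "real k"]) (simp add: ennreal_of_nat_eq_real_of_nat)
      qed
      then show ?thesis using emeasure_restricted[of ?F \<sigma> UNIV] Fb by (simp add: se)
    qed
    have "emeasure \<sigma> {x. potential \<beta> \<sigma> x < \<infinity>} \<le> emeasure \<sigma> ((\<Union>k::nat. {x. potential \<beta> \<sigma> x \<le> of_nat k} \<inter> E) \<union> - E)"
      unfolding ennreal_finite_levels using lev E by (intro emeasure_mono) (auto simp: se)
    also have "\<dots> \<le> emeasure \<sigma> (\<Union>k::nat. {x. potential \<beta> \<sigma> x \<le> of_nat k} \<inter> E) + emeasure \<sigma> (- E)"
      using lev E by (intro emeasure_subadditive) (auto simp: se)
    also have "emeasure \<sigma> (\<Union>k::nat. {x. potential \<beta> \<sigma> x \<le> of_nat k} \<inter> E) = 0"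
      using lev E null by (intro emeasure_UN_eq_0) (auto simp: se)
    finally show "emeasure \<sigma> {x. potential \<beta> \<sigma> x < \<infinity>} = 0" using E(3) by simp
  }
  assume z: "emeasure \<sigma> {x. potential \<beta> \<sigma> x < \<infinity>} = 0"
  have "- {x. potential \<beta> \<sigma> x = \<infinity>} = {x. potential \<beta> \<sigma> x < \<infinity>}" by (auto simp: less_top)
  moreover have "{x. potential \<beta> \<sigma> x = \<infinity>} \<in> sets borel"
    using measurable_sets[OF measurable_potential[OF \<sigma>, of \<beta>], of "{\<infinity>}"] by (simp add: vimage_def)
  ultimately show "\<sigma> \<in> sing \<beta>"
    using \<sigma> z capacity_infinite_potential[OF \<sigma> \<beta>] unfolding sing_def
    by (auto intro!: bexI[of _ "{x. potential \<beta> \<sigma> x = \<infinity>}"])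
qed

text \<open>The set of infinite potential has capacity 0, so no finite-energy summand charges it;
  convergence in total variation passes this on to \<sigma>.\<close>

lemma reg_imp_finite_potential:
  assumes \<sigma>: "\<sigma> \<in> reg \<beta>" and \<beta>: "0 \<le> \<beta>"
  shows "emeasure \<sigma> {x. potential \<beta> \<sigma> x = \<infinity>} = 0"
proof -
  have \<sigma>': "\<sigma> \<in> torus_measures" using \<sigma> by (simp add: reg_def)
  interpret finite_measure \<sigma> by (rule torus_measuresD[OF \<sigma>'])
  obtain \<sigma>s :: "nat \<Rightarrow> 'a torus measure" where s: "\<And>i. \<sigma>s i \<in> torus_measures" "\<And>i. energy \<beta> (\<sigma>s i) < \<infinity>"
    and lim: "(\<lambda>m. SUP B\<in>sets borel. \<bar>measure \<sigma> B - (\<Sum>i<m. measure (\<sigma>s i) B)\<bar>) \<longlonglongrightarrow> 0"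
    using \<sigma> unfolding reg_def by blast
  let ?N = "{x. potential \<beta> \<sigma> x = \<infinity>}"
  have Nb: "?N \<in> sets borel"
    using measurable_sets[OF measurable_potential[OF \<sigma>', of \<beta>], of "{\<infinity>}"] by (simp add: vimage_def)
  have null: "emeasure (\<sigma>s i) ?N = 0" for i
  proof -
    have "emeasure (density (\<sigma>s i) (indicator ?N)) UNIV = 0"
    proof (rule capacity_zero_finite_energy[OF capacity_infinite_potential[OF \<sigma>' \<beta>] torus_measures_density_indicator[OF s(1) Nb] Nb])
      show "emeasure (density (\<sigma>s i) (indicator ?N)) (- ?N) = 0"
        using emeasure_restricted[of ?N "\<sigma>s i" "- ?N"] Nb torus_measuresD(2)[OF s(1)[of i]] by simp
      show "energy \<beta> (density (\<sigma>s i) (indicator ?N)) < \<infinity>"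
        using energy_restrict_le[OF s(1) Nb] s(2) by (rule le_less_trans)
    qed
    then show ?thesis
      using emeasure_restricted[of ?N "\<sigma>s i" UNIV] Nb torus_measuresD(2)[OF s(1)[of i]] by simp
  qed
  have le: "measure \<sigma> ?N \<le> (SUP B\<in>sets borel. \<bar>measure \<sigma> B - (\<Sum>i<m. measure (\<sigma>s i) B)\<bar>)" for m
  proof -
    have "measure \<sigma> ?N = \<bar>measure \<sigma> ?N - (\<Sum>i<m. measure (\<sigma>s i) ?N)\<bar>"
      using null by (simp add: measure_def)
    also have "\<dots> \<le> (SUP B\<in>sets borel. \<bar>measure \<sigma> B - (\<Sum>i<m. measure (\<sigma>s i) B)\<bar>)"
    proof (rule cSUP_upper[OF Nb])
      have "\<bar>measure \<sigma> B - (\<Sum>i<m. measure (\<sigma>s i) B)\<bar> \<le> measure \<sigma> UNIV + (\<Sum>i<m. measure (\<sigma>s i) UNIV)"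
        if "B \<in> sets borel" for B
      proof -
        have "measure \<sigma> B \<le> measure \<sigma> UNIV" using bounded_measure[of B] torus_measuresD[OF \<sigma>'] by simp
        moreover have "(\<Sum>i<m. measure (\<sigma>s i) B) \<le> (\<Sum>i<m. measure (\<sigma>s i) UNIV)"
          using finite_measure.bounded_measure[OF torus_measuresD(1)[OF s(1)], of _ B] torus_measuresD(3)[OF s(1)]
          by (intro sum_mono) simp
        moreover have "0 \<le> measure \<sigma> B" "0 \<le> (\<Sum>i<m. measure (\<sigma>s i) B)" by (auto intro: sum_nonneg)
        ultimately show ?thesis by linarith
      qed
      then show "bdd_above ((\<lambda>B. \<bar>measure \<sigma> B - (\<Sum>i<m. measure (\<sigma>s i) B)\<bar>) ` sets borel)"
        by (intro bdd_aboveI2)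
    qed
    finally show ?thesis .
  qed
  have "measure \<sigma> ?N \<le> 0" by (rule LIMSEQ_le_const[OF lim]) (use le in blast)
  then show ?thesis by (simp add: emeasure_eq_measure measure_le_0_iff)
qed

text \<open>The summands are the restrictions of \<sigma> to the disjointed level sets of its
  potential. On each of them the potential is bounded, hence the energy finite.\<close>

lemma finite_potential_imp_reg:
  assumes \<sigma>: "\<sigma> \<in> torus_measures" and \<beta>: "0 \<le> \<beta>"
    and z: "emeasure \<sigma> {x. potential \<beta> \<sigma> x = \<infinity>} = 0"
  shows "\<sigma> \<in> reg \<beta>"
proof -
  interpret finite_measure \<sigma> by (rule torus_measuresD[OF \<sigma>])
  have se: "sets \<sigma> = sets borel" by (rule torus_measuresD[OF \<sigma>])
  have lev: "{x. potential \<beta> \<sigma> x \<le> c} \<in> sets borel" for c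
    using measurable_sets[OF measurable_potential[OF \<sigma>, of \<beta>], of "{..c}"] by (simp add: vimage_def)
  define G where "G k = {x. potential \<beta> \<sigma> x \<le> of_nat k}" for k :: nat
  have Gb: "G k \<in> sets borel" for k by (simp add: G_def lev)
  define E where "E = disjointed G"
  have "range E \<subseteq> sets borel"
    unfolding E_def using Gb by (intro sets.range_disjointed_sets) auto
  then have Eb: "E i \<in> sets borel" for i by blast
  have Cb: "- (\<Union>i<m. G i) \<in> sets borel" for m
    using Gb by (intro borel_comp sets.finite_UN) auto
  have EG: "E i \<subseteq> G i" for i unfolding E_def by (rule disjointed_subset)
  have dis: "disjoint_family E" unfolding E_def by (rule disjoint_family_disjointed)
  have UE: "(\<Union>i<m. E i) = (\<Union>i<m. G i)" for m
    unfolding E_def using finite_UN_disjointed_eq[of G m] by (simp add: lessThan_atLeast0)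
  define \<sigma>s where "\<sigma>s i = density \<sigma> (indicator (E i))" for i
  have ms: "measure (\<sigma>s i) B = measure \<sigma> (B \<inter> E i)" if "B \<in> sets borel" for i B
  proof -
    have "emeasure (\<sigma>s i) B = emeasure \<sigma> (E i \<inter> B)"
      unfolding \<sigma>s_def using that Eb by (intro emeasure_restricted) (auto simp: se)
    then show ?thesis by (simp add: measure_def Int_commute)
  qed
  let ?S = "\<lambda>m. SUP B\<in>sets borel. \<bar>measure \<sigma> B - (\<Sum>i<m. measure (\<sigma>s i) B)\<bar>"
  \<comment> \<open>The error of the partial sum is the mass outside the first m levels, which gives
    a bound uniform in \<open>B\<close>.\<close>
  have diff: "measure \<sigma> B - (\<Sum>i<m. measure (\<sigma>s i) B) = measure \<sigma> (B - (\<Union>i<m. G i))" if B: "B \<in> sets borel" for B m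
  proof -
    have "(\<Sum>i<m. measure (\<sigma>s i) B) = (\<Sum>i<m. measure \<sigma> (B \<inter> E i))" using B by (simp add: ms)
    also have "\<dots> = measure \<sigma> (\<Union>i<m. B \<inter> E i)"
      using dis B Eb by (intro finite_measure_finite_Union[symmetric]) (auto simp: se disjoint_family_on_def)
    also have "(\<Union>i<m. B \<inter> E i) = B \<inter> (\<Union>i<m. G i)" unfolding UE[symmetric] by blast
    finally show ?thesis
      using finite_measure_Diff'[of B "\<Union>i<m. G i"] B Gb by (simp add: se)
  qed
  have S: "0 \<le> ?S m \<and> ?S m \<le> measure \<sigma> (- (\<Union>i<m. G i))" for m
  proof
    have le: "\<bar>measure \<sigma> B - (\<Sum>i<m. measure (\<sigma>s i) B)\<bar> \<le> measure \<sigma> (- (\<Union>i<m. G i))" if "B \<in> sets borel" for B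
    proof -
      have "measure \<sigma> (B - (\<Union>i<m. G i)) \<le> measure \<sigma> (- (\<Union>i<m. G i))"
        using Cb by (intro finite_measure_mono) (auto simp: se)
      then show ?thesis unfolding diff[OF that] by simp
    qed
    show "?S m \<le> measure \<sigma> (- (\<Union>i<m. G i))"
      by (rule cSUP_least) (use le in auto)
    have "0 \<le> \<bar>measure \<sigma> {} - (\<Sum>i<m. measure (\<sigma>s i) {})\<bar>" by simp
    also have "\<dots> \<le> ?S m" by (rule cSUP_upper) (use le in \<open>auto intro!: bdd_aboveI2\<close>)
    finally show "0 \<le> ?S m" .
  qed
  have "(\<lambda>m. measure \<sigma> (- (\<Union>i<m. G i))) \<longlonglongrightarrow> measure \<sigma> (\<Inter>m. - (\<Union>i<m. G i))"
    using Cb by (intro finite_Lim_measure_decseq) (auto simp only: se decseq_def, auto)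
  moreover have "(\<Inter>m. - (\<Union>i<m. G i)) = {x. potential \<beta> \<sigma> x = \<infinity>}"
  proof -
    have "(\<Inter>m. - (\<Union>i<m. G i)) = - (\<Union>k. G k)" by (auto intro: lessI)
    also have "\<dots> = {x. potential \<beta> \<sigma> x = \<infinity>}"
      unfolding G_def ennreal_finite_levels[symmetric] by (auto simp: less_top[symmetric])
    finally show ?thesis .
  qed
  ultimately have "(\<lambda>m. measure \<sigma> (- (\<Union>i<m. G i))) \<longlonglongrightarrow> 0" using z by (simp add: measure_def)
  then have lim: "?S \<longlonglongrightarrow> 0"
    by (rule tendsto_sandwich[rotated 3, OF _ ]) (use S in auto)
  have en: "energy \<beta> (\<sigma>s i) < \<infinity>" for i
    unfolding \<sigma>s_def using EG[of i]
    by (intro energy_restrict_bounded_potential[OF \<sigma> Eb, of _ _ "real i"]) (auto simp: G_def ennreal_of_nat_eq_real_of_nat)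
  have carr: "emeasure (\<sigma>s i) (- E i) = 0" for i
    using emeasure_restricted[of "E i" \<sigma> "- E i"] Eb by (simp add: \<sigma>s_def se)
  show ?thesis unfolding reg_def
    using \<sigma> lim en carr Eb dis torus_measures_density_indicator[OF \<sigma> Eb]
    by (auto intro!: exI[of _ \<sigma>s] exI[of _ E] simp: \<sigma>s_def)
qed

lemma half_power_powr: "((1/2) ^ k) powr - b = 2 powr (b * real k)" for b :: real
proof -
  have "(1/2 :: real) ^ k = 2 powr - real k"
    by (simp add: powr_minus powr_realpow power_one_over inverse_eq_divide)
  then show ?thesis by (simp add: powr_powr mult.commute)
qed

text \<open>Dyadic rings around x turn the potential into a series of ratio 2^(\<beta> - \<gamma>).
  It is used in the contrapositive: an infinite potential yields arbitrarily small balls of mass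
  above 2^(-\<gamma> k).\<close>

lemma potential_finite_if_small_balls:
  fixes \<sigma> :: "'n::finite torus measure"
  assumes \<sigma>: "\<sigma> \<in> torus_measures" and \<beta>: "0 \<le> \<beta>" "\<beta> < \<gamma>"
    and small: "\<And>k. k0 \<le> k \<Longrightarrow> measure \<sigma> (ball x ((1/2) ^ k)) \<le> 2 powr - (\<gamma> * real k)"
  shows "potential \<beta> \<sigma> x < \<infinity>"
proof -
  interpret finite_measure \<sigma> by (rule torus_measuresD[OF \<sigma>])
  have se: "sets \<sigma> = sets borel" and sp: "space \<sigma> = UNIV" using torus_measuresD[OF \<sigma>] by auto
  \<comment> \<open>On the ring 2^-(k0 + k + 1) \<le> |x - y| < 2^-(k0 + k) the kernel is at most
    2^(\<beta> (k0 + k + 1)), hence the + 1.\<close>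
  let ?b = "\<lambda>k. ennreal (2 powr (\<beta> * real (k0 + k + 1)))"
  define g where "g y k = ?b k * indicator (ball x ((1/2) ^ (k0 + k))) y" for y k
  have ptw: "riesz_kernel \<beta> x y \<le> ennreal (2 powr (\<beta> * real k0)) + (\<Sum>k. g y k)" for y
  proof (cases "x = y")
    case True
    \<comment> \<open>At y = x every term is at least 1, so the series dominates even an infinite
      kernel.\<close>
    have "(\<Sum>k. g y k) = \<infinity>"
    proof (rule ccontr)
      assume "(\<Sum>k. g y k) \<noteq> \<infinity>"
      then obtain r where r: "(\<Sum>k. g y k) = ennreal r" "0 \<le> r"
        by (cases "\<Sum>k. g y k" rule: ennreal_cases) auto
      obtain K :: nat where K: "r < real K" using reals_Archimedean2 by blast
      have "(of_nat K :: ennreal) = (\<Sum>k<K. 1)" by simp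
      also have "\<dots> \<le> (\<Sum>k<K. g y k)"
        using True \<beta> by (intro sum_mono) (auto simp: g_def ge_one_powr_ge_zero)
      also have "\<dots> \<le> (\<Sum>k. g y k)"
        by (rule sum_le_suminf) auto
      finally have "ennreal (real K) \<le> ennreal r" using r by (simp add: ennreal_of_nat_eq_real_of_nat)
      then show False using K r by simp
    qed
    then show ?thesis by simp
  next
    case False
    then have d: "0 < dist x y" by simp
    show ?thesis
    proof (cases "dist x y < (1/2) ^ k0")
      case True
      have ex: "\<exists>k. (1/2) ^ (k0 + k + 1) \<le> dist x y"
      proof -
        obtain n where "(1/2::real) ^ n < dist x y" using real_arch_pow_inv[OF d, of "1/2"] by auto
        moreover have "(1/2::real) ^ (k0 + n + 1) \<le> (1/2) ^ n" by (intro power_decreasing) auto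
        ultimately show ?thesis by (intro exI[of _ n]) linarith
      qed
      define k where "k = (LEAST k. (1/2) ^ (k0 + k + 1) \<le> dist x y)"
      have k1: "(1/2) ^ (k0 + k + 1) \<le> dist x y" unfolding k_def using ex by (rule LeastI_ex)
      have k2: "dist x y < (1/2) ^ (k0 + k)"
      proof (cases k)
        case 0
        then show ?thesis using True by simp
      next
        case (Suc k')
        then have "\<not> (1/2) ^ (k0 + k' + 1) \<le> dist x y" unfolding k_def by (intro not_less_Least) simp
        then show ?thesis using Suc by simp
      qed
      have "dist x y powr - \<beta> \<le> ((1/2) ^ (k0 + k + 1)) powr - \<beta>"
        using k1 \<beta> by (intro powr_mono2') auto
      then have "riesz_kernel \<beta> x y \<le> g y k"
        unfolding riesz_kernel_pos[OF False] half_power_powr g_def using k2 by (simp add: ennreal_leI)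
      also have "\<dots> \<le> (\<Sum>k. g y k)"
        using sum_le_suminf[of "g y" "{k}"] by simp
      finally show ?thesis by (rule order_trans) simp
    next
      case False': False
      have "dist x y powr - \<beta> \<le> ((1/2) ^ k0) powr - \<beta>"
        using False' \<beta> by (intro powr_mono2') auto
      then have "riesz_kernel \<beta> x y \<le> ennreal (2 powr (\<beta> * real k0))"
        unfolding riesz_kernel_pos[OF False] half_power_powr by (rule ennreal_leI)
      then show ?thesis by (rule order_trans) simp
    qed
  qed
  have gm: "(\<lambda>y. g y k) \<in> borel_measurable \<sigma>" for k
    unfolding g_def by (intro borel_measurable_times_ennreal borel_measurable_const borel_measurable_indicator) (simp add: se)
  have gi: "(\<integral>\<^sup>+y. g y k \<partial>\<sigma>) = ?b k * emeasure \<sigma> (ball x ((1/2) ^ (k0 + k)))" for k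
    unfolding g_def by (rule nn_integral_cmult_indicator) (simp add: se)
  have "potential \<beta> \<sigma> x \<le> (\<integral>\<^sup>+y. ennreal (2 powr (\<beta> * real k0)) + (\<Sum>k. g y k) \<partial>\<sigma>)"
    unfolding potential_def by (rule nn_integral_mono) (rule ptw)
  also have "\<dots> = (\<integral>\<^sup>+y. ennreal (2 powr (\<beta> * real k0)) \<partial>\<sigma>) + (\<integral>\<^sup>+y. (\<Sum>k. g y k) \<partial>\<sigma>)"
    using gm by (intro nn_integral_add) auto
  also have "\<dots> = ennreal (2 powr (\<beta> * real k0)) * emeasure \<sigma> UNIV + (\<Sum>k. ?b k * emeasure \<sigma> (ball x ((1/2) ^ (k0 + k))))"
    unfolding nn_integral_suminf[OF gm] gi by (simp add: sp)
  also have "\<dots> < \<infinity>"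
  proof -
    define q where "q = 2 powr (\<beta> - \<gamma>)"
    have q: "0 \<le> q" "q < 1" using powr_less_cancel_iff[of 2 "\<beta> - \<gamma>" 0] \<beta> by (auto simp: q_def)
    define c where "c = 2 powr (\<beta> * real (k0 + 1) - \<gamma> * real k0)"
    have "?b k * emeasure \<sigma> (ball x ((1/2) ^ (k0 + k))) \<le> ennreal (c * q ^ k)" for k
    proof -
      have "?b k * emeasure \<sigma> (ball x ((1/2) ^ (k0 + k))) = ennreal (2 powr (\<beta> * real (k0 + k + 1)) * measure \<sigma> (ball x ((1/2) ^ (k0 + k))))"
        by (simp add: emeasure_eq_measure ennreal_mult)
      also have "\<dots> \<le> ennreal (2 powr (\<beta> * real (k0 + k + 1)) * 2 powr - (\<gamma> * real (k0 + k)))"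
        by (intro ennreal_leI mult_left_mono small) auto
      also have "2 powr (\<beta> * real (k0 + k + 1)) * 2 powr - (\<gamma> * real (k0 + k)) = c * q ^ k"
        by (simp add: c_def q_def powr_realpow[symmetric] powr_powr powr_add[symmetric] algebra_simps)
      finally show ?thesis .
    qed
    then have "(\<Sum>k. ?b k * emeasure \<sigma> (ball x ((1/2) ^ (k0 + k)))) \<le> (\<Sum>k. ennreal (c * q ^ k))"
      by (intro suminf_le) auto
    also have "\<dots> = ennreal (\<Sum>k. c * q ^ k)"
      using q by (intro suminf_ennreal2 summable_mult summable_geometric) (auto simp: c_def)
    also have "\<dots> < \<infinity>" by simp
    finally have "(\<Sum>k. ?b k * emeasure \<sigma> (ball x ((1/2) ^ (k0 + k)))) < \<infinity>" .
    then show ?thesis using emeasure_finite[of UNIV] by (auto simp: ennreal_mult_eq_top_iff less_top[symmetric])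
  qed
  finally show ?thesis .
qed

section \<open>Moments of the partial products\<close>

text \<open>The gauge \<nu> stands for either truncation, so the whole argument runs once for
  both.\<close>

locale chaos_phases = prob_space M for M :: "'w measure" +
  fixes H :: "(int ^ 'n::finite) set" and \<omega> :: "int ^ 'n \<Rightarrow> 'w \<Rightarrow> 1 torus"
    and \<alpha> :: real and \<nu> :: "int ^ 'n \<Rightarrow> real"
  assumes half: "half_lattice H"
    and indep: "indep_vars (\<lambda>_. borel) \<omega> H"
    and phase_distr: "\<And>n. n \<in> H \<Longrightarrow> distr M borel (\<omega> n) = circle_uniform"
    and lattice_norm: "lattice_norm \<nu>"
begin

definition amp :: "int ^ 'n \<Rightarrow> real" where
  "amp n = \<alpha> / norm (ivec n) powr (real CARD('n) / 2)"

text \<open>The index set is arbitrary, so that the factor between two truncations is again a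
  weight.\<close>

definition weight :: "(int ^ 'n) set \<Rightarrow> (int ^ 'n \<Rightarrow> 1 torus) \<Rightarrow> 'n torus \<Rightarrow> real" where
  "weight F w x = (\<Prod>n\<in>F. exp (amp n * cos_wave n x (w n)) / bessel_I0 (amp n))"

definition trunc :: "nat \<Rightarrow> (int ^ 'n) set" where
  "trunc N = {n \<in> H. \<nu> n \<le> real N}"

text \<open>The restriction puts the phases of a block into the product space \<open>PiM F\<close>,
  where independence of disjoint blocks and the filtration are formulated.\<close>

definition phases :: "(int ^ 'n) set \<Rightarrow> 'w \<Rightarrow> int ^ 'n \<Rightarrow> 1 torus" where
  "phases F p = (\<lambda>n\<in>F. \<omega> n p)"

lemma chaos_partial_eq_weight: "chaos_partial \<alpha> trunc w N x = weight (trunc N) w x"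
proof -
  have "\<alpha> * r powr - s = \<alpha> / r powr s" for r s :: real by (simp add: powr_minus_divide)
  then show ?thesis unfolding chaos_partial_def weight_def amp_def by simp
qed

lemma H_nonzero: "n \<in> H \<Longrightarrow> n \<noteq> 0"
  using half by (auto simp: half_lattice_def)

lemma finite_trunc: "finite (trunc N)"
  using finite_lattice_norm_ball[OF lattice_norm, of N] by (rule finite_subset[rotated]) (auto simp: trunc_def)

lemma trunc_subset: "trunc N \<subseteq> H"
  by (auto simp: trunc_def)

lemma trunc_mono: "m \<le> N \<Longrightarrow> trunc m \<subseteq> trunc N"
  by (auto simp: trunc_def intro: order_trans)

lemma norm_ivec_pos: "n \<in> H \<Longrightarrow> 1 \<le> norm (ivec n)"
  using H_nonzero norm_ivec_ge_1 by blast

lemma amp_squared: "n \<in> H \<Longrightarrow> (amp n)\<^sup>2 = \<alpha>\<^sup>2 * inv_norm_pow n"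
proof -
  assume "n \<in> H"
  then have p: "0 < norm (ivec n)" using norm_ivec_pos[of n] by linarith
  have "(norm (ivec n) powr (real CARD('n) / 2))\<^sup>2 = norm (ivec n) powr (real CARD('n))"
    by (simp add: power2_eq_square powr_add[symmetric])
  also have "\<dots> = norm (ivec n) ^ CARD('n)" using p by (simp add: powr_realpow)
  finally show ?thesis by (simp add: amp_def power_divide inv_norm_pow_def)
qed

lemma abs_amp_cubed: "\<bar>amp n\<bar> ^ 3 = \<bar>\<alpha>\<bar> ^ 3 * norm (ivec n) powr - (3 * real CARD('n) / 2)"
proof -
  define r where "r = norm (ivec n)"
  define e where "e = real CARD('n) / 2"
  have e: "3 * real CARD('n) / 2 = 3 * e" by (simp add: e_def)
  have "(r powr e) ^ 3 = r powr (3 * e)"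
    using powr_add[of r e "e + e"] powr_add[of r e e] by (simp add: power3_eq_cube)
  then have "\<bar>\<alpha> / r powr e\<bar> ^ 3 = \<bar>\<alpha>\<bar> ^ 3 / r powr (3 * e)"
    by (simp add: power_divide abs_div)
  then show ?thesis unfolding amp_def r_def[symmetric] e_def[symmetric] e by (simp add: powr_minus_divide)
qed

lemma abs_amp_le: "n \<in> H \<Longrightarrow> \<bar>amp n\<bar> \<le> \<bar>\<alpha>\<bar>"
proof -
  assume "n \<in> H"
  then have "1 \<le> norm (ivec n) powr (real CARD('n) / 2)"
    using norm_ivec_pos by (intro ge_one_powr_ge_zero) auto
  then have "\<bar>\<alpha>\<bar> * 1 \<le> \<bar>\<alpha>\<bar> * norm (ivec n) powr (real CARD('n) / 2)" by (intro mult_left_mono) auto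
  then show ?thesis using \<open>1 \<le> norm (ivec n) powr (real CARD('n) / 2)\<close>
    by (simp add: amp_def abs_div divide_le_eq)
qed

lemma weight_pos: "0 < weight F w x"
  unfolding weight_def by (intro prod_pos) (simp add: bessel_I0_pos)

lemma weight_nonneg: "0 \<le> weight F w x"
  using weight_pos by (rule less_imp_le)

lemma weight_cong: "(\<And>n. n \<in> F \<Longrightarrow> w n = w' n) \<Longrightarrow> weight F w x = weight F w' x"
  unfolding weight_def by (intro prod.cong) auto

lemma weight_phases: "weight F (phases F p) x = weight F (\<lambda>n. \<omega> n p) x"
  by (rule weight_cong) (simp add: phases_def)

lemma weight_union:
  "finite F \<Longrightarrow> finite G \<Longrightarrow> F \<inter> G = {} \<Longrightarrow> weight (F \<union> G) w x = weight F w x * weight G w x"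
  unfolding weight_def by (rule prod.union_disjoint)

lemma weight_le: "finite F \<Longrightarrow> weight F w x \<le> (\<Prod>n\<in>F. exp \<bar>amp n\<bar> / bessel_I0 (amp n))"
  unfolding weight_def
proof (intro prod_mono conjI divide_right_mono)
  fix n
  have "\<bar>cos_wave n x (w n)\<bar> \<le> 1" by transfer (simp add: abs_cos_le_one)
  then have "\<bar>amp n * cos_wave n x (w n)\<bar> \<le> \<bar>amp n\<bar> * 1" unfolding abs_mult by (intro mult_left_mono) auto
  then show "exp (amp n * cos_wave n x (w n)) \<le> exp \<bar>amp n\<bar>" by simp
qed (auto simp: bessel_I0_pos less_imp_le)

lemma measurable_weight:
  assumes "\<And>n. n \<in> F \<Longrightarrow> (\<lambda>z. W z n) \<in> borel_measurable N" "X \<in> borel_measurable N"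
  shows "(\<lambda>z. weight F (W z) (X z)) \<in> borel_measurable N"
  unfolding weight_def
proof (rule borel_measurable_prod)
  fix n assume "n \<in> F"
  note [measurable] = assms(1)[OF this] assms(2)
  show "(\<lambda>z. exp (amp n * cos_wave n (X z) (W z n)) / bessel_I0 (amp n)) \<in> borel_measurable N"
    by measurable
qed

lemma measurable_phase: "n \<in> H \<Longrightarrow> \<omega> n \<in> borel_measurable M"
  using indep by (auto simp: indep_vars_def)

lemma measurable_phases: "F \<subseteq> H \<Longrightarrow> phases F \<in> measurable M (PiM F (\<lambda>_. borel))"
  unfolding phases_def[abs_def] by (rule measurable_restrict) (use measurable_phase in auto)

section \<open>Mixed moments of the weights at two points\<close>

text \<open>Independence factors the moment over the frequencies, and each factor is the exponential
  moment of a single superposed wave.\<close>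

lemma phase_moment_exact:
  assumes F: "finite F" "F \<subseteq> H"
  shows "(\<integral>\<^sup>+p. ennreal (weight F (\<lambda>n. \<omega> n p) x powr u * weight F (\<lambda>n. \<omega> n p) y powr v) \<partial>M)
    = ennreal (\<Prod>n\<in>F. bessel_I0 (amp n * sqrt (u\<^sup>2 + v\<^sup>2 + 2 * u * v * tcosd n x y)) / bessel_I0 (amp n) powr (u + v))"
proof -
  define g where "g n w = exp (amp n * (u * cos_wave n x w + v * cos_wave n y w)) / bessel_I0 (amp n) powr (u + v)" for n w
  have g0: "0 \<le> g n w" for n w by (simp add: g_def)
  have gm: "g n \<in> borel_measurable borel" for n unfolding g_def by measurable
  have w: "weight F (\<lambda>n. \<omega> n p) x powr u * weight F (\<lambda>n. \<omega> n p) y powr v = (\<Prod>n\<in>F. g n (\<omega> n p))" for p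
  proof -
    have pw: "weight F (\<lambda>n. \<omega> n p) z powr s = (\<Prod>n\<in>F. exp (s * (amp n * cos_wave n z (\<omega> n p))) / bessel_I0 (amp n) powr s)" for z s
      unfolding weight_def
      by (subst prod_powr_distrib) (auto simp: powr_divide bessel_I0_pos less_imp_le exp_powr_real mult.commute intro!: prod.cong)
    show ?thesis unfolding pw prod.distrib[symmetric] g_def
      by (intro prod.cong refl) (simp add: exp_add[symmetric] powr_add algebra_simps)
  qed
  have "(\<integral>\<^sup>+p. ennreal (weight F (\<lambda>n. \<omega> n p) x powr u * weight F (\<lambda>n. \<omega> n p) y powr v) \<partial>M)
      = (\<integral>\<^sup>+p. (\<Prod>n\<in>F. ennreal (g n (\<omega> n p))) \<partial>M)"
    unfolding w by (simp add: prod_ennreal g0)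
  also have "\<dots> = (\<Prod>n\<in>F. \<integral>\<^sup>+p. ennreal (g n (\<omega> n p)) \<partial>M)"
  proof (rule indep_vars_nn_integral[OF F(1)])
    show "indep_vars (\<lambda>_. borel) (\<lambda>n p. ennreal (g n (\<omega> n p))) F"
      by (rule indep_vars_compose2[OF indep_vars_subset[OF indep F(2)]]) (use gm in measurable)
  qed simp
  also have "\<dots> = (\<Prod>n\<in>F. ennreal (bessel_I0 (amp n * sqrt (u\<^sup>2 + v\<^sup>2 + 2 * u * v * tcosd n x y)) / bessel_I0 (amp n) powr (u + v)))"
  proof (rule prod.cong[OF refl])
    fix n assume n: "n \<in> F"
    let ?e = "\<lambda>w. exp (amp n * (u * cos_wave n x w + v * cos_wave n y w))"
    have "(\<integral>\<^sup>+p. ennreal (g n (\<omega> n p)) \<partial>M) = (\<integral>\<^sup>+w. ennreal (g n w) \<partial>circle_uniform)"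
      unfolding phase_distr[symmetric, OF subsetD[OF F(2) n]]
      using measurable_phase[OF subsetD[OF F(2) n]] gm by (subst nn_integral_distr) auto
    also have "\<dots> = (\<integral>\<^sup>+w. ennreal (?e w) * ennreal (1 / bessel_I0 (amp n) powr (u + v)) \<partial>circle_uniform)"
      by (simp add: g_def ennreal_mult[symmetric])
    also have "\<dots> = (\<integral>\<^sup>+w. ennreal (?e w) \<partial>circle_uniform) * ennreal (1 / bessel_I0 (amp n) powr (u + v))"
    proof (rule nn_integral_multc)
      have "?e \<in> borel_measurable borel" by measurable
      then show "(\<lambda>w. ennreal (?e w)) \<in> borel_measurable circle_uniform"
        by (simp add: circle_uniform_def)
    qed
    also have "\<dots> = ennreal (bessel_I0 (amp n * sqrt (u\<^sup>2 + v\<^sup>2 + 2 * u * v * tcosd n x y)) / bessel_I0 (amp n) powr (u + v))"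
      unfolding circle_exp_moment by (simp add: ennreal_mult[symmetric] bessel_I0_pos less_imp_le)
    finally show "(\<integral>\<^sup>+p. ennreal (g n (\<omega> n p)) \<partial>M) = ennreal (bessel_I0 (amp n * sqrt (u\<^sup>2 + v\<^sup>2 + 2 * u * v * tcosd n x y)) / bessel_I0 (amp n) powr (u + v))" .
  qed
  also have "\<dots> = ennreal (\<Prod>n\<in>F. bessel_I0 (amp n * sqrt (u\<^sup>2 + v\<^sup>2 + 2 * u * v * tcosd n x y)) / bessel_I0 (amp n) powr (u + v))"
    by (rule prod_ennreal) (simp add: bessel_I0_pos less_imp_le)
  finally show ?thesis .
qed

lemma mean_weight:
  assumes "finite F" "F \<subseteq> H"
  shows "(\<integral>\<^sup>+p. ennreal (weight F (\<lambda>n. \<omega> n p) x) \<partial>M) = 1"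
proof -
  have "(\<integral>\<^sup>+p. ennreal (weight F (\<lambda>n. \<omega> n p) x) \<partial>M) = (\<integral>\<^sup>+p. ennreal (weight F (\<lambda>n. \<omega> n p) x powr 1 * weight F (\<lambda>n. \<omega> n p) x powr 0) \<partial>M)"
    using weight_pos by (intro nn_integral_cong) (simp add: less_imp_le less_imp_neq[symmetric])
  also have "\<dots> = ennreal (\<Prod>n\<in>F. 1)"
    unfolding phase_moment_exact[OF assms] using bessel_I0_pos
    by (intro arg_cong[where f = ennreal] prod.cong) (auto simp: less_imp_le less_imp_neq[symmetric])
  finally show ?thesis by simp
qed

text \<open>Each Bessel quotient is the exponential of its quadratic part plus a cubic error, and
  the cubic errors are summable, so C does not depend on the set or the points. The condition on u +
  v lets the lower bound on I_0 be raised to that power. It is used with (u, v) equal to (1, -s), (1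
  + s, 0) and (1, 1).\<close>

lemma phase_moment_bound:
  assumes uv: "0 \<le> u + v"
  obtains C where "\<And>F x y. finite F \<Longrightarrow> F \<subseteq> H \<Longrightarrow>
    (\<integral>\<^sup>+p. ennreal (weight F (\<lambda>n. \<omega> n p) x powr u * weight F (\<lambda>n. \<omega> n p) y powr v) \<partial>M)
    \<le> ennreal (exp (\<alpha>\<^sup>2 / 4 * (\<Sum>n\<in>F. inv_norm_pow n * (u\<^sup>2 + v\<^sup>2 + 2 * u * v * tcosd n x y - (u + v))) + C))"
proof -
  define B where "B = \<bar>u\<bar> + \<bar>v\<bar>"
  have B0: "0 \<le> B" by (simp add: B_def)
  \<comment> \<open>Bounds both Bessel arguments: |amp n| \<le> |\<alpha>|, and the square root of
    the quadratic form is at most B = |u| + |v|.\<close>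
  define R where "R = \<bar>\<alpha>\<bar> * (B + 1)"
  have R0: "0 \<le> R" using B0 by (simp add: R_def)
  obtain K where K: "0 \<le> K" "\<And>x. \<bar>x\<bar> \<le> R \<Longrightarrow> bessel_I0 x \<le> exp (x\<^sup>2 / 4 + K * \<bar>x\<bar> ^ 3)"
    "\<And>x. \<bar>x\<bar> \<le> R \<Longrightarrow> exp (x\<^sup>2 / 4 - K * \<bar>x\<bar> ^ 3) \<le> bessel_I0 x"
    using bessel_I0_log_expansion[OF R0] by blast
  have "real CARD('n) < 3 * real CARD('n) / 2" by simp
  then obtain C0 where C0: "\<And>F :: (int ^ 'n) set. finite F \<Longrightarrow> (\<Sum>n\<in>F. norm (ivec n) powr - (3 * real CARD('n) / 2)) \<le> C0"
    using lattice_powr_summable by blast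
  define K' where "K' = K * (B ^ 3 + (u + v))"
  have K'0: "0 \<le> K'" using K B0 uv by (simp add: K'_def)
  define C where "C = K' * (\<bar>\<alpha>\<bar> ^ 3 * C0)"
  show ?thesis
  proof (rule that[of C])
    fix F :: "(int ^ 'n) set" and x y :: "'n torus" assume F: "finite F" "F \<subseteq> H"
    let ?r = "\<lambda>n. u\<^sup>2 + v\<^sup>2 + 2 * u * v * tcosd n x y"
    have r: "0 \<le> ?r n" "?r n \<le> B\<^sup>2" for n
    proof -
      have "\<bar>2 * u * v * tcosd n x y\<bar> \<le> 2 * \<bar>u\<bar> * \<bar>v\<bar> * 1"
        unfolding abs_mult using abs_tcosd_le_1[of n x y] by (intro mult_mono) auto
      moreover have "(\<bar>u\<bar> - \<bar>v\<bar>)\<^sup>2 = u\<^sup>2 + v\<^sup>2 - 2 * \<bar>u\<bar> * \<bar>v\<bar>" "B\<^sup>2 = u\<^sup>2 + v\<^sup>2 + 2 * \<bar>u\<bar> * \<bar>v\<bar>"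
        by (simp_all add: B_def power2_diff power2_sum)
      moreover have "0 \<le> (\<bar>u\<bar> - \<bar>v\<bar>)\<^sup>2" by simp
      ultimately show "0 \<le> ?r n" "?r n \<le> B\<^sup>2" by linarith+
    qed
    have factor: "bessel_I0 (amp n * sqrt (?r n)) / bessel_I0 (amp n) powr (u + v)
        \<le> exp ((amp n)\<^sup>2 / 4 * (?r n - (u + v)) + K' * \<bar>amp n\<bar> ^ 3)" if n: "n \<in> F" for n
    proof -
      have nH: "n \<in> H" using F n by blast
      have sr: "sqrt (?r n) \<le> B" using r(2) B0 by (rule real_le_lsqrt[OF _ _, rotated 1])
      have a1: "\<bar>amp n\<bar> \<le> R"
      proof -
        have "\<bar>amp n\<bar> * 1 \<le> \<bar>\<alpha>\<bar> * (B + 1)" using abs_amp_le[OF nH] B0 by (intro mult_mono) auto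
        then show ?thesis by (simp add: R_def)
      qed
      have a2: "\<bar>amp n * sqrt (?r n)\<bar> \<le> R"
      proof -
        have "\<bar>amp n\<bar> * \<bar>sqrt (?r n)\<bar> \<le> \<bar>\<alpha>\<bar> * (B + 1)"
          using abs_amp_le[OF nH] B0 sr r(1)[of n] by (intro mult_mono) auto
        then show ?thesis by (simp add: R_def abs_mult)
      qed
      have "bessel_I0 (amp n * sqrt (?r n)) \<le> exp ((amp n * sqrt (?r n))\<^sup>2 / 4 + K * \<bar>amp n * sqrt (?r n)\<bar> ^ 3)"
        by (rule K(2)[OF a2])
      also have "\<dots> \<le> exp ((amp n)\<^sup>2 / 4 * ?r n + K * (B ^ 3 * \<bar>amp n\<bar> ^ 3))"
      proof -
        have "\<bar>amp n * sqrt (?r n)\<bar> ^ 3 \<le> (B * \<bar>amp n\<bar>) ^ 3"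
          unfolding abs_mult mult.commute[of B] using sr r(1)[of n] by (intro power_mono mult_left_mono) auto
        then have "K * \<bar>amp n * sqrt (?r n)\<bar> ^ 3 \<le> K * (B ^ 3 * \<bar>amp n\<bar> ^ 3)"
          using K(1) by (intro mult_left_mono) (auto simp: power_mult_distrib)
        then show ?thesis using r(1)[of n] by (simp add: power_mult_distrib)
      qed
      finally have up: "bessel_I0 (amp n * sqrt (?r n)) \<le> exp ((amp n)\<^sup>2 / 4 * ?r n + K * (B ^ 3 * \<bar>amp n\<bar> ^ 3))" .
      have "exp ((u + v) * ((amp n)\<^sup>2 / 4 - K * \<bar>amp n\<bar> ^ 3)) = exp ((amp n)\<^sup>2 / 4 - K * \<bar>amp n\<bar> ^ 3) powr (u + v)"
        by (simp add: exp_powr_real mult.commute)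
      also have "\<dots> \<le> bessel_I0 (amp n) powr (u + v)"
        using uv K(3)[OF a1] by (intro powr_mono2) auto
      finally have low: "exp ((u + v) * ((amp n)\<^sup>2 / 4 - K * \<bar>amp n\<bar> ^ 3)) \<le> bessel_I0 (amp n) powr (u + v)" .
      have "bessel_I0 (amp n * sqrt (?r n)) / bessel_I0 (amp n) powr (u + v)
          \<le> exp ((amp n)\<^sup>2 / 4 * ?r n + K * (B ^ 3 * \<bar>amp n\<bar> ^ 3)) / exp ((u + v) * ((amp n)\<^sup>2 / 4 - K * \<bar>amp n\<bar> ^ 3))"
        using up low by (intro frac_le) auto
      also have "\<dots> = exp ((amp n)\<^sup>2 / 4 * (?r n - (u + v)) + K' * \<bar>amp n\<bar> ^ 3)"
        unfolding exp_diff[symmetric] K'_def by (simp add: algebra_simps)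
      finally show ?thesis .
    qed
    have "(\<Prod>n\<in>F. bessel_I0 (amp n * sqrt (?r n)) / bessel_I0 (amp n) powr (u + v))
        \<le> (\<Prod>n\<in>F. exp ((amp n)\<^sup>2 / 4 * (?r n - (u + v)) + K' * \<bar>amp n\<bar> ^ 3))"
      using factor by (intro prod_mono) (auto simp: bessel_I0_pos less_imp_le)
    also have "\<dots> = exp (\<Sum>n\<in>F. (amp n)\<^sup>2 / 4 * (?r n - (u + v)) + K' * \<bar>amp n\<bar> ^ 3)"
      using F(1) by (simp add: exp_sum)
    also have "\<dots> \<le> exp (\<alpha>\<^sup>2 / 4 * (\<Sum>n\<in>F. inv_norm_pow n * (?r n - (u + v))) + C)"
    proof -
      have "(\<Sum>n\<in>F. (amp n)\<^sup>2 / 4 * (?r n - (u + v))) = \<alpha>\<^sup>2 / 4 * (\<Sum>n\<in>F. inv_norm_pow n * (?r n - (u + v)))"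
        unfolding sum_distrib_left using F(2) by (intro sum.cong refl) (auto simp: amp_squared)
      moreover have "(\<Sum>n\<in>F. K' * \<bar>amp n\<bar> ^ 3) \<le> C"
      proof -
        have "(\<Sum>n\<in>F. K' * \<bar>amp n\<bar> ^ 3) = K' * (\<bar>\<alpha>\<bar> ^ 3 * (\<Sum>n\<in>F. norm (ivec n) powr - (3 * real CARD('n) / 2)))"
          by (simp add: abs_amp_cubed sum_distrib_left)
        also have "\<dots> \<le> C" unfolding C_def using C0[OF F(1)] K'0 by (intro mult_left_mono) auto
        finally show ?thesis .
      qed
      ultimately show ?thesis by (simp add: sum.distrib)
    qed
    finally show "(\<integral>\<^sup>+p. ennreal (weight F (\<lambda>n. \<omega> n p) x powr u * weight F (\<lambda>n. \<omega> n p) y powr v) \<partial>M)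
      \<le> ennreal (exp (\<alpha>\<^sup>2 / 4 * (\<Sum>n\<in>F. inv_norm_pow n * (?r n - (u + v))) + C))"
      unfolding phase_moment_exact[OF F] by (rule ennreal_leI)
  qed
qed

lemma phases_indep_nn_integral:
  assumes FG: "F \<inter> G = {}" "F \<subseteq> H" "G \<subseteq> H"
    and f: "f \<in> borel_measurable (PiM F (\<lambda>_. borel))" and g: "g \<in> borel_measurable (PiM G (\<lambda>_. borel))"
  shows "(\<integral>\<^sup>+p. f (phases F p) * g (phases G p) \<partial>M) = (\<integral>\<^sup>+p. f (phases F p) \<partial>M) * (\<integral>\<^sup>+p. g (phases G p) \<partial>M)"
proof -
  let ?PF = "PiM F (\<lambda>_. borel :: 1 torus measure)" and ?PG = "PiM G (\<lambda>_. borel :: 1 torus measure)"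
  have ind: "indep_var ?PF (phases F) ?PG (phases G)"
    unfolding phases_def[abs_def] using indep_var_restrict[OF indep FG] .
  have mF: "phases F \<in> measurable M ?PF" and mG: "phases G \<in> measurable M ?PG"
    using measurable_phases FG by auto
  interpret F: prob_space "distr M ?PF (phases F)" by (rule prob_space_distr[OF mF])
  interpret G: prob_space "distr M ?PG (phases G)" by (rule prob_space_distr[OF mG])
  note [measurable] = f g mF mG
  have "(\<integral>\<^sup>+p. f (phases F p) * g (phases G p) \<partial>M)
      = (\<integral>\<^sup>+z. f (fst z) * g (snd z) \<partial>distr M (?PF \<Otimes>\<^sub>M ?PG) (\<lambda>p. (phases F p, phases G p)))"
    by (subst nn_integral_distr) auto
  also have "\<dots> = (\<integral>\<^sup>+z. f (fst z) * g (snd z) \<partial>(distr M ?PF (phases F) \<Otimes>\<^sub>M distr M ?PG (phases G)))"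
    using ind unfolding indep_var_distribution_eq by simp
  also have "\<dots> = (\<integral>\<^sup>+a. \<integral>\<^sup>+b. f a * g b \<partial>distr M ?PG (phases G) \<partial>distr M ?PF (phases F))"
    by (subst G.nn_integral_fst[symmetric]) auto
  also have "\<dots> = (\<integral>\<^sup>+a. f a * (\<integral>\<^sup>+b. g b \<partial>distr M ?PG (phases G)) \<partial>distr M ?PF (phases F))"
    by (intro nn_integral_cong nn_integral_cmult) simp
  also have "\<dots> = (\<integral>\<^sup>+a. f a \<partial>distr M ?PF (phases F)) * (\<integral>\<^sup>+b. g b \<partial>distr M ?PG (phases G))"
    by (intro nn_integral_multc) simp
  finally show ?thesis by (simp add: nn_integral_distr)
qed

lemma measurable_weight_PiM:
  "F \<subseteq> G \<Longrightarrow> (\<lambda>w. weight F w x) \<in> borel_measurable (PiM G (\<lambda>_. borel))"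
  by (rule measurable_weight) (auto intro!: measurable_component_singleton)

lemma weight_trunc_split:
  assumes "m \<le> N"
  shows "weight (trunc N) w x = weight (trunc m) w x * weight (trunc N - trunc m) w x"
proof -
  have "trunc N = trunc m \<union> (trunc N - trunc m)" using trunc_mono[OF assms] by blast
  then show ?thesis using weight_union[of "trunc m" "trunc N - trunc m" w x] finite_trunc by auto
qed

text \<open>The phases in \<open>trunc N - trunc m\<close> are independent of the earlier ones and
  their weight has mean 1. In other words, tilting at level N or at level m makes no difference to
  functions of the first phases.\<close>

lemma weight_martingale:
  assumes mN: "m \<le> N" and h: "h \<in> borel_measurable (PiM (trunc m) (\<lambda>_. borel))"
  shows "(\<integral>\<^sup>+p. ennreal (weight (trunc N) (\<lambda>n. \<omega> n p) x) * h (phases (trunc m) p) \<partial>M)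
    = (\<integral>\<^sup>+p. ennreal (weight (trunc m) (\<lambda>n. \<omega> n p) x) * h (phases (trunc m) p) \<partial>M)"
proof -
  let ?F = "trunc m" and ?G = "trunc N - trunc m"
  have sub: "?F \<subseteq> H" "?G \<subseteq> H" using trunc_subset by auto
  note [measurable] = h measurable_weight_PiM[OF order_refl]
  have "(\<integral>\<^sup>+p. ennreal (weight (trunc N) (\<lambda>n. \<omega> n p) x) * h (phases ?F p) \<partial>M)
      = (\<integral>\<^sup>+p. (ennreal (weight ?F (phases ?F p) x) * h (phases ?F p)) * ennreal (weight ?G (phases ?G p) x) \<partial>M)"
    unfolding weight_trunc_split[OF mN] weight_phases
    by (intro nn_integral_cong) (simp add: ennreal_mult weight_nonneg mult_ac)
  also have "\<dots> = (\<integral>\<^sup>+p. ennreal (weight ?F (phases ?F p) x) * h (phases ?F p) \<partial>M) * (\<integral>\<^sup>+p. ennreal (weight ?G (phases ?G p) x) \<partial>M)"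
    by (rule phases_indep_nn_integral[where f = "\<lambda>w. ennreal (weight ?F w x) * h w" and g = "\<lambda>w. ennreal (weight ?G w x)"])
      (use sub in auto)
  also have "(\<integral>\<^sup>+p. ennreal (weight ?G (phases ?G p) x) \<partial>M) = 1"
    unfolding weight_phases using sub finite_trunc by (intro mean_weight) auto
  finally show ?thesis by (simp add: weight_phases)
qed

section \<open>Singular measures are annihilated\<close>

definition total :: "'n torus measure \<Rightarrow> nat \<Rightarrow> 'w \<Rightarrow> ennreal" where
  "total \<sigma> N p = (\<integral>\<^sup>+x. ennreal (weight (trunc N) (\<lambda>n. \<omega> n p) x) \<partial>\<sigma>)"

definition critical :: real where
  "critical = tau CARD('n) * \<alpha>\<^sup>2 / 4"

lemma critical_nonneg: "0 \<le> critical"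
  by (auto simp: critical_def tau_def intro!: mult_nonneg_nonneg divide_nonneg_nonneg less_imp_le[OF Gamma_real_pos])

lemma log_sum_dyadic:
  "(\<lambda>k. (\<alpha>\<^sup>2 / 4 * (\<Sum>n\<in>trunc (2 ^ k). inv_norm_pow n)) / (ln 2 * real k)) \<longlonglongrightarrow> critical"
proof -
  have f: "filterlim (\<lambda>k::nat. 2 ^ k :: nat) at_top sequentially"
    by (rule filterlim_subseq) (simp add: strict_mono_def)
  have "(\<lambda>k. (\<Sum>n | n \<in> H \<and> \<nu> n \<le> real (2 ^ k). inv_norm_pow n) / ln (real (2 ^ k))) \<longlonglongrightarrow> tau CARD('n)"
    using filterlim_compose[OF lattice_log_sum[OF lattice_norm half] f] .
  then have "(\<lambda>k. \<alpha>\<^sup>2 / 4 * ((\<Sum>n\<in>trunc (2 ^ k). inv_norm_pow n) / ln (real (2 ^ k)))) \<longlonglongrightarrow> \<alpha>\<^sup>2 / 4 * tau CARD('n)"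
    unfolding trunc_def by (intro tendsto_intros)
  moreover have "ln (real (2 ^ k)) = ln 2 * real k" for k
    by (simp add: ln_realpow)
  ultimately show ?thesis by (simp add: critical_def mult.commute)
qed

lemma log_sum_lower:
  assumes "a' < critical"
  obtains k1 where "\<And>k. k1 \<le> k \<Longrightarrow> a' * ln 2 * real k \<le> \<alpha>\<^sup>2 / 4 * (\<Sum>n\<in>trunc (2 ^ k). inv_norm_pow n)"
proof -
  have "eventually (\<lambda>k. a' < (\<alpha>\<^sup>2 / 4 * (\<Sum>n\<in>trunc (2 ^ k). inv_norm_pow n)) / (ln 2 * real k)) sequentially"
    using log_sum_dyadic assms by (rule order_tendstoD)
  then obtain K where K: "\<And>k. K \<le> k \<Longrightarrow> a' < (\<alpha>\<^sup>2 / 4 * (\<Sum>n\<in>trunc (2 ^ k). inv_norm_pow n)) / (ln 2 * real k)"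
    by (auto simp: eventually_sequentially)
  show ?thesis
  proof (rule that[of "Suc K"])
    fix k assume "Suc K \<le> k"
    then have k: "K \<le> k" "0 < ln 2 * real k" by auto
    from K[OF k(1)] show "a' * ln 2 * real k \<le> \<alpha>\<^sup>2 / 4 * (\<Sum>n\<in>trunc (2 ^ k). inv_norm_pow n)"
      using k(2) by (simp add: less_divide_eq mult.assoc)
  qed
qed

lemma log_sum_upper:
  assumes "critical < a'"
  obtains C where "\<And>k. \<alpha>\<^sup>2 / 4 * (\<Sum>n\<in>trunc (2 ^ k). inv_norm_pow n) \<le> a' * ln 2 * real k + C"
proof -
  let ?S = "\<lambda>k. \<alpha>\<^sup>2 / 4 * (\<Sum>n\<in>trunc (2 ^ k). inv_norm_pow n)"
  have "eventually (\<lambda>k. ?S k / (ln 2 * real k) < a') sequentially"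
    using log_sum_dyadic assms by (rule order_tendstoD)
  then obtain K where K: "\<And>k. K \<le> k \<Longrightarrow> ?S k / (ln 2 * real k) < a'"
    by (auto simp: eventually_sequentially)
  have S0: "0 \<le> ?S k" for k by (simp add: sum_nonneg inv_norm_pow_nonneg)
  have "0 \<le> ?S K / (ln 2 * real K)" by (rule divide_nonneg_nonneg[OF S0]) simp
  also have "\<dots> < a'" by (rule K) simp
  finally have a0: "0 < a'" .
  \<comment> \<open>Adding the finitely many early values makes the bound hold for every k, not only
    eventually.\<close>
  show ?thesis
  proof (rule that[of "\<Sum>k<Suc K. ?S k"])
    fix k
    show "?S k \<le> a' * ln 2 * real k + (\<Sum>k<Suc K. ?S k)"
    proof (cases "k < Suc K")
      case True
      then have "?S k \<le> (\<Sum>k<Suc K. ?S k)" using S0 by (intro member_le_sum) auto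
      moreover have "0 \<le> a' * ln 2 * real k" using a0 by simp
      ultimately show ?thesis by linarith
    next
      case False
      then have k: "K \<le> k" "0 < ln 2 * real k" by auto
      from K[OF k(1)] have "?S k < a' * (ln 2 * real k)" using k(2) by (simp only: divide_less_eq if_True)
      moreover have "0 \<le> (\<Sum>k<Suc K. ?S k)" using S0 by (rule sum_nonneg)
      ultimately show ?thesis by (simp add: mult.assoc)
    qed
  qed
qed

lemma measurable_weight_space:
  "\<sigma> \<in> torus_measures \<Longrightarrow> (\<lambda>x. weight F w x) \<in> borel_measurable \<sigma>"
  by (rule measurable_weight) (auto simp: measurable_cong_sets[OF torus_measuresD(2) refl])

lemma measurable_weight_prob:
  "F \<subseteq> H \<Longrightarrow> (\<lambda>p. weight F (\<lambda>n. \<omega> n p) x) \<in> borel_measurable M"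
  by (rule measurable_weight) (auto intro: measurable_phase)

lemma measurable_weight_pair:
  assumes "F \<subseteq> H" "\<sigma> \<in> torus_measures"
  shows "(\<lambda>z. weight F (\<lambda>n. \<omega> n (fst z)) (snd z)) \<in> borel_measurable (M \<Otimes>\<^sub>M \<sigma>)"
proof (rule measurable_weight)
  show "(\<lambda>z. \<omega> n (fst z)) \<in> borel_measurable (M \<Otimes>\<^sub>M \<sigma>)" if "n \<in> F" for n
    using measurable_compose[OF measurable_fst measurable_phase] assms(1) that by blast
  have "snd \<in> measurable (M \<Otimes>\<^sub>M \<sigma>) \<sigma>" by (rule measurable_snd)
  then show "snd \<in> borel_measurable (M \<Otimes>\<^sub>M \<sigma>)"
    by (simp add: measurable_cong_sets[OF refl torus_measuresD(2)[OF assms(2)]])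
qed

lemma measurable_total_PiM:
  assumes "\<sigma> \<in> torus_measures"
  shows "(\<lambda>w. \<integral>\<^sup>+x. ennreal (weight F w x) \<partial>\<sigma>) \<in> borel_measurable (PiM F (\<lambda>_. borel))"
proof -
  interpret finite_measure \<sigma> by (rule torus_measuresD[OF assms])
  let ?N = "PiM F (\<lambda>_. borel :: 1 torus measure) \<Otimes>\<^sub>M \<sigma>"
  have "(\<lambda>z. weight F (fst z) (snd z)) \<in> borel_measurable ?N"
  proof (rule measurable_weight)
    show "(\<lambda>z. fst z n) \<in> borel_measurable ?N" if "n \<in> F" for n
      using measurable_compose[OF measurable_fst measurable_component_singleton[OF that]] .
    have "snd \<in> measurable ?N \<sigma>" by (rule measurable_snd)
    then show "snd \<in> borel_measurable ?N"
      by (simp add: measurable_cong_sets[OF refl torus_measuresD(2)[OF assms]])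
  qed
  then show ?thesis
    by (intro borel_measurable_nn_integral) (simp add: case_prod_beta)
qed

lemma total_phases: "total \<sigma> N p = (\<integral>\<^sup>+x. ennreal (weight (trunc N) (phases (trunc N) p) x) \<partial>\<sigma>)"
  by (simp add: total_def weight_phases)

lemma measurable_total:
  assumes "\<sigma> \<in> torus_measures" shows "total \<sigma> N \<in> borel_measurable M"
  unfolding total_phases[abs_def]
  by (rule measurable_compose[OF measurable_phases[OF trunc_subset] measurable_total_PiM[OF assms]])

lemma total_finite:
  assumes "\<sigma> \<in> torus_measures" shows "total \<sigma> N p < \<infinity>"
proof -
  interpret finite_measure \<sigma> by (rule torus_measuresD[OF assms])
  have "total \<sigma> N p \<le> (\<integral>\<^sup>+x. ennreal (\<Prod>n\<in>trunc N. exp \<bar>amp n\<bar> / bessel_I0 (amp n)) \<partial>\<sigma>)"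
    unfolding total_def by (intro nn_integral_mono ennreal_leI weight_le finite_trunc)
  also have "\<dots> < \<infinity>" using emeasure_finite by (auto simp: ennreal_mult_eq_top_iff less_top[symmetric])
  finally show ?thesis .
qed

lemma nn_integral_swap:
  assumes "\<sigma> \<in> torus_measures" "f \<in> borel_measurable (M \<Otimes>\<^sub>M \<sigma>)"
  shows "(\<integral>\<^sup>+p. \<integral>\<^sup>+x. f (p, x) \<partial>\<sigma> \<partial>M) = (\<integral>\<^sup>+x. \<integral>\<^sup>+p. f (p, x) \<partial>M \<partial>\<sigma>)"
proof -
  interpret s: finite_measure \<sigma> by (rule torus_measuresD[OF assms(1)])
  interpret pair_sigma_finite M \<sigma> ..
  show ?thesis using Fubini'[of "\<lambda>p x. f (p, x)"] assms(2) by simp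
qed

lemma expected_total_with:
  assumes \<sigma>: "\<sigma> \<in> torus_measures" and h: "h \<in> borel_measurable M"
  shows "(\<integral>\<^sup>+p. total \<sigma> N p * h p \<partial>M)
    = (\<integral>\<^sup>+x. \<integral>\<^sup>+p. ennreal (weight (trunc N) (\<lambda>n. \<omega> n p) x) * h p \<partial>M \<partial>\<sigma>)"
proof -
  have "(\<integral>\<^sup>+p. total \<sigma> N p * h p \<partial>M) = (\<integral>\<^sup>+p. \<integral>\<^sup>+x. ennreal (weight (trunc N) (\<lambda>n. \<omega> n p) x) * h p \<partial>\<sigma> \<partial>M)"
    unfolding total_def
    by (intro nn_integral_cong nn_integral_multc[symmetric] measurable_compose[OF measurable_weight_space[OF \<sigma>] measurable_ennreal])
  also have "\<dots> = (\<integral>\<^sup>+x. \<integral>\<^sup>+p. ennreal (weight (trunc N) (\<lambda>n. \<omega> n p) x) * h p \<partial>M \<partial>\<sigma>)"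
  proof -
    note [measurable] = measurable_weight_pair[OF trunc_subset \<sigma>, of N] h
    have "(\<lambda>z. ennreal (weight (trunc N) (\<lambda>n. \<omega> n (fst z)) (snd z)) * h (fst z)) \<in> borel_measurable (M \<Otimes>\<^sub>M \<sigma>)"
      by measurable
    from nn_integral_swap[OF \<sigma> this] show ?thesis by simp
  qed
  finally show ?thesis .
qed

lemma expected_total:
  assumes "\<sigma> \<in> torus_measures"
  shows "(\<integral>\<^sup>+p. total \<sigma> N p \<partial>M) = emeasure \<sigma> UNIV"
  using expected_total_with[OF assms, of "\<lambda>_. 1" N] torus_measuresD(3)[OF assms]
  by (simp add: mean_weight[OF finite_trunc trunc_subset])

section \<open>Negative moments and the tilted law\<close>

text \<open>The graph of the convex function u^-s lies above its tangent at t.\<close>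

lemma powr_tangent:
  fixes u t s :: real
  assumes "0 < u" "0 < t" "0 < s"
  shows "(1 + s) * t powr - s \<le> u powr - s + s * t powr (- s - 1) * u"
proof -
  define z where "z = u / t"
  have z: "0 < z" using assms by (simp add: z_def)
  have "1 - s * (z - 1) \<le> 1 + (- s) * ln z" using ln_le_minus_one[OF z] assms by simp
  also have "\<dots> \<le> exp ((- s) * ln z)" by (rule exp_ge_add_one_self)
  also have "\<dots> = z powr - s" using z by (simp add: powr_def)
  finally have "t powr - s * (1 - s * (z - 1)) \<le> t powr - s * z powr - s" by (intro mult_left_mono) auto
  also have "t powr - s * z powr - s = u powr - s"
    using assms by (simp add: z_def powr_mult[symmetric])
  also have "t powr - s * (1 - s * (z - 1)) = (1 + s) * t powr - s - s * t powr (- s - 1) * u"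
    using assms by (simp add: z_def powr_diff field_simps)
  finally show ?thesis by simp
qed

text \<open>Jensen's inequality: a total mass of at most K makes the mean of the weight over B at
  most t = K / \<sigma>(B), so the mean of its power -s is at least t^-s.\<close>

lemma negative_moment_ge:
  assumes \<sigma>: "\<sigma> \<in> torus_measures" and B: "B \<in> sets borel" "0 < measure \<sigma> B"
    and s: "0 < s" and K: "0 < K" and tot: "total \<sigma> m p \<le> ennreal K"
  defines "t \<equiv> K / measure \<sigma> B"
  shows "1 \<le> ennreal (t powr s / measure \<sigma> B) *
    (\<integral>\<^sup>+y. indicator B y * ennreal (weight (trunc m) (\<lambda>n. \<omega> n p) y powr - s) \<partial>\<sigma>)"
proof -
  interpret finite_measure \<sigma> by (rule torus_measuresD[OF \<sigma>])
  define b where "b = measure \<sigma> B"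
  have b: "0 < b" using B by (simp add: b_def)
  have t: "0 < t" using K b by (simp add: t_def b_def)
  let ?u = "\<lambda>y. weight (trunc m) (\<lambda>n. \<omega> n p) y"
  note [measurable] = measurable_weight_space[OF \<sigma>, of "trunc m" "\<lambda>n. \<omega> n p"]
  have [measurable]: "B \<in> sets \<sigma>" using B torus_measuresD[OF \<sigma>] by simp
  let ?I = "\<integral>\<^sup>+y. indicator B y * ennreal (?u y powr - s) \<partial>\<sigma>"
  have "ennreal ((1 + s) * t powr - s) * emeasure \<sigma> B = (\<integral>\<^sup>+y. ennreal ((1 + s) * t powr - s) * indicator B y \<partial>\<sigma>)"
    by (simp add: nn_integral_cmult_indicator)
  \<comment> \<open>The tangent inequality at t on B; its linear part is integrated over the whole
    torus, where it becomes the total mass.\<close>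
  also have "\<dots> \<le> (\<integral>\<^sup>+y. indicator B y * ennreal (?u y powr - s) + ennreal (s * t powr (- s - 1)) * ennreal (?u y) \<partial>\<sigma>)"
  proof (rule nn_integral_mono)
    fix y
    have "ennreal ((1 + s) * t powr - s) \<le> ennreal (?u y powr - s + s * t powr (- s - 1) * ?u y)"
      by (intro ennreal_leI powr_tangent weight_pos t s)
    also have "\<dots> = ennreal (?u y powr - s) + ennreal (s * t powr (- s - 1)) * ennreal (?u y)"
      using s by (simp add: ennreal_plus ennreal_mult weight_nonneg)
    finally show "ennreal ((1 + s) * t powr - s) * indicator B y
        \<le> indicator B y * ennreal (?u y powr - s) + ennreal (s * t powr (- s - 1)) * ennreal (?u y)"
      by (auto simp: indicator_def)
  qed
  also have "\<dots> = ?I + ennreal (s * t powr (- s - 1)) * total \<sigma> m p"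
    unfolding total_def by (subst nn_integral_add) (auto simp: nn_integral_cmult)
  also have "\<dots> \<le> ?I + ennreal (s * t powr (- s - 1)) * ennreal K"
    by (intro add_left_mono mult_left_mono tot) simp
  also have "ennreal (s * t powr (- s - 1)) * ennreal K = ennreal (s * t powr - s * b)"
  proof -
    have "t powr (- s - 1) * K = t powr - s * b"
      using b K t by (simp add: powr_diff t_def b_def[symmetric] field_simps)
    then show ?thesis using s K by (simp add: ennreal_mult[symmetric] mult.assoc)
  qed
  also have "ennreal ((1 + s) * t powr - s) * emeasure \<sigma> B = ennreal (t powr - s * b) + ennreal (s * t powr - s * b)"
    using b s by (simp add: emeasure_eq_measure b_def[symmetric] ennreal_mult[symmetric] ennreal_plus[symmetric] algebra_simps del: ennreal_plus)
  finally have "ennreal (t powr - s * b) \<le> ?I"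
    by (simp add: add.commute ennreal_add_left_cancel_le)
  then have "ennreal (t powr s / b) * ennreal (t powr - s * b) \<le> ennreal (t powr s / b) * ?I"
    by (intro mult_left_mono) auto
  moreover have "ennreal (t powr s / b) * ennreal (t powr - s * b) = 1"
    using b t by (simp add: ennreal_mult[symmetric] powr_minus)
  ultimately show ?thesis by (simp add: b_def)
qed

text \<open>The weight at x has mean 1, so this is the probability, under the law tilted by it, that
  the total mass at level m is at most K.\<close>

definition tilted_mass :: "'n torus measure \<Rightarrow> ennreal \<Rightarrow> nat \<Rightarrow> 'n torus \<Rightarrow> ennreal" where
  "tilted_mass \<sigma> K m x = (\<integral>\<^sup>+p. ennreal (weight (trunc m) (\<lambda>n. \<omega> n p) x) * of_bool (total \<sigma> m p \<le> K) \<partial>M)"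

text \<open>The negative moment bound is inserted as a factor at least 1 on the event, which
  replaces the event by an average over B of the mixed moments.\<close>

lemma tilted_mass_le:
  assumes \<sigma>: "\<sigma> \<in> torus_measures" and B: "B \<in> sets borel" "0 < measure \<sigma> B"
    and s: "0 < s" and K: "0 < K" and G: "0 \<le> G"
    and mom: "\<And>y. y \<in> B \<Longrightarrow> (\<integral>\<^sup>+p. ennreal (weight (trunc m) (\<lambda>n. \<omega> n p) x * weight (trunc m) (\<lambda>n. \<omega> n p) y powr - s) \<partial>M) \<le> ennreal G"
  shows "tilted_mass \<sigma> (ennreal K) m x \<le> ennreal ((K / measure \<sigma> B) powr s * G)"
proof -
  interpret s: finite_measure \<sigma> by (rule torus_measuresD[OF \<sigma>])
  define b where "b = measure \<sigma> B"
  have b: "0 < b" using B by (simp add: b_def)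
  define D where "D = ennreal ((K / b) powr s / b)"
  let ?w = "\<lambda>p y. weight (trunc m) (\<lambda>n. \<omega> n p) y"
  note [measurable] = measurable_weight_pair[OF trunc_subset \<sigma>, of m] measurable_weight_prob[OF trunc_subset, of m x]
    measurable_weight_space[OF \<sigma>, of "trunc m"] measurable_weight_prob[OF trunc_subset, of m]
  have [measurable]: "B \<in> sets \<sigma>" using B torus_measuresD[OF \<sigma>] by simp
  let ?f = "\<lambda>z. indicator B (snd z) * ennreal (?w (fst z) x * ?w (fst z) (snd z) powr - s)"
  have fm: "?f \<in> borel_measurable (M \<Otimes>\<^sub>M \<sigma>)" by measurable
  have "tilted_mass \<sigma> (ennreal K) m x \<le> (\<integral>\<^sup>+p. D * (\<integral>\<^sup>+y. ?f (p, y) \<partial>\<sigma>) \<partial>M)"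
    unfolding tilted_mass_def
  proof (rule nn_integral_mono)
    fix p
    have i: "(\<integral>\<^sup>+y. ?f (p, y) \<partial>\<sigma>) = ennreal (?w p x) * (\<integral>\<^sup>+y. indicator B y * ennreal (?w p y powr - s) \<partial>\<sigma>)"
      by (subst nn_integral_cmult[symmetric]) (auto simp: ennreal_mult weight_nonneg mult_ac)
    show "ennreal (?w p x) * of_bool (total \<sigma> m p \<le> ennreal K) \<le> D * (\<integral>\<^sup>+y. ?f (p, y) \<partial>\<sigma>)"
    proof (cases "total \<sigma> m p \<le> ennreal K")
      case True
      from negative_moment_ge[OF \<sigma> B s K True]
      have "ennreal (?w p x) * 1 \<le> ennreal (?w p x) * (D * (\<integral>\<^sup>+y. indicator B y * ennreal (?w p y powr - s) \<partial>\<sigma>))"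
        unfolding D_def b_def by (intro mult_left_mono) auto
      then show ?thesis unfolding i using True by (simp add: mult_ac)
    qed simp
  qed
  also have "\<dots> = D * (\<integral>\<^sup>+p. \<integral>\<^sup>+y. ?f (p, y) \<partial>\<sigma> \<partial>M)"
    using s.borel_measurable_nn_integral_fst[OF fm] by (intro nn_integral_cmult)
  also have "\<dots> = D * (\<integral>\<^sup>+y. \<integral>\<^sup>+p. ?f (p, y) \<partial>M \<partial>\<sigma>)"
    using nn_integral_swap[OF \<sigma> fm] by simp
  also have "\<dots> \<le> D * (\<integral>\<^sup>+y. ennreal G * indicator B y \<partial>\<sigma>)"
  proof (intro mult_left_mono nn_integral_mono)
    fix y
    show "(\<integral>\<^sup>+p. ?f (p, y) \<partial>M) \<le> ennreal G * indicator B y"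
      using mom[of y] by (cases "y \<in> B") auto
  qed simp
  also have "\<dots> = D * (ennreal G * ennreal b)"
    by (simp add: nn_integral_cmult_indicator s.emeasure_eq_measure b_def)
  also have "\<dots> = ennreal ((K / b) powr s * G)"
    unfolding D_def using b G by (simp add: ennreal_mult[symmetric])
  finally show ?thesis by (simp add: b_def)
qed

text \<open>
  Under the law tilted by the weight at \<open>x\<close>, the weight near \<open>x\<close> at scale \<open>2 ^ - k\<close> is about
  \<open>2 powr (critical * k)\<close>, which beats a ball mass \<open>2 powr - (\<gamma> * k)\<close> with \<open>\<gamma> < critical\<close>.
\<close>

lemma tilted_mass_small:
  assumes \<sigma>: "\<sigma> \<in> torus_measures" and \<beta>: "0 \<le> \<beta>" "\<beta> < critical"
    and pot: "potential \<beta> \<sigma> x = \<infinity>" and K: "0 < K" and e: "0 < e"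
  obtains m where "tilted_mass \<sigma> (ennreal K) m x \<le> ennreal e"
proof -
  interpret s: finite_measure \<sigma> by (rule torus_measuresD[OF \<sigma>])
  \<comment> \<open>\<gamma> and a' cut the interval from \<beta> to the critical exponent into
    thirds: \<gamma> will be the exponent of the ball masses, a' that of the weights.\<close>
  define \<gamma> where "\<gamma> = (2 * \<beta> + critical) / 3"
  define a' where "a' = (\<beta> + 2 * critical) / 3"
  have g: "0 < \<gamma>" "\<beta> < \<gamma>" "\<gamma> < a'" "a' < critical" using \<beta> by (auto simp: \<gamma>_def a'_def)
  \<comment> \<open>Chosen so that (1 - 2 s) a' is the midpoint of \<gamma> and a': the second-order
    loss 2 s still leaves an exponent above \<gamma>.\<close>
  define r where "r = \<gamma> / a'"
  define s where "s = (1 - r) / 4"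
  have s: "0 < s" "s < 1 / 4"
  proof -
    have "0 < r" "r < 1" using g by (simp_all add: r_def)
    then show "0 < s" "s < 1 / 4" by (simp_all add: s_def)
  qed
  have a'0: "0 < a'" using g by linarith
  define \<gamma>' where "\<gamma>' = (1 - 2 * s) * a'"
  have "\<gamma>' = (a' + \<gamma>) / 2" unfolding \<gamma>'_def s_def r_def using a'0 by (simp add: field_simps)
  then have g': "\<gamma> < \<gamma>'" using g by simp
  define d where "d = real CARD('n)"
  have d0: "0 < d" by (simp add: d_def)
  \<comment> \<open>Lowering the truncation from 2^k to 2^(k - j) makes all waves in use almost
    constant on a ball of radius 2^-k: 1 - cos is at most s / 2.\<close>
  obtain j where j: "(1/4::real) ^ j < s / d\<^sup>2"
    using real_arch_pow_inv[of "s / d\<^sup>2" "1/4"] s d0 by auto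
  obtain k1 where k1: "\<And>k. k1 \<le> k \<Longrightarrow> a' * ln 2 * real k \<le> \<alpha>\<^sup>2 / 4 * (\<Sum>n\<in>trunc (2 ^ k). inv_norm_pow n)"
    using log_sum_lower[OF g(4)] by blast
  obtain C where C: "\<And>F x y. finite F \<Longrightarrow> F \<subseteq> H \<Longrightarrow>
    (\<integral>\<^sup>+p. ennreal (weight F (\<lambda>n. \<omega> n p) x powr 1 * weight F (\<lambda>n. \<omega> n p) y powr - s) \<partial>M)
    \<le> ennreal (exp (\<alpha>\<^sup>2 / 4 * (\<Sum>n\<in>F. inv_norm_pow n * (1\<^sup>2 + (- s)\<^sup>2 + 2 * 1 * (- s) * tcosd n x y - (1 + (- s)))) + C))"
    using phase_moment_bound[of 1 "- s"] s by auto
  \<comment> \<open>The net decay per scale: s \<gamma>' from the mixed moment against s \<gamma>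
    from the ball mass. \<open>D\<close> collects the factors independent of k.\<close>
  define \<eta> where "\<eta> = s * (\<gamma>' - \<gamma>)"
  have \<eta>: "0 < \<eta>" using s g' by (simp add: \<eta>_def)
  define D where "D = K powr s * exp C * 2 powr (s * \<gamma>' * real j)"
  have D: "0 < D" using K by (simp add: D_def)
  obtain k0 where k0: "\<And>k. k0 \<le> k \<Longrightarrow> D * 2 powr (- \<eta> * real k) \<le> e"
  proof -
    define q where "q = 2 powr - \<eta>"
    have q: "0 < q" "q < 1" using powr_less_cancel_iff[of 2 "- \<eta>" 0] \<eta> by (auto simp: q_def)
    obtain k0 where k0: "q ^ k0 < e / D" using real_arch_pow_inv[of "e / D" q] q e D by auto
    show ?thesis
    proof (rule that[of k0])
      fix k assume "k0 \<le> k"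
      then have "q ^ k \<le> q ^ k0" using q by (intro power_decreasing) auto
      then have "q ^ k \<le> e / D" using k0 by linarith
      moreover have "2 powr (- \<eta> * real k) = q ^ k" using q by (simp add: q_def powr_realpow[symmetric] powr_powr)
      ultimately show "D * 2 powr (- \<eta> * real k) \<le> e" using D by (simp add: le_divide_eq mult.commute)
    qed
  qed
  \<comment> \<open>If all small balls had mass at most 2^(-\<gamma> k), the potential of the lower
    order \<beta> would be finite.\<close>
  obtain k where k: "max k0 (k1 + j) \<le> k" "2 powr - (\<gamma> * real k) < measure \<sigma> (ball x ((1/2) ^ k))"
    using potential_finite_if_small_balls[OF \<sigma> \<beta>(1) g(2), of "max k0 (k1 + j)" x] pot
    by (metis less_irrefl not_le)
  define m where "m = (2::nat) ^ (k - j)"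
  define B where "B = ball x ((1/2) ^ k)"
  have kj: "k1 \<le> k - j" "j \<le> k" "k0 \<le> k" using k(1) by auto
  have Bpos: "0 < measure \<sigma> B" using k(2) unfolding B_def by (rule less_trans[rotated]) simp
  define G where "G = exp C * 2 powr - (s * \<gamma>' * real (k - j))"
  have mom: "(\<integral>\<^sup>+p. ennreal (weight (trunc m) (\<lambda>n. \<omega> n p) x * weight (trunc m) (\<lambda>n. \<omega> n p) y powr - s) \<partial>M) \<le> ennreal G"
    if y: "y \<in> B" for y
  proof -
    \<comment> \<open>With cos \<ge> 1 - s / 2 the form 1 + s^2 - 2 s cos - (1 - s) is at most - s
      (1 - 2 s).\<close>
    have exps: "inv_norm_pow n * (1\<^sup>2 + (- s)\<^sup>2 + 2 * 1 * (- s) * tcosd n x y - (1 + (- s))) \<le> inv_norm_pow n * (- s * (1 - 2 * s))"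
      if n: "n \<in> trunc m" for n
    proof (rule mult_left_mono[OF _ inv_norm_pow_nonneg])
      have "dist x y < (1/2) ^ k" using y by (simp add: B_def)
      from tcosd_ge[OF this, of n]
      have tc: "1 - (norm (ivec n) * (1/2) ^ k)\<^sup>2 / 2 \<le> tcosd n x y" by (simp add: power_mult_distrib)
      have "norm (ivec n) \<le> d * \<nu> n" unfolding d_def by (rule norm_ivec_le_lattice_norm[OF lattice_norm])
      also have "\<dots> \<le> d * real m" using n d0 by (intro mult_left_mono) (auto simp: trunc_def)
      finally have "norm (ivec n) * (1/2) ^ k \<le> d * real m * (1/2) ^ k" by (intro mult_right_mono) auto
      also have "\<dots> = d * (1/2) ^ j"
      proof -
        have "(2::real) ^ k = 2 ^ (k - j) * 2 ^ j" using kj by (simp flip: power_add)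
        then show ?thesis by (simp add: m_def power_one_over field_simps)
      qed
      finally have "(norm (ivec n) * (1/2) ^ k)\<^sup>2 \<le> (d * (1/2) ^ j)\<^sup>2" by (intro power_mono) auto
      also have "\<dots> = d\<^sup>2 * (1/4) ^ j" by (simp add: power_mult_distrib power_one_over power_even_eq[symmetric] power2_eq_square flip: power_mult_distrib)
      also have "\<dots> \<le> s" using j d0 by (simp add: less_divide_eq mult.commute less_imp_le)
      finally have "1 - s / 2 \<le> tcosd n x y" using tc by linarith
      then have "2 * s * (1 - s / 2) \<le> 2 * s * tcosd n x y" using s by (intro mult_left_mono) auto
      then show "1\<^sup>2 + (- s)\<^sup>2 + 2 * 1 * (- s) * tcosd n x y - (1 + (- s)) \<le> - s * (1 - 2 * s)"
        by (simp add: power2_eq_square algebra_simps)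
    qed
    have "\<alpha>\<^sup>2 / 4 * (\<Sum>n\<in>trunc m. inv_norm_pow n * (1\<^sup>2 + (- s)\<^sup>2 + 2 * 1 * (- s) * tcosd n x y - (1 + (- s))))
        \<le> \<alpha>\<^sup>2 / 4 * (\<Sum>n\<in>trunc m. inv_norm_pow n * (- s * (1 - 2 * s)))"
      by (intro mult_left_mono sum_mono exps) auto
    also have "\<dots> = - (s * (1 - 2 * s)) * (\<alpha>\<^sup>2 / 4 * (\<Sum>n\<in>trunc m. inv_norm_pow n))"
      unfolding sum_distrib_right[symmetric] by simp
    also have "\<dots> \<le> - (s * (1 - 2 * s)) * (a' * ln 2 * real (k - j))"
      using k1[OF kj(1)] s unfolding m_def by (intro mult_left_mono_neg) auto
    also have "\<dots> = ln 2 * - (s * \<gamma>' * real (k - j))" by (simp add: \<gamma>'_def mult_ac)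
    finally have le: "exp (\<alpha>\<^sup>2 / 4 * (\<Sum>n\<in>trunc m. inv_norm_pow n * (1\<^sup>2 + (- s)\<^sup>2 + 2 * 1 * (- s) * tcosd n x y - (1 + (- s)))) + C)
        \<le> exp (ln 2 * - (s * \<gamma>' * real (k - j)) + C)" by simp
    also have "\<dots> = G" unfolding exp_add G_def powr_def by (simp add: mult_ac)
    finally have "ennreal (exp (\<alpha>\<^sup>2 / 4 * (\<Sum>n\<in>trunc m. inv_norm_pow n * (1\<^sup>2 + (- s)\<^sup>2 + 2 * 1 * (- s) * tcosd n x y - (1 + (- s)))) + C))
        \<le> ennreal G" by (rule ennreal_leI)
    with C[OF finite_trunc trunc_subset, of m x y] show ?thesis
      using weight_nonneg by (simp only: powr_one order_trans)
  qed
  have "tilted_mass \<sigma> (ennreal K) m x \<le> ennreal ((K / measure \<sigma> B) powr s * G)"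
    by (rule tilted_mass_le[OF \<sigma> _ Bpos s(1) K _ mom]) (auto simp: B_def G_def)
  also have "\<dots> \<le> ennreal e"
  proof (rule ennreal_leI)
    have "K / measure \<sigma> B \<le> K / 2 powr - (\<gamma> * real k)"
      using k(2) K Bpos by (intro divide_left_mono mult_pos_pos) (auto simp: B_def)
    then have "(K / measure \<sigma> B) powr s \<le> (K / 2 powr - (\<gamma> * real k)) powr s"
      using K Bpos s by (intro powr_mono2) auto
    also have "\<dots> = K powr s * 2 powr (s * \<gamma> * real k)"
      using K by (simp add: powr_mult powr_powr powr_minus divide_inverse mult_ac)
    finally have "(K / measure \<sigma> B) powr s * G \<le> K powr s * 2 powr (s * \<gamma> * real k) * G"
      by (intro mult_right_mono) (auto simp: G_def)
    also have "\<dots> = D * 2 powr (- \<eta> * real k)"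
    proof -
      have "2 powr (s * \<gamma> * real k) * 2 powr - (s * \<gamma>' * real (k - j)) = 2 powr (s * \<gamma>' * real j) * 2 powr (- \<eta> * real k)"
        unfolding powr_add[symmetric] using kj by (simp add: \<eta>_def of_nat_diff algebra_simps)
      then show ?thesis by (simp add: D_def G_def mult_ac)
    qed
    also have "\<dots> \<le> e" by (rule k0) (use kj in simp)
    finally show "(K / measure \<sigma> B) powr s * G \<le> e" .
  qed
  finally show ?thesis by (rule that)
qed

section \<open>Weak limits of the weighted measures and the upper bound on their mass\<close>

definition random_measure :: "'n torus measure \<Rightarrow> 'w \<Rightarrow> nat \<Rightarrow> 'n torus measure" where
  "random_measure \<sigma> p N = density \<sigma> (\<lambda>x. ennreal (chaos_partial \<alpha> trunc (\<lambda>n. \<omega> n p) N x))"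

definition limit_measure :: "'n torus measure \<Rightarrow> 'w \<Rightarrow> 'n torus measure" where
  "limit_measure \<sigma> p = chaos \<alpha> trunc (\<lambda>n. \<omega> n p) \<sigma>"

lemma random_measure_total:
  assumes "\<sigma> \<in> torus_measures" shows "emeasure (random_measure \<sigma> p N) UNIV = total \<sigma> N p"
  unfolding random_measure_def chaos_partial_eq_weight total_def
  using measurable_weight_space[OF assms] torus_measuresD(2)[OF assms]
  by (subst emeasure_density) auto

lemma random_measure_torus:
  assumes "\<sigma> \<in> torus_measures" shows "random_measure \<sigma> p N \<in> torus_measures"
proof -
  have "finite_measure (random_measure \<sigma> p N)"
    using random_measure_total[OF assms, of p N] total_finite[OF assms, of N p] torus_measuresD(3)[OF assms]
    by (intro finite_measureI) (simp add: random_measure_def)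
  then show ?thesis using torus_measuresD(2)[OF assms] by (simp add: torus_measures_def random_measure_def)
qed

lemma weakly_converges_unique:
  fixes \<kappa> :: "'n torus measure"
  assumes "weakly_converges \<mu> \<kappa>" "weakly_converges \<mu> \<kappa>'"
  shows "\<kappa> = \<kappa>'"
proof (rule finite_measure_eqI_continuous)
  show "(\<integral>x. f x \<partial>\<kappa>) = (\<integral>x. f x \<partial>\<kappa>')" if "continuous_on UNIV f" for f :: "'n torus \<Rightarrow> real"
    by (rule LIMSEQ_unique[OF assms(1)[unfolded weakly_converges_def, THEN conjunct2, rule_format, OF that]
        assms(2)[unfolded weakly_converges_def, THEN conjunct2, rule_format, OF that]])
qed (use assms in \<open>auto simp: weakly_converges_def torus_measures_def\<close>)

lemma limit_measure_eq:
  "weakly_converges (random_measure \<sigma> p) \<kappa> \<Longrightarrow> limit_measure \<sigma> p = \<kappa>"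
  unfolding limit_measure_def chaos_def Let_def random_measure_def[symmetric]
  using weakly_converges_unique by (auto intro!: the_equality)

lemma limit_measure_cases:
  obtains "weakly_converges (random_measure \<sigma> p) (limit_measure \<sigma> p)"
  | "\<nexists>\<kappa>. weakly_converges (random_measure \<sigma> p) \<kappa>" "limit_measure \<sigma> p = null_measure borel"
proof (cases "\<exists>\<kappa>. weakly_converges (random_measure \<sigma> p) \<kappa>")
  case True
  then show ?thesis using limit_measure_eq that(1) by metis
next
  case False
  then have "limit_measure \<sigma> p = null_measure borel"
    unfolding limit_measure_def chaos_def Let_def random_measure_def[symmetric] by (rule if_not_P)
  then show ?thesis using False that(2) by blast
qed

lemma weakly_converges_total:
  assumes \<sigma>: "\<sigma> \<in> torus_measures" and "weakly_converges (random_measure \<sigma> p) \<kappa>"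
  shows "(\<lambda>N. total \<sigma> N p) \<longlonglongrightarrow> emeasure \<kappa> UNIV"
proof -
  have \<kappa>: "\<kappa> \<in> torus_measures" using assms(2) by (simp add: weakly_converges_def)
  have "(\<lambda>N. \<integral>x. (1::real) \<partial>random_measure \<sigma> p N) \<longlonglongrightarrow> (\<integral>x. 1 \<partial>\<kappa>)"
    by (rule assms(2)[unfolded weakly_converges_def, THEN conjunct2, rule_format, OF continuous_on_const])
  then have lim: "(\<lambda>N. ennreal (measure (random_measure \<sigma> p N) UNIV)) \<longlonglongrightarrow> ennreal (measure \<kappa> UNIV)"
    using torus_measuresD(3)[OF \<kappa>] torus_measuresD(3)[OF random_measure_torus[OF \<sigma>]]
    by (intro tendsto_ennrealI) simp
  have e1: "emeasure \<kappa> UNIV = ennreal (measure \<kappa> UNIV)"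
    by (rule finite_measure.emeasure_eq_measure[OF torus_measuresD(1)[OF \<kappa>]])
  have e2: "total \<sigma> N p = ennreal (measure (random_measure \<sigma> p N) UNIV)" for N
    unfolding random_measure_total[OF \<sigma>, symmetric]
    by (rule finite_measure.emeasure_eq_measure[OF torus_measuresD(1)[OF random_measure_torus[OF \<sigma>]]])
  show ?thesis unfolding e1 e2 by (rule lim)
qed

text \<open>A convergent sequence of finite totals is bounded, so for large K the indicator is
  constantly 1. Its presence brings in the tilted law once Fatou's lemma is applied.\<close>

lemma limit_mass_le_truncated:
  assumes \<sigma>: "\<sigma> \<in> torus_measures"
  shows "emeasure (limit_measure \<sigma> p) UNIV
    \<le> (SUP K::nat. liminf (\<lambda>N. total \<sigma> N p * of_bool (\<forall>m\<le>N. total \<sigma> m p \<le> of_nat K)))"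
proof (cases rule: limit_measure_cases[of \<sigma> p])
  case 1
  note lim = weakly_converges_total[OF \<sigma> 1]
  have \<kappa>: "limit_measure \<sigma> p \<in> torus_measures" using 1 by (simp add: weakly_converges_def)
  interpret finite_measure "limit_measure \<sigma> p" by (rule torus_measuresD[OF \<kappa>])
  define r where "r = measure (limit_measure \<sigma> p) UNIV"
  have r: "emeasure (limit_measure \<sigma> p) UNIV = ennreal r" "0 \<le> r"
    unfolding r_def by (rule emeasure_eq_measure) simp
  have lt: "ennreal r < ennreal (r + 1)" using r(2) by (subst ennreal_less_iff) auto
  have "eventually (\<lambda>N. total \<sigma> N p < ennreal (r + 1)) sequentially"
    by (rule order_tendstoD(2)[OF lim[unfolded r(1)] lt])
  then obtain N0 where N0: "\<And>N. N0 \<le> N \<Longrightarrow> total \<sigma> N p < ennreal (r + 1)" by (auto simp: eventually_sequentially)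
  define S where "S = ennreal (r + 1) + (\<Sum>N<N0. total \<sigma> N p)"
  have "S < \<infinity>" using total_finite[OF \<sigma>] by (simp add: S_def less_top[symmetric])
  then have "() \<in> {x. S < \<infinity>}" by simp
  then have "() \<in> (\<Union>k::nat. {x. S \<le> of_nat k})" unfolding ennreal_finite_levels .
  then obtain K :: nat where K: "S \<le> of_nat K" by blast
  have le: "total \<sigma> m p \<le> of_nat K" for m
  proof (cases "N0 \<le> m")
    case True
    then have "total \<sigma> m p \<le> ennreal (r + 1)" using N0 less_imp_le by blast
    also have "\<dots> \<le> S" by (simp add: S_def)
    finally show ?thesis using K by (rule order_trans)
  next
    case False
    then have "total \<sigma> m p \<le> (\<Sum>N<N0. total \<sigma> N p)" by (intro member_le_sum) auto
    also have "\<dots> \<le> S" by (simp add: S_def)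
    finally show ?thesis using K by (rule order_trans)
  qed
  have "emeasure (limit_measure \<sigma> p) UNIV = liminf (\<lambda>N. total \<sigma> N p)"
    using lim by (intro lim_imp_Liminf[symmetric]) auto
  also have "\<dots> = liminf (\<lambda>N. total \<sigma> N p * of_bool (\<forall>m\<le>N. total \<sigma> m p \<le> of_nat K))"
    using le by simp
  also have "\<dots> \<le> (SUP K::nat. liminf (\<lambda>N. total \<sigma> N p * of_bool (\<forall>m\<le>N. total \<sigma> m p \<le> of_nat K)))"
    by (rule SUP_upper) simp
  finally show ?thesis .
qed simp

lemma measurable_tilted_mass:
  assumes \<sigma>: "\<sigma> \<in> torus_measures" shows "tilted_mass \<sigma> K m \<in> borel_measurable \<sigma>"
proof -
  note [measurable] = measurable_weight_pair[OF trunc_subset \<sigma>, of m] measurable_total[OF \<sigma>, of m]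
  have "(\<lambda>z. ennreal (weight (trunc m) (\<lambda>n. \<omega> n (fst z)) (snd z)) * of_bool (total \<sigma> m (fst z) \<le> K)) \<in> borel_measurable (M \<Otimes>\<^sub>M \<sigma>)"
    by measurable
  from measurable_compose[OF measurable_pair_swap' this]
  show ?thesis unfolding tilted_mass_def[abs_def]
    by (intro borel_measurable_nn_integral) (simp add: case_prod_beta)
qed

text \<open>The event of bounded totals is contained in the event at each single level m, and there
  the martingale property lowers the weight from N to m; hence the infimum over m. Off
  \<open>E\<close> only mean 1 is used.\<close>

lemma truncated_total_le:
  assumes \<sigma>: "\<sigma> \<in> torus_measures" and E: "E \<in> sets borel"
  shows "(\<integral>\<^sup>+p. total \<sigma> N p * of_bool (\<forall>m\<le>N. total \<sigma> m p \<le> K) \<partial>M)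
    \<le> emeasure \<sigma> (- E) + (\<integral>\<^sup>+x. indicator E x * (INF m\<in>{..N}. tilted_mass \<sigma> K m x) \<partial>\<sigma>)"
proof -
  note [measurable] = measurable_total[OF \<sigma>] measurable_tilted_mass[OF \<sigma>]
  have Es [measurable]: "E \<in> sets \<sigma>" using E torus_measuresD[OF \<sigma>] by simp
  have [measurable]: "- E \<in> sets \<sigma>" using E torus_measuresD[OF \<sigma>] by simp
  let ?h = "\<lambda>p. of_bool (\<forall>m\<le>N. total \<sigma> m p \<le> K) :: ennreal"
  let ?w = "\<lambda>m x p. ennreal (weight (trunc m) (\<lambda>n. \<omega> n p) x)"
  have hm: "?h \<in> borel_measurable M" by measurable
  have le: "(\<integral>\<^sup>+p. ?w N x p * ?h p \<partial>M) \<le> tilted_mass \<sigma> K m x" if m: "m \<le> N" for m x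
  proof -
    have "(\<integral>\<^sup>+p. ?w N x p * ?h p \<partial>M) \<le> (\<integral>\<^sup>+p. ?w N x p * of_bool (total \<sigma> m p \<le> K) \<partial>M)"
      using m by (intro nn_integral_mono mult_left_mono) auto
    also have "\<dots> = tilted_mass \<sigma> K m x"
    proof -
      let ?g = "\<lambda>w. of_bool ((\<integral>\<^sup>+x. ennreal (weight (trunc m) w x) \<partial>\<sigma>) \<le> K) :: ennreal"
      note [measurable] = measurable_total_PiM[OF \<sigma>, of "trunc m"]
      have "?g \<in> borel_measurable (PiM (trunc m) (\<lambda>_. borel))" by measurable
      from weight_martingale[OF m this, of x] show ?thesis
        unfolding tilted_mass_def total_phases by (simp add: weight_phases)
    qed
    finally show ?thesis .
  qed
  have le1: "(\<integral>\<^sup>+p. ?w N x p * ?h p \<partial>M) \<le> 1" for x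
  proof -
    have "(\<integral>\<^sup>+p. ?w N x p * ?h p \<partial>M) \<le> (\<integral>\<^sup>+p. ?w N x p \<partial>M)" by (intro nn_integral_mono) (auto simp: of_bool_def)
    then show ?thesis by (simp add: mean_weight[OF finite_trunc trunc_subset])
  qed
  have "(\<integral>\<^sup>+p. total \<sigma> N p * ?h p \<partial>M) = (\<integral>\<^sup>+x. \<integral>\<^sup>+p. ?w N x p * ?h p \<partial>M \<partial>\<sigma>)"
    by (rule expected_total_with[OF \<sigma> hm])
  also have "\<dots> \<le> (\<integral>\<^sup>+x. indicator (- E) x + indicator E x * (INF m\<in>{..N}. tilted_mass \<sigma> K m x) \<partial>\<sigma>)"
  proof (rule nn_integral_mono)
    fix x
    show "(\<integral>\<^sup>+p. ?w N x p * ?h p \<partial>M) \<le> indicator (- E) x + indicator E x * (INF m\<in>{..N}. tilted_mass \<sigma> K m x)"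
      using le1[of x] le[of _ x] by (cases "x \<in> E") (auto intro!: INF_greatest)
  qed
  also have "\<dots> = emeasure \<sigma> (- E) + (\<integral>\<^sup>+x. indicator E x * (INF m\<in>{..N}. tilted_mass \<sigma> K m x) \<partial>\<sigma>)"
    by (subst nn_integral_add) auto
  finally show ?thesis .
qed

text \<open>For fixed K, Fatou's lemma applies in N, and the infimum of the tilted masses tends to 0
  at every point of infinite potential, dominated by 1. Monotone convergence in K then restores the
  whole limit mass.\<close>

lemma limit_mass_upper:
  assumes \<sigma>: "\<sigma> \<in> torus_measures" and \<beta>: "0 \<le> \<beta>" "\<beta> < critical"
  shows "(\<integral>\<^sup>+p. emeasure (limit_measure \<sigma> p) UNIV \<partial>M) \<le> emeasure \<sigma> {x. potential \<beta> \<sigma> x < \<infinity>}"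
proof -
  interpret s: finite_measure \<sigma> by (rule torus_measuresD[OF \<sigma>])
  note [measurable] = measurable_total[OF \<sigma>] measurable_tilted_mass[OF \<sigma>]
  let ?E = "{x. potential \<beta> \<sigma> x = \<infinity>}"
  have Eb: "?E \<in> sets borel"
    using measurable_sets[OF measurable_potential[OF \<sigma>, of \<beta>], of "{\<infinity>}"] by (simp add: vimage_def)
  have [measurable]: "?E \<in> sets \<sigma>" using Eb torus_measuresD[OF \<sigma>] by simp
  have cE: "- ?E = {x. potential \<beta> \<sigma> x < \<infinity>}" by (auto simp: less_top[symmetric])
  let ?T = "\<lambda>K N p. total \<sigma> N p * of_bool (\<forall>m\<le>N. total \<sigma> m p \<le> of_nat K)"
  have per: "(\<integral>\<^sup>+p. liminf (\<lambda>N. ?T K N p) \<partial>M) \<le> emeasure \<sigma> (- ?E)" for K :: nat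
  proof -
    let ?g = "\<lambda>N x. indicator ?E x * (INF m\<in>{..N}. tilted_mass \<sigma> (of_nat K) m x)"
    \<comment> \<open>The estimate asks for a positive bound on the total mass while K may be 0,
      hence K + 1.\<close>
    have small: "\<exists>m. tilted_mass \<sigma> (of_nat K) m x \<le> ennreal e" if xE: "x \<in> ?E" and e0: "0 < e" for x e
    proof -
      have px: "potential \<beta> \<sigma> x = \<infinity>" and K1: "0 < real K + 1" using xE by simp_all
      obtain m where "tilted_mass \<sigma> (ennreal (real K + 1)) m x \<le> ennreal e"
        using tilted_mass_small[OF \<sigma> \<beta> px K1 e0] by blast
      moreover have "tilted_mass \<sigma> (of_nat K) m x \<le> tilted_mass \<sigma> (ennreal (real K + 1)) m x"
      proof -
        have "of_nat K \<le> ennreal (real K + 1)" unfolding ennreal_of_nat_eq_real_of_nat by (rule ennreal_leI) simp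
        then show ?thesis unfolding tilted_mass_def by (intro nn_integral_mono mult_left_mono) (auto simp: of_bool_def)
      qed
      ultimately show ?thesis using order_trans by blast
    qed
    have le1: "tilted_mass \<sigma> c m x \<le> 1" for c m x
    proof -
      have "tilted_mass \<sigma> c m x \<le> (\<integral>\<^sup>+p. ennreal (weight (trunc m) (\<lambda>n. \<omega> n p) x) \<partial>M)"
        unfolding tilted_mass_def by (intro nn_integral_mono) (auto simp: of_bool_def)
      then show ?thesis by (simp add: mean_weight[OF finite_trunc trunc_subset])
    qed
    have "(\<lambda>N. \<integral>\<^sup>+x. ?g N x \<partial>\<sigma>) \<longlonglongrightarrow> (\<integral>\<^sup>+x. 0 \<partial>\<sigma>)"
    proof (rule nn_integral_dominated_convergence[where w = "\<lambda>_. 1"])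
      show "?g N \<in> borel_measurable \<sigma>" for N by measurable
      show "AE x in \<sigma>. ?g N x \<le> 1" for N
      proof (rule AE_I2)
        fix x
        have "(INF m\<in>{..N}. tilted_mass \<sigma> (of_nat K) m x) \<le> tilted_mass \<sigma> (of_nat K) N x" by (rule INF_lower) simp
        then have "(INF m\<in>{..N}. tilted_mass \<sigma> (of_nat K) m x) \<le> 1" using le1 order_trans by blast
        then show "?g N x \<le> 1" by (cases "x \<in> ?E") auto
      qed
      show "(\<integral>\<^sup>+x. 1 \<partial>\<sigma>) < \<infinity>" using s.emeasure_finite by (simp add: less_top[symmetric])
      show "AE x in \<sigma>. (\<lambda>N. ?g N x) \<longlonglongrightarrow> 0"
      proof (rule AE_I2)
        fix x
        show "(\<lambda>N. ?g N x) \<longlonglongrightarrow> 0"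
        proof (cases "x \<in> ?E")
          case True
          show ?thesis
          proof (rule order_tendstoI)
            fix a :: ennreal assume "0 < a"
            then obtain b where b: "0 < b" "b < a" using dense by blast
            then obtain e where "b = ennreal e" by (cases b rule: ennreal_cases) auto
            then have e: "0 < ennreal e" "ennreal e < a" "0 < e" using b by auto
            obtain m where m: "tilted_mass \<sigma> (of_nat K) m x \<le> ennreal e" using small[OF True e(3)] by blast
            show "eventually (\<lambda>N. ?g N x < a) sequentially"
              using eventually_ge_at_top[of m]
            proof eventually_elim
              case (elim N)
              have "(INF m\<in>{..N}. tilted_mass \<sigma> (of_nat K) m x) \<le> tilted_mass \<sigma> (of_nat K) m x"
                using elim by (intro INF_lower) simp
              then show ?case using m e True by (simp add: order.strict_trans1)
            qed
          qed simp
        qed simp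
      qed
    qed auto
    then have r0: "(\<lambda>N. emeasure \<sigma> (- ?E) + (\<integral>\<^sup>+x. ?g N x \<partial>\<sigma>)) \<longlonglongrightarrow> emeasure \<sigma> (- ?E) + 0"
      by (intro tendsto_add tendsto_const) simp
    have "(\<integral>\<^sup>+p. liminf (\<lambda>N. ?T K N p) \<partial>M) \<le> liminf (\<lambda>N. \<integral>\<^sup>+p. ?T K N p \<partial>M)"
      by (rule nn_integral_liminf) measurable
    also have "\<dots> \<le> liminf (\<lambda>N. emeasure \<sigma> (- ?E) + (\<integral>\<^sup>+x. ?g N x \<partial>\<sigma>))"
      by (intro Liminf_mono always_eventually allI truncated_total_le[OF \<sigma> Eb])
    also have "\<dots> = emeasure \<sigma> (- ?E)" using lim_imp_Liminf[OF _ r0] by simp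
    finally show ?thesis .
  qed
  have "(\<integral>\<^sup>+p. emeasure (limit_measure \<sigma> p) UNIV \<partial>M) \<le> (\<integral>\<^sup>+p. (SUP K::nat. liminf (\<lambda>N. ?T K N p)) \<partial>M)"
    by (intro nn_integral_mono limit_mass_le_truncated[OF \<sigma>])
  also have "\<dots> = (SUP K::nat. \<integral>\<^sup>+p. liminf (\<lambda>N. ?T K N p) \<partial>M)"
  proof (rule nn_integral_monotone_convergence_SUP)
    show "incseq (\<lambda>K p. liminf (\<lambda>N. ?T K N p))"
    proof (intro incseq_SucI le_funI Liminf_mono always_eventually allI mult_left_mono)
      fix K p N
      have "(of_nat K :: ennreal) \<le> of_nat (Suc K)" by simp
      then have *: "total \<sigma> m p \<le> of_nat K \<Longrightarrow> total \<sigma> m p \<le> of_nat (Suc K)" for m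
        using order_trans by blast
      show "of_bool (\<forall>m\<le>N. total \<sigma> m p \<le> of_nat K) \<le> (of_bool (\<forall>m\<le>N. total \<sigma> m p \<le> of_nat (Suc K)) :: ennreal)"
        using * by (auto simp: of_bool_def simp del: of_nat_Suc)
    qed simp
    show "(\<lambda>p. liminf (\<lambda>N. ?T K N p)) \<in> borel_measurable M" for K by measurable
  qed
  also have "\<dots> \<le> emeasure \<sigma> (- ?E)" by (rule SUP_least) (rule per)
  finally show ?thesis unfolding cE .
qed

section \<open>Capped weights: first and second moments\<close>

text \<open>A barrier at all dyadic scales, not only at the last one: the two-point estimate uses it
  at the scale of |x - y|, which varies with the pair.\<close>

definition controlled :: "real \<Rightarrow> real \<Rightarrow> nat \<Rightarrow> 'n torus \<Rightarrow> 'w \<Rightarrow> bool" where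
  "controlled \<beta> \<Lambda> K x p \<longleftrightarrow> (\<forall>k\<le>K. weight (trunc (2 ^ k)) (\<lambda>n. \<omega> n p) x \<le> \<Lambda> * 2 powr (\<beta> * real k))"

text \<open>A union bound over the scales with a Markov inequality of order s under the tilted law.
  The moment of order 1 + s grows like 2^(s (1 + s) a' k) against 2^(s \<beta> k) from the barrier,
  so the sum over k is geometric and uniform in K.\<close>

lemma uncontrolled_mass:
  assumes \<beta>: "critical < \<beta>"
  obtains s D where "0 < s" "0 \<le> D" "\<And>\<Lambda> K x. 0 < \<Lambda> \<Longrightarrow>
    (\<integral>\<^sup>+p. ennreal (weight (trunc (2 ^ K)) (\<lambda>n. \<omega> n p) x) * of_bool (\<not> controlled \<beta> \<Lambda> K x p) \<partial>M)
      \<le> ennreal (D * \<Lambda> powr - s)"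
proof -
  define a' where "a' = (critical + \<beta>) / 2"
  have a': "critical < a'" "a' < \<beta>" "0 < a'" using \<beta> critical_nonneg by (auto simp: a'_def)
  \<comment> \<open>Makes a' (1 + s) the midpoint of a' and \<beta>, so it stays below
    \<beta>.\<close>
  define s where "s = (\<beta> / a' - 1) / 2"
  have s: "0 < s" using a' by (simp add: s_def)
  have as: "a' * (1 + s) < \<beta>"
  proof -
    have "a' * (1 + s) = (a' + \<beta>) / 2" using a' by (simp add: s_def field_simps)
    then show ?thesis using a' by simp
  qed
  obtain C1 where C1: "\<And>k. \<alpha>\<^sup>2 / 4 * (\<Sum>n\<in>trunc (2 ^ k). inv_norm_pow n) \<le> a' * ln 2 * real k + C1"
    using log_sum_upper[OF a'(1)] by blast
  obtain C where C: "\<And>F x y. finite F \<Longrightarrow> F \<subseteq> H \<Longrightarrow>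
    (\<integral>\<^sup>+p. ennreal (weight F (\<lambda>n. \<omega> n p) x powr (1 + s) * weight F (\<lambda>n. \<omega> n p) y powr 0) \<partial>M)
    \<le> ennreal (exp (\<alpha>\<^sup>2 / 4 * (\<Sum>n\<in>F. inv_norm_pow n * ((1 + s)\<^sup>2 + 0\<^sup>2 + 2 * (1 + s) * 0 * tcosd n x y - ((1 + s) + 0))) + C))"
    using phase_moment_bound[of "1 + s" 0] s by auto
  define \<delta> where "\<delta> = s * (\<beta> - a' * (1 + s))"
  have \<delta>: "0 < \<delta>" using s as by (simp add: \<delta>_def)
  define q where "q = 2 powr - \<delta>"
  have q: "0 < q" "q < 1" using powr_less_cancel_iff[of 2 "- \<delta>" 0] \<delta> by (auto simp: q_def)
  define D0 where "D0 = exp (s * (1 + s) * C1 + C)"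
  define D where "D = D0 / (1 - q)"
  have moment: "(\<integral>\<^sup>+p. ennreal (weight (trunc (2 ^ k)) (\<lambda>n. \<omega> n p) x powr (1 + s)) \<partial>M) \<le> ennreal (D0 * 2 powr (s * (1 + s) * a' * real k))" for k x
  proof -
    let ?S = "\<Sum>n\<in>trunc (2 ^ k). inv_norm_pow n"
    have "\<alpha>\<^sup>2 / 4 * (\<Sum>n\<in>trunc (2 ^ k). inv_norm_pow n * ((1 + s)\<^sup>2 + 0\<^sup>2 + 2 * (1 + s) * 0 * tcosd n x x - ((1 + s) + 0)))
        = s * (1 + s) * (\<alpha>\<^sup>2 / 4 * ?S)"
    proof -
      have "(1 + s)\<^sup>2 + 0\<^sup>2 + 2 * (1 + s) * 0 * tcosd n x x - ((1 + s) + 0) = s * (1 + s)" for n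
        by (simp add: power2_eq_square algebra_simps)
      then have "\<alpha>\<^sup>2 / 4 * (\<Sum>n\<in>trunc (2 ^ k). inv_norm_pow n * ((1 + s)\<^sup>2 + 0\<^sup>2 + 2 * (1 + s) * 0 * tcosd n x x - ((1 + s) + 0)))
          = \<alpha>\<^sup>2 / 4 * (\<Sum>n\<in>trunc (2 ^ k). inv_norm_pow n * (s * (1 + s)))" by (simp only:)
      then show ?thesis unfolding sum_distrib_right[symmetric] by (simp only: mult_ac)
    qed
    also have "\<dots> \<le> s * (1 + s) * (a' * ln 2 * real k + C1)"
      using s by (intro mult_left_mono C1) auto
    finally have "exp (\<alpha>\<^sup>2 / 4 * (\<Sum>n\<in>trunc (2 ^ k). inv_norm_pow n * ((1 + s)\<^sup>2 + 0\<^sup>2 + 2 * (1 + s) * 0 * tcosd n x x - ((1 + s) + 0))) + C)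
        \<le> exp (s * (1 + s) * (a' * ln 2 * real k + C1) + C)" by simp
    also have "\<dots> = D0 * 2 powr (s * (1 + s) * a' * real k)"
      by (simp add: D0_def powr_def exp_add[symmetric] algebra_simps)
    finally have "ennreal (exp (\<alpha>\<^sup>2 / 4 * (\<Sum>n\<in>trunc (2 ^ k). inv_norm_pow n * ((1 + s)\<^sup>2 + 0\<^sup>2 + 2 * (1 + s) * 0 * tcosd n x x - ((1 + s) + 0))) + C))
        \<le> ennreal (D0 * 2 powr (s * (1 + s) * a' * real k))" by (rule ennreal_leI)
    with C[OF finite_trunc trunc_subset, of "2 ^ k" x x] have
      "(\<integral>\<^sup>+p. ennreal (weight (trunc (2 ^ k)) (\<lambda>n. \<omega> n p) x powr (1 + s) * weight (trunc (2 ^ k)) (\<lambda>n. \<omega> n p) x powr 0) \<partial>M)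
        \<le> ennreal (D0 * 2 powr (s * (1 + s) * a' * real k))" by (rule order_trans)
    moreover have "weight F w x powr 0 = 1" for F w using weight_pos[of F w x] by simp
    ultimately show ?thesis by (simp only: mult_1_right)
  qed
  show ?thesis
  proof (rule that[OF s, of D])
    show "0 \<le> D" using q by (simp add: D_def D0_def)
    fix \<Lambda> :: real and K x assume \<Lambda>: "0 < \<Lambda>"
    let ?w = "\<lambda>k p. weight (trunc (2 ^ k)) (\<lambda>n. \<omega> n p) x"
    let ?T = "\<lambda>k. \<Lambda> * 2 powr (\<beta> * real k)"
    note [measurable] = measurable_weight_prob[OF trunc_subset]
    have T0: "0 < ?T k" for k using \<Lambda> by simp
    have one: "(\<integral>\<^sup>+p. ennreal (?w K p) * of_bool (?T k < ?w k p) \<partial>M) \<le> ennreal (\<Lambda> powr - s * D0 * q ^ k)"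
      if k: "k \<le> K" for k
    proof -
      let ?g = "\<lambda>w. of_bool (?T k < weight (trunc (2 ^ k)) w x) :: ennreal"
      have gm: "?g \<in> borel_measurable (PiM (trunc (2 ^ k)) (\<lambda>_. borel))"
      proof -
        note [measurable] = measurable_weight_PiM[OF order_refl, of "trunc (2 ^ k)" x]
        show ?thesis by measurable
      qed
      have "(2::nat) ^ k \<le> 2 ^ K" using k by (intro power_increasing) auto
      \<comment> \<open>The event depends only on the phases up to scale k, so the weight at scale K
        may be replaced by the one at scale k.\<close>
      from weight_martingale[OF this gm, of x]
      have "(\<integral>\<^sup>+p. ennreal (?w K p) * of_bool (?T k < ?w k p) \<partial>M) = (\<integral>\<^sup>+p. ennreal (?w k p) * of_bool (?T k < ?w k p) \<partial>M)"
        by (simp add: weight_phases)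
      also have "\<dots> \<le> (\<integral>\<^sup>+p. ennreal (?T k powr - s) * ennreal (?w k p powr (1 + s)) \<partial>M)"
      proof (rule nn_integral_mono)
        fix p
        show "ennreal (?w k p) * of_bool (?T k < ?w k p) \<le> ennreal (?T k powr - s) * ennreal (?w k p powr (1 + s))"
        proof (cases "?T k < ?w k p")
          case True
          have wp: "0 < ?w k p" by (rule weight_pos)
          have "?w k p powr - s \<le> ?T k powr - s" using True T0[of k] s by (intro powr_mono2') auto
          then have "?w k p powr - s * ?w k p powr (1 + s) \<le> ?T k powr - s * ?w k p powr (1 + s)"
            by (intro mult_right_mono) auto
          moreover have "?w k p powr - s * ?w k p powr (1 + s) = ?w k p"
            using wp by (simp add: powr_add[symmetric] del: powr_add)
          ultimately show ?thesis using True by (simp add: ennreal_mult[symmetric] ennreal_leI)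
        qed simp
      qed
      also have "\<dots> = ennreal (?T k powr - s) * (\<integral>\<^sup>+p. ennreal (?w k p powr (1 + s)) \<partial>M)"
        by (rule nn_integral_cmult) measurable
      also have "\<dots> \<le> ennreal (?T k powr - s) * ennreal (D0 * 2 powr (s * (1 + s) * a' * real k))"
        by (intro mult_left_mono moment) simp
      also have "\<dots> = ennreal (?T k powr - s * (D0 * 2 powr (s * (1 + s) * a' * real k)))"
        by (simp add: ennreal_mult[symmetric] D0_def)
      also have "?T k powr - s * (D0 * 2 powr (s * (1 + s) * a' * real k)) = \<Lambda> powr - s * D0 * q ^ k"
      proof -
        have "?T k powr - s = \<Lambda> powr - s * 2 powr (- s * \<beta> * real k)"
          using \<Lambda> by (simp add: powr_mult powr_powr mult_ac)
        moreover have "2 powr (- s * \<beta> * real k) * 2 powr (s * (1 + s) * a' * real k) = q ^ k"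
          using q by (simp add: q_def powr_realpow[symmetric] powr_powr powr_add[symmetric] \<delta>_def algebra_simps)
        ultimately show ?thesis by (simp add: mult_ac)
      qed
      finally show ?thesis .
    qed
    have "(\<integral>\<^sup>+p. ennreal (?w K p) * of_bool (\<not> controlled \<beta> \<Lambda> K x p) \<partial>M)
        \<le> (\<integral>\<^sup>+p. (\<Sum>k\<le>K. ennreal (?w K p) * of_bool (?T k < ?w k p)) \<partial>M)"
    proof (rule nn_integral_mono)
      fix p
      show "ennreal (?w K p) * of_bool (\<not> controlled \<beta> \<Lambda> K x p) \<le> (\<Sum>k\<le>K. ennreal (?w K p) * of_bool (?T k < ?w k p))"
      proof (cases "controlled \<beta> \<Lambda> K x p")
        case False
        then obtain k where k: "k \<le> K" "?T k < ?w k p" by (auto simp: controlled_def not_le)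
        then have "ennreal (?w K p) * of_bool (\<not> controlled \<beta> \<Lambda> K x p) = ennreal (?w K p) * of_bool (?T k < ?w k p)"
          using False by simp
        also have "\<dots> \<le> (\<Sum>k\<le>K. ennreal (?w K p) * of_bool (?T k < ?w k p))"
          using k(1) by (intro member_le_sum) auto
        finally show ?thesis .
      qed simp
    qed
    also have "\<dots> = (\<Sum>k\<le>K. \<integral>\<^sup>+p. ennreal (?w K p) * of_bool (?T k < ?w k p) \<partial>M)"
      by (rule nn_integral_sum) measurable
    also have "\<dots> \<le> (\<Sum>k\<le>K. ennreal (\<Lambda> powr - s * D0 * q ^ k))"
      by (intro sum_mono one) simp
    also have "\<dots> = ennreal (\<Sum>k\<le>K. \<Lambda> powr - s * D0 * q ^ k)"
      using q by (intro sum_ennreal) (simp add: D0_def)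
    also have "\<dots> \<le> ennreal (D * \<Lambda> powr - s)"
    proof (rule ennreal_leI)
      have "(\<Sum>k\<le>K. q ^ k) = (1 - q ^ Suc K) / (1 - q)" using q by (simp add: sum_gp0)
      also have "\<dots> \<le> 1 / (1 - q)" using q by (intro divide_right_mono) auto
      finally have "\<Lambda> powr - s * D0 * (\<Sum>k\<le>K. q ^ k) \<le> \<Lambda> powr - s * D0 * (1 / (1 - q))"
        by (intro mult_left_mono) (auto simp: D0_def)
      then show "(\<Sum>k\<le>K. \<Lambda> powr - s * D0 * q ^ k) \<le> D * \<Lambda> powr - s"
        by (simp add: sum_distrib_left D_def mult_ac)
    qed
    finally show "(\<integral>\<^sup>+p. ennreal (?w K p) * of_bool (\<not> controlled \<beta> \<Lambda> K x p) \<partial>M) \<le> ennreal (D * \<Lambda> powr - s)" .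
  qed
qed

section \<open>Regular measures keep their mass\<close>

text \<open>Split at the scale 2^-k comparable to |x - y|. Up to k the barrier bounds the weight at
  x by \<Lambda> 2^(\<beta> k), while the weight at y has mean 1; beyond k the two weights are
  almost uncorrelated, by cancellation in the cosine sums.\<close>

lemma two_point_bound:
  assumes \<beta>: "0 < \<beta>"
  obtains D where "0 < D" "\<And>\<Lambda> K x y. 0 < \<Lambda> \<Longrightarrow>
    (\<integral>\<^sup>+p. ennreal (weight (trunc (2 ^ K)) (\<lambda>n. \<omega> n p) y)
        * (ennreal (weight (trunc (2 ^ K)) (\<lambda>n. \<omega> n p) x) * of_bool (controlled \<beta> \<Lambda> K x p)) \<partial>M)
      \<le> ennreal (D * \<Lambda>) * (1 + riesz_kernel \<beta> x y)"
proof -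
  obtain C where C: "\<And>F x y. finite F \<Longrightarrow> F \<subseteq> H \<Longrightarrow>
    (\<integral>\<^sup>+p. ennreal (weight F (\<lambda>n. \<omega> n p) x powr 1 * weight F (\<lambda>n. \<omega> n p) y powr 1) \<partial>M)
    \<le> ennreal (exp (\<alpha>\<^sup>2 / 4 * (\<Sum>n\<in>F. inv_norm_pow n * (1\<^sup>2 + 1\<^sup>2 + 2 * 1 * 1 * tcosd n x y - (1 + 1))) + C))"
    using phase_moment_bound[of 1 1] by auto
  define E where "E = max 1 (exp (\<alpha>\<^sup>2 / 2 * (12 * 5 ^ CARD('n) * CARD('n)) + C))"
  have E1: "1 \<le> E" by (simp add: E_def)
  \<comment> \<open>For k = K no frequencies remain, so the distance condition is asked only for k <
    K.\<close>
  have tail: "(\<integral>\<^sup>+p. ennreal (weight (trunc (2 ^ K) - trunc (2 ^ k)) (\<lambda>n. \<omega> n p) x * weight (trunc (2 ^ K) - trunc (2 ^ k)) (\<lambda>n. \<omega> n p) y) \<partial>M) \<le> ennreal E"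
    if k: "k \<le> K" and d: "k < K \<Longrightarrow> (1/2) ^ k \<le> dist x y" for k K x y
  proof (cases "k < K")
    case True
    let ?G = "trunc (2 ^ K) - trunc (2 ^ k)"
    have G: "?G = {n. n \<in> H \<and> 2 ^ k < \<nu> n \<and> \<nu> n \<le> 2 ^ K}" by (auto simp: trunc_def)
    have "(\<Sum>n\<in>?G. inv_norm_pow n * (1\<^sup>2 + 1\<^sup>2 + 2 * 1 * 1 * tcosd n x y - (1 + 1))) = 2 * (\<Sum>n\<in>?G. inv_norm_pow n * tcosd n x y)"
      by (simp add: sum_distrib_left mult_ac)
    also have "\<dots> \<le> 2 * (12 * 5 ^ CARD('n) * CARD('n))"
      using lattice_tail_cos_sum[OF lattice_norm half d[OF True] k] unfolding G by linarith
    finally have "\<alpha>\<^sup>2 / 4 * (\<Sum>n\<in>?G. inv_norm_pow n * (1\<^sup>2 + 1\<^sup>2 + 2 * 1 * 1 * tcosd n x y - (1 + 1)))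
        \<le> \<alpha>\<^sup>2 / 4 * (2 * (12 * 5 ^ CARD('n) * CARD('n)))" by (intro mult_left_mono) auto
    then have "exp (\<alpha>\<^sup>2 / 4 * (\<Sum>n\<in>?G. inv_norm_pow n * (1\<^sup>2 + 1\<^sup>2 + 2 * 1 * 1 * tcosd n x y - (1 + 1))) + C) \<le> E"
      by (simp add: E_def le_max_iff_disj)
    then have le: "ennreal (exp (\<alpha>\<^sup>2 / 4 * (\<Sum>n\<in>?G. inv_norm_pow n * (1\<^sup>2 + 1\<^sup>2 + 2 * 1 * 1 * tcosd n x y - (1 + 1))) + C)) \<le> ennreal E"
      by (rule ennreal_leI)
    have "finite ?G" "?G \<subseteq> H" using finite_trunc trunc_subset by auto
    from order_trans[OF C[OF this, of x y] le] show ?thesis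
      using weight_nonneg by (simp only: powr_one)
  next
    case False
    then have empty: "trunc (2 ^ K) - trunc (2 ^ k) = {}" using k by simp
    show ?thesis unfolding empty weight_def using E1 by (simp add: emeasure_space_1)
  qed
  define D where "D = 2 powr \<beta> * E"
  have b1: "1 \<le> 2 powr \<beta>" using \<beta> by (intro ge_one_powr_ge_zero) auto
  have D0: "0 < D" using E1 by (simp add: D_def)
  show ?thesis
  proof (rule that[OF D0])
    fix \<Lambda> :: real and K x y assume \<Lambda>: "0 < \<Lambda>"
    let ?w = "\<lambda>k x p. weight (trunc (2 ^ k)) (\<lambda>n. \<omega> n p) x"
    let ?I = "\<integral>\<^sup>+p. ennreal (?w K y p) * (ennreal (?w K x p) * of_bool (controlled \<beta> \<Lambda> K x p)) \<partial>M"
    have step: "?I \<le> ennreal (\<Lambda> * 2 powr (\<beta> * real k)) * ennreal E"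
      if k: "k \<le> K" and d: "k < K \<Longrightarrow> (1/2) ^ k \<le> dist x y" for k
    proof -
      let ?F = "trunc (2 ^ k)" and ?G = "trunc (2 ^ K) - trunc (2 ^ k)"
      let ?v = "\<lambda>x p. weight ?G (\<lambda>n. \<omega> n p) x"
      have kK: "(2::nat) ^ k \<le> 2 ^ K" using k by (intro power_increasing) auto
      have "?I \<le> (\<integral>\<^sup>+p. ennreal (\<Lambda> * 2 powr (\<beta> * real k)) * (ennreal (weight ?F (phases ?F p) y) * ennreal (weight ?G (phases ?G p) x * weight ?G (phases ?G p) y)) \<partial>M)"
      proof (rule nn_integral_mono)
        fix p
        have wx: "?w K x p = ?w k x p * ?v x p" and wy: "?w K y p = ?w k y p * ?v y p"
          by (rule weight_trunc_split[OF kK])+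
        show "ennreal (?w K y p) * (ennreal (?w K x p) * of_bool (controlled \<beta> \<Lambda> K x p))
          \<le> ennreal (\<Lambda> * 2 powr (\<beta> * real k)) * (ennreal (weight ?F (phases ?F p) y) * ennreal (weight ?G (phases ?G p) x * weight ?G (phases ?G p) y))"
        proof (cases "controlled \<beta> \<Lambda> K x p")
          case True
          then have "?w k x p \<le> \<Lambda> * 2 powr (\<beta> * real k)" using k by (simp add: controlled_def)
          then have "?w k x p * (?w k y p * (?v x p * ?v y p)) \<le> (\<Lambda> * 2 powr (\<beta> * real k)) * (?w k y p * (?v x p * ?v y p))"
            using weight_nonneg by (intro mult_right_mono mult_nonneg_nonneg) auto
          moreover have "?w K y p * ?w K x p = ?w k x p * (?w k y p * (?v x p * ?v y p))"
            unfolding wx wy by (simp add: mult_ac)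
          ultimately have "ennreal (?w K y p * ?w K x p) \<le> ennreal ((\<Lambda> * 2 powr (\<beta> * real k)) * (?w k y p * (?v x p * ?v y p)))"
            by (intro ennreal_leI) simp
          then show ?thesis using True \<Lambda> weight_nonneg
            by (simp add: ennreal_mult weight_phases)
        qed simp
      qed
      also have "\<dots> = ennreal (\<Lambda> * 2 powr (\<beta> * real k)) * (\<integral>\<^sup>+p. ennreal (weight ?F (phases ?F p) y) * ennreal (weight ?G (phases ?G p) x * weight ?G (phases ?G p) y) \<partial>M)"
      proof (rule nn_integral_cmult)
        note [measurable] = measurable_weight_prob[OF trunc_subset, of "2 ^ k" y] measurable_weight_prob[of ?G x] measurable_weight_prob[of ?G y]
        have "?G \<subseteq> H" using trunc_subset by auto
        then show "(\<lambda>p. ennreal (weight ?F (phases ?F p) y) * ennreal (weight ?G (phases ?G p) x * weight ?G (phases ?G p) y)) \<in> borel_measurable M"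
          unfolding weight_phases by measurable
      qed
      also have "(\<integral>\<^sup>+p. ennreal (weight ?F (phases ?F p) y) * ennreal (weight ?G (phases ?G p) x * weight ?G (phases ?G p) y) \<partial>M)
          = (\<integral>\<^sup>+p. ennreal (weight ?F (phases ?F p) y) \<partial>M) * (\<integral>\<^sup>+p. ennreal (weight ?G (phases ?G p) x * weight ?G (phases ?G p) y) \<partial>M)"
      proof (rule phases_indep_nn_integral[where f = "\<lambda>w. ennreal (weight ?F w y)" and g = "\<lambda>w. ennreal (weight ?G w x * weight ?G w y)"])
        note [measurable] = measurable_weight_PiM[OF order_refl]
        show "(\<lambda>w. ennreal (weight ?F w y)) \<in> borel_measurable (PiM ?F (\<lambda>_. borel))" by measurable
        show "(\<lambda>w. ennreal (weight ?G w x * weight ?G w y)) \<in> borel_measurable (PiM ?G (\<lambda>_. borel))" by measurable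
      qed (use trunc_subset in auto)
      also have "\<dots> \<le> 1 * ennreal E"
      proof (rule mult_mono)
        show "(\<integral>\<^sup>+p. ennreal (weight ?F (phases ?F p) y) \<partial>M) \<le> 1"
          unfolding weight_phases by (simp add: mean_weight[OF finite_trunc trunc_subset])
        show "(\<integral>\<^sup>+p. ennreal (weight ?G (phases ?G p) x * weight ?G (phases ?G p) y) \<partial>M) \<le> ennreal E"
          unfolding weight_phases by (rule tail[OF k d])
      qed auto
      finally show ?thesis by (simp add: mult_left_mono)
    qed
    \<comment> \<open>The factor 2^\<beta> pays for rounding the distance to a dyadic scale, and the
      summand 1 for distances of at least 1, where k = 0.\<close>
    have fin: "?I \<le> ennreal (D * \<Lambda>) * (1 + riesz_kernel \<beta> x y)"
      if k: "k \<le> K" and d: "k < K \<Longrightarrow> (1/2) ^ k \<le> dist x y" and xy: "x \<noteq> y"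
        and b: "2 powr (\<beta> * real k) \<le> 2 powr \<beta> * (1 + dist x y powr - \<beta>)" for k
    proof -
      have "?I \<le> ennreal (\<Lambda> * 2 powr (\<beta> * real k)) * ennreal E" by (rule step[OF k d])
      also have "\<dots> = ennreal (\<Lambda> * 2 powr (\<beta> * real k) * E)" using \<Lambda> E1 by (simp add: ennreal_mult[symmetric])
      also have "\<dots> \<le> ennreal (\<Lambda> * (2 powr \<beta> * (1 + dist x y powr - \<beta>)) * E)"
        using b \<Lambda> E1 by (intro ennreal_leI mult_right_mono mult_left_mono) auto
      also have "\<Lambda> * (2 powr \<beta> * (1 + dist x y powr - \<beta>)) * E = (D * \<Lambda>) * (1 + dist x y powr - \<beta>)"
        by (simp add: D_def)
      also have "ennreal \<dots> = ennreal (D * \<Lambda>) * (1 + riesz_kernel \<beta> x y)"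
        using D0 \<Lambda> by (simp add: riesz_kernel_pos[OF xy] ennreal_mult[symmetric] ennreal_plus[symmetric] del: ennreal_plus flip: ennreal_1)
      finally show ?thesis .
    qed
    show "?I \<le> ennreal (D * \<Lambda>) * (1 + riesz_kernel \<beta> x y)"
    proof (cases "x = y")
      case True
      then show ?thesis using D0 \<Lambda> \<beta> by (simp add: riesz_kernel_diag ennreal_mult_top)
    next
      case False
      then have d0: "0 < dist x y" by simp
      show ?thesis
      proof (cases "dist x y < (1/2) ^ K")
        case True
        \<comment> \<open>Below the finest scale the barrier at K alone suffices, since 2^(\<beta>
          K) does not exceed the kernel.\<close>
        have "((1/2) ^ K) powr - \<beta> \<le> dist x y powr - \<beta>" using True d0 \<beta> by (intro powr_mono2') auto
        also have "\<dots> \<le> 2 powr \<beta> * (1 + dist x y powr - \<beta>)"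
        proof -
          have "1 * (1 + dist x y powr - \<beta>) \<le> 2 powr \<beta> * (1 + dist x y powr - \<beta>)" using b1 by (intro mult_right_mono) auto
          then show ?thesis by simp
        qed
        finally show ?thesis unfolding half_power_powr by (intro fin[of K] False) auto
      next
        case F2: False
        then have ex: "\<exists>k. (1/2) ^ k \<le> dist x y" by (intro exI[of _ K]) simp
        define k where "k = (LEAST k. (1/2) ^ k \<le> dist x y)"
        have k1: "(1/2) ^ k \<le> dist x y" unfolding k_def using ex by (rule LeastI_ex)
        have kK: "k \<le> K" unfolding k_def using F2 by (intro Least_le) simp
        have "2 powr (\<beta> * real k) \<le> 2 powr \<beta> * (1 + dist x y powr - \<beta>)"
        proof (cases k)
          case 0
          have "1 * 1 \<le> 2 powr \<beta> * (1 + dist x y powr - \<beta>)" using b1 by (intro mult_mono) auto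
          then show ?thesis using 0 by simp
        next
          case (Suc j)
          then have "\<not> (1/2) ^ j \<le> dist x y" unfolding k_def by (intro not_less_Least) simp
          then have "((1/2) ^ j) powr - \<beta> \<le> dist x y powr - \<beta>" using d0 \<beta> by (intro powr_mono2') auto
          then have "2 powr (\<beta> * real j) \<le> 1 + dist x y powr - \<beta>" unfolding half_power_powr by simp
          then have "2 powr \<beta> * 2 powr (\<beta> * real j) \<le> 2 powr \<beta> * (1 + dist x y powr - \<beta>)" by (intro mult_left_mono) auto
          moreover have "2 powr \<beta> * 2 powr (\<beta> * real j) = 2 powr (\<beta> * real k)"
            using Suc by (simp add: powr_add[symmetric] algebra_simps)
          ultimately show ?thesis by simp
        qed
        then show ?thesis using k1 kK by (intro fin[of k] False) auto
      qed
    qed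
  qed
qed

lemma measurable_controlled [measurable]:
  assumes \<sigma>: "\<sigma> \<in> torus_measures"
  shows "Measurable.pred (M \<Otimes>\<^sub>M \<sigma>) (\<lambda>z. controlled \<beta> \<Lambda> K (snd z) (fst z))"
proof -
  note [measurable] = measurable_weight_pair[OF trunc_subset \<sigma>]
  show ?thesis unfolding controlled_def by measurable
qed

text \<open>
  On \<open>controlled\<close> points the second moment is bounded by the energy; the uncontrolled points carry
  little mass. Together they give uniform integrability below the critical exponent.
\<close>

lemma total_uniformly_integrable:
  assumes \<sigma>: "\<sigma> \<in> torus_measures" and \<beta>: "critical < \<beta>" "0 < \<beta>" and en: "energy \<beta> \<sigma> < \<infinity>" and \<eta>: "0 < \<eta>"
  obtains C where "0 \<le> C" "\<And>K L. 0 < L \<Longrightarrow>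
    emeasure \<sigma> UNIV \<le> (\<integral>\<^sup>+p. min (total \<sigma> (2 ^ K) p) (ennreal L) \<partial>M) + ennreal \<eta> + ennreal (C / L)"
proof -
  interpret s: finite_measure \<sigma> by (rule torus_measuresD[OF \<sigma>])
  have sp: "space \<sigma> = UNIV" using torus_measuresD[OF \<sigma>] by simp
  define b where "b = measure \<sigma> UNIV"
  have b: "emeasure \<sigma> UNIV = ennreal b" "0 \<le> b" by (simp_all add: b_def s.emeasure_eq_measure)
  obtain s D where sD: "0 < s" "0 \<le> D" and unc: "\<And>\<Lambda> K x. 0 < \<Lambda> \<Longrightarrow>
    (\<integral>\<^sup>+p. ennreal (weight (trunc (2 ^ K)) (\<lambda>n. \<omega> n p) x) * of_bool (\<not> controlled \<beta> \<Lambda> K x p) \<partial>M)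
      \<le> ennreal (D * \<Lambda> powr - s)"
    using uncontrolled_mass[OF \<beta>(1)] by blast
  obtain D' where D': "0 < D'" and two: "\<And>\<Lambda> K x y. 0 < \<Lambda> \<Longrightarrow>
    (\<integral>\<^sup>+p. ennreal (weight (trunc (2 ^ K)) (\<lambda>n. \<omega> n p) y)
        * (ennreal (weight (trunc (2 ^ K)) (\<lambda>n. \<omega> n p) x) * of_bool (controlled \<beta> \<Lambda> K x p)) \<partial>M)
      \<le> ennreal (D' * \<Lambda>) * (1 + riesz_kernel \<beta> x y)"
    using two_point_bound[OF \<beta>(2)] by blast
  \<comment> \<open>Makes \<Lambda>^-s equal to 1 / (D b / \<eta> + 1), which brings D \<Lambda>^-s
    b below \<eta>; the + 1 keeps \<Lambda> positive when D b = 0.\<close>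
  define \<Lambda> where "\<Lambda> = (D * b / \<eta> + 1) powr (1 / s)"
  have \<Lambda>: "0 < \<Lambda>" using sD b \<eta> by (simp add: \<Lambda>_def add_nonneg_eq_0_iff)
  have \<Lambda>s: "D * \<Lambda> powr - s * b \<le> \<eta>"
  proof -
    have p: "0 < D * b / \<eta> + 1" using sD b \<eta> by (simp add: add_nonneg_pos)
    have "\<Lambda> powr - s = 1 / (D * b / \<eta> + 1)" using p sD by (simp add: \<Lambda>_def powr_powr powr_minus_divide)
    then have "D * \<Lambda> powr - s * b = D * b / (D * b / \<eta> + 1)" by simp
    also have "\<dots> \<le> \<eta>" using p \<eta> by (simp add: divide_le_eq field_simps)
    finally show ?thesis .
  qed
  obtain e where e: "energy \<beta> \<sigma> = ennreal e" "0 \<le> e"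
    using en by (cases "energy \<beta> \<sigma>" rule: ennreal_cases) auto
  define C where "C = D' * \<Lambda> * (b * b + e)"
  have C0: "0 \<le> C" using D' \<Lambda> b e by (simp add: C_def)
  show ?thesis
  proof (rule that[OF C0])
    fix K :: nat and L :: real assume L: "0 < L"
    let ?w = "\<lambda>x p. weight (trunc (2 ^ K)) (\<lambda>n. \<omega> n p) x"
    let ?c = "\<lambda>x p. of_bool (controlled \<beta> \<Lambda> K x p) :: ennreal"
    let ?u = "\<lambda>x p. of_bool (\<not> controlled \<beta> \<Lambda> K x p) :: ennreal"
    let ?t = "total \<sigma> (2 ^ K)"
    note [measurable] = measurable_weight_pair[OF trunc_subset \<sigma>] measurable_total[OF \<sigma>]
      measurable_controlled[OF \<sigma>]
    \<comment> \<open>J is the controlled and R the uncontrolled part of the total mass t. Only one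
      factor of the product J t carries the barrier, as in the two-point bound.\<close>
    define J where "J p = (\<integral>\<^sup>+x. ennreal (?w x p) * ?c x p \<partial>\<sigma>)" for p
    define R where "R p = (\<integral>\<^sup>+x. ennreal (?w x p) * ?u x p \<partial>\<sigma>)" for p
    have m1: "(\<lambda>z. ennreal (?w (snd z) (fst z)) * ?c (snd z) (fst z)) \<in> borel_measurable (M \<Otimes>\<^sub>M \<sigma>)" by measurable
    have m2: "(\<lambda>z. ennreal (?w (snd z) (fst z)) * ?u (snd z) (fst z)) \<in> borel_measurable (M \<Otimes>\<^sub>M \<sigma>)" by measurable
    have Jm [measurable]: "J \<in> borel_measurable M" unfolding J_def[abs_def]
      using m1 by (intro s.borel_measurable_nn_integral) (simp add: case_prod_beta)
    have Rm [measurable]: "R \<in> borel_measurable M" unfolding R_def[abs_def]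
      using m2 by (intro s.borel_measurable_nn_integral) (simp add: case_prod_beta)
    have split: "?t p = J p + R p" if p: "p \<in> space M" for p
    proof -
      have pm: "(\<lambda>x. (p, x)) \<in> measurable \<sigma> (M \<Otimes>\<^sub>M \<sigma>)" using p by (rule measurable_Pair1')
      have "J p + R p = (\<integral>\<^sup>+x. ennreal (?w x p) * ?c x p + ennreal (?w x p) * ?u x p \<partial>\<sigma>)"
        unfolding J_def R_def using measurable_compose[OF pm m1] measurable_compose[OF pm m2]
        by (intro nn_integral_add[symmetric]) simp_all
      also have "\<dots> = ?t p" unfolding total_def by (intro nn_integral_cong) auto
      finally show ?thesis ..
    qed
    have ER: "(\<integral>\<^sup>+p. R p \<partial>M) \<le> ennreal \<eta>"
    proof -
      have "(\<integral>\<^sup>+p. R p \<partial>M) = (\<integral>\<^sup>+x. \<integral>\<^sup>+p. ennreal (?w x p) * ?u x p \<partial>M \<partial>\<sigma>)"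
        unfolding R_def using nn_integral_swap[OF \<sigma> m2] by simp
      also have "\<dots> \<le> (\<integral>\<^sup>+x. ennreal (D * \<Lambda> powr - s) \<partial>\<sigma>)" by (intro nn_integral_mono unc \<Lambda>)
      also have "\<dots> = ennreal (D * \<Lambda> powr - s * b)" using sD b by (simp add: sp ennreal_mult[symmetric])
      also have "\<dots> \<le> ennreal \<eta>" by (rule ennreal_leI[OF \<Lambda>s])
      finally show ?thesis .
    qed
    have EJ: "(\<integral>\<^sup>+p. J p * ?t p \<partial>M) \<le> ennreal C"
    proof -
      have wc: "(\<lambda>p. ennreal (?w x p) * ?c x p) \<in> borel_measurable M" for x
      proof -
        note [measurable] = measurable_weight_prob[OF trunc_subset]
        show ?thesis unfolding controlled_def by measurable
      qed
      have "(\<integral>\<^sup>+p. J p * ?t p \<partial>M) = (\<integral>\<^sup>+p. \<integral>\<^sup>+x. ennreal (?w x p) * ?c x p * ?t p \<partial>\<sigma> \<partial>M)"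
      proof (rule nn_integral_cong)
        fix p assume p: "p \<in> space M"
        have pm: "(\<lambda>x. (p, x)) \<in> measurable \<sigma> (M \<Otimes>\<^sub>M \<sigma>)" using p by (rule measurable_Pair1')
        show "J p * ?t p = (\<integral>\<^sup>+x. ennreal (?w x p) * ?c x p * ?t p \<partial>\<sigma>)"
          unfolding J_def using measurable_compose[OF pm m1] by (intro nn_integral_multc[symmetric]) simp
      qed
      also have "\<dots> = (\<integral>\<^sup>+x. \<integral>\<^sup>+p. ennreal (?w x p) * ?c x p * ?t p \<partial>M \<partial>\<sigma>)"
      proof -
        have "(\<lambda>z. ennreal (?w (snd z) (fst z)) * ?c (snd z) (fst z) * ?t (fst z)) \<in> borel_measurable (M \<Otimes>\<^sub>M \<sigma>)" by measurable
        from nn_integral_swap[OF \<sigma> this] show ?thesis by simp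
      qed
      also have "\<dots> = (\<integral>\<^sup>+x. \<integral>\<^sup>+y. \<integral>\<^sup>+p. ennreal (?w y p) * (ennreal (?w x p) * ?c x p) \<partial>M \<partial>\<sigma> \<partial>\<sigma>)"
        using expected_total_with[OF \<sigma> wc, of "2 ^ K"] by (simp add: mult.commute)
      also have "\<dots> \<le> (\<integral>\<^sup>+x. \<integral>\<^sup>+y. ennreal (D' * \<Lambda>) * (1 + riesz_kernel \<beta> x y) \<partial>\<sigma> \<partial>\<sigma>)"
        by (intro nn_integral_mono two \<Lambda>)
      also have "\<dots> = (\<integral>\<^sup>+x. ennreal (D' * \<Lambda>) * (ennreal b + potential \<beta> \<sigma> x) \<partial>\<sigma>)"
      proof (rule nn_integral_cong)
        fix x
        have rm: "(\<lambda>y. riesz_kernel \<beta> x y) \<in> borel_measurable \<sigma>"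
          using measurable_riesz_kernel_snd by (simp add: measurable_cong_sets[OF torus_measuresD(2)[OF \<sigma>] refl])
        show "(\<integral>\<^sup>+y. ennreal (D' * \<Lambda>) * (1 + riesz_kernel \<beta> x y) \<partial>\<sigma>) = ennreal (D' * \<Lambda>) * (ennreal b + potential \<beta> \<sigma> x)"
          using rm by (simp add: nn_integral_cmult nn_integral_add potential_def sp b(1))
      qed
      also have "\<dots> = ennreal (D' * \<Lambda>) * (ennreal b * ennreal b + energy \<beta> \<sigma>)"
      proof -
        have "potential \<beta> \<sigma> \<in> borel_measurable \<sigma>"
          using measurable_potential[OF \<sigma>] by (simp add: measurable_cong_sets[OF torus_measuresD(2)[OF \<sigma>] refl])
        then show ?thesis by (simp add: nn_integral_cmult nn_integral_add energy_potential sp b(1))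
      qed
      also have "\<dots> = ennreal C"
        using D' \<Lambda> b e by (simp add: e(1) C_def ennreal_mult ennreal_plus)
      finally show ?thesis .
    qed
    have "emeasure \<sigma> UNIV = (\<integral>\<^sup>+p. ?t p \<partial>M)" by (rule expected_total[OF \<sigma>, symmetric])
    \<comment> \<open>Where t exceeds L, the controlled part satisfies J \<le> J t / L, and t = J +
      R.\<close>
    also have "\<dots> \<le> (\<integral>\<^sup>+p. min (?t p) (ennreal L) + R p + ennreal (1 / L) * (J p * ?t p) \<partial>M)"
    proof (rule nn_integral_mono)
      fix p assume p: "p \<in> space M"
      show "?t p \<le> min (?t p) (ennreal L) + R p + ennreal (1 / L) * (J p * ?t p)"
      proof (cases "?t p \<le> ennreal L")
        case True
        then have "?t p \<le> min (?t p) (ennreal L)" by simp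
        also have "\<dots> \<le> min (?t p) (ennreal L) + (R p + ennreal (1 / L) * (J p * ?t p))" by simp
        finally show ?thesis by (simp add: add.assoc)
      next
        case False
        have "ennreal (1 / L) * ennreal L = 1" using L by (simp add: ennreal_mult[symmetric])
        then have "J p = J p * (ennreal (1 / L) * ennreal L)" by simp
        also have "\<dots> = ennreal (1 / L) * (J p * ennreal L)" by (simp only: mult_ac)
        also have "\<dots> \<le> ennreal (1 / L) * (J p * ?t p)" using False by (intro mult_left_mono) auto
        finally have "J p + R p \<le> ennreal (1 / L) * (J p * ?t p) + R p" by (rule add_right_mono)
        also have "\<dots> \<le> min (?t p) (ennreal L) + R p + ennreal (1 / L) * (J p * ?t p)"
          by (simp add: add.commute add.left_commute add_increasing)
        finally show ?thesis using split[OF p] by simp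
      qed
    qed
    also have "\<dots> = (\<integral>\<^sup>+p. min (?t p) (ennreal L) \<partial>M) + (\<integral>\<^sup>+p. R p \<partial>M) + ennreal (1 / L) * (\<integral>\<^sup>+p. J p * ?t p \<partial>M)"
      by (simp add: nn_integral_add nn_integral_cmult)
    also have "\<dots> \<le> (\<integral>\<^sup>+p. min (?t p) (ennreal L) \<partial>M) + ennreal \<eta> + ennreal (1 / L) * ennreal C"
      by (intro add_mono order_refl ER mult_left_mono EJ) auto
    also have "ennreal (1 / L) * ennreal C = ennreal (C / L)" using L C0 by (simp add: ennreal_mult[symmetric])
    finally show "emeasure \<sigma> UNIV \<le> (\<integral>\<^sup>+p. min (?t p) (ennreal L) \<partial>M) + ennreal \<eta> + ennreal (C / L)" .
  qed
qed

text \<open>On a level set of the potential the energy is finite, so the totals of the restriction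
  keep their mean up to \<eta> after cutting at a high level L. Cut totals pass to the limit by
  dominated convergence, and the levels exhaust the set of finite potential.\<close>

lemma limit_mass_lower:
  assumes \<sigma>: "\<sigma> \<in> torus_measures" and \<beta>: "critical < \<beta>" "0 < \<beta>"
    and m: "m \<in> borel_measurable M" and lim: "AE p in M. (\<lambda>N. total \<sigma> N p) \<longlonglongrightarrow> m p"
  shows "emeasure \<sigma> {x. potential \<beta> \<sigma> x < \<infinity>} \<le> (\<integral>\<^sup>+p. m p \<partial>M)"
proof -
  have se: "sets \<sigma> = sets borel" by (rule torus_measuresD[OF \<sigma>])
  define G where "G k = {x. potential \<beta> \<sigma> x \<le> of_nat k}" for k :: nat
  have Gb: "G k \<in> sets borel" for k
    using measurable_sets[OF measurable_potential[OF \<sigma>, of \<beta>], of "{..of_nat k}"] by (simp add: G_def vimage_def)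
  have Ginc: "incseq G"
  proof (rule incseq_SucI)
    fix k
    have "(of_nat k :: ennreal) \<le> of_nat (Suc k)" by simp
    then show "G k \<subseteq> G (Suc k)" unfolding G_def using order_trans by blast
  qed
  have per: "emeasure \<sigma> (G k) \<le> (\<integral>\<^sup>+p. m p \<partial>M)" for k
  proof -
    let ?\<sigma> = "density \<sigma> (indicator (G k))"
    have \<sigma>': "?\<sigma> \<in> torus_measures" by (rule torus_measures_density_indicator[OF \<sigma> Gb])
    have mass: "emeasure ?\<sigma> UNIV = emeasure \<sigma> (G k)"
      using emeasure_restricted[of "G k" \<sigma> UNIV] Gb by (simp add: se)
    have en: "energy \<beta> ?\<sigma> < \<infinity>"
      by (rule energy_restrict_bounded_potential[OF \<sigma> Gb, of _ _ "real k"]) (simp add: G_def ennreal_of_nat_eq_real_of_nat)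
    have tle: "total ?\<sigma> N p \<le> total \<sigma> N p" for N p
      unfolding total_def using measurable_weight_space[OF \<sigma>] Gb
      by (subst nn_integral_density) (auto intro!: nn_integral_mono borel_measurable_indicator simp: se indicator_def)
    show ?thesis
    proof (rule ennreal_le_epsilon)
      fix \<eta> :: real assume \<eta>: "0 < \<eta>"
      then have \<eta>2: "0 < \<eta> / 2" by simp
      obtain C where C: "0 \<le> C" "\<And>K L. 0 < L \<Longrightarrow>
        emeasure ?\<sigma> UNIV \<le> (\<integral>\<^sup>+p. min (total ?\<sigma> (2 ^ K) p) (ennreal L) \<partial>M) + ennreal (\<eta> / 2) + ennreal (C / L)"
        using total_uniformly_integrable[OF \<sigma>' \<beta> en \<eta>2] by blast
      define L where "L = 2 * C / \<eta> + 1"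
      have L: "0 < L" using C \<eta> by (simp add: L_def add_nonneg_pos)
      have CL: "C / L \<le> \<eta> / 2" using L C \<eta> by (simp add: L_def divide_le_eq field_simps)
      have "(\<lambda>K. \<integral>\<^sup>+p. min (total \<sigma> (2 ^ K) p) (ennreal L) \<partial>M) \<longlonglongrightarrow> (\<integral>\<^sup>+p. min (m p) (ennreal L) \<partial>M)"
      proof (rule nn_integral_dominated_convergence[where w = "\<lambda>_. ennreal L"])
        note [measurable] = measurable_total[OF \<sigma>] m
        show "(\<lambda>p. min (total \<sigma> (2 ^ K) p) (ennreal L)) \<in> borel_measurable M" for K by measurable
        show "(\<lambda>p. min (m p) (ennreal L)) \<in> borel_measurable M" by measurable
        show "AE p in M. (\<lambda>K. min (total \<sigma> (2 ^ K) p) (ennreal L)) \<longlonglongrightarrow> min (m p) (ennreal L)"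
          using lim
        proof eventually_elim
          case (elim p)
          have "filterlim (\<lambda>k::nat. 2 ^ k :: nat) at_top sequentially"
            by (rule filterlim_subseq) (simp add: strict_mono_def)
          from filterlim_compose[OF elim this]
          show ?case by (intro tendsto_min tendsto_const)
        qed
      qed (auto simp: emeasure_space_1)
      then have lim': "(\<lambda>K. (\<integral>\<^sup>+p. min (total \<sigma> (2 ^ K) p) (ennreal L) \<partial>M) + ennreal \<eta>) \<longlonglongrightarrow> (\<integral>\<^sup>+p. min (m p) (ennreal L) \<partial>M) + ennreal \<eta>"
        by (intro tendsto_add tendsto_const)
      have "emeasure \<sigma> (G k) \<le> (\<integral>\<^sup>+p. min (m p) (ennreal L) \<partial>M) + ennreal \<eta>"
      proof (rule tendsto_lowerbound[OF lim'])
        show "eventually (\<lambda>K. emeasure \<sigma> (G k) \<le> (\<integral>\<^sup>+p. min (total \<sigma> (2 ^ K) p) (ennreal L) \<partial>M) + ennreal \<eta>) sequentially"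
        proof (intro always_eventually allI)
          fix K
          have "emeasure \<sigma> (G k) \<le> (\<integral>\<^sup>+p. min (total ?\<sigma> (2 ^ K) p) (ennreal L) \<partial>M) + ennreal (\<eta> / 2) + ennreal (C / L)"
            using C(2)[OF L] unfolding mass .
          also have "\<dots> \<le> (\<integral>\<^sup>+p. min (total \<sigma> (2 ^ K) p) (ennreal L) \<partial>M) + ennreal (\<eta> / 2) + ennreal (\<eta> / 2)"
            using tle CL by (intro add_mono nn_integral_mono min.mono ennreal_leI) auto
          also have "\<dots> = (\<integral>\<^sup>+p. min (total \<sigma> (2 ^ K) p) (ennreal L) \<partial>M) + ennreal \<eta>"
            using \<eta> by (simp add: add.assoc ennreal_plus[symmetric] del: ennreal_plus)
          finally show "emeasure \<sigma> (G k) \<le> (\<integral>\<^sup>+p. min (total \<sigma> (2 ^ K) p) (ennreal L) \<partial>M) + ennreal \<eta>" .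
        qed
      qed simp
      also have "\<dots> \<le> (\<integral>\<^sup>+p. m p \<partial>M) + ennreal \<eta>"
        by (intro add_right_mono nn_integral_mono) simp
      finally show "emeasure \<sigma> (G k) \<le> (\<integral>\<^sup>+p. m p \<partial>M) + ennreal \<eta>" .
    qed
  qed
  have "emeasure \<sigma> {x. potential \<beta> \<sigma> x < \<infinity>} = emeasure \<sigma> (\<Union>k. G k)"
    unfolding G_def ennreal_finite_levels ..
  also have "\<dots> = (SUP k. emeasure \<sigma> (G k))"
    using Gb Ginc by (intro SUP_emeasure_incseq[symmetric]) (auto simp: se)
  also have "\<dots> \<le> (\<integral>\<^sup>+p. m p \<partial>M)" by (intro SUP_least per)
  finally show ?thesis .
qed

section \<open>The expected chaotic operator\<close>

lemma random_measure_sets: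
  assumes \<sigma>: "\<sigma> \<in> torus_measures" and B: "B \<in> sets borel"
  shows "emeasure (random_measure \<sigma> p N) B = total (density \<sigma> (indicator B)) N p"
  unfolding random_measure_def chaos_partial_eq_weight total_def
  using measurable_weight_space[OF \<sigma>] torus_measuresD(2)[OF \<sigma>] B
  by (subst emeasure_density, simp, simp, subst nn_integral_density) (auto simp: mult.commute intro!: borel_measurable_indicator)

text \<open>The masses of a fixed Borel set are the totals of the restricted measure and form a
  nonnegative martingale.\<close>

lemma AE_convergent_random_measure:
  assumes \<sigma>: "\<sigma> \<in> torus_measures" and B: "B \<in> sets borel"
  shows "AE p in M. convergent (\<lambda>N. measure (random_measure \<sigma> p N) B)"
proof -
  let ?\<sigma> = "density \<sigma> (indicator B)"
  have \<sigma>': "?\<sigma> \<in> torus_measures" by (rule torus_measures_density_indicator[OF \<sigma> B])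
  define Y where "Y N p = enn2real (total ?\<sigma> N p)" for N p
  have YT: "ennreal (Y N p) = total ?\<sigma> N p" for N p
    using total_finite[OF \<sigma>'] by (simp add: Y_def ennreal_enn2real)
  let ?P = "\<lambda>n. PiM (trunc n) (\<lambda>_. borel :: 1 torus measure)"
  \<comment> \<open>The filtration generated by the phases in \<open>trunc n\<close>, pulled back
    from the product space.\<close>
  define F where "F n = vimage_algebra (space M) (phases (trunc n)) (?P n)" for n
  have ph: "phases (trunc n) \<in> measurable M (?P n)" for n by (rule measurable_phases[OF trunc_subset])
  have phs: "phases (trunc n) \<in> space M \<rightarrow> space (?P n)" for n using measurable_space[OF ph] by auto
  have setsF: "sets (F n) = {phases (trunc n) -` A \<inter> space M | A. A \<in> sets (?P n)}" for n
    unfolding F_def by (rule sets_vimage_algebra2[OF phs])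
  have res: "phases (trunc n) p = restrict (phases (trunc (Suc n)) p) (trunc n)" for n p
    using trunc_mono[of n "Suc n"] by (auto simp: phases_def restrict_def fun_eq_iff)
  have "AE p in M. convergent (\<lambda>N. Y N p)"
  proof (rule nonneg_martingale_convergence[where F = F])
    show "subalgebra M (F n)" for n
      unfolding subalgebra_def setsF using measurable_sets[OF ph[of n]] by (auto simp: F_def)
    show "subalgebra (F (Suc n)) (F n)" for n
      unfolding subalgebra_def
    proof
      show "space (F n) = space (F (Suc n))" by (simp add: F_def)
      show "sets (F n) \<subseteq> sets (F (Suc n))"
      proof
        fix G assume "G \<in> sets (F n)"
        then obtain A where A: "A \<in> sets (?P n)" "G = phases (trunc n) -` A \<inter> space M" unfolding setsF by blast
        have rm: "(\<lambda>w. restrict w (trunc n)) \<in> measurable (?P (Suc n)) (?P n)"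
          by (rule measurable_restrict_subset) (rule trunc_mono, simp)
        let ?A = "(\<lambda>w. restrict w (trunc n)) -` A \<inter> space (?P (Suc n))"
        have "?A \<in> sets (?P (Suc n))" by (rule measurable_sets[OF rm A(1)])
        moreover have "G = phases (trunc (Suc n)) -` ?A \<inter> space M"
          unfolding A(2) using phs[of "Suc n"] by (auto simp: res[symmetric])
        ultimately show "G \<in> sets (F (Suc n))" unfolding setsF by blast
      qed
    qed
    show "Y n \<in> borel_measurable (F n)" for n
    proof -
      have "phases (trunc n) \<in> measurable (F n) (?P n)"
        unfolding F_def by (rule measurable_vimage_algebra1[OF phs])
      from measurable_compose[OF this measurable_total_PiM[OF \<sigma>', of "trunc n"]]
      have "total ?\<sigma> n \<in> borel_measurable (F n)" unfolding total_phases[abs_def] .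
      then show ?thesis unfolding Y_def[abs_def] by measurable
    qed
    show Y0: "0 \<le> Y n p" for n p by (simp add: Y_def)
    have Ym [measurable]: "Y n \<in> borel_measurable M" for n
      unfolding Y_def[abs_def] using measurable_total[OF \<sigma>'] by measurable
    show int: "integrable M (Y n)" for n
    proof (rule integrableI_nonneg)
      show "(\<integral>\<^sup>+p. ennreal (Y n p) \<partial>M) < \<infinity>"
        unfolding YT expected_total[OF \<sigma>']
        using finite_measure.emeasure_finite[OF torus_measuresD(1)[OF \<sigma>']] by (simp add: less_top[symmetric])
    qed (auto simp: Y_def)
    show "(\<integral>p. indicator G p * Y (Suc n) p \<partial>M) = (\<integral>p. indicator G p * Y n p \<partial>M)" if G: "G \<in> sets (F n)" for n G
    proof -
      obtain A where A: "A \<in> sets (?P n)" "G = phases (trunc n) -` A \<inter> space M" using G unfolding setsF by blast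
      have GM [measurable]: "G \<in> sets M" unfolding A(2) by (rule measurable_sets[OF ph A(1)])
      have ind: "indicator G p = (indicator A (phases (trunc n) p) :: ennreal)" if "p \<in> space M" for p
        using that by (simp add: A(2) indicator_def)
      have gm: "(indicator A :: _ \<Rightarrow> ennreal) \<in> borel_measurable (?P n)" using A(1) by (rule borel_measurable_indicator)
      have hm: "(\<lambda>p. indicator A (phases (trunc n) p) :: ennreal) \<in> borel_measurable M"
        by (rule measurable_compose[OF ph gm])
      have eq: "(\<integral>\<^sup>+p. ennreal (indicator G p * Y k p) \<partial>M) = (\<integral>\<^sup>+p. total ?\<sigma> k p * indicator A (phases (trunc n) p) \<partial>M)" for k
      proof (rule nn_integral_cong)
        fix p assume p: "p \<in> space M"
        show "ennreal (indicator G p * Y k p) = total ?\<sigma> k p * indicator A (phases (trunc n) p)"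
          unfolding ind[OF p, symmetric] YT[symmetric] by (cases "p \<in> G") simp_all
      qed
      have "(\<integral>\<^sup>+p. ennreal (indicator G p * Y (Suc n) p) \<partial>M) = (\<integral>\<^sup>+p. ennreal (indicator G p * Y n p) \<partial>M)"
        unfolding eq expected_total_with[OF \<sigma>' hm] weight_martingale[OF le_SucI[OF order_refl] gm] ..
      then show ?thesis
        by (subst (1 2) integral_eq_nn_integral) (auto simp: Y0)
    qed
  qed
  moreover have "Y N p = measure (random_measure \<sigma> p N) B" for N p
    unfolding Y_def random_measure_sets[OF \<sigma> B, symmetric] measure_def ..
  ultimately show ?thesis by simp
qed

text \<open>Martingale convergence has an exceptional null set for each Borel set; the countable
  family \<open>\<C>\<close> suffices for weak convergence and keeps their union null.\<close>

lemma AE_weakly_converges: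
  assumes \<sigma>: "\<sigma> \<in> torus_measures"
  shows "AE p in M. weakly_converges (random_measure \<sigma> p) (limit_measure \<sigma> p)"
proof -
  obtain \<C> :: "'n torus set set" where \<C>: "countable \<C>" "\<C> \<subseteq> sets borel"
    and lim: "\<forall>\<mu> :: nat \<Rightarrow> 'n torus measure. (\<forall>N. finite_measure (\<mu> N) \<and> sets (\<mu> N) = sets borel) \<longrightarrow>
      (\<forall>C\<in>\<C>. convergent (\<lambda>N. measure (\<mu> N) C)) \<longrightarrow>
      (\<exists>\<kappa>. finite_measure \<kappa> \<and> sets \<kappa> = sets borel \<and>
        (\<forall>f :: 'n torus \<Rightarrow> real. continuous_on UNIV f \<longrightarrow> (\<lambda>N. \<integral>x. f x \<partial>\<mu> N) \<longlonglongrightarrow> (\<integral>x. f x \<partial>\<kappa>)))"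
    using compact_weak_limit[OF compact_UNIV_torus] by blast
  have "AE p in M. \<forall>C\<in>\<C>. convergent (\<lambda>N. measure (random_measure \<sigma> p N) C)"
    using \<C>(1)
  proof (rule AE_ball_countable[THEN iffD2, rule_format])
    fix C assume "C \<in> \<C>"
    then show "AE p in M. convergent (\<lambda>N. measure (random_measure \<sigma> p N) C)"
      using AE_convergent_random_measure[OF \<sigma>] \<C>(2) by blast
  qed
  then show ?thesis
  proof eventually_elim
    case (elim p)
    have "\<forall>N. finite_measure (random_measure \<sigma> p N) \<and> sets (random_measure \<sigma> p N) = sets borel"
      using torus_measuresD(1,2)[OF random_measure_torus[OF \<sigma>]] by simp
    from lim[rule_format, OF this[rule_format] elim[rule_format]] obtain \<kappa> where
      "finite_measure \<kappa>" "sets \<kappa> = sets borel"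
      "\<forall>f :: 'n torus \<Rightarrow> real. continuous_on UNIV f \<longrightarrow> (\<lambda>N. \<integral>x. f x \<partial>random_measure \<sigma> p N) \<longlonglongrightarrow> (\<integral>x. f x \<partial>\<kappa>)"
      by blast
    then have "weakly_converges (random_measure \<sigma> p) \<kappa>"
      by (simp add: weakly_converges_def torus_measures_def)
    then show ?case using limit_measure_eq by simp
  qed
qed

lemma limit_measure_torus: "limit_measure \<sigma> p \<in> torus_measures"
proof (cases rule: limit_measure_cases[of \<sigma> p])
  case 1
  then show ?thesis by (simp add: weakly_converges_def)
next
  case 2
  have "finite_measure (null_measure borel :: 'n torus measure)" by (rule finite_measureI) simp
  then show ?thesis using 2(2) by (simp add: torus_measures_def)
qed

text \<open>The set of weak convergence is only known to contain a measurable set of full measure.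
  With the value 0 outside that set, integrals of continuous functions become pointwise limits of
  measurable functions, and the masses of Borel sets follow.\<close>

lemma limit_measure_modification:
  assumes \<sigma>: "\<sigma> \<in> torus_measures"
  obtains \<kappa> where "AE p in M. limit_measure \<sigma> p = \<kappa> p" "\<And>p. \<kappa> p \<in> torus_measures"
    "\<And>B. B \<in> sets borel \<Longrightarrow> (\<lambda>p. emeasure (\<kappa> p) B) \<in> borel_measurable M"
proof -
  obtain N where N: "{p \<in> space M. \<not> weakly_converges (random_measure \<sigma> p) (limit_measure \<sigma> p)} \<subseteq> N" "N \<in> null_sets M"
    using AE_weakly_converges[OF \<sigma>] by (auto simp: eventually_ae_filter)
  define \<Omega> where "\<Omega> = space M - N"
  have \<Omega>: "\<Omega> \<in> sets M" using N(2) by (auto simp: \<Omega>_def)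
  have conv: "weakly_converges (random_measure \<sigma> p) (limit_measure \<sigma> p)" if "p \<in> \<Omega>" for p
    using that N(1) by (auto simp: \<Omega>_def)
  define \<kappa> where "\<kappa> p = (if p \<in> \<Omega> then limit_measure \<sigma> p else null_measure borel)" for p
  have null: "(null_measure borel :: 'n torus measure) \<in> torus_measures"
    by (auto simp: torus_measures_def intro!: finite_measureI)
  have \<kappa>t: "\<kappa> p \<in> torus_measures" for p using limit_measure_torus null by (simp add: \<kappa>_def)
  have mm: "(\<lambda>p. measure (\<kappa> p) B) \<in> borel_measurable M" if B: "B \<in> sets borel" for B
  proof (rule measurable_measure_kernel[OF torus_measuresD(1)[OF \<kappa>t] torus_measuresD(2)[OF \<kappa>t] _ B])
    fix f :: "'n torus \<Rightarrow> real" assume f: "continuous_on UNIV f" and f01: "\<And>x. 0 \<le> f x" "\<And>x. f x \<le> 1"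
    have fb: "f \<in> borel_measurable borel" by (rule borel_measurable_continuous_onI[OF f])
    have fs: "f \<in> borel_measurable \<sigma>" using fb by (simp add: measurable_cong_sets[OF torus_measuresD(2)[OF \<sigma>] refl])
    interpret s: finite_measure \<sigma> by (rule torus_measuresD[OF \<sigma>])
    have int: "(\<integral>x. f x \<partial>random_measure \<sigma> p N) = (\<integral>x. weight (trunc N) (\<lambda>n. \<omega> n p) x * f x \<partial>\<sigma>)" for p N
      unfolding random_measure_def chaos_partial_eq_weight
      using measurable_weight_space[OF \<sigma>] fs by (subst integral_density) (auto simp: weight_nonneg)
    have im: "(\<lambda>p. \<integral>x. weight (trunc N) (\<lambda>n. \<omega> n p) x * f x \<partial>\<sigma>) \<in> borel_measurable M" for N
    proof (rule s.borel_measurable_lebesgue_integral)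
      note [measurable] = measurable_weight_pair[OF trunc_subset \<sigma>, of N] fs
      show "(\<lambda>(p, x). weight (trunc N) (\<lambda>n. \<omega> n p) x * f x) \<in> borel_measurable (M \<Otimes>\<^sub>M \<sigma>)"
        unfolding case_prod_beta by measurable
    qed
    show "(\<lambda>p. \<integral>x. f x \<partial>\<kappa> p) \<in> borel_measurable M"
    proof (rule borel_measurable_LIMSEQ_real)
      show "(\<lambda>p. indicator \<Omega> p * (\<integral>x. weight (trunc N) (\<lambda>n. \<omega> n p) x * f x \<partial>\<sigma>)) \<in> borel_measurable M" for N
        using im \<Omega> by (intro borel_measurable_times borel_measurable_indicator)
      fix p
      show "(\<lambda>N. indicator \<Omega> p * (\<integral>x. weight (trunc N) (\<lambda>n. \<omega> n p) x * f x \<partial>\<sigma>)) \<longlonglongrightarrow> (\<integral>x. f x \<partial>\<kappa> p)"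
      proof (cases "p \<in> \<Omega>")
        case True
        from conv[OF True, unfolded weakly_converges_def, THEN conjunct2, rule_format, OF f]
        show ?thesis using True by (simp add: int \<kappa>_def)
      next
        case False
        then show ?thesis by (simp add: \<kappa>_def)
      qed
    qed
  qed
  show ?thesis
  proof (rule that[of \<kappa>])
    show "AE p in M. limit_measure \<sigma> p = \<kappa> p"
      using AE_not_in[OF N(2)] AE_space by eventually_elim (simp add: \<kappa>_def \<Omega>_def)
    show "(\<lambda>p. emeasure (\<kappa> p) B) \<in> borel_measurable M" if "B \<in> sets borel" for B
      using mm[OF that] finite_measure.emeasure_eq_measure[OF torus_measuresD(1)[OF \<kappa>t]] by simp
  qed (rule \<kappa>t)
qed

lemma sets_expected_chaos: "sets (expected_chaos M \<omega> \<alpha> trunc \<sigma>) = sets borel"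
  unfolding expected_chaos_def by (rule sets.sets_measure_of_eq)

text \<open>\<open>measure_of\<close> takes the prescribed values only if they are countably
  additive. Exchanging sum and integral requires the measurable modification.\<close>

lemma emeasure_expected_chaos:
  assumes \<sigma>: "\<sigma> \<in> torus_measures" and B: "B \<in> sets borel"
  shows "emeasure (expected_chaos M \<omega> \<alpha> trunc \<sigma>) B = (\<integral>\<^sup>+p. emeasure (limit_measure \<sigma> p) B \<partial>M)"
proof -
  obtain \<kappa> where \<kappa>: "AE p in M. limit_measure \<sigma> p = \<kappa> p" "\<And>p. \<kappa> p \<in> torus_measures"
    "\<And>B. B \<in> sets borel \<Longrightarrow> (\<lambda>p. emeasure (\<kappa> p) B) \<in> borel_measurable M"
    using limit_measure_modification[OF \<sigma>] by blast
  have eq: "(\<integral>\<^sup>+p. emeasure (limit_measure \<sigma> p) B \<partial>M) = (\<integral>\<^sup>+p. emeasure (\<kappa> p) B \<partial>M)" for B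
    by (rule nn_integral_cong_AE) (use \<kappa>(1) in \<open>eventually_elim, simp\<close>)
  have def: "expected_chaos M \<omega> \<alpha> trunc \<sigma> = measure_of (space borel) (sets borel) (\<lambda>B. \<integral>\<^sup>+p. emeasure (limit_measure \<sigma> p) B \<partial>M)"
    by (simp add: expected_chaos_def limit_measure_def)
  show ?thesis
  proof (rule emeasure_measure_of[OF def])
    show "sets borel \<subseteq> Pow (space borel)" by auto
    show "B \<in> sets (expected_chaos M \<omega> \<alpha> trunc \<sigma>)" using B by (simp add: sets_expected_chaos)
    show "positive (sets (expected_chaos M \<omega> \<alpha> trunc \<sigma>)) (\<lambda>B. \<integral>\<^sup>+p. emeasure (limit_measure \<sigma> p) B \<partial>M)"
      by (simp add: positive_def)
    show "countably_additive (sets (expected_chaos M \<omega> \<alpha> trunc \<sigma>)) (\<lambda>B. \<integral>\<^sup>+p. emeasure (limit_measure \<sigma> p) B \<partial>M)"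
    proof (rule countably_additiveI)
      fix A :: "nat \<Rightarrow> 'n torus set"
      assume "range A \<subseteq> sets (expected_chaos M \<omega> \<alpha> trunc \<sigma>)" and dis: "disjoint_family A"
      then have A: "range A \<subseteq> sets borel" by (simp add: sets_expected_chaos)
      have "(\<Sum>i. \<integral>\<^sup>+p. emeasure (\<kappa> p) (A i) \<partial>M) = (\<integral>\<^sup>+p. (\<Sum>i. emeasure (\<kappa> p) (A i)) \<partial>M)"
        using A \<kappa>(3) by (intro nn_integral_suminf[symmetric]) blast
      also have "\<dots> = (\<integral>\<^sup>+p. emeasure (\<kappa> p) (\<Union>i. A i) \<partial>M)"
        using A dis torus_measuresD(2)[OF \<kappa>(2)] by (intro nn_integral_cong suminf_emeasure) auto
      finally show "(\<Sum>i. \<integral>\<^sup>+p. emeasure (limit_measure \<sigma> p) (A i) \<partial>M) = (\<integral>\<^sup>+p. emeasure (limit_measure \<sigma> p) (\<Union>i. A i) \<partial>M)"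
        unfolding eq .
    qed
  qed
qed

lemma expected_chaos_upper:
  assumes "\<sigma> \<in> torus_measures" "0 \<le> \<beta>" "\<beta> < critical"
  shows "emeasure (expected_chaos M \<omega> \<alpha> trunc \<sigma>) UNIV \<le> emeasure \<sigma> {x. potential \<beta> \<sigma> x < \<infinity>}"
  using limit_mass_upper[OF assms] by (simp add: emeasure_expected_chaos[OF assms(1)])

lemma expected_chaos_lower:
  assumes \<sigma>: "\<sigma> \<in> torus_measures" and \<beta>: "critical < \<beta>" "0 < \<beta>"
  shows "emeasure \<sigma> {x. potential \<beta> \<sigma> x < \<infinity>} \<le> emeasure (expected_chaos M \<omega> \<alpha> trunc \<sigma>) UNIV"
proof -
  obtain \<kappa> where \<kappa>: "AE p in M. limit_measure \<sigma> p = \<kappa> p" "\<And>p. \<kappa> p \<in> torus_measures"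
    "\<And>B. B \<in> sets borel \<Longrightarrow> (\<lambda>p. emeasure (\<kappa> p) B) \<in> borel_measurable M"
    using limit_measure_modification[OF \<sigma>] by blast
  have "emeasure \<sigma> {x. potential \<beta> \<sigma> x < \<infinity>} \<le> (\<integral>\<^sup>+p. emeasure (\<kappa> p) UNIV \<partial>M)"
  proof (rule limit_mass_lower[OF \<sigma> \<beta>])
    show "(\<lambda>p. emeasure (\<kappa> p) UNIV) \<in> borel_measurable M" by (rule \<kappa>(3)) simp
    show "AE p in M. (\<lambda>N. total \<sigma> N p) \<longlonglongrightarrow> emeasure (\<kappa> p) UNIV"
      using \<kappa>(1) AE_weakly_converges[OF \<sigma>]
    proof eventually_elim
      case (elim p)
      then show ?case using weakly_converges_total[OF \<sigma>] by metis
    qed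
  qed
  also have "\<dots> = (\<integral>\<^sup>+p. emeasure (limit_measure \<sigma> p) UNIV \<partial>M)"
    by (rule nn_integral_cong_AE) (use \<kappa>(1) in \<open>eventually_elim, simp\<close>)
  finally show ?thesis by (simp add: emeasure_expected_chaos[OF \<sigma>])
qed

section \<open>Domination of the expected measure by the original one\<close>

text \<open>For a tent function f above the indicator of \<open>C\<close>, weak convergence and
  Fatou's lemma bound the expected integral of f by its integral against \<sigma>, as every weight
  has mean 1. Letting f decrease to the indicator gives the claim.\<close>

lemma expected_chaos_le_closed:
  assumes \<sigma>: "\<sigma> \<in> torus_measures" and C: "closed C"
  shows "emeasure (expected_chaos M \<omega> \<alpha> trunc \<sigma>) C \<le> emeasure \<sigma> C"
proof (cases "C = {}")
  case False
  interpret s: finite_measure \<sigma> by (rule torus_measuresD[OF \<sigma>])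
  have se: "sets \<sigma> = sets borel" by (rule torus_measuresD[OF \<sigma>])
  have Cb: "C \<in> sets borel" using C by (rule borel_closed)
  define f where "f k x = max 0 (1 - real k * infdist x C)" for k :: nat and x
  have fc: "continuous_on UNIV (f k)" for k unfolding f_def by (intro continuous_intros)
  have f01: "0 \<le> f k x" "f k x \<le> 1" for k x by (auto simp: f_def infdist_nonneg)
  have fb: "f k \<in> borel_measurable borel" for k by (rule borel_measurable_continuous_onI[OF fc])
  have fm: "f k \<in> borel_measurable \<mu>" if "\<mu> \<in> torus_measures" for k \<mu>
    using fb by (simp add: measurable_cong_sets[OF torus_measuresD(2)[OF that] refl])
  have fi: "integrable \<mu> (f k)" if "\<mu> \<in> torus_measures" for \<mu> k
    using fm[OF that] f01 by (intro finite_measure.integrable_const_bound[OF torus_measuresD(1)[OF that], where B = 1]) auto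
  have nn: "(\<integral>\<^sup>+x. ennreal (f k x) \<partial>\<mu>) = ennreal (\<integral>x. f k x \<partial>\<mu>)" if "\<mu> \<in> torus_measures" for \<mu> k
    using fi[OF that] f01 by (intro nn_integral_eq_integral) auto
  have per: "emeasure (expected_chaos M \<omega> \<alpha> trunc \<sigma>) C \<le> ennreal (\<integral>x. f k x \<partial>\<sigma>)" for k
  proof -
    let ?g = "\<lambda>N p. \<integral>\<^sup>+x. ennreal (weight (trunc N) (\<lambda>n. \<omega> n p) x) * ennreal (f k x) \<partial>\<sigma>"
    note [measurable] = measurable_weight_pair[OF trunc_subset \<sigma>] fm[OF \<sigma>] measurable_weight_prob[OF trunc_subset]
    have m2: "(\<lambda>z. ennreal (weight (trunc N) (\<lambda>n. \<omega> n (fst z)) (snd z)) * ennreal (f k (snd z))) \<in> borel_measurable (M \<Otimes>\<^sub>M \<sigma>)" for N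
      by measurable
    have gm: "?g N \<in> borel_measurable M" for N
      using m2[of N] by (intro s.borel_measurable_nn_integral) (simp add: case_prod_beta)
    have gi: "(\<integral>\<^sup>+p. ?g N p \<partial>M) = ennreal (\<integral>x. f k x \<partial>\<sigma>)" for N
    proof -
      have "(\<integral>\<^sup>+p. ?g N p \<partial>M) = (\<integral>\<^sup>+x. \<integral>\<^sup>+p. ennreal (weight (trunc N) (\<lambda>n. \<omega> n p) x) * ennreal (f k x) \<partial>M \<partial>\<sigma>)"
        using nn_integral_swap[OF \<sigma> m2] by simp
      also have "\<dots> = (\<integral>\<^sup>+x. ennreal (f k x) \<partial>\<sigma>)"
        by (simp add: nn_integral_multc mean_weight[OF finite_trunc trunc_subset])
      finally show ?thesis by (simp add: nn[OF \<sigma>])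
    qed
    have gr: "?g N p = ennreal (\<integral>x. f k x \<partial>random_measure \<sigma> p N)" for N p
      unfolding nn[OF random_measure_torus[OF \<sigma>], symmetric] unfolding random_measure_def chaos_partial_eq_weight
      using measurable_weight_space[OF \<sigma>] fm[OF \<sigma>] by (subst nn_integral_density) auto
    have "emeasure (expected_chaos M \<omega> \<alpha> trunc \<sigma>) C = (\<integral>\<^sup>+p. emeasure (limit_measure \<sigma> p) C \<partial>M)"
      by (rule emeasure_expected_chaos[OF \<sigma> Cb])
    also have "\<dots> \<le> (\<integral>\<^sup>+p. liminf (\<lambda>N. ?g N p) \<partial>M)"
    proof (rule nn_integral_mono_AE)
      show "AE p in M. emeasure (limit_measure \<sigma> p) C \<le> liminf (\<lambda>N. ?g N p)"
        using AE_weakly_converges[OF \<sigma>]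
      proof eventually_elim
        case (elim p)
        let ?\<kappa> = "limit_measure \<sigma> p"
        have \<kappa>: "?\<kappa> \<in> torus_measures" by (rule limit_measure_torus)
        have "(\<lambda>N. ennreal (\<integral>x. f k x \<partial>random_measure \<sigma> p N)) \<longlonglongrightarrow> ennreal (\<integral>x. f k x \<partial>?\<kappa>)"
          by (intro tendsto_ennrealI elim[unfolded weakly_converges_def, THEN conjunct2, rule_format, OF fc])
        then have "liminf (\<lambda>N. ?g N p) = ennreal (\<integral>x. f k x \<partial>?\<kappa>)"
          unfolding gr by (intro lim_imp_Liminf) simp
        moreover have "emeasure ?\<kappa> C \<le> (\<integral>\<^sup>+x. ennreal (f k x) \<partial>?\<kappa>)"
        proof -
          have "emeasure ?\<kappa> C = (\<integral>\<^sup>+x. indicator C x \<partial>?\<kappa>)" using Cb torus_measuresD(2)[OF \<kappa>] by simp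
          also have "\<dots> \<le> (\<integral>\<^sup>+x. ennreal (f k x) \<partial>?\<kappa>)"
            by (intro nn_integral_mono) (auto simp: indicator_def f_def)
          finally show ?thesis .
        qed
        ultimately show ?case by (simp add: nn[OF \<kappa>])
      qed
    qed
    also have "\<dots> \<le> liminf (\<lambda>N. \<integral>\<^sup>+p. ?g N p \<partial>M)" by (rule nn_integral_liminf[OF gm])
    also have "\<dots> = ennreal (\<integral>x. f k x \<partial>\<sigma>)" unfolding gi by (simp add: Liminf_const)
    finally show ?thesis .
  qed
  have "(\<lambda>k. ennreal (\<integral>x. f k x \<partial>\<sigma>)) \<longlonglongrightarrow> ennreal (measure \<sigma> C)"
    unfolding f_def by (intro tendsto_ennrealI measure_closed_LIMSEQ[OF s.finite_measure_axioms se C False])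
  then have "emeasure (expected_chaos M \<omega> \<alpha> trunc \<sigma>) C \<le> ennreal (measure \<sigma> C)"
    by (rule tendsto_lowerbound) (use per in auto)
  then show ?thesis by (simp add: s.emeasure_eq_measure)
qed simp

text \<open>Inner regularity of the expected measure reduces Borel sets to compact ones.\<close>

lemma expected_chaos_le:
  assumes \<sigma>: "\<sigma> \<in> torus_measures" and B: "B \<in> sets borel"
  shows "emeasure (expected_chaos M \<omega> \<alpha> trunc \<sigma>) B \<le> emeasure \<sigma> B"
proof -
  let ?E = "expected_chaos M \<omega> \<alpha> trunc \<sigma>"
  interpret s: finite_measure \<sigma> by (rule torus_measuresD[OF \<sigma>])
  have spE: "space ?E = UNIV" using sets_eq_imp_space_eq[OF sets_expected_chaos] by simp
  have "emeasure ?E UNIV \<le> emeasure \<sigma> UNIV" by (rule expected_chaos_le_closed[OF \<sigma>]) simp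
  then have fin: "emeasure ?E (space ?E) \<noteq> \<infinity>" using s.emeasure_finite[of UNIV] by (auto simp: spE top_unique)
  have "emeasure ?E B = (SUP K\<in>{K. K \<subseteq> B \<and> compact K}. emeasure ?E K)"
    by (rule inner_regular[OF sets_expected_chaos fin B])
  also have "\<dots> \<le> emeasure \<sigma> B"
  proof (rule SUP_least)
    fix K assume K: "K \<in> {K. K \<subseteq> B \<and> compact K}"
    have "emeasure ?E K \<le> emeasure \<sigma> K"
      using K by (intro expected_chaos_le_closed[OF \<sigma>] compact_imp_closed) auto
    also have "\<dots> \<le> emeasure \<sigma> B" using K B torus_measuresD(2)[OF \<sigma>] by (intro emeasure_mono) auto
    finally show "emeasure ?E K \<le> emeasure \<sigma> B" .
  qed
  finally show ?thesis .
qed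

text \<open>Mass lost on B cannot be regained on the complement, where the expected measure is
  dominated as well.\<close>

lemma expected_chaos_fixed:
  assumes \<sigma>: "\<sigma> \<in> torus_measures" and mass: "emeasure \<sigma> UNIV \<le> emeasure (expected_chaos M \<omega> \<alpha> trunc \<sigma>) UNIV"
  shows "expected_chaos M \<omega> \<alpha> trunc \<sigma> = \<sigma>"
proof (rule measure_eqI)
  let ?E = "expected_chaos M \<omega> \<alpha> trunc \<sigma>"
  interpret s: finite_measure \<sigma> by (rule torus_measuresD[OF \<sigma>])
  have se: "sets \<sigma> = sets borel" by (rule torus_measuresD[OF \<sigma>])
  show "sets ?E = sets \<sigma>" by (simp add: sets_expected_chaos se)
  fix B assume "B \<in> sets ?E"
  then have B: "B \<in> sets borel" "- B \<in> sets borel" by (auto simp: sets_expected_chaos)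
  have "emeasure \<sigma> B + emeasure \<sigma> (- B) = emeasure \<sigma> (B \<union> - B)"
    using B by (intro plus_emeasure) (auto simp: se)
  also have "\<dots> \<le> emeasure ?E (B \<union> - B)" using mass by simp
  also have "\<dots> = emeasure ?E B + emeasure ?E (- B)"
    using B by (intro plus_emeasure[symmetric]) (auto simp: sets_expected_chaos)
  also have "\<dots> \<le> emeasure ?E B + emeasure \<sigma> (- B)"
    by (intro add_left_mono expected_chaos_le[OF \<sigma> B(2)])
  finally have "emeasure \<sigma> B \<le> emeasure ?E B"
    using s.emeasure_finite[of "- B"] by (simp add: add.commute ennreal_add_left_cancel_le)
  then show "emeasure ?E B = emeasure \<sigma> B" using expected_chaos_le[OF \<sigma> B(1)] by simp
qed

section \<open>The four inclusions\<close>

lemma potential_level_sets: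
  assumes "\<sigma> \<in> torus_measures"
  shows "{x. potential \<beta> \<sigma> x < \<infinity>} \<in> sets borel" "{x. potential \<beta> \<sigma> x = \<infinity>} \<in> sets borel"
  using measurable_sets[OF measurable_potential[OF assms, of \<beta>], of "{..<\<infinity>}"]
    measurable_sets[OF measurable_potential[OF assms, of \<beta>], of "{\<infinity>}"] by (simp_all add: vimage_def)

lemma emeasure_split_potential:
  assumes \<sigma>: "\<sigma> \<in> torus_measures"
  shows "emeasure \<sigma> UNIV = emeasure \<sigma> {x. potential \<beta> \<sigma> x < \<infinity>} + emeasure \<sigma> {x. potential \<beta> \<sigma> x = \<infinity>}"
proof -
  have "{x. potential \<beta> \<sigma> x < \<infinity>} \<inter> {x. potential \<beta> \<sigma> x = \<infinity>} = {}"
    "{x. potential \<beta> \<sigma> x < \<infinity>} \<union> {x. potential \<beta> \<sigma> x = \<infinity>} = UNIV" by (auto simp: less_top[symmetric])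
  then show ?thesis
    using plus_emeasure[of "{x. potential \<beta> \<sigma> x < \<infinity>}" \<sigma> "{x. potential \<beta> \<sigma> x = \<infinity>}"] potential_level_sets[OF \<sigma>]
    by (simp add: torus_measuresD(2)[OF \<sigma>])
qed

lemma sing_minus_subset_Ker: "sing_minus critical \<subseteq> Ker_expected_chaos M \<omega> \<alpha> trunc"
proof
  fix \<sigma> :: "'n torus measure" assume "\<sigma> \<in> sing_minus critical"
  then obtain \<beta> where \<beta>: "0 \<le> \<beta>" "\<beta> < critical" "\<sigma> \<in> sing \<beta>" by (auto simp: sing_minus_def)
  then have \<sigma>: "\<sigma> \<in> torus_measures" by (simp add: sing_def)
  let ?E = "expected_chaos M \<omega> \<alpha> trunc \<sigma>"
  have E0: "emeasure ?E UNIV = 0"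
    using expected_chaos_upper[OF \<sigma> \<beta>(1,2)] \<beta>(3) sing_iff[OF \<sigma> \<beta>(1)] by simp
  have "?E = null_measure borel"
  proof (rule measure_eqI)
    fix B assume "B \<in> sets ?E"
    have "emeasure ?E B \<le> emeasure ?E UNIV" by (intro emeasure_mono) (auto simp: sets_expected_chaos)
    then show "emeasure ?E B = emeasure (null_measure borel) B" using E0 by simp
  qed (simp add: sets_expected_chaos)
  then show "\<sigma> \<in> Ker_expected_chaos M \<omega> \<alpha> trunc" using \<sigma> by (simp add: Ker_expected_chaos_def)
qed

lemma Ker_subset_sing_plus: "Ker_expected_chaos M \<omega> \<alpha> trunc \<subseteq> sing_plus critical"
proof
  fix \<sigma> :: "'n torus measure" assume "\<sigma> \<in> Ker_expected_chaos M \<omega> \<alpha> trunc"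
  then have \<sigma>: "\<sigma> \<in> torus_measures" and null: "expected_chaos M \<omega> \<alpha> trunc \<sigma> = null_measure borel"
    by (auto simp: Ker_expected_chaos_def)
  have "\<sigma> \<in> sing \<beta>" if \<beta>: "critical < \<beta>" for \<beta>
  proof -
    have b0: "0 < \<beta>" using \<beta> critical_nonneg by linarith
    have "emeasure \<sigma> {x. potential \<beta> \<sigma> x < \<infinity>} = 0"
      using expected_chaos_lower[OF \<sigma> \<beta> b0] by (simp add: null)
    then show ?thesis using sing_iff[OF \<sigma>, of \<beta>] b0 by simp
  qed
  then show "\<sigma> \<in> sing_plus critical" using \<sigma> by (auto simp: sing_plus_def)
qed

lemma reg_plus_subset_Im: "reg_plus critical \<subseteq> Im_expected_chaos M \<omega> \<alpha> trunc"
proof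
  fix \<sigma> :: "'n torus measure" assume "\<sigma> \<in> reg_plus critical"
  then obtain \<beta> where \<beta>: "0 \<le> \<beta>" "critical < \<beta>" "\<sigma> \<in> reg \<beta>" by (auto simp: reg_plus_def)
  then have \<sigma>: "\<sigma> \<in> torus_measures" by (simp add: reg_def)
  have b0: "0 < \<beta>" using \<beta> critical_nonneg by linarith
  have "emeasure \<sigma> UNIV \<le> emeasure (expected_chaos M \<omega> \<alpha> trunc \<sigma>) UNIV"
    using expected_chaos_lower[OF \<sigma> \<beta>(2) b0] emeasure_split_potential[OF \<sigma>, of \<beta>]
      reg_imp_finite_potential[OF \<beta>(3,1)] by simp
  then show "\<sigma> \<in> Im_expected_chaos M \<omega> \<alpha> trunc"
    using \<sigma> expected_chaos_fixed by (simp add: Im_expected_chaos_def)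
qed

text \<open>A fixed point loses no mass, so the upper bound below the critical exponent leaves
  nothing for the set of infinite potential.\<close>

lemma Im_subset_reg_minus: "Im_expected_chaos M \<omega> \<alpha> trunc \<subseteq> reg_minus critical"
proof
  fix \<sigma> :: "'n torus measure" assume "\<sigma> \<in> Im_expected_chaos M \<omega> \<alpha> trunc"
  then have \<sigma>: "\<sigma> \<in> torus_measures" and fixed: "expected_chaos M \<omega> \<alpha> trunc \<sigma> = \<sigma>"
    by (auto simp: Im_expected_chaos_def)
  interpret s: finite_measure \<sigma> by (rule torus_measuresD[OF \<sigma>])
  have "\<sigma> \<in> reg \<beta>" if \<beta>: "0 \<le> \<beta>" "\<beta> < critical" for \<beta>
  proof (rule finite_potential_imp_reg[OF \<sigma> \<beta>(1)])
    let ?F = "{x. potential \<beta> \<sigma> x < \<infinity>}" and ?I = "{x. potential \<beta> \<sigma> x = \<infinity>}"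
    have "emeasure \<sigma> ?F + emeasure \<sigma> ?I \<le> emeasure \<sigma> ?F + 0"
      using expected_chaos_upper[OF \<sigma> \<beta>] emeasure_split_potential[OF \<sigma>, of \<beta>] by (simp add: fixed)
    then show "emeasure \<sigma> ?I = 0"
      using s.emeasure_finite[of ?F] by (simp only: ennreal_add_left_cancel_le) auto
  qed
  then show "\<sigma> \<in> reg_minus critical" using \<sigma> by (auto simp: reg_minus_def)
qed

end

theorem theorem1p3:
  fixes M :: "'w measure"
    and H :: "(int ^ 'n) set"
    and \<omega> :: "int ^ 'n \<Rightarrow> 'w \<Rightarrow> 1 torus"
    and A :: "nat \<Rightarrow> (int ^ 'n) set"
    and \<alpha> :: real
  assumes "prob_space M"
    and "half_lattice H"
    and "prob_space.indep_vars M (\<lambda>_. borel) \<omega> H"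
    and "\<And>n. n \<in> H \<Longrightarrow> distr M borel (\<omega> n) = circle_uniform"
    and "A = cube_trunc H \<or> A = ball_trunc H"
  shows "sing_minus (tau CARD('n) * \<alpha>\<^sup>2 / 4) \<subseteq> Ker_expected_chaos M \<omega> \<alpha> A
    \<and> Ker_expected_chaos M \<omega> \<alpha> A \<subseteq> sing_plus (tau CARD('n) * \<alpha>\<^sup>2 / 4)
    \<and> reg_plus (tau CARD('n) * \<alpha>\<^sup>2 / 4) \<subseteq> Im_expected_chaos M \<omega> \<alpha> A
    \<and> Im_expected_chaos M \<omega> \<alpha> A \<subseteq> reg_minus (tau CARD('n) * \<alpha>\<^sup>2 / 4)"
proof -
  \<comment> \<open>Both truncations are sublevel sets of a lattice norm, so one instance of the
    locale serves each of them.\<close>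
  have main: ?thesis if \<nu>: "lattice_norm \<nu>" and A: "A = (\<lambda>N. {n \<in> H. \<nu> n \<le> real N})" for \<nu>
  proof -
    interpret chaos_phases M H \<omega> \<alpha> \<nu>
      using assms(1-4) \<nu> by (intro chaos_phases.intro chaos_phases_axioms.intro) auto
    have "A = trunc" unfolding A trunc_def[abs_def] ..
    then show ?thesis
      using sing_minus_subset_Ker Ker_subset_sing_plus reg_plus_subset_Im Im_subset_reg_minus
      by (simp add: critical_def)
  qed
  from assms(5) show ?thesis
  proof
    assume A: "A = cube_trunc H"
    have "k \<le> int N \<longleftrightarrow> real_of_int k \<le> real N" for k N by linarith
    then have "A = (\<lambda>N. {n \<in> H. real_of_int (MAX j. \<bar>n $ j\<bar>) \<le> real N})"
      unfolding A by (intro ext) (simp only: cube_trunc_def)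
    then show ?thesis by (rule main[OF lattice_norm_max])
  next
    assume "A = ball_trunc H"
    then have "A = (\<lambda>N. {n \<in> H. norm (ivec n) \<le> real N})"
      by (auto simp: ball_trunc_def fun_eq_iff)
    then show ?thesis by (rule main[OF lattice_norm_euclidean])
  qed
qed

end
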